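(* For each $t \in \mathbb{N}$ there exists $C_t > 0$ such that the following holds. Let $n \in \mathbb{N}$ with $n \geq t$, and let $\mathcal{A} \subset S_n$ with $|\mathcal{A}| = c\,(n-t)!$, where $c \geq 0$. Let $f = 1_{\mathcal{A}} \colon S_n \to \{0,1\}$ be the characteristic function of $\mathcal{A}$ (so $\mathbb{E}[f] = c/(n)_t$), and let $f_t$ be the orthogonal projection of $f$ onto $U_t$. Let $0 \leq \epsilon \leq 1$. If $\mathbb{E}[(f-f_t)^2] \leq \epsilon\, c/(n)_t$, then there exists $\mathcal{C} \subset S_n$ which is a union of $\operatorname{round}(c)$ $t$-cosets of $S_n$ and satisfies $$|\mathcal{A} \triangle \mathcal{C}| \leq C_t\left(\epsilon^{1/2} + c/\sqrt{n}\right)|\mathcal{A}|.$$ Moreover, $|c - \operatorname{round}(c)| \leq C_t(\epsilon^{1/2} + c/\sqrt{n})\,c$.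
   Context: $S_n$ is the symmetric group on $[n]=\{1,\dots,n\}$. $(n)_t = n(n-1)\cdots(n-t+1)$. For $c \geq 0$, $\operatorname{round}(c)$ is the nearest integer to $c$, rounding up when $c + \tfrac12 \in \mathbb{N}$. For ordered $t$-tuples $I=(i_1,\dots,i_t)$, $J=(j_1,\dots,j_t)$ of distinct elements of $[n]$, the $t$-coset $T_{IJ} = \{\sigma \in S_n : \sigma(i_k) = j_k \ \forall k \in [t]\}$. Complex functions on $S_n$ carry the inner product $\langle f,g\rangle = \frac{1}{n!}\sum_{\sigma \in S_n} f(\sigma)\overline{g(\sigma)}$, and $\mathbb{E}$ denotes expectation under the uniform measure on $S_n$. Irreducible representations of $S_n$ are indexed by partitions $\alpha = (\alpha_1 \geq \alpha_2 \geq \cdots)$ of $n$; $U_\alpha$ denotes the space of functions on $S_n$ whose Fourier transform $\hat f(\rho) = \frac{1}{n!}\sum_\sigma f(\sigma)\rho(\sigma)$ vanishes at every irreducible representation not isomorphic to $[\alpha]$. $U_t = \bigoplus_{\alpha \vdash n,\ \alpha_1 \geq n-t} U_\alpha$ (equivalently, the linear span of the characteristic functions of the $t$-cosets). *)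

theory Defs
  imports
    Complex_Main
    "HOL-Combinatorics.Permutations"
    "HOL-Library.Function_Algebras"
    "HOL-Library.Indicator_Function"
begin

definition Sym :: "nat \<Rightarrow> (nat \<Rightarrow> nat) set" where
  "Sym n = {\<sigma>. \<sigma> permutes {1..n}}"

definition falling :: "nat \<Rightarrow> nat \<Rightarrow> nat" where
  "falling n t = (\<Prod>i<t. n - i)"

definition tuples :: "nat \<Rightarrow> nat \<Rightarrow> nat list set" where
  "tuples n t = {I. length I = t \<and> distinct I \<and> set I \<subseteq> {1..n}}"

definition t_coset :: "nat \<Rightarrow> nat list \<Rightarrow> nat list \<Rightarrow> (nat \<Rightarrow> nat) set" where
  "t_coset n I J = {\<sigma> \<in> Sym n. \<forall>k < length I. \<sigma> (I ! k) = J ! k}"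

definition t_cosets :: "nat \<Rightarrow> nat \<Rightarrow> (nat \<Rightarrow> nat) set set" where
  "t_cosets n t = {t_coset n I J | I J. I \<in> tuples n t \<and> J \<in> tuples n t}"

definition cscale :: "complex \<Rightarrow> ('x \<Rightarrow> complex) \<Rightarrow> 'x \<Rightarrow> complex" where
  "cscale a f = (\<lambda>x. a * f x)"

global_interpretation cfun: vector_space "cscale :: complex \<Rightarrow> ('x \<Rightarrow> complex) \<Rightarrow> 'x \<Rightarrow> complex"
  by unfold_locales (auto simp: cscale_def fun_eq_iff algebra_simps)

text \<open>A function on \<open>S\<^sub>n\<close> is represented by its extension by zero.\<close>

definition sym_funs :: "nat \<Rightarrow> ((nat \<Rightarrow> nat) \<Rightarrow> complex) set" where
  "sym_funs n = {f. \<forall>\<sigma>. \<sigma> \<notin> Sym n \<longrightarrow> f \<sigma> = 0}"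

definition expect :: "nat \<Rightarrow> ((nat \<Rightarrow> nat) \<Rightarrow> 'a::field_char_0) \<Rightarrow> 'a" where
  "expect n g = (\<Sum>\<sigma>\<in>Sym n. g \<sigma>) / fact n"

definition inner_prod ::
  "nat \<Rightarrow> ((nat \<Rightarrow> nat) \<Rightarrow> complex) \<Rightarrow> ((nat \<Rightarrow> nat) \<Rightarrow> complex) \<Rightarrow> complex" where
  "inner_prod n f g = expect n (\<lambda>\<sigma>. f \<sigma> * cnj (g \<sigma>))"

definition is_orthogonal_projection ::
  "nat \<Rightarrow> ((nat \<Rightarrow> nat) \<Rightarrow> complex) set \<Rightarrow> ((nat \<Rightarrow> nat) \<Rightarrow> complex) \<Rightarrow>
    ((nat \<Rightarrow> nat) \<Rightarrow> complex) \<Rightarrow> bool" where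
  "is_orthogonal_projection n W f g \<longleftrightarrow> g \<in> W \<and> (\<forall>h\<in>W. inner_prod n (f - g) h = 0)"

text \<open>
  A representation of \<open>S\<^sub>n\<close> is a complex subspace \<open>V\<close> of some function space together with an
  action \<open>\<rho>\<close> by linear maps of \<open>V\<close>; the values of \<open>\<rho>\<close> outside \<open>Sym n\<close>, and of \<open>\<rho> \<sigma>\<close> outside
  \<open>V\<close>, are irrelevant.
\<close>

definition linear_map_on ::
  "('x \<Rightarrow> complex) set \<Rightarrow> ('y \<Rightarrow> complex) set \<Rightarrow> (('x \<Rightarrow> complex) \<Rightarrow> 'y \<Rightarrow> complex) \<Rightarrow> bool" where
  "linear_map_on V W T \<longleftrightarrow> T ` V \<subseteq> W \<and>
     (\<forall>u\<in>V. \<forall>v\<in>V. T (u + v) = T u + T v) \<and>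
     (\<forall>a. \<forall>v\<in>V. T (cscale a v) = cscale a (T v))"

type_synonym 'x action = "(nat \<Rightarrow> nat) \<Rightarrow> ('x \<Rightarrow> complex) \<Rightarrow> 'x \<Rightarrow> complex"

definition representation :: "nat \<Rightarrow> ('x \<Rightarrow> complex) set \<Rightarrow> 'x action \<Rightarrow> bool" where
  "representation n V \<rho> \<longleftrightarrow> cfun.subspace V \<and>
     (\<forall>\<sigma>\<in>Sym n. linear_map_on V V (\<rho> \<sigma>)) \<and>
     (\<forall>v\<in>V. \<rho> id v = v) \<and>
     (\<forall>\<sigma>\<in>Sym n. \<forall>\<tau>\<in>Sym n. \<forall>v\<in>V. \<rho> (\<sigma> \<circ> \<tau>) v = \<rho> \<sigma> (\<rho> \<tau> v))"

definition irreducible_rep :: "nat \<Rightarrow> ('x \<Rightarrow> complex) set \<Rightarrow> 'x action \<Rightarrow> bool" where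
  "irreducible_rep n V \<rho> \<longleftrightarrow> representation n V \<rho> \<and> V \<noteq> {0} \<and>
     (\<forall>W. W \<subseteq> V \<and> cfun.subspace W \<and> (\<forall>\<sigma>\<in>Sym n. \<rho> \<sigma> ` W \<subseteq> W) \<longrightarrow> W = {0} \<or> W = V)"

definition isomorphic_reps ::
  "nat \<Rightarrow> ('x \<Rightarrow> complex) set \<Rightarrow> 'x action \<Rightarrow> ('y \<Rightarrow> complex) set \<Rightarrow> 'y action \<Rightarrow> bool" where
  "isomorphic_reps n V \<rho> W \<pi> \<longleftrightarrow>
     (\<exists>T. linear_map_on V W T \<and> bij_betw T V W \<and> (\<forall>\<sigma>\<in>Sym n. \<forall>v\<in>V. T (\<rho> \<sigma> v) = \<pi> \<sigma> (T v)))"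

definition fourier ::
  "nat \<Rightarrow> ((nat \<Rightarrow> nat) \<Rightarrow> complex) \<Rightarrow> 'x action \<Rightarrow> ('x \<Rightarrow> complex) \<Rightarrow> 'x \<Rightarrow> complex" where
  "fourier n f \<rho> v = cscale (1 / fact n) (\<Sum>\<sigma>\<in>Sym n. cscale (f \<sigma>) (\<rho> \<sigma> v))"

definition is_partition :: "nat \<Rightarrow> nat list \<Rightarrow> bool" where
  "is_partition n \<alpha> \<longleftrightarrow> sorted_wrt (\<ge>) \<alpha> \<and> 0 \<notin> set \<alpha> \<and> sum_list \<alpha> = n"

text \<open>The only partition of 0 is empty; its largest part counts as 0.\<close>

definition largest_part :: "nat list \<Rightarrow> nat" where
  "largest_part \<alpha> = (case \<alpha> of [] \<Rightarrow> 0 | a # _ \<Rightarrow> a)"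

text \<open>Cells are pairs (row, column), both counted from 0.\<close>

definition cells :: "nat list \<Rightarrow> (nat \<times> nat) set" where
  "cells \<alpha> = {(i, j). i < length \<alpha> \<and> j < \<alpha> ! i}"

definition is_tableau :: "nat \<Rightarrow> nat list \<Rightarrow> (nat \<times> nat \<Rightarrow> nat) \<Rightarrow> bool" where
  "is_tableau n \<alpha> T \<longleftrightarrow> bij_betw T (cells \<alpha>) {1..n}"

text \<open>
  A tabloid, i.e. a tableau up to permutations within its rows, is encoded as the function sending
  each entry to the index of its row (and everything that is not an entry to 0).
\<close>

definition tabloid :: "nat list \<Rightarrow> (nat \<times> nat \<Rightarrow> nat) \<Rightarrow> nat \<Rightarrow> nat" where
  "tabloid \<alpha> T x = (if x \<in> T ` cells \<alpha> then fst (inv_into (cells \<alpha>) T x) else 0)"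

definition column_stabilizer ::
  "nat \<Rightarrow> nat list \<Rightarrow> (nat \<times> nat \<Rightarrow> nat) \<Rightarrow> (nat \<Rightarrow> nat) set" where
  "column_stabilizer n \<alpha> T =
     {\<pi> \<in> Sym n. \<forall>c\<in>cells \<alpha>. \<exists>c'\<in>cells \<alpha>. snd c' = snd c \<and> \<pi> (T c) = T c'}"

text \<open>
  The permutation module \<open>M\<^sup>\<alpha>\<close> is the space of functions on tabloids; the polytabloid of \<open>T\<close> is the
  signed sum, over the column stabilizer, of the point masses at the tabloids of \<open>\<pi> \<circ> T\<close>.
\<close>

definition polytabloid ::
  "nat \<Rightarrow> nat list \<Rightarrow> (nat \<times> nat \<Rightarrow> nat) \<Rightarrow> (nat \<Rightarrow> nat) \<Rightarrow> complex" where
  "polytabloid n \<alpha> T =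
     (\<Sum>\<pi>\<in>column_stabilizer n \<alpha> T. cscale (of_int (sign \<pi>)) (indicator {tabloid \<alpha> (\<pi> \<circ> T)}))"

definition specht :: "nat \<Rightarrow> nat list \<Rightarrow> ((nat \<Rightarrow> nat) \<Rightarrow> complex) set" where
  "specht n \<alpha> = cfun.span {polytabloid n \<alpha> T | T. is_tableau n \<alpha> T}"

text \<open>
  A permutation moves the tabloid \<open>r\<close> to \<open>r \<circ> \<sigma>\<^sup>-\<^sup>1\<close>; hence the following left action on functions
  on tabloids, which sends the point mass at \<open>r\<close> to the point mass at \<open>r \<circ> \<sigma>\<^sup>-\<^sup>1\<close>.
\<close>

definition perm_action :: "(nat \<Rightarrow> nat) action" where
  "perm_action \<sigma> \<phi> = (\<lambda>r. \<phi> (r \<circ> \<sigma>))"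

text \<open>
  The quantifier over representations has to fix a type for the carriers. An irreducible
  representation of \<open>S\<^sub>n\<close> is finite-dimensional, so up to isomorphism all of them are carried by
  subspaces of the infinite-dimensional space chosen here.
\<close>

definition isotypic :: "nat \<Rightarrow> nat list \<Rightarrow> ((nat \<Rightarrow> nat) \<Rightarrow> complex) set" where
  "isotypic n \<alpha> = {f \<in> sym_funs n.
     \<forall>(V :: ((nat \<Rightarrow> nat) \<Rightarrow> complex) set) \<rho>.
       irreducible_rep n V \<rho> \<and> \<not> isomorphic_reps n V \<rho> (specht n \<alpha>) perm_action \<longrightarrow>
       (\<forall>v\<in>V. fourier n f \<rho> v = 0)}"

text \<open>The span of a union of subspaces is their sum.\<close>

definition U_space :: "nat \<Rightarrow> nat \<Rightarrow> ((nat \<Rightarrow> nat) \<Rightarrow> complex) set" where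
  "U_space n t = cfun.span (\<Union>\<alpha>\<in>{\<alpha>. is_partition n \<alpha> \<and> n - t \<le> largest_part \<alpha>}. isotypic n \<alpha>)"

end

theory Submission
  imports Defs "HOL-Analysis.Convex" "HOL-Computational_Algebra.Polynomial"
begin

text \<open>
  Functions in \<open>U\<^sub>t\<close> are combinations of indicators of \<open>t\<close>-cosets: the vectors fixed by a point
  stabilizer \<open>S\<^sub>n\<^sub>-\<^sub>t\<close> meet every Specht module with a first row of length at least \<open>n - t\<close>.  Suppose a sparse
  indicator function \<open>f\<close> of density \<open>\<mu>\<close> is close to such a function.  Its projection to degree \<open>t - 1\<close> is
  negligible, so \<open>f\<close> is nearly a sum of centered functions \<open>b\<^sub>I\<close> of \<open>t\<close> coordinates.  For random coordinate
  sets \<open>U\<close>, \<open>U'\<close> with a prescribed probability of a common point, \<open>E f F\<^sub>U F\<^sub>U\<^sub>'\<close>, where \<open>F\<^sub>U\<close> averages \<open>f\<close> over the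
  coordinates outside \<open>U\<close>, is at most about the \<open>t\<close>-th power of that probability times \<open>\<mu>\<close>; comparing
  coefficients of the resulting polynomial shows that the diagonal terms \<open>E f b\<^sub>I\<^sup>2\<close> carry all the weight,
  which forces some \<open>t\<close>-coset to be more than half full.

  A coset that is half full is almost full: alternating sums of a function of degree \<open>t\<close> over the
  products of transpositions \<open>(i u\<^sub>i)\<close>, \<open>i \<in> I\<close>, depend only on the coordinates in \<open>I\<close> and the \<open>u\<^sub>i\<close>, so on the
  coset \<open>f\<close> is nearly a function of \<open>t\<close> further coordinates, for many disjoint choices of these, and
  hence nearly constant.  Removing all these heavy cosets from the set leaves a set without heavy
  cosets that is still close to degree \<open>t\<close>, so by the first part the remainder is small.
\<close>

text \<open>The comparison of coefficients works because only small \<open>y\<close> is tested. For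
  \<open>y\<close> of order \<open>1/M\<close> the polynomial is bounded by about
  \<open>M^(-t)\<close> plus an error proportional to \<open>\<eta>\<close>, while recovering the
  coefficient of \<open>y^r\<close> with \<open>r < t\<close> costs only a factor of order
  \<open>M^r\<close>. A large constant \<open>M\<close>, and \<open>\<eta>\<close> small depending
  on \<open>M\<close>, make the lower coefficients a small fraction of \<open>\<mu>\<close>. All
  coefficients sum to nearly \<open>\<mu>\<close>, but without heavy cosets the top one is at most
  about half of it.

  The estimate for the projection to degree \<open>t - 1\<close> loses a factor
  \<open>n^(t-1)\<close> by interpolation. Sparsity pays for it: for \<open>c \<le> sqrt n\<close>
  the density is of order at most \<open>n^(1/2-t)\<close>. For larger \<open>c\<close> the claimed
  bound is weaker than a trivial one.

  Two counts keep the errors bounded. The permutations reached from one coset by exchanges with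
  disjoint choices of the \<open>u i\<close> are all distinct, so \<open>g\<close> is summed over
  them at most once. Two distinct cosets share at most \<open>(n-t-1)!\<close> permutations, so the
  overlaps of \<open>O(c)\<close> heavy cosets cost only a fraction \<open>O(c/n)\<close> of the
  set.\<close>

declare One_nat_def [simp del] \<comment> \<open>otherwise \<open>{1..n}\<close> becomes \<open>{Suc 0..n}\<close>\<close>

section \<open>Averages over cosets and the inner product of functions on
  \<open>Sym n\<close>\<close>

definition agree :: "nat set \<Rightarrow> (nat \<Rightarrow> nat) \<Rightarrow> (nat \<Rightarrow> nat) \<Rightarrow> bool" where
  "agree I \<sigma> \<tau> \<longleftrightarrow> (\<forall>i\<in>I. \<sigma> i = \<tau> i)"

text \<open>Composition on the right permutes positions, so \<open>av D\<close> forgets which point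
  of \<open>D\<close> receives which value. Hence \<open>cnd n I\<close> is the conditional
  expectation given the images of the points of \<open>I\<close>.\<close>

definition av :: "nat set \<Rightarrow> ((nat \<Rightarrow> nat) \<Rightarrow> real) \<Rightarrow> (nat \<Rightarrow> nat) \<Rightarrow> real" where
  "av D f \<sigma> = (\<Sum>\<pi> | \<pi> permutes D. f (\<sigma> \<circ> \<pi>)) / fact (card D)"

abbreviation cnd :: "nat \<Rightarrow> nat set \<Rightarrow> ((nat \<Rightarrow> nat) \<Rightarrow> real) \<Rightarrow> (nat \<Rightarrow> nat) \<Rightarrow> real" where
  "cnd n I \<equiv> av ({1..n} - I)"

definition ksets :: "nat \<Rightarrow> nat \<Rightarrow> nat set set" where
  "ksets n k = {I. I \<subseteq> {1..n} \<and> card I = k}"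

definition ip :: "nat \<Rightarrow> ((nat \<Rightarrow> nat) \<Rightarrow> real) \<Rightarrow> ((nat \<Rightarrow> nat) \<Rightarrow> real) \<Rightarrow> real" where
  "ip n f g = (\<Sum>\<sigma>\<in>Sym n. f \<sigma> * g \<sigma>) / fact n"

abbreviation nsq :: "nat \<Rightarrow> ((nat \<Rightarrow> nat) \<Rightarrow> real) \<Rightarrow> real" where
  "nsq n f \<equiv> ip n f f"

lemma agree_sym: "agree I \<sigma> \<tau> \<longleftrightarrow> agree I \<tau> \<sigma>"
  by (auto simp: agree_def)

lemma agree_refl [simp]: "agree I \<sigma> \<sigma>"
  by (auto simp: agree_def)

lemma agree_trans: "agree I \<sigma> \<tau> \<Longrightarrow> agree I \<tau> \<omega> \<Longrightarrow> agree I \<sigma> \<omega>"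
  by (auto simp: agree_def)

lemma agree_Un: "agree (I \<union> J) \<sigma> \<tau> \<longleftrightarrow> agree I \<sigma> \<tau> \<and> agree J \<sigma> \<tau>"
  by (auto simp: agree_def)

lemma finite_Sym [simp]: "finite (Sym n)"
  by (simp add: Sym_def finite_permutations)

lemma card_Sym: "card (Sym n) = fact n"
  by (simp add: Sym_def card_permutations)

lemma Sym_comp: "\<sigma> \<in> Sym n \<Longrightarrow> \<tau> \<in> Sym n \<Longrightarrow> \<sigma> \<circ> \<tau> \<in> Sym n"
  by (simp add: Sym_def permutes_compose)

lemma Sym_inv: "\<sigma> \<in> Sym n \<Longrightarrow> inv \<sigma> \<in> Sym n"
  by (simp add: Sym_def permutes_inv)

lemma Sym_id: "id \<in> Sym n"
  by (simp add: Sym_def permutes_id)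

lemma Sym_comp_permutes: "\<sigma> \<in> Sym n \<Longrightarrow> \<pi> permutes D \<Longrightarrow> D \<subseteq> {1..n} \<Longrightarrow> \<sigma> \<circ> \<pi> \<in> Sym n"
  using permutes_subset Sym_comp by (metis Sym_def mem_Collect_eq)

lemma Sym_inv_comp: "\<sigma> \<in> Sym n \<Longrightarrow> inv \<sigma> \<circ> \<sigma> = id" "\<sigma> \<in> Sym n \<Longrightarrow> \<sigma> \<circ> inv \<sigma> = id"
  by (auto simp: Sym_def permutes_inv_o)

lemma sum_Sym_left:
  assumes "\<pi> \<in> Sym n"
  shows "(\<Sum>\<sigma>\<in>Sym n. f (\<pi> \<circ> \<sigma>)) = (\<Sum>\<sigma>\<in>Sym n. f \<sigma>)"
proof (rule sum.reindex_bij_witness[of _ "\<lambda>\<sigma>. inv \<pi> \<circ> \<sigma>" "\<lambda>\<sigma>. \<pi> \<circ> \<sigma>"])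
  show "\<And>a. a \<in> Sym n \<Longrightarrow> inv \<pi> \<circ> (\<pi> \<circ> a) = a" "\<And>a. a \<in> Sym n \<Longrightarrow> \<pi> \<circ> (inv \<pi> \<circ> a) = a"
    using Sym_inv_comp[OF assms] by (simp_all add: comp_assoc[symmetric])
qed (use assms in \<open>auto intro: Sym_comp Sym_inv\<close>)

lemma sum_permutes_right:
  assumes "\<rho> permutes D"
  shows "(\<Sum>\<pi> | \<pi> permutes D. f (\<pi> \<circ> \<rho>)) = (\<Sum>\<pi> | \<pi> permutes D. f \<pi>)"
  using sum_permutations_compose_right[OF assms, of f] by simp

lemma sum_permutes_left:
  assumes "\<rho> permutes D"
  shows "(\<Sum>\<pi> | \<pi> permutes D. f (\<rho> \<circ> \<pi>)) = (\<Sum>\<pi> | \<pi> permutes D. f \<pi>)"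
proof (rule sum.reindex_bij_witness[of _ "\<lambda>\<sigma>. inv \<rho> \<circ> \<sigma>" "\<lambda>\<sigma>. \<rho> \<circ> \<sigma>"])
  show "\<And>a. a \<in> {\<pi>. \<pi> permutes D} \<Longrightarrow> inv \<rho> \<circ> (\<rho> \<circ> a) = a" "\<And>a. a \<in> {\<pi>. \<pi> permutes D} \<Longrightarrow> \<rho> \<circ> (inv \<rho> \<circ> a) = a"
    using permutes_inv_o[OF assms] by (simp_all add: comp_assoc[symmetric])
qed (use assms in \<open>auto intro: permutes_compose permutes_inv\<close>)

lemma Sym_coset:
  assumes "\<sigma> \<in> Sym n" "D \<subseteq> {1..n}"
  shows "bij_betw (\<lambda>\<pi>. \<sigma> \<circ> \<pi>) {\<pi>. \<pi> permutes D} {\<tau>\<in>Sym n. agree ({1..n} - D) \<sigma> \<tau>}"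
proof (rule bij_betw_byWitness[of _ "\<lambda>\<tau>. inv \<sigma> \<circ> \<tau>"])
  have p: "\<sigma> permutes {1..n}" using assms by (simp add: Sym_def)
  show "\<forall>\<pi>\<in>{\<pi>. \<pi> permutes D}. inv \<sigma> \<circ> (\<sigma> \<circ> \<pi>) = \<pi>"
    "\<forall>\<tau>\<in>{\<tau> \<in> Sym n. agree ({1..n} - D) \<sigma> \<tau>}. \<sigma> \<circ> (inv \<sigma> \<circ> \<tau>) = \<tau>"
    using Sym_inv_comp[OF assms(1)] by (simp_all add: comp_assoc[symmetric])
  show "(\<lambda>\<pi>. \<sigma> \<circ> \<pi>) ` {\<pi>. \<pi> permutes D} \<subseteq> {\<tau>\<in>Sym n. agree ({1..n} - D) \<sigma> \<tau>}"
    using assms by (auto simp: agree_def permutes_not_in intro: Sym_comp_permutes)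
  show "(\<lambda>\<tau>. inv \<sigma> \<circ> \<tau>) ` {\<tau> \<in> Sym n. agree ({1..n} - D) \<sigma> \<tau>} \<subseteq> {\<pi>. \<pi> permutes D}"
  proof safe
    fix \<tau> assume t: "\<tau> \<in> Sym n" "agree ({1..n} - D) \<sigma> \<tau>"
    have "inv \<sigma> \<circ> \<tau> permutes {1..n}" using t assms Sym_comp Sym_inv by (auto simp: Sym_def permutes_compose permutes_inv)
    moreover have "(inv \<sigma> \<circ> \<tau>) x = x" if "x \<in> {1..n} - D" for x
      using t that p unfolding agree_def by (metis comp_apply permutes_inverses(2))
    ultimately show "inv \<sigma> \<circ> \<tau> permutes D" by (rule permutes_superset)
  qed
qed

lemma card_agree:
  assumes "\<sigma> \<in> Sym n" "I \<subseteq> {1..n}"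
  shows "card {\<tau>\<in>Sym n. agree I \<sigma> \<tau>} = fact (n - card I)"
proof -
  have "{1..n} - ({1..n} - I) = I" using assms by auto
  then have "card {\<tau>\<in>Sym n. agree I \<sigma> \<tau>} = card {\<pi>. \<pi> permutes ({1..n} - I)}"
    using bij_betw_same_card[OF Sym_coset[OF assms(1), of "{1..n} - I"]] by simp
  also have "\<dots> = fact (card ({1..n} - I))" by (simp add: card_permutations)
  also have "card ({1..n} - I) = n - card I" using assms by (simp add: card_Diff_subset finite_subset[OF assms(2)])
  finally show ?thesis .
qed

lemma av_coset:
  assumes "\<sigma> \<in> Sym n" "D \<subseteq> {1..n}"
  shows "av D f \<sigma> = (\<Sum>\<tau>\<in>Sym n. if agree ({1..n} - D) \<sigma> \<tau> then f \<tau> else 0) / fact (card D)"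
proof -
  have "(\<Sum>\<pi> | \<pi> permutes D. f (\<sigma> \<circ> \<pi>)) = (\<Sum>\<tau>\<in>{\<tau>\<in>Sym n. agree ({1..n} - D) \<sigma> \<tau>}. f \<tau>)"
    by (rule sum.reindex_bij_betw[OF Sym_coset[OF assms]])
  also have "\<dots> = (\<Sum>\<tau>\<in>Sym n. if agree ({1..n} - D) \<sigma> \<tau> then f \<tau> else 0)"
    by (rule sum.inter_filter) simp
  finally show ?thesis by (simp add: av_def)
qed

lemma card_compl: "I \<subseteq> {1..n} \<Longrightarrow> card ({1..n} - I) = n - card (I :: nat set)"
  by (simp add: card_Diff_subset finite_subset)

lemma cnd_coset:
  assumes "\<sigma> \<in> Sym n" "I \<subseteq> {1..n}"
  shows "cnd n I f \<sigma> = (\<Sum>\<tau>\<in>Sym n. if agree I \<sigma> \<tau> then f \<tau> else 0) / fact (n - card I)"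
proof -
  have "{1..n} - ({1..n} - I) = I" using assms by auto
  then show ?thesis using av_coset[OF assms(1), of "{1..n} - I" f] card_compl[OF assms(2)] by simp
qed

lemma cnd_cong_agree:
  assumes "\<sigma> \<in> Sym n" "\<sigma>' \<in> Sym n" "I \<subseteq> {1..n}" "agree I \<sigma> \<sigma>'"
  shows "cnd n I f \<sigma> = cnd n I f \<sigma>'"
proof -
  have "agree I \<sigma> \<tau> \<longleftrightarrow> agree I \<sigma>' \<tau>" for \<tau> using assms(4) by (auto simp: agree_def)
  then show ?thesis using assms by (simp add: cnd_coset)
qed

lemma av_cong:
  assumes "\<And>\<tau>. \<tau> \<in> Sym n \<Longrightarrow> f \<tau> = g \<tau>" "\<sigma> \<in> Sym n" "D \<subseteq> {1..n}"
  shows "av D f \<sigma> = av D g \<sigma>"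
  using assms by (auto simp: av_def intro!: arg_cong2[where f="(/)"] sum.cong Sym_comp_permutes)

lemma av_add: "av D (\<lambda>\<sigma>. f \<sigma> + g \<sigma>) \<sigma> = av D f \<sigma> + av D g \<sigma>"
  by (simp add: av_def sum.distrib add_divide_distrib)

lemma av_diff: "av D (\<lambda>\<sigma>. f \<sigma> - g \<sigma>) \<sigma> = av D f \<sigma> - av D g \<sigma>"
  by (simp add: av_def sum_subtractf diff_divide_distrib)

lemma av_scale: "av D (\<lambda>\<sigma>. a * f \<sigma>) \<sigma> = a * av D f \<sigma>"
  by (simp add: av_def sum_distrib_left)

lemma av_sum: "av D (\<lambda>\<sigma>. \<Sum>x\<in>X. f x \<sigma>) \<sigma> = (\<Sum>x\<in>X. av D (f x) \<sigma>)"
  by (simp add: av_def sum.swap[of _ "{\<pi>. \<pi> permutes D}"] sum_divide_distrib)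

lemma av_const:
  assumes "\<And>\<pi>. \<pi> permutes D \<Longrightarrow> f (\<sigma> \<circ> \<pi>) = a" "finite D"
  shows "av D f \<sigma> = a"
proof -
  have "(\<Sum>\<pi> | \<pi> permutes D. f (\<sigma> \<circ> \<pi>)) = (\<Sum>\<pi> | \<pi> permutes D. a)" using assms by (intro sum.cong) auto
  then show ?thesis using assms(2) by (simp add: av_def card_permutations[OF refl])
qed

lemma av_nonneg:
  assumes "\<And>\<tau>. \<tau> \<in> Sym n \<Longrightarrow> 0 \<le> f \<tau>" "\<sigma> \<in> Sym n" "D \<subseteq> {1..n}"
  shows "0 \<le> av D f \<sigma>"
  unfolding av_def using assms by (intro divide_nonneg_nonneg sum_nonneg) (auto intro: Sym_comp_permutes)

lemma av_av:
  assumes "E \<subseteq> D" "finite D"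
  shows "av D (av E f) \<sigma> = av D f \<sigma>" "av E (av D f) \<sigma> = av D f \<sigma>"
proof -
  have fE: "finite E" using assms finite_subset by blast
  have r: "(\<Sum>\<pi> | \<pi> permutes D. f (\<sigma> \<circ> \<pi> \<circ> \<rho>)) = (\<Sum>\<pi> | \<pi> permutes D. f (\<sigma> \<circ> \<pi>))" if "\<rho> permutes D" for \<rho>
    using sum_permutes_right[OF that, of "\<lambda>\<pi>. f (\<sigma> \<circ> \<pi>)"] by (simp add: comp_assoc)
  have l: "(\<Sum>\<pi> | \<pi> permutes D. f (\<sigma> \<circ> \<rho> \<circ> \<pi>)) = (\<Sum>\<pi> | \<pi> permutes D. f (\<sigma> \<circ> \<pi>))" if "\<rho> permutes D" for \<rho>
    using sum_permutes_left[OF that, of "\<lambda>\<pi>. f (\<sigma> \<circ> \<pi>)"] by (simp add: comp_assoc)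
  have "av D (av E f) \<sigma> = av E (\<lambda>_. av D f \<sigma>) \<sigma>"
  proof -
    have "(\<Sum>\<pi> | \<pi> permutes D. \<Sum>\<rho> | \<rho> permutes E. f (\<sigma> \<circ> \<pi> \<circ> \<rho>)) = (\<Sum>\<rho> | \<rho> permutes E. \<Sum>\<pi> | \<pi> permutes D. f (\<sigma> \<circ> \<pi>))"
      by (subst sum.swap, rule sum.cong[OF refl], rule r) (use assms permutes_subset in auto)
    then show ?thesis unfolding av_def sum_divide_distrib[symmetric] by simp
  qed
  also have "\<dots> = av D f \<sigma>" by (rule av_const[OF _ fE]) simp
  finally show "av D (av E f) \<sigma> = av D f \<sigma>" .
  show "av E (av D f) \<sigma> = av D f \<sigma>"
  proof (rule av_const[OF _ fE])
    fix \<pi> assume "\<pi> permutes E"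
    then have "\<pi> permutes D" using permutes_subset assms(1) by blast
    from l[OF this] show "av D f (\<sigma> \<circ> \<pi>) = av D f \<sigma>" by (simp add: av_def)
  qed
qed

text \<open>Permutations of disjoint sets commute. The projections \<open>av D\<close> for disjoint
  \<open>D\<close> can therefore be treated as simultaneously diagonal, which
  \<open>sum_dif_le\<close> exploits.\<close>

lemma av_commute:
  assumes "D \<inter> E = {}"
  shows "av D (av E f) \<sigma> = av E (av D f) \<sigma>"
proof -
  have c: "\<pi> \<circ> \<rho> = \<rho> \<circ> \<pi>" if "\<pi> permutes D" "\<rho> permutes E" for \<pi> \<rho>
  proof
    fix x
    show "(\<pi> \<circ> \<rho>) x = (\<rho> \<circ> \<pi>) x"
      using that assms permutes_in_image[OF that(1), of x] permutes_in_image[OF that(2), of x]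
      by (cases "x \<in> D"; cases "x \<in> E") (auto simp: permutes_not_in, (metis disjoint_iff permutes_not_in)+)
  qed
  have "(\<Sum>\<pi> | \<pi> permutes D. \<Sum>\<rho> | \<rho> permutes E. f (\<sigma> \<circ> \<pi> \<circ> \<rho>)) = (\<Sum>\<rho> | \<rho> permutes E. \<Sum>\<pi> | \<pi> permutes D. f (\<sigma> \<circ> \<rho> \<circ> \<pi>))"
    by (subst sum.swap, intro sum.cong refl) (simp add: comp_assoc c)
  then show ?thesis unfolding av_def sum_divide_distrib[symmetric] by simp
qed

lemma ip_commute: "ip n f g = ip n g f"
  by (simp add: ip_def mult.commute)

lemma ip_add: "ip n (\<lambda>\<sigma>. f \<sigma> + g \<sigma>) h = ip n f h + ip n g h"
  by (simp add: ip_def algebra_simps sum.distrib add_divide_distrib)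

lemma ip_diff: "ip n (\<lambda>\<sigma>. f \<sigma> - g \<sigma>) h = ip n f h - ip n g h"
  by (simp add: ip_def algebra_simps sum_subtractf diff_divide_distrib)

lemma ip_add_right: "ip n h (\<lambda>\<sigma>. f \<sigma> + g \<sigma>) = ip n h f + ip n h g"
  by (simp add: ip_def algebra_simps sum.distrib add_divide_distrib)

lemma ip_diff_right: "ip n h (\<lambda>\<sigma>. f \<sigma> - g \<sigma>) = ip n h f - ip n h g"
  by (simp add: ip_def algebra_simps sum_subtractf diff_divide_distrib)

lemma ip_scale: "ip n (\<lambda>\<sigma>. a * f \<sigma>) h = a * ip n f h"
  by (simp add: ip_def sum_distrib_left mult.assoc)

lemma ip_scale_right: "ip n h (\<lambda>\<sigma>. a * f \<sigma>) = a * ip n h f"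
  by (simp add: ip_def sum_distrib_left algebra_simps)

lemma ip_sum_right: "ip n h (\<lambda>\<sigma>. \<Sum>x\<in>X. f x \<sigma>) = (\<Sum>x\<in>X. ip n h (f x))"
  by (simp add: ip_def sum_distrib_left sum.swap[of _ "Sym n"] sum_divide_distrib)

lemma ip_cong:
  assumes "\<And>\<tau>. \<tau> \<in> Sym n \<Longrightarrow> f \<tau> = f' \<tau>" "\<And>\<tau>. \<tau> \<in> Sym n \<Longrightarrow> g \<tau> = g' \<tau>"
  shows "ip n f g = ip n f' g'"
  using assms by (simp add: ip_def)

lemma ip_mono:
  assumes "\<And>\<tau>. \<tau> \<in> Sym n \<Longrightarrow> f \<tau> * g \<tau> \<le> f' \<tau> * g' \<tau>"
  shows "ip n f g \<le> ip n f' g'"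
  unfolding ip_def using assms by (intro divide_right_mono sum_mono) auto

lemma nsq_nonneg [simp]: "0 \<le> nsq n f"
  by (simp add: ip_def sum_nonneg)

lemma nsq_eq_0:
  assumes "nsq n f = 0" "\<sigma> \<in> Sym n" shows "f \<sigma> = 0"
proof -
  have "(\<Sum>\<sigma>\<in>Sym n. f \<sigma> * f \<sigma>) = 0" using assms by (simp add: ip_def)
  then show ?thesis using assms(2) by (subst (asm) sum_nonneg_eq_0_iff) auto
qed

lemma nsq_add_le: "nsq n (\<lambda>\<sigma>. f \<sigma> + g \<sigma>) \<le> 2 * nsq n f + 2 * nsq n g"
proof -
  have "nsq n (\<lambda>\<sigma>. f \<sigma> + g \<sigma>) + nsq n (\<lambda>\<sigma>. f \<sigma> - g \<sigma>) = 2 * nsq n f + 2 * nsq n g"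
    by (simp add: ip_add ip_diff ip_add_right ip_diff_right)
  moreover have "0 \<le> nsq n (\<lambda>\<sigma>. f \<sigma> - g \<sigma>)" by simp
  ultimately show ?thesis by linarith
qed

lemma nsq_diff_le: "nsq n (\<lambda>\<sigma>. f \<sigma> - g \<sigma>) \<le> 2 * nsq n f + 2 * nsq n g"
proof -
  have "nsq n (\<lambda>\<sigma>. f \<sigma> + g \<sigma>) + nsq n (\<lambda>\<sigma>. f \<sigma> - g \<sigma>) = 2 * nsq n f + 2 * nsq n g"
    by (simp add: ip_add ip_diff ip_add_right ip_diff_right)
  moreover have "0 \<le> nsq n (\<lambda>\<sigma>. f \<sigma> + g \<sigma>)" by simp
  ultimately show ?thesis by linarith
qed

text \<open>Agreement outside \<open>D\<close> is a symmetric relation, so the kernel of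
  \<open>av D\<close> is symmetric. Together with \<open>av_av\<close> this makes
  \<open>av D\<close> an orthogonal projection.\<close>

lemma ip_av:
  assumes "D \<subseteq> {1..n}"
  shows "ip n (av D f) g = ip n f (av D g)"
proof -
  have "ip n (av D f) g = (\<Sum>\<sigma>\<in>Sym n. \<Sum>\<tau>\<in>Sym n. if agree ({1..n} - D) \<sigma> \<tau> then f \<tau> * g \<sigma> else 0) / fact (card D) / fact n"
    using assms by (simp add: ip_def av_coset sum_divide_distrib sum_distrib_right if_distrib[of "\<lambda>x. x * _"] if_distrib[of "\<lambda>x. x / _"] cong: if_cong)
  also have "\<dots> = (\<Sum>\<tau>\<in>Sym n. \<Sum>\<sigma>\<in>Sym n. if agree ({1..n} - D) \<tau> \<sigma> then f \<tau> * g \<sigma> else 0) / fact (card D) / fact n"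
    by (subst sum.swap) (simp add: agree_sym)
  also have "\<dots> = ip n f (av D g)"
    using assms by (simp add: ip_def av_coset sum_divide_distrib sum_distrib_left if_distrib[of "\<lambda>x. _ * x"] if_distrib[of "\<lambda>x. x / _"] cong: if_cong)
  finally show ?thesis .
qed

lemma finite_sub: "D \<subseteq> {1..n::nat} \<Longrightarrow> finite D"
  by (rule finite_subset) auto

lemma ip_av_av:
  assumes "D \<subseteq> {1..n}"
  shows "ip n (av D f) (av D g) = ip n f (av D g)"
proof -
  have "ip n (av D f) (av D g) = ip n f (av D (av D g))" using ip_av[OF assms] .
  also have "av D (av D g) = av D g" using av_av[OF order_refl finite_sub[OF assms]] by (intro ext) simp
  finally show ?thesis .
qed

lemma nsq_av: "D \<subseteq> {1..n} \<Longrightarrow> nsq n (av D f) = ip n f (av D f)"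
  by (rule ip_av_av)

lemma nsq_minus_av:
  assumes "D \<subseteq> {1..n}"
  shows "nsq n (\<lambda>\<sigma>. f \<sigma> - av D f \<sigma>) = nsq n f - nsq n (av D f)"
  using nsq_av[OF assms, of f] ip_commute[of n "av D f" f] by (simp add: ip_diff ip_diff_right)

lemma nsq_av_le:
  assumes "D \<subseteq> {1..n}"
  shows "nsq n (av D f) \<le> nsq n f"
  using nsq_minus_av[OF assms, of f] nsq_nonneg[of n "\<lambda>\<sigma>. f \<sigma> - av D f \<sigma>"] by linarith

text \<open>Cauchy-Schwarz with a free weight in place of square roots: such bounds can be added up
  over many pairs of functions without a second Cauchy-Schwarz.\<close>

lemma ip_amgm:
  assumes "\<eta> > 0"
  shows "\<bar>ip n f g\<bar> \<le> (nsq n f / \<eta> + \<eta> * nsq n g) / 2"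
proof -
  have *: "\<bar>f \<sigma> * g \<sigma>\<bar> \<le> (f \<sigma> * f \<sigma> / \<eta> + \<eta> * (g \<sigma> * g \<sigma>)) / 2" for \<sigma>
  proof -
    have "0 \<le> (\<bar>f \<sigma>\<bar> - \<eta> * \<bar>g \<sigma>\<bar>)\<^sup>2" by simp
    then have "2 * \<eta> * \<bar>f \<sigma> * g \<sigma>\<bar> \<le> f \<sigma> * f \<sigma> + \<eta> * \<eta> * (g \<sigma> * g \<sigma>)"
      by (simp add: power2_eq_square algebra_simps abs_mult)
    then show ?thesis using assms by (simp add: field_simps)
  qed
  have "\<bar>ip n f g\<bar> \<le> (\<Sum>\<sigma>\<in>Sym n. \<bar>f \<sigma> * g \<sigma>\<bar>) / fact n"
    by (simp add: ip_def divide_right_mono)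
  also have "\<dots> \<le> (\<Sum>\<sigma>\<in>Sym n. (f \<sigma> * f \<sigma> / \<eta> + \<eta> * (g \<sigma> * g \<sigma>)) / 2) / fact n"
    by (intro divide_right_mono sum_mono *) simp
  also have "\<dots> = (nsq n f / \<eta> + \<eta> * nsq n g) / 2"
    by (simp add: ip_def sum.distrib sum_divide_distrib[symmetric] sum_distrib_left[symmetric] add_divide_distrib algebra_simps)
  finally show ?thesis .
qed

section \<open>Functions of low degree and centered functions\<close>

lemma finite_ksets [simp]: "finite (ksets n k)"
  unfolding ksets_def by (rule finite_subset[of _ "Pow {1..n}"]) auto

lemma card_ksets: "card (ksets n k) = n choose k"
  using n_subsets[of "{1..n}" k] by (simp add: ksets_def)

lemma ksets_sub: "I \<in> ksets n k \<Longrightarrow> I \<subseteq> {1..n}" "I \<in> ksets n k \<Longrightarrow> card I = k" "I \<in> ksets n k \<Longrightarrow> finite I"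
  by (auto simp: ksets_def intro: finite_sub)

text \<open>Up to the factor \<open>n choose k\<close>, conditioning on a random set of
  \<open>k\<close> positions. At a fixed permutation this average of a function of degree
  \<open>t\<close> is a polynomial in \<open>k\<close> of degree at most \<open>t\<close> as long as
  \<open>k + t \<le> n\<close>; the level estimates below rest on this.\<close>

definition Sop :: "nat \<Rightarrow> nat \<Rightarrow> ((nat \<Rightarrow> nat) \<Rightarrow> real) \<Rightarrow> (nat \<Rightarrow> nat) \<Rightarrow> real" where
  "Sop n k f \<sigma> = (\<Sum>I\<in>ksets n k. cnd n I f \<sigma>)"

text \<open>
  Taking \<open>\<tau>\<close> over all of \<open>Sym n\<close> repeats every coset indicator, which does not affect the span.
\<close>

definition lowdeg :: "nat \<Rightarrow> nat \<Rightarrow> ((nat \<Rightarrow> nat) \<Rightarrow> 'a::comm_ring_1) \<Rightarrow> bool" where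
  "lowdeg n k g \<longleftrightarrow> (\<exists>a. \<forall>\<sigma>\<in>Sym n. g \<sigma> = (\<Sum>I\<in>ksets n k. \<Sum>\<tau>\<in>Sym n. if agree I \<sigma> \<tau> then a I \<tau> else 0))"

lemma lowdeg_cong:
  assumes "lowdeg n k f" "\<And>\<sigma>. \<sigma> \<in> Sym n \<Longrightarrow> f \<sigma> = g \<sigma>"
  shows "lowdeg n k g"
  using assms by (simp add: lowdeg_def)

lemma lowdeg_zero: "lowdeg n k (\<lambda>_. 0)"
  unfolding lowdeg_def by (rule exI[of _ "\<lambda>_ _. 0"]) simp

lemma lowdeg_add:
  assumes "lowdeg n k f" "lowdeg n k g"
  shows "lowdeg n k (\<lambda>\<sigma>. f \<sigma> + g \<sigma>)"
proof -
  obtain a b where "\<forall>\<sigma>\<in>Sym n. f \<sigma> = (\<Sum>I\<in>ksets n k. \<Sum>\<tau>\<in>Sym n. if agree I \<sigma> \<tau> then a I \<tau> else 0)"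
    "\<forall>\<sigma>\<in>Sym n. g \<sigma> = (\<Sum>I\<in>ksets n k. \<Sum>\<tau>\<in>Sym n. if agree I \<sigma> \<tau> then b I \<tau> else 0)"
    using assms unfolding lowdeg_def by blast
  then show ?thesis unfolding lowdeg_def
    by (intro exI[of _ "\<lambda>I \<tau>. a I \<tau> + b I \<tau>"]) (auto simp: sum.distrib[symmetric] intro!: sum.cong)
qed

lemma lowdeg_scale:
  assumes "lowdeg n k f"
  shows "lowdeg n k (\<lambda>\<sigma>. x * f \<sigma>)"
proof -
  obtain a where "\<forall>\<sigma>\<in>Sym n. f \<sigma> = (\<Sum>I\<in>ksets n k. \<Sum>\<tau>\<in>Sym n. if agree I \<sigma> \<tau> then a I \<tau> else 0)"
    using assms unfolding lowdeg_def by blast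
  then show ?thesis unfolding lowdeg_def
    by (intro exI[of _ "\<lambda>I \<tau>. x * a I \<tau>"]) (auto simp: sum_distrib_left intro!: sum.cong)
qed

lemma lowdeg_diff:
  assumes "lowdeg n k f" "lowdeg n k g"
  shows "lowdeg n k (\<lambda>\<sigma>. f \<sigma> - g \<sigma>)"
  using lowdeg_add[OF assms(1) lowdeg_scale[OF assms(2), of "-1"]] by simp

lemma lowdeg_sum:
  assumes "\<And>x. x \<in> X \<Longrightarrow> lowdeg n k (f x)"
  shows "lowdeg n k (\<lambda>\<sigma>. \<Sum>x\<in>X. f x \<sigma>)"
  using assms by (induction X rule: infinite_finite_induct) (auto intro: lowdeg_add lowdeg_zero)

text \<open>The coefficients are the values of \<open>f\<close> itself, divided by
  \<open>(n - k)!\<close> because each coset of \<open>I\<close> is listed once for each of its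
  elements.\<close>

lemma lowdeg_measurable:
  fixes f :: "(nat \<Rightarrow> nat) \<Rightarrow> 'a::field_char_0"
  assumes "I \<in> ksets n k" "\<And>\<sigma> \<tau>. \<sigma> \<in> Sym n \<Longrightarrow> \<tau> \<in> Sym n \<Longrightarrow> agree I \<sigma> \<tau> \<Longrightarrow> f \<sigma> = f \<tau>"
  shows "lowdeg n k f"
  unfolding lowdeg_def
proof (intro exI[of _ "\<lambda>J \<tau>. if J = I then f \<tau> / fact (n - k) else 0"] ballI)
  fix \<sigma> assume s: "\<sigma> \<in> Sym n"
  have "(\<Sum>J\<in>ksets n k. \<Sum>\<tau>\<in>Sym n. if agree J \<sigma> \<tau> then if J = I then f \<tau> / fact (n - k) else 0 else 0)
     = (\<Sum>J\<in>ksets n k. if J = I then \<Sum>\<tau>\<in>Sym n. if agree I \<sigma> \<tau> then f \<tau> / fact (n - k) else 0 else 0)"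
    by (intro sum.cong refl) (simp cong: if_cong)
  also have "\<dots> = (\<Sum>\<tau>\<in>Sym n. if agree I \<sigma> \<tau> then f \<tau> / fact (n - k) else 0)"
    using assms(1) by simp
  also have "\<dots> = (\<Sum>\<tau>\<in>Sym n. if agree I \<sigma> \<tau> then f \<sigma> / fact (n - k) else 0)"
  proof (intro sum.cong refl)
    fix \<tau> assume "\<tau> \<in> Sym n"
    from assms(2)[OF s this] show "(if agree I \<sigma> \<tau> then f \<tau> / fact (n - k) else 0) = (if agree I \<sigma> \<tau> then f \<sigma> / fact (n - k) else 0)"
      by (cases "agree I \<sigma> \<tau>") simp_all
  qed
  also have "\<dots> = f \<sigma>"
    unfolding sum.inter_filter[OF finite_Sym, symmetric] sum_constant
      card_agree[OF s ksets_sub(1)[OF assms(1)]] ksets_sub(2)[OF assms(1)] by simp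
  finally show "f \<sigma> = (\<Sum>J\<in>ksets n k. \<Sum>\<tau>\<in>Sym n. if agree J \<sigma> \<tau> then if J = I then f \<tau> / fact (n - k) else 0 else 0)" by simp
qed

lemma lowdeg_cnd: "I \<in> ksets n k \<Longrightarrow> lowdeg n k (cnd n I f)"
  by (rule lowdeg_measurable, assumption, rule cnd_cong_agree) (simp_all add: ksets_sub)

lemma lowdeg_agree: "I \<in> ksets n k \<Longrightarrow> lowdeg n k (\<lambda>\<sigma>. if agree I \<sigma> \<tau> then 1 else 0 :: 'a::field_char_0)"
  by (rule lowdeg_measurable) (auto simp: agree_def)

text \<open>Orthogonality to all functions of fewer than \<open>t\<close> coordinates, stated
  through conditional expectations so that it can be used pointwise. For \<open>t = 0\<close> it is
  void.\<close>

definition centered :: "nat \<Rightarrow> nat \<Rightarrow> ((nat \<Rightarrow> nat) \<Rightarrow> real) \<Rightarrow> bool" where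
  "centered n t v \<longleftrightarrow> (\<forall>K. K \<subseteq> {1..n} \<and> card K < t \<longrightarrow> (\<forall>\<sigma>\<in>Sym n. cnd n K v \<sigma> = 0))"

lemma centered_Sop:
  assumes "centered n t v" "j < t" "\<sigma> \<in> Sym n"
  shows "Sop n j v \<sigma> = 0"
  using assms by (auto simp: centered_def Sop_def ksets_def intro!: sum.neutral)

lemma centered_sum:
  assumes "\<And>x. x \<in> X \<Longrightarrow> centered n t (f x)"
  shows "centered n t (\<lambda>\<sigma>. \<Sum>x\<in>X. f x \<sigma>)"
  using assms by (auto simp: centered_def av_sum intro!: sum.neutral)

text \<open>Moving \<open>\<rho>\<close> past \<open>\<pi>\<close> by conjugation turns the average
  over the complement of \<open>K\<close> into one over the complement of the preimage of
  \<open>K\<close> under \<open>\<rho>\<close>. This preimage has the same size, so every term of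
  \<open>av D\<close> contributes 0.\<close>

lemma centered_av:
  assumes "centered n t v" "D \<subseteq> {1..n}"
  shows "centered n t (av D v)"
  unfolding centered_def
proof (intro allI impI ballI)
  fix K \<sigma> assume K: "K \<subseteq> {1..n} \<and> card K < t" and s: "\<sigma> \<in> Sym n"
  have 1: "(\<Sum>\<pi> | \<pi> permutes {1..n} - K. v (\<sigma> \<circ> \<pi> \<circ> \<rho>)) = 0" if r: "\<rho> permutes D" for \<rho>
  proof -
    have rn: "\<rho> permutes {1..n}" using r assms(2) permutes_subset by blast
    let ?K = "inv \<rho> ` K"
    have K': "?K \<subseteq> {1..n}" "card ?K < t"
      using K image_mono[of K "{1..n}" "inv \<rho>"] permutes_image[OF permutes_inv[OF rn]]
        card_image[OF permutes_inj_on[OF permutes_inv[OF rn], of K]] by auto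
    have "(\<Sum>\<pi> | \<pi> permutes {1..n} - K. v (\<sigma> \<circ> \<pi> \<circ> \<rho>)) = (\<Sum>\<pi> | \<pi> permutes {1..n} - ?K. v (\<sigma> \<circ> \<rho> \<circ> \<pi>))"
    proof (rule sum.reindex_bij_witness[of _ "\<lambda>\<pi>. \<rho> \<circ> \<pi> \<circ> inv \<rho>" "\<lambda>\<pi>. inv \<rho> \<circ> \<pi> \<circ> \<rho>"])
      have b: "bij \<rho>" using rn permutes_bij by blast
      have e: "inv \<rho> \<circ> \<rho> = id" "\<rho> \<circ> inv \<rho> = id" using rn permutes_inv_o by auto
      show "\<rho> \<circ> (inv \<rho> \<circ> a \<circ> \<rho>) \<circ> inv \<rho> = a" "inv \<rho> \<circ> (\<rho> \<circ> a \<circ> inv \<rho>) \<circ> \<rho> = a" for a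
        using e by (auto simp: fun_eq_iff)
      show "v (\<sigma> \<circ> \<rho> \<circ> (inv \<rho> \<circ> a \<circ> \<rho>)) = v (\<sigma> \<circ> a \<circ> \<rho>)" for a
        using e by (intro arg_cong[of _ _ v]) (auto simp: fun_eq_iff)
      show "inv \<rho> \<circ> a \<circ> \<rho> \<in> {\<pi>. \<pi> permutes {1..n} - ?K}" if "a \<in> {\<pi>. \<pi> permutes {1..n} - K}" for a
      proof -
        have a: "a permutes {1..n} - K" using that by simp
        have "inv \<rho> \<circ> a \<circ> \<rho> permutes {1..n}"
          by (intro permutes_compose permutes_inv rn permutes_subset[OF a Diff_subset])
        moreover have "(inv \<rho> \<circ> a \<circ> \<rho>) x = x" if "x \<in> {1..n} - ({1..n} - ?K)" for x
        proof -
          have "\<rho> x \<in> K" using that permutes_inverses(1)[OF rn] by auto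
          then have "\<rho> x \<notin> {1..n} - K" by blast
          then have "a (\<rho> x) = \<rho> x" by (rule permutes_not_in[OF a])
          then show ?thesis using permutes_inverses[OF rn] by simp
        qed
        ultimately have "inv \<rho> \<circ> a \<circ> \<rho> permutes {1..n} - ?K" by (rule permutes_superset)
        then show ?thesis by simp
      qed
      show "\<rho> \<circ> a \<circ> inv \<rho> \<in> {\<pi>. \<pi> permutes {1..n} - K}" if "a \<in> {\<pi>. \<pi> permutes {1..n} - ?K}" for a
      proof -
        have a: "a permutes {1..n} - ?K" using that by simp
        have "\<rho> \<circ> a \<circ> inv \<rho> permutes {1..n}"
          by (intro permutes_compose permutes_inv rn permutes_subset[OF a Diff_subset])
        moreover have "(\<rho> \<circ> a \<circ> inv \<rho>) x = x" if "x \<in> {1..n} - ({1..n} - K)" for x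
        proof -
          have "x \<in> K" using that by blast
          then have "inv \<rho> x \<in> ?K" by (rule imageI)
          then have "inv \<rho> x \<notin> {1..n} - ?K" by blast
          then have "a (inv \<rho> x) = inv \<rho> x" by (rule permutes_not_in[OF a])
          then show ?thesis using permutes_inverses[OF rn] by simp
        qed
        ultimately have "\<rho> \<circ> a \<circ> inv \<rho> permutes {1..n} - K" by (rule permutes_superset)
        then show ?thesis by simp
      qed
    qed
    also have "\<dots> = 0"
    proof -
      have "\<sigma> \<circ> \<rho> \<in> Sym n" using Sym_comp_permutes[OF s r assms(2)] .
      then have "cnd n ?K v (\<sigma> \<circ> \<rho>) = 0" using assms(1) K' unfolding centered_def by blast
      then show ?thesis by (simp add: av_def)
    qed
    finally show ?thesis .
  qed
  show "cnd n K (av D v) \<sigma> = 0"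
    unfolding av_def sum_divide_distrib[symmetric]
    by (subst sum.swap) (simp add: 1)
qed

lemma permutation_extension:
  assumes "inj_on f D" "D \<subseteq> S" "f ` D \<subseteq> S" "finite S"
  shows "\<exists>p. p permutes S \<and> (\<forall>x\<in>D. p x = f x)"
proof -
  have fD: "finite D" using assms finite_subset by blast
  have "card (S - D) = card (S - f ` D)"
    using assms fD by (simp add: card_Diff_subset card_image)
  then obtain g where g: "bij_betw g (S - D) (S - f ` D)"
    using assms(4) finite_same_card_bij by blast
  define p where "p x = (if x \<in> D then f x else if x \<in> S then g x else x)" for x
  have "bij_betw p (D \<union> (S - D)) (f ` D \<union> (S - f ` D))"
  proof (rule bij_betw_combine)
    show "bij_betw p D (f ` D)" using assms(1) by (simp add: p_def bij_betw_def inj_on_def)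
    show "bij_betw p (S - D) (S - f ` D)" using g by (rule bij_betw_cong[THEN iffD1, rotated]) (simp add: p_def)
  qed auto
  moreover have "D \<union> (S - D) = S" "f ` D \<union> (S - f ` D) = S" using assms by auto
  ultimately have "bij_betw p S S" by simp
  moreover have "p x = x" if "x \<notin> S" for x using that assms(2) by (auto simp: p_def)
  ultimately have "p permutes S" by (rule bij_imp_permutes)
  then show ?thesis by (auto simp: p_def)
qed

section \<open>Averages over coordinate sets of a given size\<close>

lemma lagrange_interpolation:
  fixes p :: "real poly"
  assumes "degree p \<le> d"
  shows "poly p x = (\<Sum>k\<le>d. poly p (real k) * (\<Prod>j\<in>{..d}-{k}. (x - real j) / (real k - real j)))"
proof -
  define q :: "real poly" where
    "q = (\<Sum>k\<le>d. smult (poly p (real k)) (\<Prod>j\<in>{..d}-{k}. smult (1 / (real k - real j)) [:- real j, 1:]))"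
  have pq: "poly q y = (\<Sum>k\<le>d. poly p (real k) * (\<Prod>j\<in>{..d}-{k}. (y - real j) / (real k - real j)))" for y
    by (simp add: q_def poly_sum poly_prod diff_divide_distrib)
  have dq: "degree q \<le> d" unfolding q_def
  proof (rule degree_sum_le)
    fix k assume k: "k \<in> {..d}"
    have "degree (\<Prod>j\<in>{..d}-{k}. smult (1 / (real k - real j)) [:- real j, 1:])
      \<le> (\<Sum>j\<in>{..d}-{k}. degree (smult (1 / (real k - real j)) [:- real j, 1:]))"
      using degree_prod_sum_le[of "{..d}-{k}" "\<lambda>j. smult (1 / (real k - real j)) [:- real j, 1:]"] by simp
    also have "\<dots> \<le> (\<Sum>j\<in>{..d}-{k}. 1)" by (intro sum_mono) simp
    also have "\<dots> = d" using k by simp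
    finally show "degree (smult (poly p (real k)) (\<Prod>j\<in>{..d}-{k}. smult (1 / (real k - real j)) [:- real j, 1:])) \<le> d"
      using degree_smult_le le_trans by blast
  qed simp
  have "p = q"
  proof (rule poly_eqI_degree)
    fix y assume "y \<in> real ` {..d}"
    then obtain m where m: "m \<le> d" "y = real m" by auto
    have "poly q y = (\<Sum>k\<le>d. if k = m then poly p (real m) else 0)"
      unfolding pq
    proof (intro sum.cong refl)
      fix k assume "k \<in> {..d}"
      show "poly p (real k) * (\<Prod>j\<in>{..d}-{k}. (y - real j) / (real k - real j)) = (if k = m then poly p (real m) else 0)"
      proof (cases "k = m")
        case True
        have "(\<Prod>j\<in>{..d}-{m}. (real m - real j) / (real m - real j)) = 1" by (intro prod.neutral) auto
        then show ?thesis using True m by simp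
      next
        case False
        then have "(\<Prod>j\<in>{..d}-{k}. (y - real j) / (real k - real j)) = 0" using m by (intro prod_zero) auto
        then show ?thesis using False by simp
      qed
    qed
    then show "poly p y = poly q y" using m by simp
  next
    have "card (real ` {..d}) = Suc d" by (simp add: card_image)
    then show "degree p < card (real ` {..d})" "degree q < card (real ` {..d})" using assms dq by auto
  qed
  then have "poly p x = poly q x" by (rule arg_cong)
  also note pq
  finally show ?thesis .
qed

lemma prod_falling:
  "k \<le> N \<Longrightarrow> (\<Prod>i<k. real N - real i) = fact N / fact (N - k)"
proof (induction k)
  case (Suc k)
  define m where "m = N - Suc k"
  have m: "N - k = Suc m" "N - Suc k = m" using Suc.prems by (auto simp: m_def)
  have h: "real N - real k = real (Suc m)" using m Suc.prems by linarith
  have "(\<Prod>i<k. real N - real i) = fact N / fact (Suc m)" using Suc m by simp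
  then have "(\<Prod>i<Suc k. real N - real i) = fact N / fact (Suc m) * real (Suc m)"
    by (simp only: prod.lessThan_Suc h)
  also have "\<dots> = fact N / fact m" by (simp add: fact_Suc del: of_nat_Suc)
  finally show ?case by (simp only: m)
qed simp

lemma prod_falling_zero: "N < k \<Longrightarrow> (\<Prod>i<k. real N - real i) = 0"
  by (rule prod_zero) auto

text \<open>\<open>R\<close> may not contain a point of \<open>I\<close> where
  \<open>\<sigma>\<close> and \<open>\<tau>\<close> differ, nor, by injectivity of
  \<open>\<omega>\<close>, a point outside \<open>I\<close> where \<open>\<sigma>\<close> takes a
  value that \<open>\<tau>\<close> takes on \<open>I\<close>. These points make up
  \<open>E - A\<close>. If \<open>R\<close> avoids them, the prescribed values form an injection on
  \<open>R \<union> I\<close> and the count is that of a coset.\<close>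

lemma card_two_constraints:
  assumes s: "\<sigma> \<in> Sym n" and t: "\<tau> \<in> Sym n" and I: "I \<subseteq> {1..n}" and R: "R \<subseteq> {1..n}"
  defines "A \<equiv> {i\<in>I. \<sigma> i = \<tau> i}" and "E \<equiv> I \<union> (inv \<sigma> \<circ> \<tau>) ` I"
  shows "card {\<omega>\<in>Sym n. agree R \<sigma> \<omega> \<and> agree I \<omega> \<tau>} = (if R \<inter> (E - A) = {} then fact (n - card (R \<union> I)) else 0)"
proof -
  have ps: "\<sigma> permutes {1..n}" and pt: "\<tau> permutes {1..n}" using s t by (auto simp: Sym_def)
  have E: "x \<in> E \<longleftrightarrow> x \<in> I \<or> (\<exists>i\<in>I. \<sigma> x = \<tau> i)" for x
    unfolding E_def using permutes_inverses[OF ps] by (auto simp: image_iff) (metis)+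
  show ?thesis
  proof (cases "R \<inter> (E - A) = {}")
    case True
    define f where "f x = (if x \<in> R then \<sigma> x else \<tau> x)" for x
    have key: "x = y" if "x \<in> R" "y \<in> I" "\<sigma> x = \<tau> y" for x y
    proof -
      have "x \<in> E" using that E by blast
      then have "x \<in> A" using True that by blast
      then have "\<tau> x = \<tau> y" using that by (simp add: A_def)
      then show ?thesis using permutes_inj[OF pt] by (auto dest: injD)
    qed
    have "inj_on f (R \<union> I)"
      unfolding inj_on_def f_def using key permutes_inj[OF ps] permutes_inj[OF pt]
      by (auto dest: injD) (metis injD)+
    moreover have "f ` (R \<union> I) \<subseteq> {1..n}" unfolding f_def
      using permutes_in_image[OF ps] permutes_in_image[OF pt] I R by (auto simp del: atLeastAtMost_iff)
    ultimately obtain p where p: "p permutes {1..n}" "\<forall>x\<in>R \<union> I. p x = f x"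
      using permutation_extension[of f "R \<union> I" "{1..n}"] I R by auto
    have RA: "\<sigma> i = \<tau> i" if "i \<in> R" "i \<in> I" for i
      using True that E by (auto simp: A_def)
    have "agree R \<sigma> \<omega> \<and> agree I \<omega> \<tau> \<longleftrightarrow> agree (R \<union> I) p \<omega>" for \<omega>
    proof
      assume "agree R \<sigma> \<omega> \<and> agree I \<omega> \<tau>"
      then show "agree (R \<union> I) p \<omega>" using p(2) by (auto simp: agree_def f_def)
    next
      assume "agree (R \<union> I) p \<omega>"
      then have "f i = \<omega> i" if "i \<in> R \<union> I" for i using that p(2) by (auto simp: agree_def)
      then show "agree R \<sigma> \<omega> \<and> agree I \<omega> \<tau>"
        unfolding agree_def f_def using RA by (metis UnCI)
    qed
    then have "{\<omega>\<in>Sym n. agree R \<sigma> \<omega> \<and> agree I \<omega> \<tau>} = {\<omega>\<in>Sym n. agree (R \<union> I) p \<omega>}" by simp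
    also have "card \<dots> = fact (n - card (R \<union> I))" using p(1) I R by (intro card_agree) (auto simp: Sym_def)
    finally show ?thesis using True by simp
  next
    case False
    then obtain r where r: "r \<in> R" "r \<in> E" "r \<notin> A" by blast
    have "{\<omega>\<in>Sym n. agree R \<sigma> \<omega> \<and> agree I \<omega> \<tau>} = {}"
    proof (rule ccontr)
      assume "\<not> ?thesis"
      then obtain \<omega> where w: "\<omega> \<in> Sym n" "agree R \<sigma> \<omega>" "agree I \<omega> \<tau>" by auto
      have sr: "\<sigma> r = \<omega> r" using w r by (auto simp: agree_def)
      show False
      proof (cases "r \<in> I")
        case True
        then have "\<omega> r = \<tau> r" using w by (auto simp: agree_def)
        then show False using sr True r by (simp add: A_def)
      next
        case F: False
        then obtain i where i: "i \<in> I" "\<sigma> r = \<tau> i" using r E by blast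
        then have "\<omega> r = \<omega> i" using w sr by (auto simp: agree_def)
        then have "r = i" using w(1) by (auto simp: Sym_def dest: permutes_inj injD)
        then show False using F i by simp
      qed
    qed
    then have "card {\<omega>\<in>Sym n. agree R \<sigma> \<omega> \<and> agree I \<omega> \<tau>} = 0" by (simp only: card.empty)
    then show ?thesis using False by simp
  qed
qed

text \<open>Vanishing falling factorials absorb both degenerate cases, \<open>j < k\<close> and
  \<open>n - e < j - k\<close>, so that the right-hand side is a single polynomial in
  \<open>j\<close>, of degree \<open>k + (e - t)\<close>.\<close>

lemma falling_term:
  assumes "j + t \<le> n" "t \<le> e" "e \<le> n"
  shows "(if k \<le> j then real (n - e choose (j - k)) * fact (n - (j - k + t)) else 0) / (fact (n - j) * real (n choose j))
    = fact (n - e) / fact n * ((\<Prod>i<k. real j - real i) * (\<Prod>i<e - t. (real n - real t + real k - real j) - real i))"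
proof (cases "k \<le> j")
  case False
  then show ?thesis by (simp add: prod_falling_zero)
next
  case True
  have b: "fact (n - j) * real (n choose j) = fact n / fact j"
    using assms binomial_fact[of j n, where ?'a=real] by (simp add: field_simps)
  define N where "N = n - (j - k + t)"
  have N: "real n - real t + real k - real j = real N"
    using assms True by (simp add: N_def of_nat_diff)
  show ?thesis
  proof (cases "j - k \<le> n - e")
    case T2: True
    define M where "M = n - e - (j - k)"
    have "e - t \<le> N" using assms True T2 by (simp add: N_def)
    then have p2: "(\<Prod>i<e - t. real N - real i) = fact N / fact M"
      using assms T2 True by (subst prod_falling) (auto simp: N_def M_def intro!: arg_cong[of _ _ fact])
    have c: "real (n - e choose (j - k)) = fact (n - e) / (fact (j - k) * fact M)"
      using binomial_fact[OF T2] by (simp add: M_def)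
    show ?thesis unfolding N p2 prod_falling[OF True] b c N_def[symmetric] using True by (simp add: field_simps)
  next
    case F2: False
    then have "N < e - t" using assms True by (simp add: N_def)
    then show ?thesis unfolding N using True F2 by (simp add: prod_falling_zero binomial_eq_0)
  qed
qed

lemma Sop_cong:
  assumes "\<And>\<tau>. \<tau> \<in> Sym n \<Longrightarrow> f \<tau> = g \<tau>" "\<sigma> \<in> Sym n"
  shows "Sop n k f \<sigma> = Sop n k g \<sigma>"
  unfolding Sop_def using assms by (intro sum.cong refl av_cong[of n]) auto

lemma Sop_sum: "Sop n k (\<lambda>\<sigma>. \<Sum>x\<in>X. f x \<sigma>) \<sigma> = (\<Sum>x\<in>X. Sop n k (f x) \<sigma>)"
  by (simp add: Sop_def av_sum sum.swap[of _ X])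

lemma Sop_scale: "Sop n k (\<lambda>\<sigma>. a * f \<sigma>) \<sigma> = a * Sop n k f \<sigma>"
  by (simp add: Sop_def av_scale sum_distrib_left)

text \<open>An admissible \<open>R\<close> splits uniquely into a part \<open>K\<close> inside
  \<open>A\<close> and a part outside \<open>E\<close>; only the sizes of the two parts enter the
  count of \<open>card_two_constraints\<close>.\<close>

lemma Sop_agree:
  assumes s: "\<sigma> \<in> Sym n" and t: "\<tau> \<in> Sym n" and I: "I \<in> ksets n t"
  defines "A \<equiv> {i\<in>I. \<sigma> i = \<tau> i}" and "E \<equiv> I \<union> (inv \<sigma> \<circ> \<tau>) ` I"
  shows "Sop n j (\<lambda>\<omega>. if agree I \<omega> \<tau> then 1 else 0) \<sigma> =
    (\<Sum>K\<in>Pow A. if card K \<le> j then real (n - card E choose (j - card K)) * fact (n - (j - card K + t)) else 0) / fact (n - j)"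
proof -
  have I': "I \<subseteq> {1..n}" "card I = t" "finite I" using I by (auto simp: ksets_sub)
  have ps: "\<sigma> permutes {1..n}" and pt: "\<tau> permutes {1..n}" using s t by (auto simp: Sym_def)
  have En: "E \<subseteq> {1..n}" unfolding E_def
    using I' permutes_in_image[OF permutes_inv[OF ps]] permutes_in_image[OF pt] by (auto simp del: atLeastAtMost_iff)
  have A: "A \<subseteq> I" "finite A" "A \<subseteq> E" using I' by (auto simp: A_def E_def)
  have fE: "finite E" using En finite_sub by blast
  have IE: "I \<subseteq> E" by (auto simp: E_def)
  let ?X = "{R\<in>ksets n j. R \<inter> (E - A) = {}}"
  let ?Y = "SIGMA K:{K\<in>Pow A. card K \<le> j}. {R. R \<subseteq> {1..n} - E \<and> card R = j - card K}"
  have "Sop n j (\<lambda>\<omega>. if agree I \<omega> \<tau> then 1 else 0) \<sigma> =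
     (\<Sum>R\<in>ksets n j. real (card {\<omega>\<in>Sym n. agree R \<sigma> \<omega> \<and> agree I \<omega> \<tau>}) / fact (n - j))"
    unfolding Sop_def
  proof (intro sum.cong refl)
    fix R assume R: "R \<in> ksets n j"
    have "cnd n R (\<lambda>\<omega>. if agree I \<omega> \<tau> then 1 else 0) \<sigma> = (\<Sum>\<omega>\<in>Sym n. if agree R \<sigma> \<omega> then if agree I \<omega> \<tau> then 1 else 0 else 0) / fact (n - j)"
      using cnd_coset[OF s ksets_sub(1)[OF R]] ksets_sub(2)[OF R] by simp
    also have "(\<Sum>\<omega>\<in>Sym n. if agree R \<sigma> \<omega> then if agree I \<omega> \<tau> then 1 else 0 else 0) = (\<Sum>\<omega>\<in>Sym n. if agree R \<sigma> \<omega> \<and> agree I \<omega> \<tau> then 1 else 0 :: real)"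
      by (intro sum.cong) auto
    also have "\<dots> = real (card {\<omega>\<in>Sym n. agree R \<sigma> \<omega> \<and> agree I \<omega> \<tau>})"
      by (simp add: sum.inter_filter[symmetric])
    finally show "cnd n R (\<lambda>\<omega>. if agree I \<omega> \<tau> then 1 else 0) \<sigma> = real (card {\<omega>\<in>Sym n. agree R \<sigma> \<omega> \<and> agree I \<omega> \<tau>}) / fact (n - j)" .
  qed
  also have "\<dots> = (\<Sum>R\<in>ksets n j. if R \<inter> (E - A) = {} then fact (n - card (R \<union> I)) / fact (n - j) else 0)"
    using card_two_constraints[OF s t I'(1)] unfolding A_def E_def by (intro sum.cong refl) (auto simp: ksets_sub)
  also have "\<dots> = (\<Sum>R\<in>?X. fact (n - card (R \<union> I)) / fact (n - j))"
    by (simp add: sum.inter_filter)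
  also have "\<dots> = (\<Sum>(K, R)\<in>?Y. fact (n - (j - card K + t)) / fact (n - j))"
  proof (rule sum.reindex_bij_witness[of _ "\<lambda>(K, R). K \<union> R" "\<lambda>R. (R \<inter> A, R - A)"])
    fix R assume R: "R \<in> ?X"
    then have Rj: "R \<in> ksets n j" by simp
    have Rn: "R \<subseteq> {1..n}" "card R = j" "finite R" using ksets_sub[OF Rj] by auto
    show "(case (R \<inter> A, R - A) of (K, R) \<Rightarrow> K \<union> R) = R" by auto
    have cj: "card R = card (R \<inter> A) + card (R - A)" using Rn by (metis Int_commute card_Int_Diff)
    show "(R \<inter> A, R - A) \<in> ?Y" using R Rn cj by (auto simp: ksets_def)
    have "R \<union> I = (R - A) \<union> I" "(R - A) \<inter> I = {}" using A R IE by auto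
    then have "card (R \<union> I) = card (R - A) + t" using I' Rn by (simp add: card_Un_disjoint)
    then show "(case (R \<inter> A, R - A) of (K, R) \<Rightarrow> fact (n - (j - card K + t)) / fact (n - j)) = fact (n - card (R \<union> I)) / (fact (n - j) :: real)"
      using cj Rn by simp
  next
    fix b assume b: "b \<in> ?Y"
    then obtain K R where KR: "b = (K, R)" "K \<subseteq> A" "card K \<le> j" "R \<subseteq> {1..n} - E" "card R = j - card K" by auto
    have fin: "finite K" "finite R" using KR A finite_subset finite_sub by (blast, meson Diff_subset finite_sub subset_trans)
    have d: "K \<inter> R = {}" "(K \<union> R) \<inter> A = K" "(K \<union> R) - A = R" using KR A by auto
    then show "(\<lambda>R. (R \<inter> A, R - A)) (case b of (K, R) \<Rightarrow> K \<union> R) = b" using KR by simp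
    have "card (K \<union> R) = j" using fin d KR by (simp add: card_Un_disjoint)
    then show "(case b of (K, R) \<Rightarrow> K \<union> R) \<in> ?X" using KR A En by (auto simp: ksets_def)
  qed
  also have "\<dots> = (\<Sum>K\<in>{K\<in>Pow A. card K \<le> j}. \<Sum>R\<in>{R. R \<subseteq> {1..n} - E \<and> card R = j - card K}. fact (n - (j - card K + t)) / fact (n - j))"
    using A by (subst sum.Sigma) (auto intro: finite_subset[of _ "Pow {1..n}"])
  also have "\<dots> = (\<Sum>K\<in>{K\<in>Pow A. card K \<le> j}. real (n - card E choose (j - card K)) * (fact (n - (j - card K + t)) / fact (n - j)))"
    using n_subsets[of "{1..n} - E"] card_compl[OF En] by (intro sum.cong refl) simp
  also have "\<dots> = (\<Sum>K\<in>Pow A. if card K \<le> j then real (n - card E choose (j - card K)) * (fact (n - (j - card K + t)) / fact (n - j)) else 0)"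
    using A by (intro sum.inter_filter) auto
  also have "\<dots> = (\<Sum>K\<in>Pow A. if card K \<le> j then real (n - card E choose (j - card K)) * fact (n - (j - card K + t)) else 0) / fact (n - j)"
    by (simp add: sum_divide_distrib if_distrib[of "\<lambda>x. x / _"] cong: if_cong)
  finally show ?thesis .
qed

text \<open>The term of \<open>K\<close> has degree \<open>card K + (e - t)\<close>. This is at most
  \<open>t\<close> because \<open>A\<close> lies both in \<open>I\<close> and in its image under
  \<open>inv \<sigma> \<circ> \<tau>\<close>, whence \<open>e + card A \<le> 2 * t\<close>.\<close>

lemma Sop_agree_poly:
  assumes s: "\<sigma> \<in> Sym n" and t: "\<tau> \<in> Sym n" and I: "I \<in> ksets n t"
  shows "\<exists>p::real poly. degree p \<le> t \<and> (\<forall>j. j + t \<le> n \<longrightarrow>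
    Sop n j (\<lambda>\<omega>. if agree I \<omega> \<tau> then 1 else 0) \<sigma> / real (n choose j) = poly p (real j))"
proof -
  define A where "A = {i\<in>I. \<sigma> i = \<tau> i}"
  define E where "E = I \<union> (inv \<sigma> \<circ> \<tau>) ` I"
  define e where "e = card E"
  have I': "I \<subseteq> {1..n}" "card I = t" "finite I" using I by (auto simp: ksets_sub)
  have ps: "\<sigma> permutes {1..n}" and pt: "\<tau> permutes {1..n}" using s t by (auto simp: Sym_def)
  have En: "E \<subseteq> {1..n}" unfolding E_def
    using I' permutes_in_image[OF permutes_inv[OF ps]] permutes_in_image[OF pt] by (auto simp del: atLeastAtMost_iff)
  have A: "A \<subseteq> I" "finite A" using I' by (auto simp: A_def)
  have fE: "finite E" using En finite_sub by blast
  have te: "t \<le> e" unfolding e_def using I' fE by (metis E_def Un_upper1 card_mono)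
  have en: "e \<le> n" unfolding e_def using card_mono[OF _ En] by simp
  have "A \<subseteq> I \<inter> (inv \<sigma> \<circ> \<tau>) ` I"
  proof
    fix x assume "x \<in> A"
    then have "x \<in> I" "(inv \<sigma> \<circ> \<tau>) x = x" using permutes_inverses[OF ps] by (auto simp: A_def) (metis)
    then show "x \<in> I \<inter> (inv \<sigma> \<circ> \<tau>) ` I" by (metis IntI imageI)
  qed
  then have "card A \<le> card (I \<inter> (inv \<sigma> \<circ> \<tau>) ` I)" using I' by (intro card_mono) auto
  moreover have "card E + card (I \<inter> (inv \<sigma> \<circ> \<tau>) ` I) = card I + card ((inv \<sigma> \<circ> \<tau>) ` I)"
    unfolding E_def using I' by (subst card_Un_Int[symmetric]) auto
  moreover have "card ((inv \<sigma> \<circ> \<tau>) ` I) \<le> t" using I' card_image_le by blast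
  ultimately have eA: "e + card A \<le> 2 * t" using I' unfolding e_def by linarith
  define p :: "real poly" where "p = (\<Sum>K\<in>Pow A. smult (fact (n - e) / fact n)
     ((\<Prod>i<card K. [:- real i, 1:]) * (\<Prod>i<e - t. [:real n - real t + real (card K) - real i, -1:])))"
  have "degree p \<le> t" unfolding p_def
  proof (rule degree_sum_le)
    fix K assume K: "K \<in> Pow A"
    have "degree (\<Prod>i<card K. [:- real i, 1:]) \<le> card K"
      using degree_prod_sum_le[of "{..<card K}" "\<lambda>i. [:- real i, 1:]"] by simp
    moreover have "degree (\<Prod>i<e - t. [:real n - real t + real (card K) - real i, -1:]) \<le> e - t"
      using degree_prod_sum_le[of "{..<e - t}" "\<lambda>i. [:real n - real t + real (card K) - real i, -1:]"] by simp
    moreover have "card K \<le> card A" using K A card_mono by blast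
    ultimately have "degree ((\<Prod>i<card K. [:- real i, 1:]) * (\<Prod>i<e - t. [:real n - real t + real (card K) - real i, -1:])) \<le> t"
      using eA te by (intro order.trans[OF degree_mult_le]) linarith
    then show "degree (smult (fact (n - e) / fact n)
     ((\<Prod>i<card K. [:- real i, 1:]) * (\<Prod>i<e - t. [:real n - real t + real (card K) - real i, -1:]))) \<le> t"
      using degree_smult_le le_trans by blast
  qed (use A in simp)
  moreover have "Sop n j (\<lambda>\<omega>. if agree I \<omega> \<tau> then 1 else 0) \<sigma> / real (n choose j) = poly p (real j)" if "j + t \<le> n" for j
  proof -
    have "Sop n j (\<lambda>\<omega>. if agree I \<omega> \<tau> then 1 else 0) \<sigma> / real (n choose j) =
      (\<Sum>K\<in>Pow A. (if card K \<le> j then real (n - e choose (j - card K)) * fact (n - (j - card K + t)) else 0) / (fact (n - j) * real (n choose j)))"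
      using Sop_agree[OF s t I, of j] unfolding A_def[symmetric] E_def[symmetric] e_def[symmetric] by (simp add: sum_divide_distrib)
    also have "\<dots> = (\<Sum>K\<in>Pow A. fact (n - e) / fact n * ((\<Prod>i<card K. real j - real i) * (\<Prod>i<e - t. (real n - real t + real (card K) - real j) - real i)))"
      by (intro sum.cong refl falling_term that te en)
    also have "\<dots> = poly p (real j)" by (simp add: p_def poly_sum poly_prod algebra_simps)
    finally show ?thesis .
  qed
  ultimately show ?thesis by blast
qed

lemma Sop_lowdeg_poly:
  assumes g: "lowdeg n t g" and s: "\<sigma> \<in> Sym n"
  shows "\<exists>p::real poly. degree p \<le> t \<and> (\<forall>j. j + t \<le> n \<longrightarrow> Sop n j g \<sigma> / real (n choose j) = poly p (real j))"
proof -
  obtain a where a: "\<And>\<omega>. \<omega> \<in> Sym n \<Longrightarrow> g \<omega> = (\<Sum>I\<in>ksets n t. \<Sum>\<tau>\<in>Sym n. a I \<tau> * (if agree I \<omega> \<tau> then 1 else 0))"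
    using g unfolding lowdeg_def by (auto simp: if_distrib[of "\<lambda>x. _ * x"] cong: if_cong)
  have "\<forall>I\<in>ksets n t. \<forall>\<tau>\<in>Sym n. \<exists>p::real poly. degree p \<le> t \<and> (\<forall>j. j + t \<le> n \<longrightarrow>
    Sop n j (\<lambda>\<omega>. if agree I \<omega> \<tau> then 1 else 0) \<sigma> / real (n choose j) = poly p (real j))"
    using Sop_agree_poly[OF s] by blast
  then obtain P where P: "\<And>I \<tau>. I \<in> ksets n t \<Longrightarrow> \<tau> \<in> Sym n \<Longrightarrow> degree (P I \<tau> :: real poly) \<le> t"
    "\<And>I \<tau> j. I \<in> ksets n t \<Longrightarrow> \<tau> \<in> Sym n \<Longrightarrow> j + t \<le> n \<Longrightarrow>
      Sop n j (\<lambda>\<omega>. if agree I \<omega> \<tau> then 1 else 0) \<sigma> / real (n choose j) = poly (P I \<tau>) (real j)"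
    by metis
  define p where "p = (\<Sum>I\<in>ksets n t. \<Sum>\<tau>\<in>Sym n. smult (a I \<tau>) (P I \<tau>))"
  have "degree p \<le> t" unfolding p_def
    by (intro degree_sum_le order.trans[OF degree_smult_le] P(1)) simp_all
  moreover have "Sop n j g \<sigma> / real (n choose j) = poly p (real j)" if "j + t \<le> n" for j
  proof -
    have "Sop n j g \<sigma> = Sop n j (\<lambda>\<omega>. \<Sum>I\<in>ksets n t. \<Sum>\<tau>\<in>Sym n. a I \<tau> * (if agree I \<omega> \<tau> then 1 else 0)) \<sigma>"
      by (rule Sop_cong[OF a s])
    then show ?thesis using P(2)[OF _ _ that]
      by (simp add: Sop_sum Sop_scale p_def poly_sum sum_divide_distrib times_divide_eq_right[symmetric] del: times_divide_eq_right)
  qed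
  ultimately show ?thesis by blast
qed

text \<open>The level polynomial has degree at most \<open>t\<close> and vanishes at
  \<open>0, ..., t - 1\<close>, hence is a multiple of \<open>j choose t\<close>; its value at
  \<open>j = t\<close> determines the multiple.\<close>

lemma Sop_centered:
  assumes v: "lowdeg n t v" "centered n t v" and s: "\<sigma> \<in> Sym n" and nt: "2 * t \<le> n" and j: "j + t \<le> n"
  shows "Sop n j v \<sigma> / real (n choose j) = real (j choose t) / real (n choose t) * Sop n t v \<sigma>"
proof -
  obtain p :: "real poly" where p: "degree p \<le> t" "\<And>j. j + t \<le> n \<Longrightarrow> Sop n j v \<sigma> / real (n choose j) = poly p (real j)"
    using Sop_lowdeg_poly[OF v(1) s] by blast
  have z: "poly p (real k) = 0" if "k < t" for k
    using p(2)[of k] centered_Sop[OF v(2) that s] that nt by simp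
  have "poly p (real j) = (\<Sum>k\<le>t. poly p (real k) * (\<Prod>i\<in>{..t}-{k}. (real j - real i) / (real k - real i)))"
    by (rule lagrange_interpolation[OF p(1)])
  also have "\<dots> = (\<Sum>k\<le>t. if k = t then poly p (real t) * (\<Prod>i\<in>{..t}-{t}. (real j - real i) / (real t - real i)) else 0)"
    using z by (intro sum.cong refl) auto
  also have "\<dots> = poly p (real t) * (\<Prod>i<t. (real j - real i) / (real t - real i))"
  proof -
    have "{..t} - {t} = {..<t}" by auto
    then show ?thesis by simp
  qed
  also have "(\<Prod>i<t. (real j - real i) / (real t - real i)) = real (j choose t)"
  proof (cases "t \<le> j")
    case True
    then show ?thesis by (simp add: prod_dividef prod_falling binomial_fact field_simps)
  next
    case False
    then show ?thesis by (simp add: prod_dividef prod_falling_zero)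
  qed
  also have "poly p (real t) = Sop n t v \<sigma> / real (n choose t)" using p(2)[of t] nt by simp
  finally show ?thesis using p(2)[OF j] by simp
qed

text \<open>Interpolation from the levels \<open>0, ..., k\<close>, with numerators at most
  \<open>n\<close> and denominators at least 1. The crude factor \<open>n ^ k\<close> is affordable
  because it is applied to sparse functions only.\<close>

lemma Sop_extrapolate:
  assumes g: "lowdeg n k g" and nk: "2 * k \<le> n"
  shows "\<exists>l. (\<forall>i\<le>k. \<bar>l i\<bar> \<le> real n ^ k) \<and>
    (\<forall>\<sigma>\<in>Sym n. Sop n (n - k) g \<sigma> / real (n choose (n - k)) = (\<Sum>i\<le>k. l i * (Sop n i g \<sigma> / real (n choose i))))"
proof -
  define l where "l i = (\<Prod>j\<in>{..k}-{i}. (real (n - k) - real j) / (real i - real j))" for i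
  have b: "\<bar>l i\<bar> \<le> real n ^ k" if "i \<le> k" for i
  proof -
  have "\<bar>l i\<bar> = (\<Prod>j\<in>{..k}-{i}. \<bar>(real (n - k) - real j) / (real i - real j)\<bar>)" unfolding l_def by (simp add: abs_prod)
  also have "\<dots> \<le> (\<Prod>j\<in>{..k}-{i}. real n)"
  proof (intro prod_mono conjI abs_ge_zero)
    fix j assume j: "j \<in> {..k} - {i}"
    have "\<bar>real (n - k) - real j\<bar> \<le> real n" using j nk by (simp add: of_nat_diff)
    moreover have "1 \<le> \<bar>real i - real j\<bar>" using j by (auto simp: abs_if)
    ultimately show "\<bar>(real (n - k) - real j) / (real i - real j)\<bar> \<le> real n"
      using frac_le[of "real n" "\<bar>real (n - k) - real j\<bar>" 1 "\<bar>real i - real j\<bar>"] by (simp add: abs_divide)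
  qed
  also have "\<dots> = real n ^ k" using that by simp
  finally show ?thesis .
  qed
  have "Sop n (n - k) g \<sigma> / real (n choose (n - k)) = (\<Sum>i\<le>k. l i * (Sop n i g \<sigma> / real (n choose i)))"
    if s: "\<sigma> \<in> Sym n" for \<sigma>
  proof -
  obtain p :: "real poly" where p: "degree p \<le> k" "\<And>j. j + k \<le> n \<Longrightarrow> Sop n j g \<sigma> / real (n choose j) = poly p (real j)"
    using Sop_lowdeg_poly[OF g s] by blast
  have "Sop n (n - k) g \<sigma> / real (n choose (n - k)) = poly p (real (n - k))" using p(2)[of "n - k"] nk by simp
  also have "\<dots> = (\<Sum>i\<le>k. poly p (real i) * l i)"
    unfolding l_def by (rule lagrange_interpolation[OF p(1)])
  also have "\<dots> = (\<Sum>i\<le>k. l i * (Sop n i g \<sigma> / real (n choose i)))"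
    using p(2) nk by (intro sum.cong refl) (simp add: mult.commute)
  finally show ?thesis .
  qed
  with b show ?thesis by blast
qed

section \<open>Restricting low degree functions to most coordinates\<close>

text \<open>The complementary projection of \<open>av D\<close>: the part of \<open>g\<close> that
  depends on how the values on \<open>D\<close> are arranged.\<close>

definition dif :: "nat set \<Rightarrow> ((nat \<Rightarrow> nat) \<Rightarrow> real) \<Rightarrow> (nat \<Rightarrow> nat) \<Rightarrow> real" where
  "dif D g = (\<lambda>\<sigma>. g \<sigma> - av D g \<sigma>)"

lemma dif_zero: "finite D \<Longrightarrow> dif D (\<lambda>_. 0) = (\<lambda>_. 0)"
  by (simp add: dif_def av_def)

lemma fold_dif_zero: "\<forall>D\<in>set xs. finite D \<Longrightarrow> fold dif xs (\<lambda>_. 0) = (\<lambda>_. 0)"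
  by (induction xs) (auto simp: dif_zero)

lemma dif_cong:
  assumes "\<And>\<tau>. \<tau> \<in> Sym n \<Longrightarrow> f \<tau> = g \<tau>" "\<sigma> \<in> Sym n" "D \<subseteq> {1..n}"
  shows "dif D f \<sigma> = dif D g \<sigma>"
  using av_cong[OF assms] assms by (simp add: dif_def)

lemma fold_dif_cong:
  "(\<And>\<tau>. \<tau> \<in> Sym n \<Longrightarrow> f \<tau> = g \<tau>) \<Longrightarrow> \<sigma> \<in> Sym n \<Longrightarrow> \<forall>D\<in>set xs. D \<subseteq> {1..n} \<Longrightarrow>
    fold dif xs f \<sigma> = fold dif xs g \<sigma>"
proof (induction xs arbitrary: f g)
  case (Cons D xs)
  have "\<And>\<tau>. \<tau> \<in> Sym n \<Longrightarrow> dif D f \<tau> = dif D g \<tau>"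
    using Cons.prems by (intro dif_cong[of n]) auto
  then show ?case using Cons.IH[of "dif D f" "dif D g"] Cons.prems by simp
qed simp

lemma dif_sum: "dif D (\<lambda>\<sigma>. \<Sum>x\<in>X. f x \<sigma>) = (\<lambda>\<sigma>. \<Sum>x\<in>X. dif D (f x) \<sigma>)"
  by (simp add: dif_def av_sum sum_subtractf)

lemma fold_dif_sum: "fold dif xs (\<lambda>\<sigma>. \<Sum>x\<in>X. f x \<sigma>) = (\<lambda>\<sigma>. \<Sum>x\<in>X. fold dif xs (f x) \<sigma>)"
  by (induction xs arbitrary: f) (simp_all add: dif_sum)

lemma dif_av_commute:
  assumes "D \<inter> E = {}"
  shows "dif E (av D g) = av D (dif E g)"
  using av_commute[OF assms, of g] by (simp add: dif_def av_diff fun_eq_iff)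

lemma fold_dif_av:
  "\<forall>E\<in>set xs. D \<inter> E = {} \<Longrightarrow> fold dif xs (av D g) = av D (fold dif xs g)"
  by (induction xs arbitrary: g) (simp_all add: dif_av_commute)

lemma fold_dif_invariant:
  assumes "sorted_wrt (\<lambda>d e. d \<inter> e = {}) xs" "\<forall>D\<in>set xs. finite D" "D \<in> set xs" "av D h = h"
  shows "fold dif xs h = (\<lambda>_. 0)"
  using assms
proof (induction xs arbitrary: h)
  case (Cons E xs)
  show ?case
  proof (cases "D = E")
    case True
    then have "dif E h = (\<lambda>_. 0)" using Cons.prems(4) by (simp add: dif_def)
    then show ?thesis using fold_dif_zero Cons.prems(2) by simp
  next
    case False
    then have D: "D \<in> set xs" using Cons.prems by simp
    then have "av D (dif E h) = dif E h" using Cons.prems dif_av_commute[of D E h] by (simp add: Int_commute)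
    then show ?thesis using Cons D by simp
  qed
qed simp

lemma Nil_in_subseqs: "[] \<in> set (subseqs ds)"
  by (induction ds) (auto simp: Let_def)

lemma subseqs_subset: "xs \<in> set (subseqs ds) \<Longrightarrow> set xs \<subseteq> set ds"
  using subseqs_powset[of ds] by blast

lemma sorted_wrt_subseqs: "xs \<in> set (subseqs ds) \<Longrightarrow> sorted_wrt R ds \<Longrightarrow> sorted_wrt R xs"
proof (induction ds arbitrary: xs)
  case (Cons d ds)
  show ?case
  proof (cases "xs \<in> set (subseqs ds)")
    case False
    then obtain ys where ys: "xs = d # ys" "ys \<in> set (subseqs ds)" using Cons.prems(1) by (auto simp: Let_def)
    then show ?thesis using Cons subseqs_subset[OF ys(2)] by auto
  qed (use Cons in simp)
qed simp

lemma sum_list_map_zero: "(\<And>x. x \<in> set xs \<Longrightarrow> f x = (0::real)) \<Longrightarrow> (\<Sum>x\<leftarrow>xs. f x) = 0"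
  by (induction xs) auto

text \<open>For disjoint sets \<open>D\<close> the \<open>dif D\<close> are commuting orthogonal
  projections. If any \<open>s\<close> of them together annihilate \<open>g\<close>, then each joint
  component of \<open>g\<close> survives at most \<open>s - 1\<close> of them and is counted at most
  that often on the left. The induction splits \<open>g\<close> along one projection at a time
  instead of forming the joint decomposition.\<close>

lemma sum_dif_le:
  assumes "sorted_wrt (\<lambda>d e. d \<inter> e = {}) ds" "\<forall>D\<in>set ds. D \<subseteq> {1..n}"
    "\<And>xs \<sigma>. xs \<in> set (subseqs ds) \<Longrightarrow> length xs = s \<Longrightarrow> \<sigma> \<in> Sym n \<Longrightarrow> fold dif xs g \<sigma> = 0"
  shows "(\<Sum>D\<leftarrow>ds. nsq n (dif D g)) \<le> (real s - 1) * nsq n g"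
  using assms
proof (induction ds arbitrary: s g)
  case Nil
  show ?case
  proof (cases s)
    case 0
    then have "nsq n g = 0" using Nil(3)[of "[]"] by (simp add: ip_def)
    then show ?thesis by simp
  qed simp
next
  case (Cons D ds)
  have D: "D \<subseteq> {1..n}" and disj: "\<forall>E\<in>set ds. D \<inter> E = {}" and dsn: "\<forall>E\<in>set ds. E \<subseteq> {1..n}" "sorted_wrt (\<lambda>d e. d \<inter> e = {}) ds"
    using Cons.prems by auto
  show ?case
  proof (cases s)
    case 0
    have g0: "g \<sigma> = 0" if "\<sigma> \<in> Sym n" for \<sigma> using Cons.prems(3)[OF Nil_in_subseqs _ that] 0 by simp
    have ng: "nsq n g = 0" using g0 by (simp add: ip_def)
    have "nsq n (dif E g) = 0" if "E \<in> set (D # ds)" for E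
    proof -
      have "E \<subseteq> {1..n}" using Cons.prems(2) that by blast
      then have "nsq n (dif E g) \<le> nsq n g" using nsq_minus_av[of E n g] nsq_nonneg[of n "av E g"] by (simp add: dif_def)
      then show ?thesis using ng nsq_nonneg[of n "dif E g"] by linarith
    qed
    then have "(\<Sum>D\<leftarrow>D # ds. nsq n (dif D g)) = 0" by (intro sum_list_map_zero) blast
    then show ?thesis using ng by simp
  next
    case (Suc s')
    have sub: "xs \<in> set (subseqs (D # ds))" "D # xs \<in> set (subseqs (D # ds))" if "xs \<in> set (subseqs ds)" for xs
      using that by (auto simp: Let_def)
    have sd: "set xs \<subseteq> set ds" if "xs \<in> set (subseqs ds)" for xs
      using that by (rule subseqs_subset)
    \<comment> \<open>On \<open>dif D g\<close> one of the \<open>s\<close> projections has been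
      used up, so the budget drops to \<open>s'\<close>; on \<open>av D g\<close> below it stays at
      \<open>s\<close>.\<close>
    have 1: "(\<Sum>E\<leftarrow>ds. nsq n (dif E (dif D g))) \<le> (real s' - 1) * nsq n (dif D g)"
    proof (rule Cons.IH[OF dsn(2) dsn(1)])
      fix xs \<sigma> assume "xs \<in> set (subseqs ds)" "length xs = s'" "\<sigma> \<in> Sym n"
      then show "fold dif xs (dif D g) \<sigma> = 0" using Cons.prems(3)[of "D # xs" \<sigma>] sub Suc by simp
    qed
    have 0: "(\<Sum>E\<leftarrow>ds. nsq n (dif E (av D g))) \<le> (real s - 1) * nsq n (av D g)"
    proof (rule Cons.IH[OF dsn(2) dsn(1)])
      fix xs \<sigma> assume xs: "xs \<in> set (subseqs ds)" "length xs = s" and s: "\<sigma> \<in> Sym n"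
      have "fold dif xs (av D g) \<sigma> = av D (fold dif xs g) \<sigma>"
        using disj sd[OF xs(1)] by (subst fold_dif_av) auto
      also have "\<dots> = av D (\<lambda>_. 0) \<sigma>"
        by (rule av_cong[of n]) (use Cons.prems(3)[of xs] sub(1) xs s D in auto)
      finally show "fold dif xs (av D g) \<sigma> = 0" by (simp add: av_def)
    qed
    have split: "nsq n (dif E g) = nsq n (dif E (dif D g)) + nsq n (dif E (av D g))" if "E \<in> set ds" for E
    proof -
      have a: "dif E (av D g) = av D (dif E g)" using dif_av_commute disj that by blast
      have b: "dif E (dif D g) = (\<lambda>\<sigma>. dif E g \<sigma> - av D (dif E g) \<sigma>)"
        using a by (auto simp: dif_def fun_eq_iff av_diff)
      show ?thesis unfolding a b using nsq_minus_av[OF D, of "dif E g"] by simp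
    qed
    have "(\<Sum>E\<leftarrow>ds. nsq n (dif E g)) = (\<Sum>E\<leftarrow>ds. nsq n (dif E (dif D g)) + nsq n (dif E (av D g)))"
      using split by (intro arg_cong[of _ _ sum_list] map_cong) auto
    also have "\<dots> = (\<Sum>E\<leftarrow>ds. nsq n (dif E (dif D g))) + (\<Sum>E\<leftarrow>ds. nsq n (dif E (av D g)))"
      by (rule sum_list_addf)
    finally have "(\<Sum>E\<leftarrow>D # ds. nsq n (dif E g)) \<le> nsq n (dif D g) + (real s' - 1) * nsq n (dif D g) + (real s - 1) * nsq n (av D g)"
      using 0 1 by simp
    also have "\<dots> = (real s - 1) * (nsq n (dif D g) + nsq n (av D g))" using Suc by (simp add: algebra_simps)
    also have "nsq n (dif D g) + nsq n (av D g) = nsq n g" using nsq_minus_av[OF D, of g] by (simp add: dif_def)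
    finally show ?thesis .
  qed
qed

lemma av_agree:
  assumes "D \<inter> I = {}" "finite D"
  shows "av D (\<lambda>\<omega>. a * (if agree I \<omega> \<tau> then 1 else 0)) = (\<lambda>\<omega>. a * (if agree I \<omega> \<tau> then 1 else 0))"
proof
  fix \<sigma>
  show "av D (\<lambda>\<omega>. a * (if agree I \<omega> \<tau> then 1 else 0)) \<sigma> = a * (if agree I \<sigma> \<tau> then 1 else 0)"
  proof (rule av_const[OF _ assms(2)])
    fix \<pi> assume "\<pi> permutes D"
    then have "\<pi> i = i" if "i \<in> I" for i using that assms(1) permutes_not_in by (metis disjoint_iff)
    then have "agree I (\<sigma> \<circ> \<pi>) \<tau> = agree I \<sigma> \<tau>" by (simp add: agree_def)
    then show "a * (if agree I (\<sigma> \<circ> \<pi>) \<tau> then 1 else 0) = a * (if agree I \<sigma> \<tau> then 1 else 0)" by simp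
  qed
qed

lemma disjoint_hits:
  assumes "sorted_wrt (\<lambda>d e. d \<inter> e = {}) xs" "\<forall>D\<in>set xs. D \<inter> I \<noteq> {}" "finite I"
  shows "length xs \<le> card I"
  using assms
proof (induction xs arbitrary: I)
  case (Cons D xs)
  have "\<forall>E\<in>set xs. E \<inter> (I - D) \<noteq> {}" using Cons.prems by fastforce
  then have "length xs \<le> card (I - D)" using Cons by simp
  also have "\<dots> < card I" using Cons.prems by (intro psubset_card_mono) auto
  finally show ?case by simp
qed simp

text \<open>A set of \<open>t\<close> coordinates misses one of \<open>t + 1\<close> disjoint sets,
  so every coset indicator is invariant under one of the averages and is killed by the corresponding
  \<open>dif\<close>.\<close>

lemma lowdeg_fold_dif:
  assumes g: "lowdeg n t g" and xs: "sorted_wrt (\<lambda>d e. d \<inter> e = {}) xs" "\<forall>D\<in>set xs. D \<subseteq> {1..n}" "length xs = Suc t"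
    and s: "\<sigma> \<in> Sym n"
  shows "fold dif xs g \<sigma> = 0"
proof -
  obtain a where a: "\<And>\<omega>. \<omega> \<in> Sym n \<Longrightarrow> g \<omega> = (\<Sum>I\<in>ksets n t. \<Sum>\<tau>\<in>Sym n. a I \<tau> * (if agree I \<omega> \<tau> then 1 else 0))"
    using g unfolding lowdeg_def by (auto simp: if_distrib[of "\<lambda>x. _ * x"] cong: if_cong)
  have fin: "\<forall>D\<in>set xs. finite D" using xs(2) finite_sub by blast
  have "fold dif xs g \<sigma> = fold dif xs (\<lambda>\<omega>. \<Sum>I\<in>ksets n t. \<Sum>\<tau>\<in>Sym n. a I \<tau> * (if agree I \<omega> \<tau> then 1 else 0)) \<sigma>"
    by (rule fold_dif_cong[OF a s xs(2)])
  also have "\<dots> = (\<Sum>I\<in>ksets n t. \<Sum>\<tau>\<in>Sym n. fold dif xs (\<lambda>\<omega>. a I \<tau> * (if agree I \<omega> \<tau> then 1 else 0)) \<sigma>)"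
    by (simp add: fold_dif_sum)
  also have "\<dots> = 0"
  proof (intro sum.neutral ballI)
    fix I \<tau> assume I: "I \<in> ksets n t"
    have "\<not> (\<forall>D\<in>set xs. D \<inter> I \<noteq> {})" using disjoint_hits[OF xs(1)] ksets_sub[OF I] xs(3) by fastforce
    then obtain D where D: "D \<in> set xs" "D \<inter> I = {}" by blast
    show "fold dif xs (\<lambda>\<omega>. a I \<tau> * (if agree I \<omega> \<tau> then 1 else 0)) \<sigma> = 0"
      using fold_dif_invariant[OF xs(1) fin D(1) av_agree[OF D(2)]] fin D(1) by simp
  qed
  finally show ?thesis .
qed

lemma ksets_transitive:
  assumes "D \<in> ksets n t" "E \<in> ksets n t"
  shows "\<exists>\<rho>\<in>Sym n. \<rho> ` D = E"
proof -
  have "card D = card E" "finite D" "finite E" using assms ksets_sub by auto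
  then obtain f where f: "bij_betw f D E" using finite_same_card_bij by blast
  then have "inj_on f D" "f ` D = E" by (auto simp: bij_betw_def)
  then obtain p where p: "p permutes {1..n}" "\<forall>x\<in>D. p x = f x"
    using permutation_extension[of f D "{1..n}"] assms ksets_sub(1) by blast
  then have "p ` D = E" using \<open>f ` D = E\<close> by (metis image_cong)
  then show ?thesis using p(1) by (auto simp: Sym_def)
qed

lemma Sym_image_ksets:
  assumes "\<sigma> \<in> Sym n" "D \<in> ksets n t"
  shows "\<sigma> ` D \<in> ksets n t"
proof -
  have p: "\<sigma> permutes {1..n}" using assms by (simp add: Sym_def)
  then show ?thesis
    using image_mono[OF ksets_sub(1)[OF assms(2)], of \<sigma>] permutes_image[OF p]
      card_image[OF permutes_inj_on[OF p, of D]] assms(2) by (simp add: ksets_def)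
qed

text \<open>Left multiplication shows that every \<open>t\<close>-set is the image of
  \<open>D\<close> equally often.\<close>

lemma sum_Sym_image:
  fixes h :: "nat set \<Rightarrow> real"
  assumes D: "D \<in> ksets n t"
  shows "(\<Sum>\<rho>\<in>Sym n. h (\<rho> ` D)) * real (n choose t) = fact n * (\<Sum>E\<in>ksets n t. h E)"
proof -
  define c where "c E = card {\<rho>\<in>Sym n. \<rho> ` D = E}" for E
  have le: "c E \<le> c E'" if E: "E \<in> ksets n t" "E' \<in> ksets n t" for E E'
  proof -
    obtain p where p: "p \<in> Sym n" "p ` E = E'" using ksets_transitive[OF E] by blast
    show ?thesis unfolding c_def
    proof (rule card_inj_on_le[of "\<lambda>\<rho>. p \<circ> \<rho>"])
      show "inj_on (\<lambda>\<rho>. p \<circ> \<rho>) {\<rho> \<in> Sym n. \<rho> ` D = E}"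
      proof (rule inj_onI)
        fix x y assume "p \<circ> x = p \<circ> y"
        then have "inv p \<circ> (p \<circ> x) = inv p \<circ> (p \<circ> y)" by (rule arg_cong)
        then show "x = y" by (simp only: comp_assoc[symmetric] Sym_inv_comp[OF p(1)] id_comp)
      qed
      show "(\<lambda>\<rho>. p \<circ> \<rho>) ` {\<rho> \<in> Sym n. \<rho> ` D = E} \<subseteq> {\<rho> \<in> Sym n. \<rho> ` D = E'}"
      proof
        fix y assume "y \<in> (\<lambda>\<rho>. p \<circ> \<rho>) ` {\<rho> \<in> Sym n. \<rho> ` D = E}"
        then obtain \<rho> where "\<rho> \<in> Sym n" "\<rho> ` D = E" "y = p \<circ> \<rho>" by blast
        then show "y \<in> {\<rho> \<in> Sym n. \<rho> ` D = E'}" using p Sym_comp by auto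
      qed
    qed simp
  qed
  have ceq: "c E = c D" if "E \<in> ksets n t" for E using le that D by (meson le_antisym)
  have grp: "(\<Sum>\<rho>\<in>Sym n. h' (\<rho> ` D)) = (\<Sum>E\<in>ksets n t. real (c E) * h' E)" for h' :: "nat set \<Rightarrow> real"
  proof -
    have "(\<Sum>\<rho>\<in>Sym n. h' (\<rho> ` D)) = (\<Sum>E\<in>ksets n t. \<Sum>\<rho>\<in>{\<rho>\<in>Sym n. \<rho> ` D = E}. h' (\<rho> ` D))"
      using Sym_image_ksets[OF _ D] by (intro sum.group[symmetric]) auto
    also have "\<dots> = (\<Sum>E\<in>ksets n t. real (c E) * h' E)"
      by (intro sum.cong refl) (simp add: c_def)
    finally show ?thesis .
  qed
  have "fact n = (\<Sum>E\<in>ksets n t. real (c E) * 1)" using grp[of "\<lambda>_. 1"] by (simp add: card_Sym)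
  also have "\<dots> = real (c D) * real (n choose t)" using ceq by (simp add: card_ksets)
  finally have f: "fact n = real (c D) * real (n choose t)" .
  have "(\<Sum>\<rho>\<in>Sym n. h (\<rho> ` D)) = real (c D) * (\<Sum>E\<in>ksets n t. h E)"
    using grp[of h] ceq by (simp add: sum_distrib_left)
  then show ?thesis using f by simp
qed

text \<open>\<open>K\<close> disjoint blocks of size \<open>t\<close> together contribute at most
  \<open>t * nsq n g\<close> by \<open>sum_dif_le\<close>. Moving them by a uniformly random
  permutation makes each block a uniformly random \<open>t\<close>-set.\<close>

lemma lowdeg_dif_le:
  assumes g: "lowdeg n t g" and K: "K * t \<le> n"
  shows "real K * (\<Sum>D\<in>ksets n t. nsq n (dif D g)) \<le> real t * real (n choose t) * nsq n g"
proof -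
  define B where "B i = {i * t + 1..(i + 1) * t}" for i
  have B: "B i \<in> ksets n t" if "i < K" for i
  proof -
    have "(i + 1) * t \<le> K * t" using that by (intro mult_le_mono1) simp
    then have "(i + 1) * t \<le> n" using K by linarith
    moreover have "(i + 1) * t = i * t + t" by (simp add: add_mult_distrib)
    ultimately show ?thesis by (auto simp: B_def ksets_def)
  qed
  have Bd: "B i \<inter> B j = {}" if "i < j" for i j
  proof -
    define a b where "a = (i + 1) * t" and "b = j * t"
    have "a \<le> b" unfolding a_def b_def using that by (intro mult_le_mono1) simp
    then show ?thesis unfolding B_def a_def[symmetric] b_def[symmetric] by auto
  qed
  have 1: "(\<Sum>i<K. nsq n (dif (\<rho> ` B i) g)) \<le> real t * nsq n g" if r: "\<rho> \<in> Sym n" for \<rho>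
  proof -
    define ds where "ds = map (\<lambda>i. \<rho> ` B i) [0..<K]"
    have inj: "inj \<rho>" using r by (auto simp: Sym_def dest: permutes_inj)
    have ds: "sorted_wrt (\<lambda>d e. d \<inter> e = {}) ds" unfolding ds_def sorted_wrt_map
      by (rule sorted_wrt_mono_rel[OF _ sorted_wrt_upt]) (use Bd inj in \<open>simp add: image_Int[symmetric]\<close>)
    have dn: "\<forall>D\<in>set ds. D \<subseteq> {1..n}"
    proof
      fix D assume "D \<in> set ds"
      then obtain i where "i < K" "D = \<rho> ` B i" by (auto simp: ds_def)
      then show "D \<subseteq> {1..n}" using ksets_sub(1)[OF Sym_image_ksets[OF r B]] by blast
    qed
    have "(\<Sum>D\<leftarrow>ds. nsq n (dif D g)) \<le> (real (Suc t) - 1) * nsq n g"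
    proof (rule sum_dif_le[OF ds dn])
      fix xs \<sigma> assume xs: "xs \<in> set (subseqs ds)" "length xs = Suc t" and s: "\<sigma> \<in> Sym n"
      have "set xs \<subseteq> set ds" using xs(1) by (rule subseqs_subset)
      then have "\<forall>D\<in>set xs. D \<subseteq> {1..n}" using dn by blast
      moreover have "sorted_wrt (\<lambda>d e. d \<inter> e = {}) xs" using xs(1) ds by (rule sorted_wrt_subseqs)
      ultimately show "fold dif xs g \<sigma> = 0" using lowdeg_fold_dif[OF g _ _ xs(2) s] by blast
    qed
    moreover have "(\<Sum>D\<leftarrow>ds. nsq n (dif D g)) = (\<Sum>i<K. nsq n (dif (\<rho> ` B i) g))"
      by (simp add: ds_def comp_def interv_sum_list_conv_sum_set_nat atLeast0LessThan)
    ultimately show ?thesis by simp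
  qed
  have "real K * (fact n * (\<Sum>D\<in>ksets n t. nsq n (dif D g))) = (\<Sum>i<K. (\<Sum>\<rho>\<in>Sym n. nsq n (dif (\<rho> ` B i) g)) * real (n choose t))"
    using sum_Sym_image[OF B, of _ "\<lambda>D. nsq n (dif D g)"] by simp
  also have "\<dots> = (\<Sum>\<rho>\<in>Sym n. \<Sum>i<K. nsq n (dif (\<rho> ` B i) g)) * real (n choose t)"
    by (subst sum.swap) (simp add: sum_distrib_right)
  also have "\<dots> \<le> (\<Sum>\<rho>\<in>Sym n. real t * nsq n g) * real (n choose t)"
    by (intro mult_right_mono sum_mono 1) auto
  also have "\<dots> = fact n * (real t * real (n choose t) * nsq n g)" by (simp add: card_Sym)
  finally have "fact n * (real K * (\<Sum>D\<in>ksets n t. nsq n (dif D g))) \<le> fact n * (real t * real (n choose t) * nsq n g)"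
    by (simp add: algebra_simps)
  then show ?thesis by (rule mult_left_le_imp_le) simp
qed

lemma ip_Sop: "ip n f (Sop n k f) = (\<Sum>I\<in>ksets n k. nsq n (cnd n I f))"
proof -
  have "ip n f (Sop n k f) = (\<Sum>I\<in>ksets n k. ip n f (cnd n I f))" unfolding Sop_def by (rule ip_sum_right)
  then show ?thesis by (simp add: nsq_av)
qed

text \<open>Forgetting the arrangement on a random set of \<open>t\<close> positions costs a
  function of degree \<open>t\<close> only a fraction \<open>O(1/n)\<close> of its squared norm: the
  number of disjoint sets of this size grows with \<open>n\<close>, while their total loss stays
  below \<open>t * nsq n g\<close>.\<close>

lemma Sop_compl_lower:
  assumes g: "lowdeg n t g" and n: "n \<ge> 2 * (t + 1)"
  shows "(1 - 2 * real t * real (t + 1) / real n) * nsq n g \<le> ip n g (Sop n (n - t) g) / real (n choose (n - t))"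
proof -
  \<comment> \<open>Dividing by \<open>t + 1\<close> instead of \<open>t\<close> keeps the case
    \<open>t = 0\<close> regular.\<close>
  define K where "K = n div (t + 1)"
  have "K * t \<le> K * (t + 1)" by simp
  also have "\<dots> \<le> n" by (simp add: K_def)
  finally have K: "K * t \<le> n" .
  have "n < K * (t + 1) + (t + 1)" unfolding K_def
    by (metis add.commute add_gr_0 div_mult_mod_eq mod_less_divisor nat_add_left_cancel_less zero_less_one)
  then have "real n < real (K * (t + 1) + (t + 1))" by (simp only: of_nat_less_iff)
  moreover have "2 * real (t + 1) \<le> real n" using n by (metis of_nat_le_iff of_nat_mult of_nat_numeral)
  ultimately have "real n / 2 \<le> real K * real (t + 1)" by simp
  then have Kn: "real n / (2 * real (t + 1)) \<le> real K" by (simp add: field_simps)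
  have npos: "real n > 0" using n by simp
  have "real n / (2 * real (t + 1)) > 0" using npos by (intro divide_pos_pos) auto
  from less_le_trans[OF this Kn] have Kpos: "real K > 0" .
  have bin: "real (n choose t) > 0" using n by simp
  have "(\<Sum>I\<in>ksets n (n - t). nsq n (cnd n I g)) = (\<Sum>D\<in>ksets n t. nsq n (av D g))"
  proof (rule sum.reindex_bij_witness[of _ "\<lambda>D. {1..n} - D" "\<lambda>I. {1..n} - I"])
    show "\<And>a. a \<in> ksets n (n - t) \<Longrightarrow> {1..n} - ({1..n} - a) = a" "\<And>a. a \<in> ksets n t \<Longrightarrow> {1..n} - ({1..n} - a) = a"
      by (auto simp: ksets_def)
    show "\<And>a. a \<in> ksets n (n - t) \<Longrightarrow> {1..n} - a \<in> ksets n t" "\<And>a. a \<in> ksets n t \<Longrightarrow> {1..n} - a \<in> ksets n (n - t)"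
      using n by (auto simp: ksets_def card_compl)
  qed simp
  also have "\<dots> = (\<Sum>D\<in>ksets n t. nsq n g - nsq n (dif D g))"
    using nsq_minus_av ksets_sub(1) by (intro sum.cong refl) (simp add: dif_def)
  also have "\<dots> = real (n choose t) * nsq n g - (\<Sum>D\<in>ksets n t. nsq n (dif D g))"
    by (simp add: sum_subtractf card_ksets)
  finally have e: "ip n g (Sop n (n - t) g) = real (n choose t) * nsq n g - (\<Sum>D\<in>ksets n t. nsq n (dif D g))"
    by (simp add: ip_Sop)
  have "(\<Sum>D\<in>ksets n t. nsq n (dif D g)) \<le> real t * real (n choose t) * nsq n g / real K"
    using lowdeg_dif_le[OF g K] Kpos by (simp add: field_simps)
  also have "\<dots> \<le> real t * real (n choose t) * nsq n g / (real n / (2 * real (t + 1)))"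
    using Kn npos Kpos by (intro divide_left_mono mult_nonneg_nonneg mult_pos_pos) auto
  finally have "ip n g (Sop n (n - t) g) \<ge> real (n choose t) * nsq n g - real t * real (n choose t) * nsq n g / (real n / (2 * real (t + 1)))"
    using e by simp
  then have "ip n g (Sop n (n - t) g) \<ge> real (n choose t) * ((1 - 2 * real t * real (t + 1) / real n) * nsq n g)"
    by (simp add: field_simps)
  moreover have "n choose (n - t) = n choose t" using n by (intro binomial_symmetric[symmetric]) simp
  ultimately show ?thesis using bin by (simp add: pos_le_divide_eq mult.commute)
qed

text \<open>One Gram-Schmidt step for each element of \<open>B\<close>.\<close>

lemma projection_exists:
  fixes B :: "'i set" and b :: "'i \<Rightarrow> (nat \<Rightarrow> nat) \<Rightarrow> real"
  assumes "finite B"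
  shows "\<exists>a. \<forall>i\<in>B. ip n (\<lambda>\<sigma>. f \<sigma> - (\<Sum>j\<in>B. a j * b j \<sigma>)) (b i) = 0"
  using assms
proof (induction B arbitrary: f)
  case (insert k B)
  obtain a where a: "\<And>i. i \<in> B \<Longrightarrow> ip n (\<lambda>\<sigma>. f \<sigma> - (\<Sum>j\<in>B. a j * b j \<sigma>)) (b i) = 0" using insert.IH by blast
  obtain d where d: "\<And>i. i \<in> B \<Longrightarrow> ip n (\<lambda>\<sigma>. b k \<sigma> - (\<Sum>j\<in>B. d j * b j \<sigma>)) (b i) = 0" using insert.IH by blast
  define r where "r = (\<lambda>\<sigma>. b k \<sigma> - (\<Sum>j\<in>B. d j * b j \<sigma>))"
  define q where "q = (\<lambda>\<sigma>. f \<sigma> - (\<Sum>j\<in>B. a j * b j \<sigma>))"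
  \<comment> \<open>If \<open>r\<close> has norm 0, the division yields \<open>x = 0\<close>; then
    \<open>r\<close> vanishes on \<open>Sym n\<close> and orthogonality to it is automatic.\<close>
  define x where "x = ip n q r / nsq n r"
  define a' where "a' j = (if j = k then x else a j - x * d j)" for j
  have e: "(\<Sum>j\<in>insert k B. a' j * b j \<sigma>) = (\<Sum>j\<in>B. a j * b j \<sigma>) + x * r \<sigma>" for \<sigma>
  proof -
    have "(\<Sum>j\<in>insert k B. a' j * b j \<sigma>) = x * b k \<sigma> + (\<Sum>j\<in>B. a' j * b j \<sigma>)"
      using insert.hyps by (simp add: a'_def)
    also have "(\<Sum>j\<in>B. a' j * b j \<sigma>) = (\<Sum>j\<in>B. a j * b j \<sigma> - x * (d j * b j \<sigma>))"
      using insert.hyps by (intro sum.cong refl) (auto simp: a'_def algebra_simps)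
    finally show ?thesis by (simp add: r_def sum_subtractf sum_distrib_left algebra_simps)
  qed
  have f': "(\<lambda>\<sigma>. f \<sigma> - (\<Sum>j\<in>insert k B. a' j * b j \<sigma>)) = (\<lambda>\<sigma>. q \<sigma> - x * r \<sigma>)"
    by (simp add: e q_def algebra_simps)
  have B0: "ip n (\<lambda>\<sigma>. q \<sigma> - x * r \<sigma>) (b i) = 0" if "i \<in> B" for i
    using a[OF that] d[OF that] unfolding q_def[symmetric] r_def[symmetric] by (simp add: ip_diff ip_scale)
  have r0: "ip n (\<lambda>\<sigma>. q \<sigma> - x * r \<sigma>) r = 0"
  proof (cases "nsq n r = 0")
    case True
    then have "ip n h r = 0" for h using nsq_eq_0[OF True] by (simp add: ip_def)
    then show ?thesis by simp
  next
    case False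
    then show ?thesis unfolding ip_diff ip_scale by (simp add: x_def)
  qed
  have bk: "b k = (\<lambda>\<sigma>. r \<sigma> + (\<Sum>j\<in>B. d j * b j \<sigma>))" by (simp add: r_def)
  have "ip n (\<lambda>\<sigma>. q \<sigma> - x * r \<sigma>) (b k) = 0"
    by (subst bk) (simp add: ip_add_right r0 ip_sum_right ip_scale_right B0)
  then show ?case using B0 f' by (intro exI[of _ a']) simp
qed simp

text \<open>Orthogonality to the indicator of a coset of \<open>I\<close> says that the conditional
  expectation given \<open>I\<close> vanishes on that coset. Sets with fewer than \<open>k\<close>
  elements are reached by conditioning further.\<close>

lemma lowdeg_projection:
  "\<exists>w. lowdeg n k w \<and> centered n (Suc k) (\<lambda>\<sigma>. f \<sigma> - w \<sigma>) \<and> ip n (\<lambda>\<sigma>. f \<sigma> - w \<sigma>) w = 0" if "k \<le> n"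
proof -
  define b :: "nat set \<times> (nat \<Rightarrow> nat) \<Rightarrow> (nat \<Rightarrow> nat) \<Rightarrow> real" where
    "b = (\<lambda>(I, \<tau>) \<sigma>. if agree I \<sigma> \<tau> then 1 else 0)"
  obtain a where a: "\<And>i. i \<in> ksets n k \<times> Sym n \<Longrightarrow> ip n (\<lambda>\<sigma>. f \<sigma> - (\<Sum>j\<in>ksets n k \<times> Sym n. a j * b j \<sigma>)) (b i) = 0"
    using projection_exists[of "ksets n k \<times> Sym n" n f b] by auto
  define w where "w = (\<lambda>\<sigma>. \<Sum>j\<in>ksets n k \<times> Sym n. a j * b j \<sigma>)"
  have "lowdeg n k w" unfolding w_def
    by (intro lowdeg_sum lowdeg_scale) (auto simp: b_def intro: lowdeg_agree)
  moreover have "ip n (\<lambda>\<sigma>. f \<sigma> - w \<sigma>) w = 0"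
    using a unfolding w_def by (simp add: ip_sum_right ip_scale_right)
  moreover have z: "cnd n I (\<lambda>\<sigma>. f \<sigma> - w \<sigma>) \<tau> = 0" if I: "I \<in> ksets n k" and t: "\<tau> \<in> Sym n" for I \<tau>
  proof -
    have "cnd n I (\<lambda>\<sigma>. f \<sigma> - w \<sigma>) \<tau> = (\<Sum>\<sigma>\<in>Sym n. if agree I \<tau> \<sigma> then f \<sigma> - w \<sigma> else 0) / fact (n - card I)"
      using cnd_coset[OF t ksets_sub(1)[OF I]] .
    also have "(\<Sum>\<sigma>\<in>Sym n. if agree I \<tau> \<sigma> then f \<sigma> - w \<sigma> else 0) = ip n (\<lambda>\<sigma>. f \<sigma> - w \<sigma>) (b (I, \<tau>)) * fact n"
      by (simp add: ip_def b_def agree_sym if_distrib[of "\<lambda>x. _ * x"] cong: if_cong)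
    also have "\<dots> = 0" using a[of "(I, \<tau>)"] I t by (simp add: w_def)
    finally show ?thesis by simp
  qed
  have "centered n (Suc k) (\<lambda>\<sigma>. f \<sigma> - w \<sigma>)"
    unfolding centered_def
  proof (intro allI impI ballI)
    fix J \<sigma> assume J: "J \<subseteq> {1..n} \<and> card J < Suc k" and s: "\<sigma> \<in> Sym n"
    have "\<exists>I. J \<subseteq> I \<and> I \<subseteq> {1..n} \<and> card I = k"
      by (rule exists_subset_between) (use J that in auto)
    then obtain I where I: "J \<subseteq> I" "I \<subseteq> {1..n}" "card I = k" by blast
    have "cnd n J (\<lambda>\<sigma>. f \<sigma> - w \<sigma>) \<sigma> = cnd n J (cnd n I (\<lambda>\<sigma>. f \<sigma> - w \<sigma>)) \<sigma>"
      using I by (subst av_av(1)) auto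
    also have "\<dots> = cnd n J (\<lambda>_. 0) \<sigma>"
      by (rule av_cong[of n]) (use z I s in \<open>auto simp: ksets_def\<close>)
    finally show "cnd n J (\<lambda>\<sigma>. f \<sigma> - w \<sigma>) \<sigma> = 0" by (simp add: av_def)
  qed
  ultimately show ?thesis by blast
qed

text \<open>Each coefficient is a linear combination of the values at the \<open>d + 1\<close> fixed
  nodes, so the constant depends on \<open>d\<close> alone. Later uses rescale the variable to bring
  short intervals to these nodes.\<close>

lemma interpolation_bound:
  "\<exists>K>0. \<forall>(a::nat \<Rightarrow> real) V. (\<forall>k\<le>d. \<bar>\<Sum>i\<le>d. a i * real k ^ i\<bar> \<le> V) \<longrightarrow> (\<forall>i\<le>d. \<bar>a i\<bar> \<le> K * V)"
proof -
  define L :: "nat \<Rightarrow> real poly" where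
    "L k = (\<Prod>j\<in>{..d}-{k}. smult (1 / (real k - real j)) [:- real j, 1:])" for k
  define K where "K = 1 + (\<Sum>i\<le>d. \<Sum>k\<le>d. \<bar>coeff (L k) i\<bar>)"
  have "\<bar>a i\<bar> \<le> K * V" if V: "\<forall>k\<le>d. \<bar>\<Sum>i\<le>d. a i * real k ^ i\<bar> \<le> V" and i: "i \<le> d" for a :: "nat \<Rightarrow> real" and V i
  proof -
    define p :: "real poly" where "p = (\<Sum>i\<le>d. monom (a i) i)"
    have pa: "poly p x = (\<Sum>i\<le>d. a i * x ^ i)" for x by (simp add: p_def poly_sum poly_monom)
    have dp: "degree p \<le> d" unfolding p_def by (intro degree_sum_le order.trans[OF degree_monom_le]) auto
    have co: "coeff p i = a i" using i by (simp add: p_def coeff_sum)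
    have "p = (\<Sum>k\<le>d. smult (poly p (real k)) (L k))"
    proof (rule poly_eq_poly_eq_iff[THEN iffD1], rule ext)
      fix x show "poly p x = poly (\<Sum>k\<le>d. smult (poly p (real k)) (L k)) x"
        using lagrange_interpolation[OF dp, of x] by (simp add: poly_sum poly_prod L_def diff_divide_distrib)
    qed
    then have "coeff p i = (\<Sum>k\<le>d. poly p (real k) * coeff (L k) i)" by (metis (no_types, lifting) coeff_smult coeff_sum sum.cong)
    then have "\<bar>a i\<bar> \<le> (\<Sum>k\<le>d. \<bar>poly p (real k)\<bar> * \<bar>coeff (L k) i\<bar>)" using co
      by (metis (no_types, lifting) abs_mult sum.cong sum_abs)
    also have "\<dots> \<le> (\<Sum>k\<le>d. V * \<bar>coeff (L k) i\<bar>)" using V pa by (intro sum_mono mult_right_mono) auto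
    also have "\<dots> = V * (\<Sum>k\<le>d. \<bar>coeff (L k) i\<bar>)" by (simp add: sum_distrib_left)
    also have "\<dots> \<le> V * K"
    proof (rule mult_left_mono)
      have "(\<Sum>k\<le>d. \<bar>coeff (L k) i\<bar>) \<le> (\<Sum>i\<le>d. \<Sum>k\<le>d. \<bar>coeff (L k) i\<bar>)"
        using i by (intro member_le_sum) (auto intro: sum_nonneg)
      then show "(\<Sum>k\<le>d. \<bar>coeff (L k) i\<bar>) \<le> K" by (simp add: K_def)
      show "0 \<le> V" using V by (metis abs_ge_zero le0 order_trans)
    qed
    finally show ?thesis by (simp add: mult.commute)
  qed
  moreover have "K > 0" unfolding K_def by (intro add_pos_nonneg sum_nonneg) auto
  ultimately show ?thesis by blast
qed

lemma prod_sum_Pow: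
  fixes g :: "'a \<Rightarrow> bool \<Rightarrow> real"
  assumes "finite S"
  shows "(\<Sum>U\<in>Pow S. \<Prod>i\<in>S. g i (i \<in> U)) = (\<Prod>i\<in>S. g i True + g i False)"
  using assms
proof (induction S)
  case (insert x S)
  have inj: "inj_on (insert x) (Pow S)" using insert.hyps by (auto simp: inj_on_def)
  have 1: "(\<Prod>i\<in>S. g i (i \<in> insert x U)) = (\<Prod>i\<in>S. g i (i \<in> U))" for U
    by (intro prod.cong refl arg_cong[of _ _ "g _"]) (use insert.hyps in auto)
  have "(\<Sum>U\<in>Pow (insert x S). \<Prod>i\<in>insert x S. g i (i \<in> U))
     = (\<Sum>U\<in>Pow S. \<Prod>i\<in>insert x S. g i (i \<in> U)) + (\<Sum>U\<in>insert x ` Pow S. \<Prod>i\<in>insert x S. g i (i \<in> U))"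
    unfolding Pow_insert using insert.hyps by (intro sum.union_disjoint) auto
  also have "(\<Sum>U\<in>insert x ` Pow S. \<Prod>i\<in>insert x S. g i (i \<in> U)) = (\<Sum>U\<in>Pow S. g x True * (\<Prod>i\<in>S. g i (i \<in> U)))"
    using insert.hyps 1 by (simp add: sum.reindex[OF inj])
  also have "(\<Sum>U\<in>Pow S. \<Prod>i\<in>insert x S. g i (i \<in> U)) = (\<Sum>U\<in>Pow S. g x False * (\<Prod>i\<in>S. g i (i \<in> U)))"
  proof (intro sum.cong refl)
    fix U assume "U \<in> Pow S"
    then have "x \<notin> U" using insert.hyps by auto
    then show "(\<Prod>i\<in>insert x S. g i (i \<in> U)) = g x False * (\<Prod>i\<in>S. g i (i \<in> U))"
      using insert.hyps by simp
  qed
  finally show ?case using insert by (simp add: sum_distrib_left[symmetric] algebra_simps)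
qed simp

section \<open>Random coordinate sets and centered functions\<close>

text \<open>
  The law of a random subset of \<open>{1..n}\<close> containing each point with probability \<open>u\<close>, and the law of two
  such sets where a point lies in both with probability \<open>y\<close>, independently for the points.
\<close>

definition mw :: "nat \<Rightarrow> real \<Rightarrow> nat set \<Rightarrow> real" where
  "mw n u U = (\<Prod>i\<in>{1..n}. if i \<in> U then u else 1 - u)"

definition pairw :: "real \<Rightarrow> real \<Rightarrow> bool \<Rightarrow> bool \<Rightarrow> real" where
  "pairw y u a b = (if a then (if b then y else u - y) else (if b then u - y else 1 - 2 * u + y))"

definition pw :: "nat \<Rightarrow> real \<Rightarrow> real \<Rightarrow> nat set \<Rightarrow> nat set \<Rightarrow> real" where
  "pw n y u U U' = (\<Prod>i\<in>{1..n}. pairw y u (i \<in> U) (i \<in> U'))"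

lemma mw_nonneg: "0 \<le> u \<Longrightarrow> u \<le> 1 \<Longrightarrow> 0 \<le> mw n u U"
  by (auto simp: mw_def intro!: prod_nonneg)

lemma pw_nonneg: "0 \<le> y \<Longrightarrow> y \<le> u \<Longrightarrow> 2 * u - y \<le> 1 \<Longrightarrow> 0 \<le> pw n y u U U'"
  by (auto simp: pw_def pairw_def intro!: prod_nonneg)

lemma pw_commute: "pw n y u U U' = pw n y u U' U"
  by (auto simp: pw_def pairw_def intro!: prod.cong)

lemma pw_marginal: "(\<Sum>U'\<in>Pow {1..n}. pw n y u U U') = mw n u U"
proof -
  have "(\<Sum>U'\<in>Pow {1..n}. pw n y u U U') = (\<Prod>i\<in>{1..n}. pairw y u (i \<in> U) True + pairw y u (i \<in> U) False)"
    unfolding pw_def by (rule prod_sum_Pow) simp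
  then show ?thesis by (auto simp: mw_def pairw_def intro!: prod.cong)
qed

lemma subset_prod:
  assumes "I \<subseteq> {1..n::nat}"
  shows "(if I \<subseteq> U then 1 else 0 :: real) = (\<Prod>i\<in>{1..n}. if i \<in> I \<and> i \<notin> U then 0 else 1)"
proof (cases "I \<subseteq> U")
  case True
  then have "(\<Prod>i\<in>{1..n}. if i \<in> I \<and> i \<notin> U then 0 else 1 :: real) = 1" by (intro prod.neutral) auto
  then show ?thesis using True by simp
next
  case False
  then have "(\<Prod>i\<in>{1..n}. if i \<in> I \<and> i \<notin> U then 0 else 1 :: real) = 0" using assms by (intro prod_zero) auto
  then show ?thesis using False by simp
qed

lemma prod_if_subset: "J \<subseteq> {1..n::nat} \<Longrightarrow> (\<Prod>i\<in>{1..n}. if i \<in> J then x else 1 :: real) = (\<Prod>i\<in>J. x)"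
  by (simp add: prod.inter_restrict[symmetric] Int_absorb1)

lemma mw_subset:
  assumes "I \<subseteq> {1..n}"
  shows "(\<Sum>U\<in>Pow {1..n}. mw n u U * (if I \<subseteq> U then 1 else 0)) = u ^ card I"
proof -
  have "(\<Sum>U\<in>Pow {1..n}. mw n u U * (if I \<subseteq> U then 1 else 0))
    = (\<Sum>U\<in>Pow {1..n}. \<Prod>i\<in>{1..n}. (if i \<in> U then u else 1 - u) * (if i \<in> I \<and> i \<notin> U then 0 else 1))"
    unfolding subset_prod[OF assms] mw_def prod.distrib ..
  also have "\<dots> = (\<Prod>i\<in>{1..n}. (if True then u else 1 - u) * (if i \<in> I \<and> \<not> True then 0 else 1) + (if False then u else 1 - u) * (if i \<in> I \<and> \<not> False then 0 else 1))"
    by (rule prod_sum_Pow) simp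
  also have "\<dots> = (\<Prod>i\<in>{1..n}. if i \<in> I then u else 1)" by (intro prod.cong) auto
  also have "\<dots> = (\<Prod>i\<in>I. u)" using assms by (simp add: prod.inter_restrict[symmetric] Int_absorb1)
  finally show ?thesis by simp
qed

text \<open>The points behave independently: a common point of \<open>I\<close> and
  \<open>I'\<close> contributes \<open>y\<close>, a point of exactly one of them contributes
  \<open>u\<close>.\<close>

lemma pw_subset:
  assumes "I \<subseteq> {1..n}" "I' \<subseteq> {1..n}"
  shows "(\<Sum>U\<in>Pow {1..n}. \<Sum>U'\<in>Pow {1..n}. pw n y u U U' * ((if I \<subseteq> U then 1 else 0) * (if I' \<subseteq> U' then 1 else 0)))
    = y ^ card (I \<inter> I') * u ^ card ((I - I') \<union> (I' - I))"
proof -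
  let ?h = "\<lambda>i a b. pairw y u a b * ((if i \<in> I \<and> \<not> a then 0 else 1) * (if i \<in> I' \<and> \<not> b then 0 else 1))"
  have "(\<Sum>U\<in>Pow {1..n}. \<Sum>U'\<in>Pow {1..n}. pw n y u U U' * ((if I \<subseteq> U then 1 else 0) * (if I' \<subseteq> U' then 1 else 0)))
     = (\<Sum>U\<in>Pow {1..n}. \<Sum>U'\<in>Pow {1..n}. \<Prod>i\<in>{1..n}. ?h i (i \<in> U) (i \<in> U'))"
    unfolding subset_prod[OF assms(1)] subset_prod[OF assms(2)] pw_def prod.distrib ..
  also have "\<dots> = (\<Sum>U\<in>Pow {1..n}. \<Prod>i\<in>{1..n}. ?h i (i \<in> U) True + ?h i (i \<in> U) False)"
    by (intro sum.cong refl prod_sum_Pow) simp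
  also have "\<dots> = (\<Prod>i\<in>{1..n}. (?h i True True + ?h i True False) + (?h i False True + ?h i False False))"
    by (rule prod_sum_Pow) simp
  also have "\<dots> = (\<Prod>i\<in>{1..n}. (if i \<in> I \<inter> I' then y else 1) * (if i \<in> (I - I') \<union> (I' - I) then u else 1))"
    by (intro prod.cong) (auto simp: pairw_def)
  also have "\<dots> = (\<Prod>i\<in>I \<inter> I'. y) * (\<Prod>i\<in>(I - I') \<union> (I' - I). u)"
    unfolding prod.distrib by (subst (1 2) prod_if_subset) (use assms in auto)
  finally show ?thesis by simp
qed

lemma card_symdiff_ksets:
  assumes "I \<in> ksets n t" "I' \<in> ksets n t"
  shows "card ((I - I') \<union> (I' - I)) = 2 * (t - card (I \<inter> I'))" "card (I \<inter> I') \<le> t"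
    "card (I \<union> I') = 2 * t - card (I \<inter> I')"
proof -
  have f: "finite I" "finite I'" "card I = t" "card I' = t" using assms ksets_sub by auto
  have "card (I - I') = t - card (I \<inter> I')" "card (I' - I) = t - card (I \<inter> I')"
    using f card_Diff_subset_Int[of I I'] card_Diff_subset_Int[of I' I] by (auto simp: Int_commute)
  moreover have "card ((I - I') \<union> (I' - I)) = card (I - I') + card (I' - I)"
    using f by (intro card_Un_disjoint) auto
  ultimately show "card ((I - I') \<union> (I' - I)) = 2 * (t - card (I \<inter> I'))" by simp
  show "card (I \<inter> I') \<le> t" using f by (metis Int_lower1 card_mono)
  show "card (I \<union> I') = 2 * t - card (I \<inter> I')" using card_Un_Int[of I I'] f by simp
qed

lemma mw_card: "U \<subseteq> {1..n} \<Longrightarrow> mw n u U = u ^ card U * (1 - u) ^ (n - card U)"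
proof -
  assume U: "U \<subseteq> {1..n}"
  have "mw n u U = (\<Prod>i\<in>{1..n}. (if i \<in> U then u else 1) * (if i \<in> {1..n} - U then 1 - u else 1))"
    unfolding mw_def by (intro prod.cong) auto
  also have "\<dots> = (\<Prod>i\<in>U. u) * (\<Prod>i\<in>{1..n} - U. 1 - u)"
    unfolding prod.distrib by (subst (1 2) prod_if_subset) (use U in auto)
  also have "\<dots> = u ^ card U * (1 - u) ^ (n - card U)" using card_compl[OF U] by simp
  finally show ?thesis .
qed

text \<open>The factor of \<open>Sop_centered\<close> at \<open>j = n - t\<close>, the last level
  that its formula reaches. For fixed \<open>t\<close> it is \<open>1 - O(1/n)\<close>.\<close>

definition lam :: "nat \<Rightarrow> nat \<Rightarrow> real" where
  "lam n t = real (n - t choose t) / real (n choose t)"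

lemma lam_lower:
  assumes "2 * t \<le> n"
  shows "1 - 2 * real t * real t / real n \<le> lam n t"
proof (cases "n = 0")
  case False
  have e: "real (m choose t) = (\<Prod>i<t. real m - real i) / fact t" if "t \<le> m" for m
    using that by (simp add: prod_falling binomial_fact)
  have "lam n t = (\<Prod>i<t. (real (n - t) - real i) / (real n - real i))"
    unfolding lam_def using assms by (subst (1 2) e) (auto simp: prod_dividef)
  also have "\<dots> \<ge> (\<Prod>i<t. 1 - 2 * real t / real n)"
  proof (intro prod_mono conjI)
    fix i assume i: "i \<in> {..<t}"
    have "2 * real t \<le> real n" using assms by (metis of_nat_le_iff of_nat_mult of_nat_numeral)
    then show "0 \<le> 1 - 2 * real t / real n" using False by (simp add: field_simps)
    have p: "real n - real i > 0" "real n - real i \<ge> real n / 2" using i \<open>2 * real t \<le> real n\<close> by auto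
    have "(real (n - t) - real i) / (real n - real i) = 1 - real t / (real n - real i)"
      using p assms by (simp add: field_simps of_nat_diff)
    moreover have "real t / (real n - real i) \<le> real t / (real n / 2)"
      using p False by (intro divide_left_mono) auto
    ultimately show "1 - 2 * real t / real n \<le> (real (n - t) - real i) / (real n - real i)" by (simp add: mult.commute)
  qed
  finally have "(1 - 2 * real t / real n) ^ t \<le> lam n t" by simp
  moreover have "1 + real t * (- (2 * real t / real n)) \<le> (1 + - (2 * real t / real n)) ^ t"
  proof (rule Bernoulli_inequality)
    have "2 * real t \<le> real n" using assms by (metis of_nat_le_iff of_nat_mult of_nat_numeral)
    then show "- 1 \<le> - (2 * real t / real n)" using False by (simp add: field_simps)
  qed
  ultimately show ?thesis by (simp add: algebra_simps)
qed (use assms in \<open>simp add: lam_def\<close>)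


lemma level_sum:
  assumes "lowdeg n t v" "centered n t v" "2 * t \<le> n" "j + t \<le> n"
  shows "(\<Sum>R\<in>ksets n j. nsq n (cnd n R v)) = real (n choose j) * (real (j choose t) / real (n choose t)) * (\<Sum>I\<in>ksets n t. nsq n (cnd n I v))"
proof -
  have "n choose j > 0" using assms by simp
  then have "Sop n j v \<sigma> = real (n choose j) * (real (j choose t) / real (n choose t)) * Sop n t v \<sigma>" if "\<sigma> \<in> Sym n" for \<sigma>
    using Sop_centered[OF assms(1,2) that assms(3,4)] by (simp add: divide_eq_eq)
  then have "ip n v (Sop n j v) = ip n v (\<lambda>\<sigma>. real (n choose j) * (real (j choose t) / real (n choose t)) * Sop n t v \<sigma>)"
    by (intro ip_cong) auto
  then show ?thesis by (simp only: ip_scale_right ip_Sop)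
qed

text \<open>This is level \<open>n - t\<close> of \<open>level_sum\<close>, where every conditional
  expectation is bounded by \<open>v\<close> itself.\<close>

lemma lam_upper:
  assumes "lowdeg n t v" "centered n t v" "2 * t \<le> n"
  shows "lam n t * (\<Sum>I\<in>ksets n t. nsq n (cnd n I v)) \<le> nsq n v"
proof -
  have c: "real (n choose (n - t)) > 0" using assms by simp
  have "real (n choose (n - t)) * (lam n t * (\<Sum>I\<in>ksets n t. nsq n (cnd n I v))) = (\<Sum>R\<in>ksets n (n - t). nsq n (cnd n R v))"
    using level_sum[OF assms, of "n - t"] assms by (simp add: lam_def)
  also have "\<dots> \<le> (\<Sum>R\<in>ksets n (n - t). nsq n v)" by (intro sum_mono nsq_av_le) auto
  also have "\<dots> = real (n choose (n - t)) * nsq n v" by (simp add: card_ksets)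
  finally show ?thesis using c by simp
qed

text \<open>The same level seen from below, through \<open>Sop_compl_lower\<close>. Up to a factor
  \<open>1 + O(1/n)\<close> the squared norms of the pieces \<open>cnd n I v\<close> with
  \<open>card I = t\<close> therefore add up to that of \<open>v\<close>.\<close>

lemma lam_lower_nsq:
  assumes "lowdeg n t v" "centered n t v" "n \<ge> 2 * (t + 1)"
  shows "(1 - 2 * real t * real (t + 1) / real n) * nsq n v \<le> lam n t * (\<Sum>I\<in>ksets n t. nsq n (cnd n I v))"
proof -
  have nt: "2 * t \<le> n" using assms by simp
  have c: "real (n choose (n - t)) > 0" using assms by simp
  have "real (n choose (n - t)) * (lam n t * (\<Sum>I\<in>ksets n t. nsq n (cnd n I v))) = ip n v (Sop n (n - t) v)"
    using level_sum[OF assms(1,2) nt, of "n - t"] assms by (simp add: lam_def ip_Sop)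
  then have "ip n v (Sop n (n - t) v) / real (n choose (n - t)) = lam n t * (\<Sum>I\<in>ksets n t. nsq n (cnd n I v))"
    using c by (simp add: field_simps)
  then show ?thesis using Sop_compl_lower[OF assms(1,3)] by simp
qed

text \<open>A partial sum \<open>q\<close> of the pieces is again centered of degree
  \<open>t\<close>. After the weighted inequality of means, \<open>lam_upper\<close> for
  \<open>q\<close> bounds half of the right-hand side by half of \<open>nsq n q\<close>, which is
  absorbed on the left.\<close>

lemma nsq_sum_cnd_le:
  assumes v: "lowdeg n t v" "centered n t v" and nt: "2 * t \<le> n" and l: "0 < lam n t" and X: "X \<subseteq> ksets n t"
  shows "nsq n (\<lambda>\<sigma>. \<Sum>I\<in>X. cnd n I v \<sigma>) \<le> (\<Sum>I\<in>X. nsq n (cnd n I v)) / lam n t"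
proof -
  define q where "q = (\<lambda>\<sigma>. \<Sum>I\<in>X. cnd n I v \<sigma>)"
  have ql: "lowdeg n t q" unfolding q_def using X by (intro lowdeg_sum lowdeg_cnd) auto
  have qc: "centered n t q" unfolding q_def by (intro centered_sum centered_av[OF v(2)]) auto
  have "nsq n q = (\<Sum>I\<in>X. ip n q (cnd n I v))" by (subst (2) q_def) (rule ip_sum_right)
  also have "\<dots> = (\<Sum>I\<in>X. ip n (cnd n I q) (cnd n I v))" by (intro sum.cong refl) (simp add: ip_av_av)
  also have "\<dots> \<le> (\<Sum>I\<in>X. (nsq n (cnd n I q) / (1 / lam n t) + 1 / lam n t * nsq n (cnd n I v)) / 2)"
    using l by (intro sum_mono order.trans[OF abs_ge_self ip_amgm]) simp
  also have "\<dots> = (lam n t * (\<Sum>I\<in>X. nsq n (cnd n I q)) + (\<Sum>I\<in>X. nsq n (cnd n I v)) / lam n t) / 2"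
    by (simp add: sum.distrib sum_divide_distrib[symmetric] sum_distrib_left[symmetric] mult.commute)
  also have "(\<Sum>I\<in>X. nsq n (cnd n I q)) \<le> (\<Sum>I\<in>ksets n t. nsq n (cnd n I q))"
    using X by (intro sum_mono2) auto
  finally have "nsq n q \<le> (lam n t * (\<Sum>I\<in>ksets n t. nsq n (cnd n I q)) + (\<Sum>I\<in>X. nsq n (cnd n I v)) / lam n t) / 2"
    using l by (simp add: mult_left_mono)
  then show ?thesis using lam_upper[OF ql qc nt] unfolding q_def by simp
qed

lemma card_subsets_choose:
  assumes "U \<subseteq> {1..n}"
  shows "(\<Sum>I\<in>ksets n t. if I \<subseteq> U then 1 else 0 :: real) = real (card U choose t)"
proof -
  have "(\<Sum>I\<in>ksets n t. if I \<subseteq> U then 1 else 0 :: real) = real (card {I\<in>ksets n t. I \<subseteq> U})"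
    by (simp add: sum.inter_filter[symmetric])
  also have "{I\<in>ksets n t. I \<subseteq> U} = {I. I \<subseteq> U \<and> card I = t}" using assms by (auto simp: ksets_def)
  also have "card \<dots> = card U choose t" using n_subsets[OF finite_sub[OF assms]] .
  finally show ?thesis .
qed

lemma le_divide_one_minus: "0 \<le> a \<Longrightarrow> 0 \<le> \<delta> \<Longrightarrow> \<delta> < 1 \<Longrightarrow> a \<le> a / (1 - \<delta> :: real)"
  by (simp add: pos_le_divide_eq mult_left_le)

text \<open>On levels \<open>j \<le> n - t\<close> the sum of the norms is known exactly and
  corresponds to \<open>j choose t\<close>; the mean of \<open>card U choose t\<close> over the
  random set is \<open>u ^ t * (n choose t)\<close>.\<close>

lemma expect_nsq_cnd:
  assumes v: "lowdeg n t v" "centered n t v" and nt: "2 * t \<le> n"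
    and del: "0 \<le> \<delta>" "\<delta> < 1" and vlow: "(1 - \<delta>) * nsq n v \<le> lam n t * (\<Sum>I\<in>ksets n t. nsq n (cnd n I v))"
    and u: "0 \<le> u" "u \<le> 1"
  defines "S \<equiv> (\<Sum>I\<in>ksets n t. nsq n (cnd n I v))"
  shows "(\<Sum>U\<in>Pow {1..n}. mw n u U * nsq n (cnd n U v)) \<le> u ^ t * S / (1 - \<delta>)"
proof -
  have S0: "0 \<le> S" by (simp add: S_def sum_nonneg)
  have c0: "real (n choose t) > 0" using nt by simp
  have lev: "(\<Sum>U\<in>ksets n j. nsq n (cnd n U v)) \<le> (\<Sum>U\<in>ksets n j. real (card U choose t) / real (n choose t) * S / (1 - \<delta>))" if j: "j \<le> n" for j
  proof (cases "j + t \<le> n")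
    case True
    have "(\<Sum>U\<in>ksets n j. nsq n (cnd n U v)) = (\<Sum>U\<in>ksets n j. real (card U choose t) / real (n choose t) * S)"
      using level_sum[OF v nt True] by (simp add: S_def card_ksets ksets_sub cong: sum.cong)
    also have "\<dots> \<le> (\<Sum>U\<in>ksets n j. real (card U choose t) / real (n choose t) * S / (1 - \<delta>))"
    proof (intro sum_mono)
      fix U
      have "0 \<le> real (card U choose t) / real (n choose t) * S" using S0 by simp
      then show "real (card U choose t) / real (n choose t) * S \<le> real (card U choose t) / real (n choose t) * S / (1 - \<delta>)"
        by (rule le_divide_one_minus[OF _ del])
    qed
    finally show ?thesis .
  next
    case False
    show ?thesis
    proof (intro sum_mono)
      fix U assume U: "U \<in> ksets n j"
      have "nsq n (cnd n U v) \<le> nsq n v" by (intro nsq_av_le) auto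
      also have "\<dots> \<le> lam n t * S / (1 - \<delta>)" using vlow del by (simp add: S_def field_simps)
      also have "lam n t \<le> real (card U choose t) / real (n choose t)"
      proof -
        have "n - t choose t \<le> card U choose t" using U False ksets_sub(2) by (intro binomial_right_mono) fastforce
        then show ?thesis unfolding lam_def using c0 by (simp add: divide_right_mono)
      qed
      finally show "nsq n (cnd n U v) \<le> real (card U choose t) / real (n choose t) * S / (1 - \<delta>)"
        using S0 del by (simp add: divide_right_mono mult_right_mono)
    qed
  qed
  have grp: "(\<Sum>U\<in>Pow {1..n}. mw n u U * h U) = (\<Sum>j\<le>n. u ^ j * (1 - u) ^ (n - j) * (\<Sum>U\<in>ksets n j. h U))" for h
  proof -
    have "(\<Sum>U\<in>Pow {1..n}. mw n u U * h U) = (\<Sum>j\<le>n. \<Sum>U\<in>{U\<in>Pow {1..n}. card U = j}. mw n u U * h U)"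
      using card_mono[of "{1..n}"] by (intro sum.group[symmetric]) fastforce+
    also have "\<dots> = (\<Sum>j\<le>n. u ^ j * (1 - u) ^ (n - j) * (\<Sum>U\<in>ksets n j. h U))"
      unfolding sum_distrib_left by (intro sum.cong refl) (auto simp: ksets_def mw_card)
    finally show ?thesis .
  qed
  have "(\<Sum>U\<in>Pow {1..n}. mw n u U * nsq n (cnd n U v)) \<le> (\<Sum>U\<in>Pow {1..n}. mw n u U * (real (card U choose t) / real (n choose t) * S / (1 - \<delta>)))"
    unfolding grp
  proof (rule sum_mono)
    fix j assume "j \<in> {..n}"
    then show "u ^ j * (1 - u) ^ (n - j) * (\<Sum>U\<in>ksets n j. nsq n (cnd n U v))
      \<le> u ^ j * (1 - u) ^ (n - j) * (\<Sum>U\<in>ksets n j. real (card U choose t) / real (n choose t) * S / (1 - \<delta>))"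
      using u by (intro mult_left_mono lev) auto
  qed
  also have "\<dots> = (\<Sum>U\<in>Pow {1..n}. \<Sum>I\<in>ksets n t. mw n u U * (if I \<subseteq> U then 1 else 0)) * (S / (1 - \<delta>) / real (n choose t))"
    unfolding sum_distrib_right
    by (intro sum.cong refl) (simp add: card_subsets_choose[symmetric] sum_distrib_left sum_distrib_right sum_divide_distrib algebra_simps)
  also have "(\<Sum>U\<in>Pow {1..n}. \<Sum>I\<in>ksets n t. mw n u U * (if I \<subseteq> U then 1 else 0)) = (\<Sum>I\<in>ksets n t. u ^ t)"
    by (subst sum.swap) (intro sum.cong refl, simp add: mw_subset ksets_sub)
  also have "\<dots> * (S / (1 - \<delta>) / real (n choose t)) = u ^ t * S / (1 - \<delta>)" using c0 by (simp add: card_ksets)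
  finally show ?thesis .
qed


text \<open>
  For centered \<open>v\<close> of degree \<open>t\<close>, \<open>qs n t v U\<close> approximates the average of \<open>v\<close> over the coordinates
  outside \<open>U\<close>; \<open>CC n t v m r\<close> is the coefficient of \<open>y ^ r\<close> in the polynomial obtained by averaging
  \<open>ip n m (qs U * qs U')\<close> over pairs of random sets.
\<close>

definition qs :: "nat \<Rightarrow> nat \<Rightarrow> ((nat \<Rightarrow> nat) \<Rightarrow> real) \<Rightarrow> nat set \<Rightarrow> (nat \<Rightarrow> nat) \<Rightarrow> real" where
  "qs n t v U \<sigma> = (\<Sum>I\<in>ksets n t. (if I \<subseteq> U then 1 else 0) * cnd n I v \<sigma>)"

definition CC :: "nat \<Rightarrow> nat \<Rightarrow> ((nat \<Rightarrow> nat) \<Rightarrow> real) \<Rightarrow> ((nat \<Rightarrow> nat) \<Rightarrow> real) \<Rightarrow> nat \<Rightarrow> real" where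
  "CC n t v m r = (\<Sum>P\<in>{P\<in>ksets n t \<times> ksets n t. card (fst P \<inter> snd P) = r}.
     ip n m (\<lambda>\<sigma>. cnd n (fst P) v \<sigma> * cnd n (snd P) v \<sigma>))"

lemma sum_mw_subset:
  "(\<Sum>U\<in>Pow {1..n}. mw n u U * (\<Sum>I\<in>ksets n t. (if I \<subseteq> U then 1 else 0) * h I)) = u ^ t * (\<Sum>I\<in>ksets n t. h I)"
proof -
  have "(\<Sum>U\<in>Pow {1..n}. mw n u U * (\<Sum>I\<in>ksets n t. (if I \<subseteq> U then 1 else 0) * h I))
    = (\<Sum>I\<in>ksets n t. (\<Sum>U\<in>Pow {1..n}. mw n u U * (if I \<subseteq> U then 1 else 0)) * h I)"
    unfolding sum_distrib_left sum_distrib_right by (subst sum.swap) (simp add: mult.assoc)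
  also have "\<dots> = (\<Sum>I\<in>ksets n t. u ^ t * h I)"
    by (intro sum.cong refl) (simp add: mw_subset ksets_sub)
  finally show ?thesis by (simp add: sum_distrib_left)
qed

lemma nsq_qs_le:
  assumes v: "lowdeg n t v" "centered n t v" and nt: "2 * t \<le> n" and l: "0 < lam n t"
  shows "nsq n (qs n t v U) \<le> (\<Sum>I\<in>ksets n t. (if I \<subseteq> U then 1 else 0) * nsq n (cnd n I v)) / lam n t"
proof -
  have "qs n t v U = (\<lambda>\<sigma>. \<Sum>I\<in>{I\<in>ksets n t. I \<subseteq> U}. cnd n I v \<sigma>)"
    by (simp add: qs_def fun_eq_iff sum.inter_filter if_distrib[of "\<lambda>x. x * _"] cong: if_cong)
  then have "nsq n (qs n t v U) \<le> (\<Sum>I\<in>{I\<in>ksets n t. I \<subseteq> U}. nsq n (cnd n I v)) / lam n t"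
    using nsq_sum_cnd_le[OF v nt l, of "{I\<in>ksets n t. I \<subseteq> U}"] by simp
  also have "(\<Sum>I\<in>{I\<in>ksets n t. I \<subseteq> U}. nsq n (cnd n I v)) = (\<Sum>I\<in>ksets n t. (if I \<subseteq> U then 1 else 0) * nsq n (cnd n I v))"
    by (simp add: sum.inter_filter if_distrib[of "\<lambda>x. x * _"] cong: if_cong)
  finally show ?thesis .
qed

lemma expect_nsq_qs:
  assumes v: "lowdeg n t v" "centered n t v" and nt: "2 * t \<le> n" and l: "0 < lam n t" and u: "0 \<le> u" "u \<le> 1"
  shows "(\<Sum>U\<in>Pow {1..n}. mw n u U * nsq n (qs n t v U)) \<le> u ^ t * (\<Sum>I\<in>ksets n t. nsq n (cnd n I v)) / lam n t"
proof -
  have "(\<Sum>U\<in>Pow {1..n}. mw n u U * nsq n (qs n t v U)) \<le>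
    (\<Sum>U\<in>Pow {1..n}. mw n u U * ((\<Sum>I\<in>ksets n t. (if I \<subseteq> U then 1 else 0) * nsq n (cnd n I v)) / lam n t))"
    by (intro sum_mono mult_left_mono nsq_qs_le v nt l mw_nonneg u)
  then show ?thesis by (simp add: sum_divide_distrib[symmetric] sum_mw_subset)
qed

lemma ip_cnd_qs:
  assumes "U \<subseteq> {1..n}"
  shows "ip n (cnd n U v) (qs n t v U) = (\<Sum>I\<in>ksets n t. (if I \<subseteq> U then 1 else 0) * nsq n (cnd n I v))"
proof -
  have "ip n (cnd n U v) (qs n t v U) = (\<Sum>I\<in>ksets n t. (if I \<subseteq> U then 1 else 0) * ip n (cnd n U v) (cnd n I v))"
    unfolding qs_def by (simp add: ip_sum_right ip_scale_right)
  also have "\<dots> = (\<Sum>I\<in>ksets n t. (if I \<subseteq> U then 1 else 0) * nsq n (cnd n I v))"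
  proof (intro sum.cong refl)
    fix I assume I: "I \<in> ksets n t"
    have "ip n (cnd n U v) (cnd n I v) = nsq n (cnd n I v)" if "I \<subseteq> U"
    proof -
      have "ip n (cnd n U v) (cnd n I v) = ip n v (cnd n U (cnd n I v))" by (rule ip_av) auto
      also have "cnd n U (cnd n I v) = cnd n I v" using that by (intro ext av_av(2)) auto
      finally show ?thesis by (simp add: nsq_av)
    qed
    then show "(if I \<subseteq> U then 1 else 0) * ip n (cnd n U v) (cnd n I v) = (if I \<subseteq> U then 1 else 0) * nsq n (cnd n I v)" by simp
  qed
  finally show ?thesis .
qed

lemma nsq_diff: "nsq n (\<lambda>\<sigma>. f \<sigma> - g \<sigma>) = nsq n f - 2 * ip n f g + nsq n g"
  by (simp add: ip_diff ip_diff_right ip_commute[of n g f])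

text \<open>In the expanded square the two norms average to at most about \<open>u ^ t * S\<close>
  each and the inner product to exactly \<open>u ^ t * S\<close>, so the main terms cancel.
  Nonnegativity of the same square gives the second claim.\<close>

lemma expect_nsq_diff:
  assumes v: "lowdeg n t v" "centered n t v" and nt: "2 * t \<le> n" and l: "0 < lam n t"
    and del: "0 \<le> \<delta>" "\<delta> < 1" and vlow: "(1 - \<delta>) * nsq n v \<le> lam n t * (\<Sum>I\<in>ksets n t. nsq n (cnd n I v))"
    and u: "0 \<le> u" "u \<le> 1"
  defines "S \<equiv> (\<Sum>I\<in>ksets n t. nsq n (cnd n I v))"
  shows "(\<Sum>U\<in>Pow {1..n}. mw n u U * nsq n (\<lambda>\<sigma>. cnd n U v \<sigma> - qs n t v U \<sigma>)) \<le> u ^ t * S * (1 / (1 - \<delta>) + 1 / lam n t - 2)"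
    and "2 * u ^ t * S - u ^ t * S / (1 - \<delta>) \<le> (\<Sum>U\<in>Pow {1..n}. mw n u U * nsq n (qs n t v U))"
proof -
  let ?X = "\<Sum>U\<in>Pow {1..n}. mw n u U * nsq n (\<lambda>\<sigma>. cnd n U v \<sigma> - qs n t v U \<sigma>)"
  let ?Q = "\<Sum>U\<in>Pow {1..n}. mw n u U * nsq n (qs n t v U)"
  let ?P = "\<Sum>U\<in>Pow {1..n}. mw n u U * nsq n (cnd n U v)"
  have "?X = ?P - 2 * (\<Sum>U\<in>Pow {1..n}. mw n u U * (\<Sum>I\<in>ksets n t. (if I \<subseteq> U then 1 else 0) * nsq n (cnd n I v))) + ?Q"
  proof -
    have "?X = (\<Sum>U\<in>Pow {1..n}. mw n u U * nsq n (cnd n U v) - 2 * (mw n u U * (\<Sum>I\<in>ksets n t. (if I \<subseteq> U then 1 else 0) * nsq n (cnd n I v))) + mw n u U * nsq n (qs n t v U))"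
      unfolding nsq_diff by (intro sum.cong refl) (simp add: ip_cnd_qs algebra_simps)
    then show ?thesis by (simp add: sum.distrib sum_subtractf sum_distrib_left)
  qed
  then have X: "?X = ?P - 2 * (u ^ t * S) + ?Q" by (simp add: sum_mw_subset S_def)
  have P: "?P \<le> u ^ t * S / (1 - \<delta>)" unfolding S_def by (rule expect_nsq_cnd[OF v nt del vlow u])
  have Q: "?Q \<le> u ^ t * S / lam n t" unfolding S_def by (rule expect_nsq_qs[OF v nt l u])
  have "0 \<le> ?X" by (intro sum_nonneg mult_nonneg_nonneg mw_nonneg u) simp
  then show "2 * u ^ t * S - u ^ t * S / (1 - \<delta>) \<le> ?Q" using X P by simp
  show "?X \<le> u ^ t * S * (1 / (1 - \<delta>) + 1 / lam n t - 2)"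
    using X P Q by (simp add: algebra_simps)
qed

lemma CC_expand:
  "(\<Sum>P\<in>ksets n t \<times> ksets n t. h (card (fst P \<inter> snd P)) * ip n m (\<lambda>\<sigma>. cnd n (fst P) v \<sigma> * cnd n (snd P) v \<sigma>))
    = (\<Sum>r\<le>t. CC n t v m r * h r)"
proof -
  have "(\<Sum>P\<in>ksets n t \<times> ksets n t. h (card (fst P \<inter> snd P)) * ip n m (\<lambda>\<sigma>. cnd n (fst P) v \<sigma> * cnd n (snd P) v \<sigma>))
    = (\<Sum>r\<le>t. \<Sum>P\<in>{P\<in>ksets n t \<times> ksets n t. card (fst P \<inter> snd P) = r}. h (card (fst P \<inter> snd P)) * ip n m (\<lambda>\<sigma>. cnd n (fst P) v \<sigma> * cnd n (snd P) v \<sigma>))"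
    using card_symdiff_ksets(2) by (intro sum.group[symmetric]) auto
  also have "\<dots> = (\<Sum>r\<le>t. CC n t v m r * h r)"
    unfolding CC_def sum_distrib_right by (intro sum.cong refl) auto
  finally show ?thesis .
qed

lemma ip_qs_qs:
  "ip n m (\<lambda>\<sigma>. qs n t v U \<sigma> * qs n t v U' \<sigma>) =
    (\<Sum>P\<in>ksets n t \<times> ksets n t. ((if fst P \<subseteq> U then 1 else 0) * (if snd P \<subseteq> U' then 1 else 0)) * ip n m (\<lambda>\<sigma>. cnd n (fst P) v \<sigma> * cnd n (snd P) v \<sigma>))"
proof -
  have "(\<lambda>\<sigma>. qs n t v U \<sigma> * qs n t v U' \<sigma>) = (\<lambda>\<sigma>. \<Sum>P\<in>ksets n t \<times> ksets n t.
    ((if fst P \<subseteq> U then 1 else 0) * (if snd P \<subseteq> U' then 1 else 0)) * (cnd n (fst P) v \<sigma> * cnd n (snd P) v \<sigma>))"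
    unfolding qs_def sum_product sum.cartesian_product by (auto intro!: ext sum.cong)
  then show ?thesis by (simp only: ip_sum_right ip_scale_right)
qed

lemma expect_pair:
  "(\<Sum>U\<in>Pow {1..n}. \<Sum>U'\<in>Pow {1..n}. pw n y u U U' * ip n m (\<lambda>\<sigma>. qs n t v U \<sigma> * qs n t v U' \<sigma>))
    = (\<Sum>r\<le>t. CC n t v m r * (y ^ r * u ^ (2 * (t - r))))"
proof -
  let ?c = "\<lambda>P. ip n m (\<lambda>\<sigma>. cnd n (fst P) v \<sigma> * cnd n (snd P) v \<sigma>)"
  let ?s = "\<lambda>P U U'. (if fst P \<subseteq> U then 1 else 0) * (if snd P \<subseteq> U' then 1 else 0) :: real"
  have "(\<Sum>U\<in>Pow {1..n}. \<Sum>U'\<in>Pow {1..n}. pw n y u U U' * ip n m (\<lambda>\<sigma>. qs n t v U \<sigma> * qs n t v U' \<sigma>))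
    = (\<Sum>U\<in>Pow {1..n}. \<Sum>U'\<in>Pow {1..n}. \<Sum>P\<in>ksets n t \<times> ksets n t. pw n y u U U' * ?s P U U' * ?c P)"
    unfolding ip_qs_qs by (simp only: sum_distrib_left mult.assoc)
  also have "\<dots> = (\<Sum>U\<in>Pow {1..n}. \<Sum>P\<in>ksets n t \<times> ksets n t. \<Sum>U'\<in>Pow {1..n}. pw n y u U U' * ?s P U U' * ?c P)"
    by (intro sum.cong refl sum.swap)
  also have "\<dots> = (\<Sum>P\<in>ksets n t \<times> ksets n t. \<Sum>U\<in>Pow {1..n}. \<Sum>U'\<in>Pow {1..n}. pw n y u U U' * ?s P U U' * ?c P)"
    by (rule sum.swap)
  also have "\<dots> = (\<Sum>P\<in>ksets n t \<times> ksets n t. (\<Sum>U\<in>Pow {1..n}. \<Sum>U'\<in>Pow {1..n}. pw n y u U U' * ?s P U U') * ?c P)"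
    by (simp only: sum_distrib_right)
  also have "\<dots> = (\<Sum>P\<in>ksets n t \<times> ksets n t. (\<lambda>r. y ^ r * u ^ (2 * (t - r))) (card (fst P \<inter> snd P)) * ?c P)"
  proof (intro sum.cong refl)
    fix P assume "P \<in> ksets n t \<times> ksets n t"
    then have P: "fst P \<in> ksets n t" "snd P \<in> ksets n t" by auto
    show "(\<Sum>U\<in>Pow {1..n}. \<Sum>U'\<in>Pow {1..n}. pw n y u U U' * ?s P U U') * ?c P = (\<lambda>r. y ^ r * u ^ (2 * (t - r))) (card (fst P \<inter> snd P)) * ?c P"
      unfolding pw_subset[OF ksets_sub(1)[OF P(1)] ksets_sub(1)[OF P(2)]] card_symdiff_ksets(1)[OF P] ..
  qed
  also have "\<dots> = (\<Sum>r\<le>t. CC n t v m r * (y ^ r * u ^ (2 * (t - r))))" by (rule CC_expand)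
  finally show ?thesis .
qed

text \<open>With one set in both roles, \<open>I \<union> I'\<close> has to lie in it, and this
  union has \<open>2 * t - r\<close> elements. Different overlaps \<open>r\<close> thus appear at
  different powers of \<open>u\<close>, which lets \<open>CC_one_bound\<close> separate
  them.\<close>

lemma expect_single:
  "(\<Sum>U\<in>Pow {1..n}. mw n u U * ip n m (\<lambda>\<sigma>. qs n t v U \<sigma> * qs n t v U \<sigma>)) = (\<Sum>r\<le>t. CC n t v m r * u ^ (2 * t - r))"
proof -
  let ?c = "\<lambda>P. ip n m (\<lambda>\<sigma>. cnd n (fst P) v \<sigma> * cnd n (snd P) v \<sigma>)"
  let ?s = "\<lambda>P U. (if fst P \<subseteq> U then 1 else 0) * (if snd P \<subseteq> U then 1 else 0) :: real"
  have "(\<Sum>U\<in>Pow {1..n}. mw n u U * ip n m (\<lambda>\<sigma>. qs n t v U \<sigma> * qs n t v U \<sigma>))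
    = (\<Sum>U\<in>Pow {1..n}. \<Sum>P\<in>ksets n t \<times> ksets n t. mw n u U * ?s P U * ?c P)"
    unfolding ip_qs_qs by (simp only: sum_distrib_left mult.assoc)
  also have "\<dots> = (\<Sum>P\<in>ksets n t \<times> ksets n t. (\<Sum>U\<in>Pow {1..n}. mw n u U * ?s P U) * ?c P)"
    by (subst sum.swap) (simp only: sum_distrib_right)
  also have "\<dots> = (\<Sum>P\<in>ksets n t \<times> ksets n t. (\<lambda>r. u ^ (2 * t - r)) (card (fst P \<inter> snd P)) * ?c P)"
  proof (intro sum.cong refl)
    fix P assume "P \<in> ksets n t \<times> ksets n t"
    then have P: "fst P \<in> ksets n t" "snd P \<in> ksets n t" by auto
    then have Un: "fst P \<union> snd P \<subseteq> {1..n}" using ksets_sub(1) by blast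
    have "(\<Sum>U\<in>Pow {1..n}. mw n u U * ?s P U) = (\<Sum>U\<in>Pow {1..n}. mw n u U * (if fst P \<union> snd P \<subseteq> U then 1 else 0))"
      by (intro sum.cong refl) auto
    also have "\<dots> = u ^ (2 * t - card (fst P \<inter> snd P))" unfolding mw_subset[OF Un] card_symdiff_ksets(3)[OF P] ..
    finally show "(\<Sum>U\<in>Pow {1..n}. mw n u U * ?s P U) * ?c P = (\<lambda>r. u ^ (2 * t - r)) (card (fst P \<inter> snd P)) * ?c P" by simp
  qed
  also have "\<dots> = (\<Sum>r\<le>t. CC n t v m r * u ^ (2 * t - r))" by (rule CC_expand)
  finally show ?thesis .
qed

text \<open>For constant weight the average of \<open>nsq n (qs n t v U)\<close> is within
  \<open>\<rho> * S\<close> of \<open>u ^ t * S\<close> for every \<open>u\<close> in the unit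
  interval, where \<open>S\<close> is the sum over \<open>I\<close>. By \<open>expect_single\<close>
  this average is a polynomial in \<open>u\<close>, so its coefficients are close to those of
  \<open>S * u ^ t\<close>: only the diagonal \<open>r = t\<close> survives.\<close>

lemma CC_one_bound:
  "\<exists>K>0. \<forall>n v \<delta> \<rho>. lowdeg n t v \<longrightarrow> centered n t v \<longrightarrow> 2 * t \<le> n \<longrightarrow> 0 < lam n t \<longrightarrow> 0 \<le> \<delta> \<longrightarrow> \<delta> < 1 \<longrightarrow>
    (1 - \<delta>) * nsq n v \<le> lam n t * (\<Sum>I\<in>ksets n t. nsq n (cnd n I v)) \<longrightarrow> 1 / (1 - \<delta>) - 1 \<le> \<rho> \<longrightarrow> 1 / lam n t - 1 \<le> \<rho> \<longrightarrow>
    (\<forall>r\<le>t. \<bar>CC n t v (\<lambda>_. 1) r - (if r = t then \<Sum>I\<in>ksets n t. nsq n (cnd n I v) else 0)\<bar> \<le> K * \<rho> * (\<Sum>I\<in>ksets n t. nsq n (cnd n I v)))"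
proof -
  obtain K0 where K0: "K0 > 0" "\<And>(a::nat \<Rightarrow> real) V. (\<forall>k\<le>2 * t. \<bar>\<Sum>i\<le>2 * t. a i * real k ^ i\<bar> \<le> V) \<Longrightarrow> (\<forall>i\<le>2 * t. \<bar>a i\<bar> \<le> K0 * V)"
    using interpolation_bound[of "2 * t"] by blast
  \<comment> \<open>Division by \<open>N\<close> sends the interpolation nodes
    \<open>0, ..., 2 * t\<close> into the unit interval, where \<open>u\<close> is a
    probability.\<close>
  define N where "N = real (2 * t + 1)"
  have N: "N \<ge> 1" by (simp add: N_def)
  show ?thesis
  proof (intro exI[of _ "K0 * N ^ (2 * t)"] conjI allI impI)
    show "0 < K0 * N ^ (2 * t)" using K0(1) N by simp
    fix n v \<delta> \<rho> r
    assume v: "lowdeg n t v" "centered n t v" and nt: "2 * t \<le> n" and l: "0 < lam n t" and del: "0 \<le> \<delta>" "\<delta> < (1::real)"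
      and vlow: "(1 - \<delta>) * nsq n v \<le> lam n t * (\<Sum>I\<in>ksets n t. nsq n (cnd n I v))"
      and \<rho>: "1 / (1 - \<delta>) - 1 \<le> \<rho>" "1 / lam n t - 1 \<le> \<rho>" and r: "r \<le> t"
    define S where "S = (\<Sum>I\<in>ksets n t. nsq n (cnd n I v))"
    have S0: "0 \<le> S" by (simp add: S_def sum_nonneg)
    \<comment> \<open>The deviation of the coefficient of \<open>u ^ i\<close> from that of
      \<open>S * u ^ t\<close>; this coefficient belongs to overlap \<open>2 * t - i\<close>, and
      powers below \<open>t\<close> do not occur.\<close>
    define c where "c i = (if t \<le> i then CC n t v (\<lambda>_. 1) (2 * t - i) - (if i = t then S else 0) else 0)" for i
    have "1 \<le> 1 / (1 - \<delta>)" using del by simp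
    then have \<rho>0: "0 \<le> \<rho>" using \<rho> by linarith
    have "\<bar>\<Sum>i\<le>2 * t. (c i / N ^ i) * real k ^ i\<bar> \<le> \<rho> * S" if k: "k \<le> 2 * t" for k
    proof -
      define u where "u = real k / N"
      have u: "0 \<le> u" "u \<le> 1" using k by (auto simp: u_def N_def)
      have ut: "0 \<le> u ^ t" "u ^ t \<le> 1" using u by (auto simp: power_le_one)
      have "(\<Sum>i\<le>2 * t. (c i / N ^ i) * real k ^ i) = (\<Sum>i\<le>2 * t. c i * u ^ i)"
        by (simp add: u_def power_divide)
      also have "\<dots> = (\<Sum>i\<in>{t..2 * t}. c i * u ^ i)"
        by (rule sum.mono_neutral_right) (auto simp: c_def)
      also have "\<dots> = (\<Sum>i\<in>{t..2 * t}. CC n t v (\<lambda>_. 1) (2 * t - i) * u ^ i - (if i = t then S * u ^ t else 0))"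
        by (intro sum.cong refl) (auto simp: c_def algebra_simps)
      also have "\<dots> = (\<Sum>i\<in>{t..2 * t}. CC n t v (\<lambda>_. 1) (2 * t - i) * u ^ i) - S * u ^ t"
        by (simp add: sum_subtractf)
      also have "(\<Sum>i\<in>{t..2 * t}. CC n t v (\<lambda>_. 1) (2 * t - i) * u ^ i) = (\<Sum>r\<le>t. CC n t v (\<lambda>_. 1) r * u ^ (2 * t - r))"
        by (rule sum.reindex_bij_witness[of _ "\<lambda>r. 2 * t - r" "\<lambda>i. 2 * t - i"]) auto
      also have "\<dots> = (\<Sum>U\<in>Pow {1..n}. mw n u U * nsq n (qs n t v U))"
        unfolding expect_single[symmetric] by (simp add: ip_def)
      finally have e: "(\<Sum>i\<le>2 * t. (c i / N ^ i) * real k ^ i) = (\<Sum>U\<in>Pow {1..n}. mw n u U * nsq n (qs n t v U)) - S * u ^ t" .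
      have up: "(\<Sum>U\<in>Pow {1..n}. mw n u U * nsq n (qs n t v U)) - S * u ^ t \<le> u ^ t * S * (1 / lam n t - 1)"
        using expect_nsq_qs[OF v nt l u] by (simp add: S_def algebra_simps)
      have lo: "- (u ^ t * S * (1 / (1 - \<delta>) - 1)) \<le> (\<Sum>U\<in>Pow {1..n}. mw n u U * nsq n (qs n t v U)) - S * u ^ t"
        using expect_nsq_diff(2)[OF v nt l del vlow u] by (simp add: S_def algebra_simps)
      have "u ^ t * S * x \<le> \<rho> * S" if "x \<le> \<rho>" for x
      proof -
        have "u ^ t * S * x \<le> u ^ t * S * \<rho>" using that ut S0 by (intro mult_left_mono) auto
        also have "\<dots> \<le> 1 * S * \<rho>" using ut S0 \<rho>0 by (intro mult_right_mono) auto
        finally show ?thesis by (simp add: mult.commute)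
      qed
      from this[OF \<rho>(1)] this[OF \<rho>(2)] show ?thesis unfolding e using up lo by linarith
    qed
    then have "\<forall>i\<le>2 * t. \<bar>c i / N ^ i\<bar> \<le> K0 * (\<rho> * S)" using K0(2)[of "\<lambda>i. c i / N ^ i" "\<rho> * S"] by blast
    then have "\<bar>c (2 * t - r) / N ^ (2 * t - r)\<bar> \<le> K0 * (\<rho> * S)" by simp
    then have "\<bar>c (2 * t - r)\<bar> \<le> K0 * (\<rho> * S) * N ^ (2 * t - r)" using N by (simp add: abs_divide pos_divide_le_eq)
    also have "\<dots> \<le> K0 * (\<rho> * S) * N ^ (2 * t)"
      using K0(1) \<rho>0 S0 N by (intro mult_left_mono power_increasing) auto
    finally have "\<bar>c (2 * t - r)\<bar> \<le> K0 * N ^ (2 * t) * \<rho> * S" by (simp add: algebra_simps)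
    moreover have "c (2 * t - r) = CC n t v (\<lambda>_. 1) r - (if r = t then S else 0)" using r by (auto simp: c_def)
    ultimately show "\<bar>CC n t v (\<lambda>_. 1) r - (if r = t then \<Sum>I\<in>ksets n t. nsq n (cnd n I v) else 0)\<bar> \<le> K0 * N ^ (2 * t) * \<rho> * (\<Sum>I\<in>ksets n t. nsq n (cnd n I v))"
      unfolding S_def[symmetric] by simp
  qed
qed

lemma ip_weight_amgm:
  assumes "0 < \<eta>" "\<And>\<sigma>. \<sigma> \<in> Sym n \<Longrightarrow> 0 \<le> m \<sigma> \<and> m \<sigma> \<le> 1"
  shows "\<bar>ip n m (\<lambda>\<sigma>. x \<sigma> * y \<sigma>)\<bar> \<le> (nsq n x / \<eta> + \<eta> * nsq n y) / 2"
proof -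
  have e: "ip n m (\<lambda>\<sigma>. x \<sigma> * y \<sigma>) = ip n (\<lambda>\<sigma>. m \<sigma> * x \<sigma>) y" by (simp add: ip_def mult.assoc)
  have nle: "nsq n (\<lambda>\<sigma>. m \<sigma> * x \<sigma>) \<le> nsq n x"
  proof (rule ip_mono)
    fix \<tau> assume t: "\<tau> \<in> Sym n"
    have "m \<tau> * x \<tau> * (m \<tau> * x \<tau>) = (m \<tau> * m \<tau>) * (x \<tau> * x \<tau>)" by (simp add: algebra_simps)
    also have "\<dots> \<le> 1 * (x \<tau> * x \<tau>)"
      using assms(2)[OF t] by (intro mult_right_mono mult_le_one) auto
    finally show "m \<tau> * x \<tau> * (m \<tau> * x \<tau>) \<le> x \<tau> * x \<tau>" by simp
  qed
  have "(nsq n (\<lambda>\<sigma>. m \<sigma> * x \<sigma>) / \<eta> + \<eta> * nsq n y) / 2 \<le> (nsq n x / \<eta> + \<eta> * nsq n y) / 2"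
    using assms(1) by (intro divide_right_mono add_right_mono nle) auto
  with ip_amgm[OF assms(1)] have "\<bar>ip n (\<lambda>\<sigma>. m \<sigma> * x \<sigma>) y\<bar> \<le> (nsq n x / \<eta> + \<eta> * nsq n y) / 2" by (rule order.trans)
  with e show ?thesis by simp
qed

text \<open>The factors are exchanged one at a time. The weight \<open>m\<close> stands both for
  \<open>f\<close> and for the constant 1, the two cases that \<open>near_lowdeg_light\<close>
  compares.\<close>

lemma ip_diff_products:
  assumes "0 < \<eta>" "\<And>\<sigma>. \<sigma> \<in> Sym n \<Longrightarrow> 0 \<le> m \<sigma> \<and> m \<sigma> \<le> 1"
  shows "\<bar>ip n m (\<lambda>\<sigma>. a \<sigma> * a' \<sigma>) - ip n m (\<lambda>\<sigma>. b \<sigma> * b' \<sigma>)\<bar> \<le>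
    (nsq n (\<lambda>\<sigma>. a \<sigma> - b \<sigma>) / \<eta> + \<eta> * nsq n a') / 2 + (nsq n (\<lambda>\<sigma>. a' \<sigma> - b' \<sigma>) / \<eta> + \<eta> * nsq n b) / 2"
proof -
  have "(\<lambda>\<sigma>. a \<sigma> * a' \<sigma>) = (\<lambda>\<sigma>. ((a \<sigma> - b \<sigma>) * a' \<sigma> + (a' \<sigma> - b' \<sigma>) * b \<sigma>) + b \<sigma> * b' \<sigma>)"
    by (simp add: algebra_simps)
  then have "ip n m (\<lambda>\<sigma>. a \<sigma> * a' \<sigma>) - ip n m (\<lambda>\<sigma>. b \<sigma> * b' \<sigma>) =
    ip n m (\<lambda>\<sigma>. (a \<sigma> - b \<sigma>) * a' \<sigma>) + ip n m (\<lambda>\<sigma>. (a' \<sigma> - b' \<sigma>) * b \<sigma>)"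
    by (simp add: ip_add_right)
  moreover have W: "\<bar>ip n m (\<lambda>\<sigma>. x \<sigma> * y \<sigma>)\<bar> \<le> (nsq n x / \<eta> + \<eta> * nsq n y) / 2" for x y
    using assms by (rule ip_weight_amgm)
  note W[of "\<lambda>\<sigma>. a \<sigma> - b \<sigma>" a'] W[of "\<lambda>\<sigma>. a' \<sigma> - b' \<sigma>" b]
  ultimately show ?thesis by linarith
qed

lemma sum_mw: "(\<Sum>U\<in>Pow {1..n}. mw n u U) = 1"
  using mw_subset[of "{}" n u] by simp

lemma expect_pw_left: "(\<Sum>U\<in>Pow {1..n}. \<Sum>U'\<in>Pow {1..n}. pw n y u U U' * h U) = (\<Sum>U\<in>Pow {1..n}. mw n u U * h U)"
  by (simp add: sum_distrib_right[symmetric] pw_marginal)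

lemma expect_pw_right: "(\<Sum>U\<in>Pow {1..n}. \<Sum>U'\<in>Pow {1..n}. pw n y u U U' * h U') = (\<Sum>U\<in>Pow {1..n}. mw n u U * h U)"
proof -
  have "(\<Sum>U\<in>Pow {1..n}. \<Sum>U'\<in>Pow {1..n}. pw n y u U U' * h U') = (\<Sum>U'\<in>Pow {1..n}. \<Sum>U\<in>Pow {1..n}. pw n y u U' U * h U')"
    by (subst sum.swap) (simp add: pw_commute)
  then show ?thesis by (simp add: sum_distrib_right[symmetric] pw_marginal)
qed

text \<open>Here \<open>f\<close> is an indicator function, \<open>v\<close> its centered
  approximation, and \<open>\<delta>\<close> the defect in the norm identity for \<open>v\<close>.
  The fractions of \<open>\<eta>\<^sup>2\<close> are chosen so that the total error in
  \<open>expect_diff\<close> stays below \<open>\<eta>\<^sup>2 * mu\<close>.\<close>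

locale near_lowdeg =
  fixes n t :: nat and v f :: "(nat \<Rightarrow> nat) \<Rightarrow> real" and \<delta> \<eta> :: real
  assumes low: "lowdeg n t v" and cen: "centered n t v" and nt: "2 * t \<le> n" and lam0: "0 < lam n t"
    and del: "0 \<le> \<delta>" "\<delta> < 1"
    and vlow: "(1 - \<delta>) * nsq n v \<le> lam n t * (\<Sum>I\<in>ksets n t. nsq n (cnd n I v))"
    and eta: "0 < \<eta>" "\<eta> \<le> 1 / 20"
    and d1: "1 / (1 - \<delta>) - 1 \<le> \<eta>\<^sup>2 / 16" and l1: "1 / lam n t - 1 \<le> \<eta>\<^sup>2 / 16"
    and f01: "\<And>\<sigma>. \<sigma> \<in> Sym n \<Longrightarrow> f \<sigma> = 0 \<or> f \<sigma> = 1"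
    and fv: "nsq n (\<lambda>\<sigma>. f \<sigma> - v \<sigma>) \<le> \<eta>\<^sup>2 / 8 * nsq n f"
begin

definition mu :: real where "mu = nsq n f"
definition SS :: real where "SS = (\<Sum>I\<in>ksets n t. nsq n (cnd n I v))"
definition q :: "nat set \<Rightarrow> (nat \<Rightarrow> nat) \<Rightarrow> real" where "q = qs n t v"

lemma mu0: "0 \<le> mu" and SS0: "0 \<le> SS"
  by (auto simp: mu_def SS_def sum_nonneg)

lemma ip_f_small:
  assumes "nsq n g \<le> \<eta>\<^sup>2 * mu"
  shows "\<bar>ip n f g\<bar> \<le> \<eta> * mu"
proof -
  have "\<bar>ip n f g\<bar> \<le> (nsq n f / (1 / \<eta>) + 1 / \<eta> * nsq n g) / 2" using eta by (intro ip_amgm) simp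
  also have "1 / \<eta> * nsq n g \<le> 1 / \<eta> * (\<eta>\<^sup>2 * mu)" using assms eta by (intro mult_left_mono) auto
  finally show ?thesis using eta by (simp add: mu_def power2_eq_square)
qed

lemma eta_sq: "\<eta>\<^sup>2 \<le> 1 / 400" "0 \<le> \<eta>\<^sup>2" "\<eta>\<^sup>2 \<le> \<eta>"
proof -
  have "\<eta>\<^sup>2 \<le> (1 / 20)\<^sup>2" using eta by (intro power_mono) auto
  then show "\<eta>\<^sup>2 \<le> 1 / 400" by (simp add: power2_eq_square)
  show "\<eta>\<^sup>2 \<le> \<eta>" using eta by (simp add: power2_eq_square mult_left_le)
qed simp

text \<open>The constant comes from \<open>(1 + 1/20)^2 = 1.1025\<close>, for the distance of
  \<open>v\<close> from \<open>f\<close>, times \<open>1 + 1/6400\<close>, for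
  \<open>1 / lam n t\<close>.\<close>

lemma SS_le: "SS \<le> 1.12 * mu"
proof -
  have fv': "nsq n (\<lambda>\<sigma>. f \<sigma> - v \<sigma>) \<le> \<eta>\<^sup>2 * mu"
    using fv mult_nonneg_nonneg[OF eta_sq(2) mu0] unfolding mu_def by linarith
  have "v = (\<lambda>\<sigma>. f \<sigma> - (f \<sigma> - v \<sigma>))" by simp
  then have "nsq n v = nsq n f - 2 * ip n f (\<lambda>\<sigma>. f \<sigma> - v \<sigma>) + nsq n (\<lambda>\<sigma>. f \<sigma> - v \<sigma>)"
    using nsq_diff[of n f "\<lambda>\<sigma>. f \<sigma> - v \<sigma>"] by simp
  also have "\<dots> \<le> mu + 2 * (\<eta> * mu) + \<eta>\<^sup>2 * mu" using ip_f_small[OF fv'] fv' by (simp add: mu_def)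
  also have "\<dots> \<le> mu + 2 * (1 / 20 * mu) + 1 / 400 * mu"
    using eta eta_sq mu0 by (intro add_mono mult_left_mono mult_right_mono) auto
  finally have nv: "nsq n v \<le> 1.1025 * mu" by simp
  have "SS \<le> nsq n v * (1 / lam n t)"
    using lam_upper[OF low cen nt] lam0 by (simp add: SS_def pos_le_divide_eq mult.commute)
  also have "\<dots> \<le> (1.1025 * mu) * (1 + 1 / 6400)"
    using nv l1 eta_sq lam0 mu0 by (intro mult_mono) auto
  finally show ?thesis using mu0 by simp
qed

text \<open>The difference splits into the conditioned error \<open>f - v\<close>, where
  conditioning is a contraction, and the defect from \<open>expect_nsq_diff\<close>. They contribute
  \<open>0.25\<close> and \<open>0.28\<close> times \<open>\<eta>\<^sup>2 * mu\<close>.\<close>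

lemma expect_diff:
  assumes u: "0 \<le> u" "u \<le> 1"
  shows "(\<Sum>U\<in>Pow {1..n}. mw n u U * nsq n (\<lambda>\<sigma>. cnd n U f \<sigma> - q U \<sigma>)) \<le> \<eta>\<^sup>2 * mu"
proof -
  have 1: "nsq n (\<lambda>\<sigma>. cnd n U f \<sigma> - q U \<sigma>) \<le> 2 * (\<eta>\<^sup>2 / 8 * mu) + 2 * nsq n (\<lambda>\<sigma>. cnd n U v \<sigma> - q U \<sigma>)" for U
  proof -
    have "(\<lambda>\<sigma>. cnd n U f \<sigma> - q U \<sigma>) = (\<lambda>\<sigma>. cnd n U (\<lambda>\<sigma>. f \<sigma> - v \<sigma>) \<sigma> + (cnd n U v \<sigma> - q U \<sigma>))"
      by (simp add: av_diff)
    then have "nsq n (\<lambda>\<sigma>. cnd n U f \<sigma> - q U \<sigma>) \<le> 2 * nsq n (cnd n U (\<lambda>\<sigma>. f \<sigma> - v \<sigma>)) + 2 * nsq n (\<lambda>\<sigma>. cnd n U v \<sigma> - q U \<sigma>)"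
      using nsq_add_le[of n "cnd n U (\<lambda>\<sigma>. f \<sigma> - v \<sigma>)" "\<lambda>\<sigma>. cnd n U v \<sigma> - q U \<sigma>"] by simp
    moreover have "nsq n (cnd n U (\<lambda>\<sigma>. f \<sigma> - v \<sigma>)) \<le> nsq n (\<lambda>\<sigma>. f \<sigma> - v \<sigma>)" by (intro nsq_av_le) auto
    ultimately show ?thesis using fv unfolding mu_def by linarith
  qed
  have "(\<Sum>U\<in>Pow {1..n}. mw n u U * nsq n (\<lambda>\<sigma>. cnd n U f \<sigma> - q U \<sigma>)) \<le>
    (\<Sum>U\<in>Pow {1..n}. mw n u U * (2 * (\<eta>\<^sup>2 / 8 * mu) + 2 * nsq n (\<lambda>\<sigma>. cnd n U v \<sigma> - q U \<sigma>)))"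
    by (intro sum_mono mult_left_mono 1 mw_nonneg u)
  also have "\<dots> = 2 * (\<eta>\<^sup>2 / 8 * mu) * (\<Sum>U\<in>Pow {1..n}. mw n u U) + 2 * (\<Sum>U\<in>Pow {1..n}. mw n u U * nsq n (\<lambda>\<sigma>. cnd n U v \<sigma> - q U \<sigma>))"
    by (simp add: distrib_left sum.distrib sum_distrib_left algebra_simps)
  also have "\<dots> \<le> 2 * (\<eta>\<^sup>2 / 8 * mu) + 2 * (u ^ t * SS * (1 / (1 - \<delta>) + 1 / lam n t - 2))"
    using expect_nsq_diff(1)[OF low cen nt lam0 del vlow u] by (simp add: sum_mw q_def SS_def)
  also have "u ^ t * SS * (1 / (1 - \<delta>) + 1 / lam n t - 2) \<le> 1 * (1.12 * mu) * (\<eta>\<^sup>2 / 8)"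
  proof -
    have "u ^ t * SS * (1 / (1 - \<delta>) + 1 / lam n t - 2) \<le> u ^ t * SS * (\<eta>\<^sup>2 / 8)"
      using d1 l1 SS0 u by (intro mult_left_mono) auto
    also have "\<dots> \<le> 1 * (1.12 * mu) * (\<eta>\<^sup>2 / 8)"
      using SS0 SS_le u eta_sq mu0 by (intro mult_right_mono mult_mono power_le_one) auto
    finally show ?thesis .
  qed
  finally have "(\<Sum>U\<in>Pow {1..n}. mw n u U * nsq n (\<lambda>\<sigma>. cnd n U f \<sigma> - q U \<sigma>)) \<le> 53 / 100 * (\<eta>\<^sup>2 * mu)" by (simp add: mult.commute)
  then show ?thesis using mult_nonneg_nonneg[OF eta_sq(2) mu0] by linarith
qed

text \<open>Replacing both conditional expectations by their approximations turns the average into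
  the polynomial of \<open>expect_pair\<close>. The error involves only the two marginals of the
  pair of sets, each with law \<open>mw\<close>; so it is uniform in \<open>y\<close>, as the
  comparison of coefficients requires.\<close>

lemma triple_diff:
  assumes y: "0 \<le> y" "y \<le> u" "2 * u - y \<le> 1" "u \<le> 1" and m: "\<And>\<sigma>. \<sigma> \<in> Sym n \<Longrightarrow> 0 \<le> m \<sigma> \<and> m \<sigma> \<le> 1"
  shows "\<bar>(\<Sum>U\<in>Pow {1..n}. \<Sum>U'\<in>Pow {1..n}. pw n y u U U' * ip n m (\<lambda>\<sigma>. cnd n U f \<sigma> * cnd n U' f \<sigma>))
     - (\<Sum>r\<le>t. CC n t v m r * (y ^ r * u ^ (2 * (t - r))))\<bar> \<le> 3 * \<eta> * mu"
proof -
  have u: "0 \<le> u" "u \<le> 1" using y by auto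
  let ?d = "\<lambda>U. nsq n (\<lambda>\<sigma>. cnd n U f \<sigma> - q U \<sigma>)"
  have "\<bar>(\<Sum>U\<in>Pow {1..n}. \<Sum>U'\<in>Pow {1..n}. pw n y u U U' * ip n m (\<lambda>\<sigma>. cnd n U f \<sigma> * cnd n U' f \<sigma>))
     - (\<Sum>r\<le>t. CC n t v m r * (y ^ r * u ^ (2 * (t - r))))\<bar>
    = \<bar>\<Sum>U\<in>Pow {1..n}. \<Sum>U'\<in>Pow {1..n}. pw n y u U U' * (ip n m (\<lambda>\<sigma>. cnd n U f \<sigma> * cnd n U' f \<sigma>) - ip n m (\<lambda>\<sigma>. q U \<sigma> * q U' \<sigma>))\<bar>"
    unfolding expect_pair[symmetric] q_def by (simp add: sum_subtractf right_diff_distrib)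
  also have "\<dots> \<le> (\<Sum>U\<in>Pow {1..n}. \<Sum>U'\<in>Pow {1..n}. \<bar>pw n y u U U' * (ip n m (\<lambda>\<sigma>. cnd n U f \<sigma> * cnd n U' f \<sigma>) - ip n m (\<lambda>\<sigma>. q U \<sigma> * q U' \<sigma>))\<bar>)"
    by (intro order.trans[OF sum_abs] sum_mono sum_abs)
  also have "\<dots> \<le> (\<Sum>U\<in>Pow {1..n}. \<Sum>U'\<in>Pow {1..n}. pw n y u U U' * ((?d U / \<eta> + \<eta> * mu) / 2) + pw n y u U U' * (?d U' / \<eta> / 2) + pw n y u U U' * (\<eta> * nsq n (q U) / 2))"
  proof (intro sum_mono)
    fix U U'
    have p: "0 \<le> pw n y u U U'" using y by (intro pw_nonneg) auto
    have "\<bar>ip n m (\<lambda>\<sigma>. cnd n U f \<sigma> * cnd n U' f \<sigma>) - ip n m (\<lambda>\<sigma>. q U \<sigma> * q U' \<sigma>)\<bar>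
      \<le> (?d U / \<eta> + \<eta> * nsq n (cnd n U' f)) / 2 + (?d U' / \<eta> + \<eta> * nsq n (q U)) / 2"
      by (rule ip_diff_products[OF eta(1) m])
    also have "\<eta> * nsq n (cnd n U' f) \<le> \<eta> * mu" using eta by (intro mult_left_mono) (auto simp: mu_def intro: nsq_av_le)
    finally have "\<bar>ip n m (\<lambda>\<sigma>. cnd n U f \<sigma> * cnd n U' f \<sigma>) - ip n m (\<lambda>\<sigma>. q U \<sigma> * q U' \<sigma>)\<bar>
      \<le> (?d U / \<eta> + \<eta> * mu) / 2 + (?d U' / \<eta> + \<eta> * nsq n (q U)) / 2" by simp
    then have "pw n y u U U' * \<bar>ip n m (\<lambda>\<sigma>. cnd n U f \<sigma> * cnd n U' f \<sigma>) - ip n m (\<lambda>\<sigma>. q U \<sigma> * q U' \<sigma>)\<bar>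
      \<le> pw n y u U U' * ((?d U / \<eta> + \<eta> * mu) / 2 + (?d U' / \<eta> + \<eta> * nsq n (q U)) / 2)"
      using p by (intro mult_left_mono) auto
    then show "\<bar>pw n y u U U' * (ip n m (\<lambda>\<sigma>. cnd n U f \<sigma> * cnd n U' f \<sigma>) - ip n m (\<lambda>\<sigma>. q U \<sigma> * q U' \<sigma>))\<bar>
      \<le> pw n y u U U' * ((?d U / \<eta> + \<eta> * mu) / 2) + pw n y u U U' * (?d U' / \<eta> / 2) + pw n y u U U' * (\<eta> * nsq n (q U) / 2)"
      using p by (simp add: abs_mult distrib_left add_divide_distrib)
  qed
  also have "\<dots> = (\<Sum>U\<in>Pow {1..n}. mw n u U * ((?d U / \<eta> + \<eta> * mu) / 2)) + (\<Sum>U\<in>Pow {1..n}. mw n u U * (?d U / \<eta> / 2)) + (\<Sum>U\<in>Pow {1..n}. mw n u U * (\<eta> * nsq n (q U) / 2))"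
    unfolding sum.distrib expect_pw_left expect_pw_right ..
  also have "\<dots> = (\<Sum>U\<in>Pow {1..n}. mw n u U * ?d U) / \<eta> + \<eta> * mu / 2 * (\<Sum>U\<in>Pow {1..n}. mw n u U) + \<eta> / 2 * (\<Sum>U\<in>Pow {1..n}. mw n u U * nsq n (q U))"
    by (simp add: distrib_left add_divide_distrib sum.distrib sum_divide_distrib[symmetric] sum_distrib_left sum_distrib_right algebra_simps)
  also have "\<dots> \<le> (\<eta>\<^sup>2 * mu) / \<eta> + \<eta> * mu / 2 * 1 + \<eta> / 2 * (2 * mu)"
  proof -
    have "(\<Sum>U\<in>Pow {1..n}. mw n u U * nsq n (q U)) \<le> u ^ t * SS * (1 / lam n t)"
      using expect_nsq_qs[OF low cen nt lam0 u] by (simp add: q_def SS_def)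
    also have "\<dots> \<le> 1 * (1.12 * mu) * (1 + 1 / 6400)"
      using SS0 SS_le u eta_sq mu0 l1 lam0 by (intro mult_mono power_le_one) auto
    also have "\<dots> \<le> 2 * mu" using mu0 by simp
    finally show ?thesis using expect_diff[OF u] eta mult_nonneg_nonneg[OF less_imp_le[OF eta(1)] mu0]
      by (intro add_mono mult_left_mono divide_right_mono) (auto simp: sum_mw)
  qed
  also have "\<dots> \<le> 3 * \<eta> * mu" using eta mu0 by (simp add: power2_eq_square)
  finally show ?thesis .
qed

text \<open>For \<open>u = 1\<close> the random set is all of \<open>{1..n}\<close>, and the
  polynomial becomes the mean of \<open>f * h^2\<close> with \<open>h\<close> close to
  \<open>f\<close>.\<close>

lemma CC_total: "(1 - 2 * \<eta>) * mu \<le> (\<Sum>r\<le>t. CC n t v f r)"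
proof -
  have "mw n 1 U = (if U = {1..n} then 1 else 0)" if "U \<in> Pow {1..n}" for U
  proof (cases "U = {1..n}")
    case False
    then obtain a where "a \<in> {1..n}" "a \<notin> U" using \<open>U \<in> Pow {1..n}\<close> by blast
    then have "(\<Prod>i\<in>{1..n}. if i \<in> U then 1 else 0 :: real) = 0" by (intro prod_zero bexI[of _ a]) auto
    with False show ?thesis by (simp only: mw_def diff_self if_False)
  qed (simp add: mw_def)
  then have e: "(\<Sum>U\<in>Pow {1..n}. mw n 1 U * h U) = h {1..n}" for h
    by (simp add: if_distrib[of "\<lambda>x. x * _"] cong: if_cong)
  have c: "cnd n {1..n} f = f" by (rule ext, rule av_const) auto
  define h where "h = q {1..n}"
  have fh: "nsq n (\<lambda>\<sigma>. f \<sigma> - h \<sigma>) \<le> \<eta>\<^sup>2 * mu"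
    using expect_diff[of 1] unfolding e c h_def by simp
  have "(\<Sum>r\<le>t. CC n t v f r) = ip n f (\<lambda>\<sigma>. h \<sigma> * h \<sigma>)"
    using expect_single[of n 1 f t v] unfolding e h_def q_def by simp
  also have "\<dots> \<ge> ip n f (\<lambda>\<sigma>. f \<sigma> - 2 * (f \<sigma> - h \<sigma>))"
  proof (rule ip_mono)
    fix \<tau> assume t: "\<tau> \<in> Sym n"
    \<comment> \<open>The tangent at 1 replaces the square by a linear expression, which the mean
      square distance controls.\<close>
    have "2 * h \<tau> - 1 \<le> h \<tau> * h \<tau>" using zero_le_square[of "h \<tau> - 1"] by (simp add: algebra_simps)
    then show "f \<tau> * (f \<tau> - 2 * (f \<tau> - h \<tau>)) \<le> f \<tau> * (h \<tau> * h \<tau>)" using f01[OF t] by auto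
  qed
  finally have "ip n f (\<lambda>\<sigma>. f \<sigma> - 2 * (f \<sigma> - h \<sigma>)) \<le> (\<Sum>r\<le>t. CC n t v f r)" .
  moreover have "ip n f (\<lambda>\<sigma>. f \<sigma> - 2 * (f \<sigma> - h \<sigma>)) = mu - 2 * ip n f (\<lambda>\<sigma>. f \<sigma> - h \<sigma>)"
    by (subst ip_diff_right) (simp only: ip_scale_right mu_def)
  ultimately show ?thesis using ip_f_small[OF fh] by (simp add: algebra_simps)
qed

text \<open>Full overlap forces \<open>I = I'\<close>. The square of \<open>cnd n I v\<close>
  depends only on the coordinates in \<open>I\<close>, so its weight \<open>f\<close> may be
  replaced by \<open>cnd n I f\<close>, which is at most 1/2; and
  \<open>1.12 / 2 = 0.56\<close>.\<close>

lemma CC_top: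
  assumes "\<And>I \<sigma>. I \<in> ksets n t \<Longrightarrow> \<sigma> \<in> Sym n \<Longrightarrow> cnd n I f \<sigma> \<le> 1 / 2"
  shows "CC n t v f t \<le> 0.56 * mu"
proof -
  have "CC n t v f t = (\<Sum>I\<in>ksets n t. ip n f (\<lambda>\<sigma>. cnd n I v \<sigma> * cnd n I v \<sigma>))"
    unfolding CC_def
  proof (rule sum.reindex_bij_witness[of _ "\<lambda>I. (I, I)" fst])
    fix P assume "P \<in> {P \<in> ksets n t \<times> ksets n t. card (fst P \<inter> snd P) = t}"
    then have P: "fst P \<in> ksets n t" "snd P \<in> ksets n t" "card (fst P \<inter> snd P) = t" by auto
    have "fst P \<inter> snd P = fst P" "fst P \<inter> snd P = snd P"
      using P ksets_sub(2,3) by (metis card_subset_eq Int_lower1 Int_lower2)+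
    then show "(fst P, fst P) = P" by (metis prod.collapse)
    then show "ip n f (\<lambda>\<sigma>. cnd n (fst P) v \<sigma> * cnd n (fst P) v \<sigma>) = ip n f (\<lambda>\<sigma>. cnd n (fst P) v \<sigma> * cnd n (snd P) v \<sigma>)"
      by (metis snd_conv)
  qed (auto simp: ksets_sub)
  also have "\<dots> \<le> (\<Sum>I\<in>ksets n t. 1 / 2 * nsq n (cnd n I v))"
  proof (rule sum_mono)
    fix I assume I: "I \<in> ksets n t"
    let ?b = "\<lambda>\<sigma>. cnd n I v \<sigma> * cnd n I v \<sigma>"
    have inv: "cnd n I ?b \<sigma> = ?b \<sigma>" if "\<sigma> \<in> Sym n" for \<sigma>
    proof (rule av_const)
      fix \<pi> assume p: "\<pi> permutes {1..n} - I"
      have "agree I (\<sigma> \<circ> \<pi>) \<sigma>" using p by (auto simp: agree_def permutes_not_in)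
      then have "cnd n I v (\<sigma> \<circ> \<pi>) = cnd n I v \<sigma>"
        using that p I by (intro cnd_cong_agree) (auto simp: ksets_sub intro: Sym_comp_permutes)
      then show "?b (\<sigma> \<circ> \<pi>) = ?b \<sigma>" by simp
    qed simp
    have "ip n f ?b = ip n f (cnd n I ?b)" by (rule ip_cong) (simp_all add: inv)
    also have "\<dots> = ip n (cnd n I f) ?b" by (rule ip_av[symmetric]) auto
    also have "\<dots> \<le> ip n (\<lambda>_. 1 / 2) ?b" using assms[OF I] by (intro ip_mono mult_right_mono) auto
    also have "\<dots> = 1 / 2 * nsq n (cnd n I v)" unfolding ip_def sum_distrib_left[symmetric] by simp
    finally show "ip n f ?b \<le> 1 / 2 * nsq n (cnd n I v)" .
  qed
  also have "\<dots> = 1 / 2 * SS" by (simp add: SS_def sum_distrib_left)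
  finally show ?thesis using SS_le by simp
qed

end

section \<open>A set close to low degree has a heavy coset\<close>

text \<open>Take \<open>u = 1/2\<close>, for which every \<open>y\<close> in \<open>[0, 1/2]\<close>
  is admissible. Bounding \<open>f\<close> by 1 compares the polynomial in \<open>y\<close> for
  \<open>m = f\<close> with that for \<open>m = 1\<close>, which by \<open>CC_one_bound\<close> is
  nearly \<open>SS * y ^ t\<close>. Hence the coefficients below the top one sum to at most
  \<open>0.1 * mu\<close>. The total is at least \<open>0.9 * mu\<close> and the top one at most
  \<open>0.56 * mu\<close>, which forces \<open>mu\<close> to vanish.\<close>

lemma near_lowdeg_light:
  "\<exists>\<eta>>0. \<eta> \<le> 1 / 20 \<and> (\<forall>n v f \<delta>. near_lowdeg n t v f \<delta> \<eta> \<longrightarrow>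
    (\<forall>I\<in>ksets n t. \<forall>\<sigma>\<in>Sym n. cnd n I f \<sigma> \<le> 1 / 2) \<longrightarrow> nsq n f \<le> 0)"
proof -
  obtain K where K: "K > 0" "\<And>n v \<delta> \<rho> r. lowdeg n t v \<Longrightarrow> centered n t v \<Longrightarrow> 2 * t \<le> n \<Longrightarrow> 0 < lam n t \<Longrightarrow> 0 \<le> \<delta> \<Longrightarrow> \<delta> < 1 \<Longrightarrow>
    (1 - \<delta>) * nsq n v \<le> lam n t * (\<Sum>I\<in>ksets n t. nsq n (cnd n I v)) \<Longrightarrow> 1 / (1 - \<delta>) - 1 \<le> \<rho> \<Longrightarrow> 1 / lam n t - 1 \<le> \<rho> \<Longrightarrow>
    r \<le> t \<Longrightarrow> \<bar>CC n t v (\<lambda>_. 1) r - (if r = t then \<Sum>I\<in>ksets n t. nsq n (cnd n I v) else 0)\<bar> \<le> K * \<rho> * (\<Sum>I\<in>ksets n t. nsq n (cnd n I v))"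
    using CC_one_bound[of t] by blast
  obtain K' where K': "K' > 0" "\<And>(a::nat \<Rightarrow> real) V i. (\<And>k. k \<le> t \<Longrightarrow> \<bar>\<Sum>i\<le>t. a i * real k ^ i\<bar> \<le> V) \<Longrightarrow> i \<le> t \<Longrightarrow> \<bar>a i\<bar> \<le> K' * V"
    using interpolation_bound[of t] by blast
  define c where "c = real t * K' * 4 ^ t"
  have c0: "0 \<le> c" using K' by (simp add: c_def)
  \<comment> \<open>The variable \<open>y\<close> runs over \<open>k / M\<close> with
    \<open>k \<le> t\<close>. The first entry gives \<open>M \<ge> 2 * t\<close>, hence
    \<open>y \<le> 1/2\<close>; the second makes the main part \<open>2 * c * t^t / M\<close> of the
    lower coefficients at most 1/20.\<close>
  define M where "M = max (real (2 * t + 1)) (40 * c * real t ^ t)"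
  have M1: "M \<ge> 1" and M2: "M \<ge> 2 * real t" and M3: "M \<ge> 40 * c * real t ^ t" by (auto simp: M_def)
  \<comment> \<open>\<open>B * \<eta> * mu\<close> collects the errors: \<open>t + 1\<close>
    coefficients from \<open>CC_one_bound\<close>, and \<open>3 * \<eta> * mu\<close> from each of
    two uses of \<open>triple_diff\<close>.\<close>
  define B where "B = real (t + 1) * K + 6"
  have B0: "B > 0" using K by (simp add: B_def add_nonneg_pos)
  \<comment> \<open>Chosen after \<open>M\<close>, so that the error is at most 1/20 even when
    amplified by \<open>c * B * M ^ t\<close>.\<close>
  define \<eta> where "\<eta> = 1 / (20 * (1 + c * B * M ^ t))"
  have pos: "0 \<le> c * B * M ^ t" using c0 B0 M1 by simp
  have eta: "0 < \<eta>" "\<eta> \<le> 1 / 20" using pos by (auto simp: \<eta>_def field_simps)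
  have etaB: "c * B * M ^ t * \<eta> \<le> 1 / 20" using pos by (simp add: \<eta>_def field_simps)
  have "nsq n f \<le> 0" if L: "near_lowdeg n t v f \<delta> \<eta>" and light: "\<forall>I\<in>ksets n t. \<forall>\<sigma>\<in>Sym n. cnd n I f \<sigma> \<le> 1 / 2" for n v f \<delta>
  proof -
    interpret near_lowdeg n t v f \<delta> \<eta> by (rule L)
    define V where "V = (2 * (real t / M) ^ t + B * \<eta>) * mu"
    have V0: "0 \<le> V" using mu0 eta B0 M1 by (simp add: V_def)
    have one: "\<bar>CC n t v (\<lambda>_. 1) r - (if r = t then SS else 0)\<bar> \<le> K * \<eta> * mu" if "r \<le> t" for r
    proof -
      have "\<bar>CC n t v (\<lambda>_. 1) r - (if r = t then SS else 0)\<bar> \<le> K * (\<eta>\<^sup>2 / 16) * SS"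
        unfolding SS_def by (rule K(2)[OF low cen nt lam0 del vlow d1 l1 that])
      also have "\<dots> \<le> K * (\<eta> / 16) * (16 * mu)" using K eta_sq SS_le SS0 mu0 eta by (intro mult_mono) auto
      finally show ?thesis by simp
    qed
    have P: "\<bar>\<Sum>r\<le>t. (CC n t v f r * (1 / 2) ^ (2 * (t - r)) / M ^ r) * real k ^ r\<bar> \<le> V" if k: "k \<le> t" for k
    proof -
      define y where "y = real k / M"
      have y: "0 \<le> y" "y \<le> 1 / 2" "y \<le> real t / M" using k M1 M2 by (auto simp: y_def field_simps)
      let ?X = "\<lambda>m. \<Sum>U\<in>Pow {1..n}. \<Sum>U'\<in>Pow {1..n}. pw n y (1/2) U U' * ip n m (\<lambda>\<sigma>. cnd n U f \<sigma> * cnd n U' f \<sigma>)"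
      let ?P = "\<lambda>m. \<Sum>r\<le>t. CC n t v m r * (y ^ r * (1 / 2) ^ (2 * (t - r)))"
      have f1: "0 \<le> f \<sigma> \<and> f \<sigma> \<le> 1" if "\<sigma> \<in> Sym n" for \<sigma> using f01[OF that] by auto
      have Xf: "\<bar>?X f - ?P f\<bar> \<le> 3 * \<eta> * mu" using y f1 by (intro triple_diff) auto
      have X1: "\<bar>?X (\<lambda>_. 1) - ?P (\<lambda>_. 1)\<bar> \<le> 3 * \<eta> * mu" using y by (intro triple_diff) auto
      have Fnn: "0 \<le> cnd n U f \<sigma>" if "\<sigma> \<in> Sym n" for U \<sigma> by (rule av_nonneg[of n]) (use f1 that in auto)
      have pwn: "0 \<le> pw n y (1/2) U U'" for U U' using y by (intro pw_nonneg) auto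
      have X0: "0 \<le> ?X f"
        by (intro sum_nonneg mult_nonneg_nonneg pwn) (auto simp: ip_def intro!: divide_nonneg_nonneg sum_nonneg mult_nonneg_nonneg Fnn f1[THEN conjunct1])
      \<comment> \<open>Here \<open>f \<le> 1\<close> enters: replacing the weight \<open>f\<close>
        by 1 can only increase the average, since the conditional expectations of \<open>f\<close>
        are nonnegative.\<close>
      have Xle: "?X f \<le> ?X (\<lambda>_. 1)"
        by (intro sum_mono mult_left_mono pwn ip_mono mult_right_mono mult_nonneg_nonneg Fnn f1[THEN conjunct2])
      have "?P (\<lambda>_. 1) \<le> (\<Sum>r\<le>t. (if r = t then SS * y ^ t else 0) + K * \<eta> * mu)"
      proof (rule sum_mono)
        fix r assume "r \<in> {..t}"
        then have r: "r \<le> t" by simp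
        have w: "0 \<le> y ^ r * (1 / 2) ^ (2 * (t - r))" "y ^ r * (1 / 2) ^ (2 * (t - r)) \<le> 1"
          using y by (auto intro!: mult_le_one power_le_one)
        have "CC n t v (\<lambda>_. 1) r * (y ^ r * (1 / 2) ^ (2 * (t - r))) \<le> ((if r = t then SS else 0) + K * \<eta> * mu) * (y ^ r * (1 / 2) ^ (2 * (t - r)))"
          using one[OF r] w by (intro mult_right_mono) linarith+
        also have "\<dots> = (if r = t then SS * y ^ t else 0) + K * \<eta> * mu * (y ^ r * (1 / 2) ^ (2 * (t - r)))"
          by (simp add: distrib_right)
        also have "K * \<eta> * mu * (y ^ r * (1 / 2) ^ (2 * (t - r))) \<le> K * \<eta> * mu * 1"
          using w K eta mu0 by (intro mult_left_mono) auto
        finally show "CC n t v (\<lambda>_. 1) r * (y ^ r * (1 / 2) ^ (2 * (t - r))) \<le> (if r = t then SS * y ^ t else 0) + K * \<eta> * mu" by simp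
      qed
      also have "\<dots> = SS * y ^ t + real (t + 1) * (K * \<eta> * mu)" by (simp add: sum.distrib)
      also have "SS * y ^ t \<le> (2 * mu) * (real t / M) ^ t"
        using SS_le SS0 mu0 y by (intro mult_mono power_mono) auto
      finally have P1: "?P (\<lambda>_. 1) \<le> 2 * mu * (real t / M) ^ t + real (t + 1) * (K * \<eta> * mu)" by simp
      have "?P f \<le> 2 * mu * (real t / M) ^ t + real (t + 1) * (K * \<eta> * mu) + 6 * \<eta> * mu"
        using Xf X1 Xle P1 by linarith
      then have "?P f \<le> V" by (simp add: V_def B_def algebra_simps)
      moreover have "- (3 * \<eta> * mu) \<le> ?P f" using Xf X0 by linarith
      moreover have "3 * \<eta> * mu \<le> V"
      proof -
        have "3 * \<eta> * mu \<le> (B * \<eta>) * mu" using K eta mu0 by (intro mult_right_mono) (auto simp: B_def)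
        also have "\<dots> \<le> V" unfolding V_def using mu0 M1 by (intro mult_right_mono) auto
        finally show ?thesis .
      qed
      moreover have "?P f = (\<Sum>r\<le>t. (CC n t v f r * (1 / 2) ^ (2 * (t - r)) / M ^ r) * real k ^ r)"
        by (intro sum.cong refl) (simp add: y_def power_divide)
      ultimately show ?thesis by linarith
    qed
    \<comment> \<open>Undoing the scaling costs \<open>4 ^ (t - r) * M ^ r\<close>; for
      \<open>r < t\<close> this is at least one power of \<open>M\<close> short of the
      \<open>M ^ t\<close> in the denominator of the main part of \<open>V\<close>.\<close>
    have Cr: "CC n t v f r \<le> K' * V * 4 ^ t * M ^ (t - 1)" if r: "r < t" for r
    proof -
      have "\<bar>CC n t v f r * (1 / 2) ^ (2 * (t - r)) / M ^ r\<bar> \<le> K' * V" by (rule K'(2)[OF P]) (use r in auto)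
      then have "\<bar>CC n t v f r\<bar> * ((1 / 2) ^ (2 * (t - r)) / M ^ r) \<le> K' * V" using M1 by (simp add: abs_mult abs_divide)
      also have "(1 / 2 :: real) ^ (2 * (t - r)) = 1 / 4 ^ (t - r)" by (simp add: power_mult power_divide)
      finally have "\<bar>CC n t v f r\<bar> \<le> K' * V * (4 ^ (t - r) * M ^ r)" using M1 by (simp add: field_simps)
      also have "\<dots> \<le> K' * V * (4 ^ t * M ^ (t - 1))"
        using K' V0 M1 r by (intro mult_left_mono mult_mono power_increasing) auto
      finally show ?thesis by (simp add: algebra_simps)
    qed
    have lowsum: "(\<Sum>r<t. CC n t v f r) \<le> 0.1 * mu"
    proof (cases "t = 0")
      case False
      then have Mt: "M ^ t = M * M ^ (t - 1)" by (metis power_eq_if)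
      have "(\<Sum>r<t. CC n t v f r) \<le> (\<Sum>r<t. K' * V * 4 ^ t * M ^ (t - 1))" by (intro sum_mono Cr) auto
      also have "\<dots> = c * (V * M ^ (t - 1))" by (simp add: c_def algebra_simps)
      also have "V * M ^ (t - 1) = (2 * (real t ^ t / M) + B * \<eta> * M ^ (t - 1)) * mu"
        using M1 Mt by (simp add: V_def power_divide field_simps)
      also have "c * \<dots> = (2 * c * real t ^ t / M + c * B * M ^ (t - 1) * \<eta>) * mu" by (simp add: algebra_simps)
      also have "\<dots> \<le> (1 / 20 + 1 / 20) * mu"
      proof (intro mult_right_mono add_mono mu0)
        show "2 * c * real t ^ t / M \<le> 1 / 20" using M1 M3 by (simp add: field_simps)
        have "c * B * M ^ (t - 1) * \<eta> \<le> c * B * M ^ t * \<eta>"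
          using c0 B0 M1 eta by (intro mult_right_mono mult_left_mono power_increasing) auto
        then show "c * B * M ^ (t - 1) * \<eta> \<le> 1 / 20" using etaB by linarith
      qed
      finally show ?thesis by simp
    qed (use mu0 in simp)
    have "(\<Sum>r\<le>t. CC n t v f r) = (\<Sum>r<t. CC n t v f r) + CC n t v f t"
      by (simp add: lessThan_Suc_atMost[symmetric])
    then have "(1 - 2 * \<eta>) * mu \<le> 0.1 * mu + 0.56 * mu" using CC_total lowsum CC_top light by fastforce
    moreover have "0.9 * mu \<le> (1 - 2 * \<eta>) * mu" using eta mu0 by (intro mult_right_mono) auto
    ultimately show ?thesis by (simp add: mu_def)
  qed
  then show ?thesis using eta by blast
qed

section \<open>Sparse sets have little weight in degree below \<open>t\<close>\<close>

lemma lowdeg_mono: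
  fixes g :: "(nat \<Rightarrow> nat) \<Rightarrow> real"
  assumes g: "lowdeg n k g" and kt: "k \<le> t" "t \<le> n"
  shows "lowdeg n t g"
proof -
  obtain a where a: "\<And>\<omega>. \<omega> \<in> Sym n \<Longrightarrow> g \<omega> = (\<Sum>I\<in>ksets n k. \<Sum>\<tau>\<in>Sym n. a I \<tau> * (if agree I \<omega> \<tau> then 1 else 0))"
    using g unfolding lowdeg_def by (auto simp: if_distrib[of "\<lambda>x. _ * x"] cong: if_cong)
  have "lowdeg n t (\<lambda>\<omega>. \<Sum>I\<in>ksets n k. \<Sum>\<tau>\<in>Sym n. a I \<tau> * (if agree I \<omega> \<tau> then 1 else 0))"
  proof (intro lowdeg_sum lowdeg_scale)
    fix I \<tau> assume I: "I \<in> ksets n k"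
    have "\<exists>J. I \<subseteq> J \<and> J \<subseteq> {1..n} \<and> card J = t"
      by (rule exists_subset_between) (use I kt in \<open>auto simp: ksets_def\<close>)
    then obtain J where J: "I \<subseteq> J" "J \<in> ksets n t" by (auto simp: ksets_def)
    show "lowdeg n t (\<lambda>\<sigma>. if agree I \<sigma> \<tau> then 1 else 0 :: real)"
      by (rule lowdeg_measurable[OF J(2)]) (use J(1) in \<open>auto simp: agree_def subset_iff\<close>)
  qed
  then show ?thesis by (rule lowdeg_cong) (simp add: a)
qed

text \<open>\<open>X\<close> will be a number of agreements of two permutations. Up to
  \<open>a\<close> the bound \<open>a ^ k\<close> suffices; beyond \<open>a\<close> a higher
  binomial coefficient dominates by a large factor, and its mean is bounded.\<close>

lemma choose_split_bound:
  fixes a :: real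
  assumes "i \<le> k" "k \<le> s" "real s \<le> a" "1 \<le> a"
  shows "real (X choose i) \<le> a ^ k + real s ^ s / a ^ (s - k) * real (X choose s)"
proof -
  have Xi: "real (X choose i) \<le> real X ^ i"
  proof (cases "i \<le> X")
    case True
    then have "X choose i \<le> X ^ i" by (rule binomial_le_pow)
    then show ?thesis by (metis of_nat_le_iff of_nat_power)
  qed (simp add: binomial_eq_0)
  show ?thesis
  proof (cases "real X \<le> a")
    case True
    have "real X ^ i \<le> a ^ i" using True by (intro power_mono) auto
    also have "\<dots> \<le> a ^ k" using assms by (intro power_increasing) auto
    finally have "real (X choose i) \<le> a ^ k" using Xi by linarith
    moreover have "0 \<le> real s ^ s / a ^ (s - k) * real (X choose s)" using assms by simp
    ultimately show ?thesis by linarith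
  next
    case False
    then have X: "a < real X" "1 \<le> real X" "s \<le> X" using assms by auto
    have "(real X / real s) ^ s \<le> real (X choose s)" using binomial_ge_n_over_k_pow_k[OF X(3), where ?'a=real] by simp
    then have ss: "real X ^ s \<le> real s ^ s * real (X choose s)"
      by (cases "s = 0") (auto simp: power_divide field_simps)
    have "real (X choose i) \<le> real X ^ k" using Xi power_increasing[OF assms(1) X(2)] by linarith
    also have "real X ^ k = real X ^ s / real X ^ (s - k)" using X assms by (simp add: power_diff)
    also have "\<dots> \<le> real s ^ s * real (X choose s) / a ^ (s - k)"
      using ss X assms by (intro frac_le power_mono) auto
    finally show ?thesis using assms by (simp add: add_increasing)
  qed
qed

lemma agree_choose:
  "real (card {i\<in>{1..n}. \<sigma> i = \<tau> i} choose s) = (\<Sum>I\<in>ksets n s. if agree I \<sigma> \<tau> then 1 else 0)"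
proof -
  have "agree I \<sigma> \<tau> \<longleftrightarrow> I \<subseteq> {i\<in>{1..n}. \<sigma> i = \<tau> i}" if "I \<in> ksets n s" for I
    using ksets_sub(1)[OF that] unfolding agree_def by blast
  then show ?thesis by (subst card_subsets_choose[symmetric, of _ n]) (auto intro!: sum.cong)
qed

lemma sum_agree_choose:
  assumes "\<sigma> \<in> Sym n" "s \<le> n"
  shows "(\<Sum>\<tau>\<in>Sym n. real (card {i\<in>{1..n}. \<sigma> i = \<tau> i} choose s)) = fact n / fact s"
proof -
  have "(\<Sum>\<tau>\<in>Sym n. real (card {i\<in>{1..n}. \<sigma> i = \<tau> i} choose s)) = (\<Sum>I\<in>ksets n s. \<Sum>\<tau>\<in>Sym n. if agree I \<sigma> \<tau> then 1 else 0)"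
    unfolding agree_choose by (rule sum.swap)
  also have "\<dots> = (\<Sum>I\<in>ksets n s. fact (n - s))"
    using card_agree[OF assms(1)] by (intro sum.cong refl) (simp add: sum.inter_filter[symmetric] ksets_sub)
  also have "\<dots> = fact n / fact s" using assms(2) by (simp add: card_ksets binomial_fact)
  finally show ?thesis .
qed

lemma ip_Sop_agree:
  assumes "i \<le> n"
  shows "ip n f (Sop n i f) = (\<Sum>\<sigma>\<in>Sym n. f \<sigma> * (\<Sum>\<tau>\<in>Sym n. f \<tau> * real (card {i\<in>{1..n}. \<sigma> i = \<tau> i} choose i))) / (fact n * fact (n - i))"
proof -
  have "Sop n i f \<sigma> = (\<Sum>\<tau>\<in>Sym n. f \<tau> * real (card {i\<in>{1..n}. \<sigma> i = \<tau> i} choose i)) / fact (n - i)" if s: "\<sigma> \<in> Sym n" for \<sigma>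
  proof -
    have "Sop n i f \<sigma> = (\<Sum>I\<in>ksets n i. \<Sum>\<tau>\<in>Sym n. (f \<tau> * (if agree I \<sigma> \<tau> then 1 else 0)) / fact (n - i))"
      unfolding Sop_def using cnd_coset[OF s]
      by (intro sum.cong refl) (simp add: ksets_sub sum_divide_distrib if_distrib[of "\<lambda>x. _ * x"] cong: if_cong)
    also have "\<dots> = (\<Sum>\<tau>\<in>Sym n. f \<tau> * real (card {i\<in>{1..n}. \<sigma> i = \<tau> i} choose i)) / fact (n - i)"
      unfolding agree_choose by (subst sum.swap) (simp add: sum_distrib_left sum_divide_distrib)
    finally show ?thesis .
  qed
  then have "(\<Sum>\<sigma>\<in>Sym n. f \<sigma> * Sop n i f \<sigma>) = (\<Sum>\<sigma>\<in>Sym n. f \<sigma> * (\<Sum>\<tau>\<in>Sym n. f \<tau> * real (card {i\<in>{1..n}. \<sigma> i = \<tau> i} choose i))) / fact (n - i)"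
    by (subst sum_divide_distrib, intro sum.cong refl) (simp only: times_divide_eq_right)
  then show ?thesis unfolding ip_def by simp
qed

text \<open>The left side sums a binomial coefficient of the number of agreements over pairs from
  the set. Pairs with few agreements are charged to the size of the set, pairs with many to the
  whole group, where a random permutation has on average \<open>1 / s!\<close> sets of
  \<open>s\<close> agreements with a given one.\<close>

lemma ip_Sop_sparse:
  fixes a :: real
  assumes f: "\<And>\<sigma>. \<sigma> \<in> Sym n \<Longrightarrow> f \<sigma> = 0 \<or> f \<sigma> = 1" and ik: "i \<le> k" "k \<le> s" "s \<le> n" "real s \<le> a" "1 \<le> a"
  shows "ip n f (Sop n i f) / real (n choose i) \<le> fact k * nsq n f * (a ^ k * nsq n f + real s ^ s / a ^ (s - k))"
proof -
  have iN: "i \<le> n" using ik by simp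
  have nf: "nsq n f = (\<Sum>\<sigma>\<in>Sym n. f \<sigma>) / fact n"
    unfolding ip_def by (intro arg_cong2[of _ _ _ _ "(/)"] sum.cong refl) (use f in fastforce)
  define B where "B = real s ^ s / a ^ (s - k)"
  have B0: "0 \<le> B" using ik by (simp add: B_def)
  have in1: "(\<Sum>\<tau>\<in>Sym n. f \<tau> * real (card {i\<in>{1..n}. \<sigma> i = \<tau> i} choose i)) \<le> a ^ k * (nsq n f * fact n) + B * fact n" if s: "\<sigma> \<in> Sym n" for \<sigma>
  proof -
    have "(\<Sum>\<tau>\<in>Sym n. f \<tau> * real (card {i\<in>{1..n}. \<sigma> i = \<tau> i} choose i))
       \<le> (\<Sum>\<tau>\<in>Sym n. a ^ k * f \<tau> + B * real (card {i\<in>{1..n}. \<sigma> i = \<tau> i} choose s))"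
    proof (rule sum_mono)
      fix \<tau> assume t: "\<tau> \<in> Sym n"
      show "f \<tau> * real (card {i\<in>{1..n}. \<sigma> i = \<tau> i} choose i) \<le> a ^ k * f \<tau> + B * real (card {i\<in>{1..n}. \<sigma> i = \<tau> i} choose s)"
        using f[OF t] choose_split_bound[OF ik(1,2,4,5), of "card {i\<in>{1..n}. \<sigma> i = \<tau> i}", folded B_def]
          mult_nonneg_nonneg[OF B0 of_nat_0_le_iff, of "card {i\<in>{1..n}. \<sigma> i = \<tau> i} choose s"]
        by (elim disjE) (simp_all only: mult_zero_left mult_zero_right mult_1 mult_1_right add_0)
    qed
    also have "\<dots> = a ^ k * (nsq n f * fact n) + B * (fact n / fact s)"
      unfolding sum.distrib sum_distrib_left[symmetric] sum_agree_choose[OF s ik(3)] nf by simp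
    also have "B * (fact n / fact s) \<le> B * fact n"
      using B0 by (intro mult_left_mono) (auto simp: divide_le_eq fact_ge_1 mult_left_le)
    finally show ?thesis by simp
  qed
  have "ip n f (Sop n i f) \<le> (\<Sum>\<sigma>\<in>Sym n. f \<sigma> * (a ^ k * (nsq n f * fact n) + B * fact n)) / (fact n * fact (n - i))"
    unfolding ip_Sop_agree[OF iN] using f in1 by (intro divide_right_mono sum_mono mult_left_mono) fastforce+
  also have "\<dots> = nsq n f * fact n / fact (n - i) * (a ^ k * nsq n f + B)"
    unfolding sum_distrib_right[symmetric] nf by (simp add: field_simps)
  finally have "ip n f (Sop n i f) / real (n choose i) \<le> nsq n f * fact n / fact (n - i) * (a ^ k * nsq n f + B) / real (n choose i)"
    by (rule divide_right_mono) simp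
  also have "\<dots> = fact i * nsq n f * (a ^ k * nsq n f + B)" using iN by (simp add: binomial_fact)
  also have "\<dots> \<le> fact k * nsq n f * (a ^ k * nsq n f + B)"
    using ik B0 by (intro mult_right_mono fact_mono add_nonneg_nonneg mult_nonneg_nonneg) auto
  finally show ?thesis by (simp add: B_def)
qed

lemma fact_ratio_lower:
  assumes "2 * t \<le> n"
  shows "(real n / 2) ^ t * fact (n - t) \<le> fact n"
proof -
  have "(\<Prod>i<t. real n / 2) \<le> (\<Prod>i<t. real n - real i)"
  proof (intro prod_mono conjI)
    fix i assume "i \<in> {..<t}"
    moreover have "2 * real t \<le> real n" using assms by (metis of_nat_le_iff of_nat_mult of_nat_numeral)
    ultimately show "real n / 2 \<le> real n - real i" by simp
  qed simp
  then show ?thesis using assms by (simp add: prod_falling pos_le_divide_eq)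
qed

text \<open>Up to level \<open>k\<close> the projection \<open>w\<close> has the same level sums as
  \<open>f\<close>. By \<open>Sop_extrapolate\<close> they bound its level \<open>n - k\<close>, and
  by \<open>Sop_compl_lower\<close> that level retains at least half of the squared norm.\<close>

lemma sparse_projection_bound:
  fixes a :: real
  assumes f: "\<And>\<sigma>. \<sigma> \<in> Sym n \<Longrightarrow> f \<sigma> = 0 \<or> f \<sigma> = 1" and k: "k \<le> s" "s \<le> n" "real s \<le> a" "1 \<le> a"
    and w: "lowdeg n k w" "centered n (Suc k) (\<lambda>\<sigma>. f \<sigma> - w \<sigma>)"
    and n: "n \<ge> 2 * (k + 1)" and d: "2 * real k * real (k + 1) / real n \<le> 1 / 2"
  shows "nsq n w \<le> 2 * (real k + 1) * real n ^ k * (fact k * nsq n f * (a ^ k * nsq n f + real s ^ s / a ^ (s - k)))"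
proof -
  define Y where "Y = fact k * nsq n f * (a ^ k * nsq n f + real s ^ s / a ^ (s - k))"
  have n2: "2 * k \<le> n" using n by simp
  obtain l where l: "\<And>i. i \<le> k \<Longrightarrow> \<bar>l i\<bar> \<le> real n ^ k"
    "\<And>\<sigma>. \<sigma> \<in> Sym n \<Longrightarrow> Sop n (n - k) w \<sigma> / real (n choose (n - k)) = (\<Sum>i\<le>k. l i * (Sop n i w \<sigma> / real (n choose i)))"
    using Sop_extrapolate[OF w(1) n2] by blast
  have cw: "ip n w (Sop n i w) = ip n f (Sop n i f)" if "i \<le> k" for i
  proof -
    have "nsq n (cnd n I w) = nsq n (cnd n I f)" if I: "I \<in> ksets n i" for I
    proof (rule ip_cong)
      fix \<tau> assume t: "\<tau> \<in> Sym n"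
      have "cnd n I (\<lambda>\<sigma>. f \<sigma> - w \<sigma>) \<tau> = 0" using w(2) I \<open>i \<le> k\<close> t unfolding centered_def by (auto simp: ksets_def)
      then show "cnd n I w \<tau> = cnd n I f \<tau>" "cnd n I w \<tau> = cnd n I f \<tau>" by (simp_all add: av_diff)
    qed
    then show ?thesis by (simp add: ip_Sop)
  qed
  have "(1 / 2) * nsq n w \<le> (1 - 2 * real k * real (k + 1) / real n) * nsq n w" using d by (intro mult_right_mono) auto
  also have "\<dots> \<le> ip n w (Sop n (n - k) w) / real (n choose (n - k))" by (rule Sop_compl_lower[OF w(1) n])
  also have "\<dots> = ip n w (\<lambda>\<sigma>. Sop n (n - k) w \<sigma> / real (n choose (n - k)))"
    by (simp add: ip_def sum_divide_distrib algebra_simps)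
  also have "\<dots> = ip n w (\<lambda>\<sigma>. \<Sum>i\<le>k. (l i / real (n choose i)) * Sop n i w \<sigma>)"
    by (rule ip_cong) (simp_all add: l(2))
  also have "\<dots> = (\<Sum>i\<le>k. l i * (ip n w (Sop n i w) / real (n choose i)))"
    by (simp only: ip_sum_right ip_scale_right) simp
  also have "\<dots> \<le> (\<Sum>i\<le>k. real n ^ k * Y)"
  proof (rule sum_mono)
    fix i assume "i \<in> {..k}"
    then have i: "i \<le> k" by simp
    have x0: "0 \<le> ip n f (Sop n i f) / real (n choose i)" by (simp add: ip_Sop sum_nonneg)
    have "l i * (ip n f (Sop n i f) / real (n choose i)) \<le> real n ^ k * (ip n f (Sop n i f) / real (n choose i))"
      using l(1)[OF i] x0 by (intro mult_right_mono) auto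
    also have "\<dots> \<le> real n ^ k * Y"
      unfolding Y_def by (rule mult_left_mono[OF ip_Sop_sparse[OF f i k]]) simp_all
    finally show "l i * (ip n w (Sop n i w) / real (n choose i)) \<le> real n ^ k * Y" by (simp add: cw[OF i])
  qed
  finally have "(1 / 2) * nsq n w \<le> (real k + 1) * (real n ^ k * Y)" by (simp add: add.commute)
  then have "nsq n w \<le> 2 * (real k + 1) * real n ^ k * Y" by (simp add: algebra_simps)
  then show ?thesis unfolding Y_def .
qed

text \<open>With \<open>t = k + 1\<close>, density at most \<open>2^t * n^(1/2 - t)\<close> against
  the loss \<open>n ^ k\<close> leaves a factor \<open>n^(-1/2)\<close>, of which
  \<open>a ^ k \<le> n^(1/4)\<close> uses up half.\<close>

lemma sparse_projection:
  assumes nu: "\<nu> > 0"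
  shows "\<exists>n0. \<forall>n\<ge>n0. \<forall>f w. (\<forall>\<sigma>\<in>Sym n. f \<sigma> = 0 \<or> f \<sigma> = 1) \<longrightarrow> nsq n f \<le> sqrt (real n) * fact (n - Suc k) / fact n \<longrightarrow>
    lowdeg n k w \<longrightarrow> centered n (Suc k) (\<lambda>\<sigma>. f \<sigma> - w \<sigma>) \<longrightarrow> nsq n w \<le> \<nu> * nsq n f"
proof -
  define t where "t = Suc k"
  \<comment> \<open>With \<open>a = n^(1 / (4 * t))\<close> below, this gives
    \<open>a ^ (s - k) = n ^ t\<close>, so that the second error term is of order
    \<open>1 / n\<close>.\<close>
  define s where "s = k + 4 * t * t"
  define C where "C = 2 * (real k + 1) * fact k"
  have "((\<lambda>n. C * (2 ^ t * real n powr (- 1 / 4) + real s ^ s * real n powr (- 1))) \<longlongrightarrow> C * (2 ^ t * 0 + real s ^ s * 0)) sequentially"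
    by (intro tendsto_intros tendsto_neg_powr filterlim_real_sequentially) auto
  then have ev1: "\<forall>\<^sub>F n in sequentially. C * (2 ^ t * real n powr (- 1 / 4) + real s ^ s * real n powr (- 1)) < \<nu>"
    using nu by (intro order_tendstoD) auto
  have "\<forall>\<^sub>F n in sequentially. (real s + 1) powr (4 * real t) \<le> real n"
    using filterlim_real_sequentially by (simp add: filterlim_at_top)
  then have ev2: "\<forall>\<^sub>F n in sequentially. real s + 1 \<le> real n powr (1 / (4 * real t))"
  proof (rule eventually_mono)
    fix n :: nat assume "(real s + 1) powr (4 * real t) \<le> real n"
    then have "((real s + 1) powr (4 * real t)) powr (1 / (4 * real t)) \<le> real n powr (1 / (4 * real t))"
      by (intro powr_mono2) auto
    then show "real s + 1 \<le> real n powr (1 / (4 * real t))" by (simp add: powr_powr t_def)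
  qed
  have ev3: "\<forall>\<^sub>F n in sequentially. nat \<lceil>4 * real k * real (k + 1)\<rceil> + s + 2 * t + 1 \<le> n" by (rule eventually_ge_at_top)
  from eventually_conj[OF ev1 eventually_conj[OF ev2 ev3]] obtain n0 where n0: "\<And>n. n \<ge> n0 \<Longrightarrow>
    C * (2 ^ t * real n powr (- 1 / 4) + real s ^ s * real n powr (- 1)) < \<nu> \<and> real s + 1 \<le> real n powr (1 / (4 * real t)) \<and>
    nat \<lceil>4 * real k * real (k + 1)\<rceil> + s + 2 * t + 1 \<le> n"
    unfolding eventually_sequentially by blast
  show ?thesis
  proof (intro exI[of _ n0] allI impI)
    fix n f w
    assume n: "n0 \<le> n" and f: "\<forall>\<sigma>\<in>Sym n. f \<sigma> = 0 \<or> f \<sigma> = (1::real)" and mu: "nsq n f \<le> sqrt (real n) * fact (n - Suc k) / fact n"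
      and w: "lowdeg n k w" "centered n (Suc k) (\<lambda>\<sigma>. f \<sigma> - w \<sigma>)"
    have c1: "C * (2 ^ t * real n powr (- 1 / 4) + real s ^ s * real n powr (- 1)) < \<nu>" and c2: "real s + 1 \<le> real n powr (1 / (4 * real t))"
      and c3: "nat \<lceil>4 * real k * real (k + 1)\<rceil> + s + 2 * t + 1 \<le> n" using n0[OF n] by auto
    define a where "a = real n powr (1 / (4 * real t))"
    have npos: "real n > 0" using c3 by simp
    have n1: "real n \<ge> 1" using c3 by simp
    have "4 * real k * real (k + 1) \<le> real n" using c3 by linarith
    then have d: "2 * real k * real (k + 1) / real n \<le> 1 / 2" using npos by (simp add: field_simps)
    have ak: "a ^ k \<le> real n powr (1 / 4)"
    proof -
      have "a ^ k = real n powr (real k / (4 * real t))" unfolding a_def using npos by (simp add: powr_power)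
      also have "\<dots> \<le> real n powr (1 / 4)" using n1 by (intro powr_mono) (auto simp: t_def field_simps)
      finally show ?thesis .
    qed
    have as: "a ^ (s - k) = real n ^ t"
    proof -
      have "a ^ (s - k) = real n powr (real (4 * t * t) / (4 * real t))" unfolding a_def s_def using npos by (simp add: powr_power)
      also have "real (4 * t * t) / (4 * real t) = real t"
      proof -
        have "real t \<noteq> 0" by (simp add: t_def)
        then show ?thesis by simp
      qed
      finally show ?thesis using npos by (simp add: powr_realpow)
    qed
    have mu2: "nsq n f \<le> sqrt (real n) * 2 ^ t / real n ^ t"
    proof -
      have "(real n / 2) ^ t * fact (n - t) \<le> fact n" using c3 by (intro fact_ratio_lower) simp
      then have "fact (n - t) / fact n \<le> 2 ^ t / real n ^ t" using npos by (simp add: field_simps)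
      then have "sqrt (real n) * (fact (n - t) / fact n) \<le> sqrt (real n) * (2 ^ t / real n ^ t)" by (intro mult_left_mono) auto
      then show ?thesis using mu by (simp add: t_def)
    qed
    have nk: "real n ^ t = real n * real n ^ k" by (simp add: t_def)
    have sq: "sqrt (real n) = real n powr (1 / 2)" using npos by (simp add: powr_half_sqrt)
    have "nsq n w \<le> 2 * (real k + 1) * real n ^ k * (fact k * nsq n f * (a ^ k * nsq n f + real s ^ s / a ^ (s - k)))"
    proof (rule sparse_projection_bound)
      show "real s \<le> a" "1 \<le> a" using c2 unfolding a_def by linarith+
      show "s \<le> n" using c3 by linarith
      show "2 * (k + 1) \<le> n" using c3 by (simp add: t_def)
    qed (use f w d in \<open>auto simp: s_def\<close>)
    also have "\<dots> = C * nsq n f * (real n ^ k * (a ^ k * nsq n f) + real n ^ k * (real s ^ s / real n ^ t))"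
      unfolding as by (simp add: C_def algebra_simps)
    also have "\<dots> \<le> C * nsq n f * (2 ^ t * real n powr (- 1 / 4) + real s ^ s * real n powr (- 1))"
    proof (intro mult_left_mono add_mono)
      have "real n ^ k * (a ^ k * nsq n f) \<le> real n ^ k * (real n powr (1 / 4) * (real n powr (1 / 2) * 2 ^ t / real n ^ t))"
        using ak mu2 unfolding sq by (intro mult_left_mono mult_mono) auto
      also have "\<dots> = 2 ^ t * (real n powr (1 / 4) * real n powr (1 / 2) * real n powr (- 1))"
        unfolding nk using npos by (simp add: field_simps powr_minus)
      also have "real n powr (1 / 4) * real n powr (1 / 2) * real n powr (- 1) = real n powr (- 1 / 4)"
        unfolding powr_add[symmetric] by (rule arg_cong[of _ _ "\<lambda>x. real n powr x"]) simp
      finally show "real n ^ k * (a ^ k * nsq n f) \<le> 2 ^ t * real n powr (- 1 / 4)" .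
      show "real n ^ k * (real s ^ s / real n ^ t) \<le> real s ^ s * real n powr (- 1)"
        unfolding nk using npos by (simp add: powr_minus field_simps)
      show "0 \<le> C * nsq n f" by (simp add: C_def)
    qed
    also have "\<dots> = (C * (2 ^ t * real n powr (- 1 / 4) + real s ^ s * real n powr (- 1))) * nsq n f" by simp
    also have "\<dots> \<le> \<nu> * nsq n f" using c1 by (intro mult_right_mono) auto
    finally show "nsq n w \<le> \<nu> * nsq n f" .
  qed
qed


text \<open>For \<open>t > 0\<close> a centered \<open>v\<close> results from subtracting from
  \<open>g\<close> its projection to degree \<open>t - 1\<close>. This is the sum of the projections
  of \<open>f\<close>, small by sparsity, and of \<open>g - f\<close>, small by assumption.\<close>

lemma lowdeg_heavy:
  "\<exists>\<epsilon>>0. \<exists>n0. \<forall>n\<ge>n0. \<forall>f g. (\<forall>\<sigma>\<in>Sym n. f \<sigma> = 0 \<or> f \<sigma> = 1) \<longrightarrow> lowdeg n t g \<longrightarrow>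
    nsq n f \<le> sqrt (real n) * fact (n - t) / fact n \<longrightarrow> nsq n (\<lambda>\<sigma>. f \<sigma> - g \<sigma>) \<le> \<epsilon> * nsq n f \<longrightarrow> nsq n f > 0 \<longrightarrow>
    (\<exists>I\<in>ksets n t. \<exists>\<sigma>\<in>Sym n. cnd n I f \<sigma> > 1 / 2)"
proof -
  obtain \<eta> where eta: "\<eta> > 0" "\<eta> \<le> 1 / 20" and light: "\<And>n v f \<delta>. near_lowdeg n t v f \<delta> \<eta> \<Longrightarrow>
    (\<forall>I\<in>ksets n t. \<forall>\<sigma>\<in>Sym n. cnd n I f \<sigma> \<le> 1 / 2) \<Longrightarrow> nsq n f \<le> 0"
    using near_lowdeg_light[of t] by blast
  \<comment> \<open>The squared distance of \<open>v\<close> from \<open>f\<close> will be at most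
    \<open>4 * \<nu> * nsq n f\<close>, and the locale asks for
    \<open>\<eta>\<^sup>2 / 8\<close>.\<close>
  define \<nu> where "\<nu> = \<eta>\<^sup>2 / 32"
  have nu: "\<nu> > 0" using eta by (simp add: \<nu>_def)
  have "\<exists>n1. \<forall>n\<ge>n1. \<forall>f g. (\<forall>\<sigma>\<in>Sym n. f \<sigma> = 0 \<or> f \<sigma> = 1) \<longrightarrow> lowdeg n t g \<longrightarrow>
    nsq n f \<le> sqrt (real n) * fact (n - t) / fact n \<longrightarrow> nsq n (\<lambda>\<sigma>. f \<sigma> - g \<sigma>) \<le> \<nu> * nsq n f \<longrightarrow>
    (\<exists>v. lowdeg n t v \<and> centered n t v \<and> nsq n (\<lambda>\<sigma>. f \<sigma> - v \<sigma>) \<le> 4 * \<nu> * nsq n f)"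
  proof (cases t)
    case 0
    show ?thesis
    proof (intro exI[of _ "0::nat"] allI impI)
      fix n f g
      assume "lowdeg n t g" "nsq n (\<lambda>\<sigma>. f \<sigma> - g \<sigma>) \<le> \<nu> * nsq n f"
      moreover have "0 \<le> \<nu> * nsq n f" using nu by simp
      ultimately have "lowdeg n t g \<and> centered n t g \<and> nsq n (\<lambda>\<sigma>. f \<sigma> - g \<sigma>) \<le> 4 * \<nu> * nsq n f"
        unfolding 0 centered_def by auto
      then show "\<exists>v. lowdeg n t v \<and> centered n t v \<and> nsq n (\<lambda>\<sigma>. f \<sigma> - v \<sigma>) \<le> 4 * \<nu> * nsq n f" by blast
    qed
  next
    case (Suc k)
    obtain n0 where n0: "\<And>n f w. n \<ge> n0 \<Longrightarrow> \<forall>\<sigma>\<in>Sym n. f \<sigma> = 0 \<or> f \<sigma> = 1 \<Longrightarrow> nsq n f \<le> sqrt (real n) * fact (n - Suc k) / fact n \<Longrightarrow>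
      lowdeg n k w \<Longrightarrow> centered n (Suc k) (\<lambda>\<sigma>. f \<sigma> - w \<sigma>) \<Longrightarrow> nsq n w \<le> \<nu> * nsq n f"
      using sparse_projection[OF nu, of k] by blast
    show ?thesis
    proof (intro exI[of _ "max n0 t"] allI impI)
      fix n f g
      assume n: "max n0 t \<le> n" and f: "\<forall>\<sigma>\<in>Sym n. f \<sigma> = 0 \<or> f \<sigma> = 1" and g: "lowdeg n t g"
        and mu: "nsq n f \<le> sqrt (real n) * fact (n - t) / fact n" and fg: "nsq n (\<lambda>\<sigma>. f \<sigma> - g \<sigma>) \<le> \<nu> * nsq n f"
      have kn: "k \<le> n" "k \<le> t" "t \<le> n" using n Suc by auto
      obtain w where w: "lowdeg n k w" "centered n (Suc k) (\<lambda>\<sigma>. f \<sigma> - w \<sigma>)"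
        using lowdeg_projection[OF kn(1)] by blast
      define h where "h = (\<lambda>\<sigma>. g \<sigma> - f \<sigma>)"
      obtain w' where w': "lowdeg n k w'" "centered n (Suc k) (\<lambda>\<sigma>. h \<sigma> - w' \<sigma>)" "ip n (\<lambda>\<sigma>. h \<sigma> - w' \<sigma>) w' = 0"
        using lowdeg_projection[OF kn(1), of h] by blast
      define v where "v = (\<lambda>\<sigma>. g \<sigma> - w \<sigma> - w' \<sigma>)"
      have "lowdeg n t v" unfolding v_def
        by (intro lowdeg_diff g lowdeg_mono[OF w(1)] lowdeg_mono[OF w'(1)] kn)
      moreover have "centered n t v" unfolding centered_def
      proof (intro allI impI ballI)
        fix K \<sigma> assume K: "K \<subseteq> {1..n} \<and> card K < t" and s: "\<sigma> \<in> Sym n"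
        have "v = (\<lambda>\<sigma>. (f \<sigma> - w \<sigma>) + (h \<sigma> - w' \<sigma>))" by (simp add: v_def h_def algebra_simps)
        then have "cnd n K v \<sigma> = cnd n K (\<lambda>\<sigma>. f \<sigma> - w \<sigma>) \<sigma> + cnd n K (\<lambda>\<sigma>. h \<sigma> - w' \<sigma>) \<sigma>" by (simp only: av_add)
        then show "cnd n K v \<sigma> = 0" using w(2) w'(2) K s Suc unfolding centered_def by simp
      qed
      moreover have "nsq n (\<lambda>\<sigma>. f \<sigma> - v \<sigma>) \<le> 4 * \<nu> * nsq n f"
      proof -
        have nh: "nsq n h \<le> \<nu> * nsq n f" using fg by (simp add: h_def ip_def algebra_simps)
        have nw: "nsq n w \<le> \<nu> * nsq n f" using n0[OF _ f _ w] n mu Suc by simp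
        have "nsq n (\<lambda>\<sigma>. h \<sigma> - w' \<sigma>) = nsq n h - nsq n w'"
          using w'(3) by (simp add: ip_diff ip_diff_right ip_commute[of n w' h])
        then have nhw: "nsq n (\<lambda>\<sigma>. h \<sigma> - w' \<sigma>) \<le> nsq n h" using nsq_nonneg[of n w'] by linarith
        have "(\<lambda>\<sigma>. f \<sigma> - v \<sigma>) = (\<lambda>\<sigma>. w \<sigma> - (h \<sigma> - w' \<sigma>))" by (simp add: v_def h_def algebra_simps)
        then have "nsq n (\<lambda>\<sigma>. f \<sigma> - v \<sigma>) \<le> 2 * nsq n w + 2 * nsq n (\<lambda>\<sigma>. h \<sigma> - w' \<sigma>)"
          using nsq_diff_le[of n w "\<lambda>\<sigma>. h \<sigma> - w' \<sigma>"] by simp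
        then show ?thesis using nh nw nhw by linarith
      qed
      ultimately show "\<exists>v. lowdeg n t v \<and> centered n t v \<and> nsq n (\<lambda>\<sigma>. f \<sigma> - v \<sigma>) \<le> 4 * \<nu> * nsq n f" by blast
    qed
  qed
  then obtain n1 where n1: "\<And>n f g. n \<ge> n1 \<Longrightarrow> \<forall>\<sigma>\<in>Sym n. f \<sigma> = 0 \<or> f \<sigma> = 1 \<Longrightarrow> lowdeg n t g \<Longrightarrow>
    nsq n f \<le> sqrt (real n) * fact (n - t) / fact n \<Longrightarrow> nsq n (\<lambda>\<sigma>. f \<sigma> - g \<sigma>) \<le> \<nu> * nsq n f \<Longrightarrow>
    \<exists>v. lowdeg n t v \<and> centered n t v \<and> nsq n (\<lambda>\<sigma>. f \<sigma> - v \<sigma>) \<le> 4 * \<nu> * nsq n f" by blast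
  \<comment> \<open>Makes \<open>\<delta> = 2 * t * (t + 1) / n\<close> at most
    \<open>\<eta>\<^sup>2 / 32\<close>, so that
    \<open>1 / (1 - \<delta>) - 1 \<le> 2 * \<delta>\<close> meets the bound in the locale.\<close>
  define n2 where "n2 = nat \<lceil>64 * real t * real (t + 1) / \<eta>\<^sup>2\<rceil>"
  have "\<exists>I\<in>ksets n t. \<exists>\<sigma>\<in>Sym n. cnd n I f \<sigma> > 1 / 2"
    if n: "n \<ge> max n1 (max n2 (2 * (t + 1)))" and f: "\<forall>\<sigma>\<in>Sym n. f \<sigma> = 0 \<or> f \<sigma> = 1" and g: "lowdeg n t g"
      and mu: "nsq n f \<le> sqrt (real n) * fact (n - t) / fact n" and fg: "nsq n (\<lambda>\<sigma>. f \<sigma> - g \<sigma>) \<le> \<nu> * nsq n f" and pos: "nsq n f > 0"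
    for n f g
  proof (rule ccontr)
    assume "\<not> ?thesis"
    then have all: "\<forall>I\<in>ksets n t. \<forall>\<sigma>\<in>Sym n. cnd n I f \<sigma> \<le> 1 / 2" by (meson not_le)
    obtain v where v: "lowdeg n t v" "centered n t v" "nsq n (\<lambda>\<sigma>. f \<sigma> - v \<sigma>) \<le> 4 * \<nu> * nsq n f"
      using n1[OF _ f g mu fg] n by auto
    define \<delta> where "\<delta> = 2 * real t * real (t + 1) / real n"
    have nn: "n \<ge> 2 * (t + 1)" "2 * t \<le> n" "real n > 0" using n by auto
    have "64 * real t * real (t + 1) / \<eta>\<^sup>2 \<le> real n" using n unfolding n2_def by linarith
    then have "\<delta> \<le> \<eta>\<^sup>2 / 32" using nn eta by (simp add: \<delta>_def field_simps)
    moreover have "\<eta>\<^sup>2 \<le> 1" using eta by (simp add: power_le_one)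
    ultimately have d: "0 \<le> \<delta>" "\<delta> \<le> 1 / 32" "\<delta> \<le> \<eta>\<^sup>2 / 32" by (auto simp: \<delta>_def)
    have inv: "1 / x - 1 \<le> \<eta>\<^sup>2 / 16" if "1 - \<delta> \<le> x" for x
    proof -
      have "1 / x \<le> 1 / (1 - \<delta>)" using that d by (intro divide_left_mono) auto
      also have "1 / (1 - \<delta>) \<le> 1 + 2 * \<delta>"
      proof -
        have "2 * \<delta> * \<delta> \<le> \<delta>" using d mult_right_mono[of "2 * \<delta>" 1 \<delta>] by simp
        then have "1 \<le> (1 + 2 * \<delta>) * (1 - \<delta>)" by (simp add: algebra_simps)
        then show ?thesis using d by (simp add: pos_divide_le_eq)
      qed
      finally show ?thesis using d by simp
    qed
    have lm: "1 - \<delta> \<le> lam n t"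
    proof -
      have "2 * real t * real t / real n \<le> \<delta>" unfolding \<delta>_def using nn by (intro divide_right_mono mult_left_mono) auto
      then show ?thesis using lam_lower[OF nn(2)] by linarith
    qed
    have "near_lowdeg n t v f \<delta> \<eta>"
    proof
      show "0 < lam n t" using lm d by linarith
      show "(1 - \<delta>) * nsq n v \<le> lam n t * (\<Sum>I\<in>ksets n t. nsq n (cnd n I v))"
        unfolding \<delta>_def by (rule lam_lower_nsq[OF v(1,2) nn(1)])
      show "nsq n (\<lambda>\<sigma>. f \<sigma> - v \<sigma>) \<le> \<eta>\<^sup>2 / 8 * nsq n f" using v(3) by (simp add: \<nu>_def)
    qed (use v nn d eta inv lm f in auto)
    from light[OF this all] pos show False by simp
  qed
  then show ?thesis using nu by (intro exI[of _ \<nu>] conjI exI[of _ "max n1 (max n2 (2 * (t + 1)))"]) blast+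
qed

section \<open>The space \<open>U\<^sub>t\<close>\<close>

lemma sum_fun_apply: "(\<Sum>x\<in>X. f x) y = (\<Sum>x\<in>X. f x y :: 'a::comm_monoid_add)"
  by (induction X rule: infinite_finite_induct) auto

text \<open>The left regular representation. Its carriers have the type over which
  \<open>isotypic\<close> quantifies, so invariant spaces of functions on the group can be inserted
  there directly.\<close>

definition left_shift :: "(nat \<Rightarrow> nat) \<Rightarrow> ((nat \<Rightarrow> nat) \<Rightarrow> complex) \<Rightarrow> (nat \<Rightarrow> nat) \<Rightarrow> complex" where
  "left_shift \<sigma> \<phi> = (\<lambda>\<tau>. \<phi> (inv \<sigma> \<circ> \<tau>))"

definition low_space :: "nat \<Rightarrow> nat \<Rightarrow> ((nat \<Rightarrow> nat) \<Rightarrow> complex) set" where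
  "low_space n t = {\<phi> \<in> sym_funs n. lowdeg n t \<phi>}"

definition cip :: "nat \<Rightarrow> ((nat \<Rightarrow> nat) \<Rightarrow> complex) \<Rightarrow> ((nat \<Rightarrow> nat) \<Rightarrow> complex) \<Rightarrow> complex" where
  "cip n f g = (\<Sum>\<sigma>\<in>Sym n. f \<sigma> * cnj (g \<sigma>))"

lemma subspace_sym_funs: "cfun.subspace (sym_funs n)"
  by (rule cfun.subspaceI) (auto simp: sym_funs_def cscale_def)

lemma subspace_low_space: "cfun.subspace (low_space n t)"
proof (rule cfun.subspaceI)
  show "0 \<in> low_space n t" using lowdeg_zero[of n t] by (simp add: low_space_def sym_funs_def zero_fun_def)
  show "x + y \<in> low_space n t" if "x \<in> low_space n t" "y \<in> low_space n t" for x y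
    using that lowdeg_add[of n t x y] by (simp add: low_space_def sym_funs_def plus_fun_def)
  show "cscale c x \<in> low_space n t" if "x \<in> low_space n t" for c x
    using that lowdeg_scale[of n t x c] by (simp add: low_space_def sym_funs_def cscale_def)
qed

lemma left_shift_add: "left_shift \<sigma> (u + v) = left_shift \<sigma> u + left_shift \<sigma> v"
  by (simp add: left_shift_def plus_fun_def)

lemma left_shift_scale: "left_shift \<sigma> (cscale c u) = cscale c (left_shift \<sigma> u)"
  by (simp add: left_shift_def cscale_def)

lemma left_shift_sym_funs:
  assumes "\<sigma> \<in> Sym n" "\<phi> \<in> sym_funs n"
  shows "left_shift \<sigma> \<phi> \<in> sym_funs n"
proof -
  have "\<tau> \<in> Sym n" if "inv \<sigma> \<circ> \<tau> \<in> Sym n" for \<tau>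
  proof -
    have "\<sigma> \<circ> (inv \<sigma> \<circ> \<tau>) \<in> Sym n" using assms(1) that by (rule Sym_comp)
    then show ?thesis using Sym_inv_comp(2)[OF assms(1)] by (simp add: comp_assoc[symmetric])
  qed
  then show ?thesis using assms(2) by (auto simp: sym_funs_def left_shift_def)
qed

lemma left_shift_id: "left_shift id \<phi> = \<phi>"
  by (simp add: left_shift_def)

lemma left_shift_comp:
  assumes "\<sigma> \<in> Sym n" "\<tau> \<in> Sym n"
  shows "left_shift (\<sigma> \<circ> \<tau>) \<phi> = left_shift \<sigma> (left_shift \<tau> \<phi>)"
proof -
  have "inv (\<sigma> \<circ> \<tau>) = inv \<tau> \<circ> inv \<sigma>"
    using assms by (intro o_inv_distrib) (auto simp: Sym_def permutes_bij)
  then show ?thesis by (simp add: left_shift_def comp_assoc)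
qed

lemma left_shift_low_space:
  assumes s: "\<sigma> \<in> Sym n" and p: "\<phi> \<in> low_space n t"
  shows "left_shift \<sigma> \<phi> \<in> low_space n t"
proof -
  have pl: "lowdeg n t \<phi>" and ps: "\<phi> \<in> sym_funs n" using p by (auto simp: low_space_def)
  obtain a where a: "\<And>\<omega>. \<omega> \<in> Sym n \<Longrightarrow> \<phi> \<omega> = (\<Sum>I\<in>ksets n t. \<Sum>\<tau>\<in>Sym n. a I \<tau> * (if agree I \<omega> \<tau> then 1 else 0))"
    using pl unfolding lowdeg_def by (auto simp: if_distrib[of "\<lambda>x. _ * x"] cong: if_cong)
  have "lowdeg n t (\<lambda>\<omega>. \<Sum>I\<in>ksets n t. \<Sum>\<tau>\<in>Sym n. a I \<tau> * (if agree I (inv \<sigma> \<circ> \<omega>) \<tau> then 1 else 0))"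
  proof (intro lowdeg_sum lowdeg_scale)
    fix I \<tau> assume I: "I \<in> ksets n t"
    show "lowdeg n t (\<lambda>\<omega>. if agree I (inv \<sigma> \<circ> \<omega>) \<tau> then 1 else 0 :: complex)"
      by (rule lowdeg_measurable[OF I]) (auto simp: agree_def)
  qed
  then have "lowdeg n t (left_shift \<sigma> \<phi>)"
    by (rule lowdeg_cong) (simp add: left_shift_def a Sym_comp Sym_inv s)
  then show ?thesis using left_shift_sym_funs[OF s ps] by (simp add: low_space_def)
qed

lemma cip_add: "cip n (f + g) h = cip n f h + cip n g h"
  by (simp add: cip_def algebra_simps sum.distrib)

lemma cip_diff: "cip n (f - g) h = cip n f h - cip n g h"
  by (simp add: cip_def algebra_simps sum_subtractf)

lemma cip_scale: "cip n (cscale c f) h = c * cip n f h"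
  by (simp add: cip_def cscale_def sum_distrib_left mult.assoc)

lemma cip_add_right: "cip n h (f + g) = cip n h f + cip n h g"
  by (simp add: cip_def algebra_simps sum.distrib)

lemma cip_scale_right: "cip n h (cscale c f) = cnj c * cip n h f"
  by (simp add: cip_def cscale_def sum_distrib_left algebra_simps)

lemma cip_self_eq_0_on:
  assumes "cip n f f = 0" "\<sigma> \<in> Sym n"
  shows "f \<sigma> = 0"
proof -
  have "cip n f f = of_real (\<Sum>\<sigma>\<in>Sym n. (cmod (f \<sigma>))\<^sup>2)" by (simp add: cip_def complex_norm_square[symmetric])
  then have "(\<Sum>\<sigma>\<in>Sym n. (cmod (f \<sigma>))\<^sup>2) = 0" using assms(1) of_real_eq_0_iff by metis
  then show ?thesis using assms(2) finite_Sym by (subst (asm) sum_nonneg_eq_0_iff) auto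
qed

lemma cip_self_eq_0:
  assumes "cip n f f = 0" "f \<in> sym_funs n"
  shows "f = 0"
proof
  fix \<sigma> show "f \<sigma> = 0 \<sigma>"
    using cip_self_eq_0_on[OF assms(1)] assms(2) by (cases "\<sigma> \<in> Sym n") (auto simp: sym_funs_def)
qed

lemma cip_left_shift:
  assumes "\<sigma> \<in> Sym n"
  shows "cip n (left_shift \<sigma> f) (left_shift \<sigma> g) = cip n f g"
  unfolding cip_def left_shift_def by (rule sum_Sym_left[OF Sym_inv[OF assms]])

lemma cip_projection:
  assumes "finite B"
  shows "\<exists>p\<in>cfun.span B. \<forall>b\<in>cfun.span B. cip n (f - p) b = 0"
proof -
  have "\<exists>p\<in>cfun.span B. \<forall>b\<in>B. cip n (f - p) b = 0" using assms
  proof (induction B arbitrary: f)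
    case empty
    show ?case by (rule bexI[OF _ cfun.span_zero]) simp
  next
    case (insert k B)
    obtain p where p: "p \<in> cfun.span B" "\<And>b. b \<in> B \<Longrightarrow> cip n (f - p) b = 0" using insert.IH by blast
    obtain d where d: "d \<in> cfun.span B" "\<And>b. b \<in> B \<Longrightarrow> cip n (k - d) b = 0" using insert.IH by blast
    define r where "r = k - d"
    have dz: "cip n h d = 0" if h: "\<And>b. b \<in> B \<Longrightarrow> cip n h b = 0" for h
      using d(1)
    proof (induction rule: cfun.span_induct_alt)
      case (step c x y)
      then show ?case unfolding cip_add_right cip_scale_right using h by simp
    qed (simp add: cip_def)
    define x where "x = cip n (f - p) r / cip n r r"
    have sub: "cfun.span B \<subseteq> cfun.span (insert k B)" by (rule cfun.span_mono) auto
    have kin: "k \<in> cfun.span (insert k B)" by (rule cfun.span_base) simp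
    have mem: "p + cscale x r \<in> cfun.span (insert k B)"
      unfolding r_def using p(1) d(1) sub kin by (intro cfun.span_add cfun.span_scale cfun.span_diff) auto
    have e: "f - (p + cscale x r) = (f - p) - cscale x r" by (simp add: algebra_simps)
    have B0: "cip n (f - (p + cscale x r)) b = 0" if "b \<in> B" for b
      unfolding e cip_diff cip_scale using p(2)[OF that] d(2)[OF that] by (simp add: r_def cip_diff)
    have r0: "cip n (f - (p + cscale x r)) r = 0"
    proof (cases "cip n r r = 0")
      case True
      then show ?thesis using cip_self_eq_0_on[OF True] by (simp add: cip_def)
    next
      case False
      then show ?thesis unfolding e cip_diff[of n "f - p"] cip_scale by (simp add: x_def)
    qed
    have "cip n (f - (p + cscale x r)) k = cip n (f - (p + cscale x r)) (r + d)" by (simp add: r_def)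
    also have "\<dots> = 0" unfolding cip_add_right r0 using dz[OF B0] by simp
    finally show ?case using mem B0 by blast
  qed
  then obtain p where p: "p \<in> cfun.span B" "\<And>b. b \<in> B \<Longrightarrow> cip n (f - p) b = 0" by blast
  have "cip n (f - p) b = 0" if "b \<in> cfun.span B" for b
    using that
  proof (induction rule: cfun.span_induct_alt)
    case (step c x y)
    then show ?case by (simp only: cip_add_right cip_scale_right p(2) mult_zero_right add_0_right)
  qed (simp add: cip_def)
  then show ?thesis using p(1) by blast
qed

lemma cells_sum: "card (cells \<alpha>) = sum_list \<alpha>" and finite_cells: "finite (cells \<alpha>)"
proof -
  have c: "cells \<alpha> = (SIGMA i:{..<length \<alpha>}. {..<\<alpha> ! i})" by (auto simp: cells_def)
  show "card (cells \<alpha>) = sum_list \<alpha>" unfolding c by (simp add: sum_list_sum_nth atLeast0LessThan)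
  show "finite (cells \<alpha>)" unfolding c by simp
qed

lemma tabloid_apply:
  assumes "inj_on T (cells \<alpha>)" "c \<in> cells \<alpha>"
  shows "tabloid \<alpha> T (T c) = fst c"
  using assms by (simp add: tabloid_def)

text \<open>Let \<open>D\<close> be the entries of the first \<open>n - t\<close> cells of the first
  row. The tabloid \<open>r0\<close> is fixed by all permutations of \<open>D\<close>, and the
  polytabloid has coefficient 1 at \<open>r0\<close>; hence its sum over these permutations is a
  fixed vector with coefficient \<open>(n - t)!\<close> at \<open>r0\<close>. Invariance of the
  Specht module is assumed here and is supplied by the supposed isomorphism in
  \<open>not_isomorphic_specht\<close>.\<close>

lemma specht_fixed_vector:
  assumes \<alpha>: "is_partition n \<alpha>" "n - t \<le> largest_part \<alpha>" and tn: "t \<le> n"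
    and inv: "\<And>\<sigma> \<phi>. \<sigma> \<in> Sym n \<Longrightarrow> \<phi> \<in> specht n \<alpha> \<Longrightarrow> perm_action \<sigma> \<phi> \<in> specht n \<alpha>"
  shows "\<exists>D u. D \<subseteq> {1..n} \<and> card D = n - t \<and> u \<in> specht n \<alpha> \<and> u \<noteq> 0 \<and> (\<forall>\<sigma>. \<sigma> permutes D \<longrightarrow> perm_action \<sigma> u = u)"
proof -
  have "card (cells \<alpha>) = card {1..n}" using \<alpha>(1) by (simp add: cells_sum is_partition_def)
  then obtain T where T: "bij_betw T (cells \<alpha>) {1..n}" using finite_cells finite_same_card_bij by blast
  have injT: "inj_on T (cells \<alpha>)" and imT: "T ` cells \<alpha> = {1..n}" using T by (auto simp: bij_betw_def)
  \<comment> \<open>For \<open>t = n\<close> this is empty, which also covers the empty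
    partition.\<close>
  define F where "F = {0::nat} \<times> {..<n - t}"
  have F: "F \<subseteq> cells \<alpha>" using \<alpha>(2) by (cases \<alpha>) (auto simp: F_def cells_def largest_part_def)
  define D where "D = T ` F"
  have D: "D \<subseteq> {1..n}" using F imT unfolding D_def by blast
  have "card D = card F" unfolding D_def using F injT by (meson card_image inj_on_subset)
  then have cD: "card D = n - t" by (simp add: F_def)
  define r0 where "r0 = tabloid \<alpha> T"
  have rD: "r0 x = 0" if "x \<in> D" for x
  proof -
    obtain c where c: "c \<in> F" "x = T c" using \<open>x \<in> D\<close>[unfolded D_def] by (rule imageE)
    then show ?thesis using tabloid_apply[OF injT] F by (auto simp: r0_def F_def)
  qed
  have rinv: "r0 \<circ> \<pi> = r0" if "\<pi> permutes D" for \<pi>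
  proof
    fix x show "(r0 \<circ> \<pi>) x = r0 x"
      using permutes_in_image[OF that, of x] permutes_not_in[OF that, of x] rD by (cases "x \<in> D") auto
  qed
  define e where "e = polytabloid n \<alpha> T"
  define C where "C = column_stabilizer n \<alpha> T"
  have finC: "finite C" unfolding C_def column_stabilizer_def by simp
  have idC: "id \<in> C" by (auto simp: C_def column_stabilizer_def Sym_id)
  \<comment> \<open>A column permutation that keeps every entry in its row fixes every cell, so
    \<open>r0\<close> occurs only once in the signed sum.\<close>
  have only: "\<pi> = id" if pi: "\<pi> \<in> C" and eq: "tabloid \<alpha> (\<pi> \<circ> T) = r0" for \<pi>
  proof -
    have pn: "\<pi> permutes {1..n}" using pi by (auto simp: C_def column_stabilizer_def Sym_def)
    have "inj_on (\<pi> \<circ> T) (cells \<alpha>)" using injT permutes_inj_on[OF pn] by (intro comp_inj_on) auto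
    have "\<pi> (T c) = T c" if c: "c \<in> cells \<alpha>" for c
    proof -
      obtain c' where c': "c' \<in> cells \<alpha>" "snd c' = snd c" "\<pi> (T c) = T c'" using pi c by (auto simp: C_def column_stabilizer_def)
      have "fst c = tabloid \<alpha> (\<pi> \<circ> T) ((\<pi> \<circ> T) c)" using tabloid_apply[OF \<open>inj_on (\<pi> \<circ> T) (cells \<alpha>)\<close> c] by simp
      also have "\<dots> = r0 (T c')" using eq c'(3) by simp
      also have "\<dots> = fst c'" using tabloid_apply[OF injT c'(1)] by (simp add: r0_def)
      finally show ?thesis using c' by (metis prod.expand)
    qed
    then have "\<pi> x = x" if "x \<in> {1..n}" for x using that imT by (metis imageE)
    then show ?thesis using pn permutes_not_in by fastforce
  qed
  have "e r0 = (\<Sum>\<pi>\<in>C. of_int (sign \<pi>) * indicator {tabloid \<alpha> (\<pi> \<circ> T)} r0)"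
    by (simp add: e_def polytabloid_def C_def sum_fun_apply cscale_def)
  also have "\<dots> = (\<Sum>\<pi>\<in>C. if \<pi> = id then 1 else 0)"
  proof (intro sum.cong refl)
    fix \<pi> assume pi: "\<pi> \<in> C"
    show "of_int (sign \<pi>) * indicator {tabloid \<alpha> (\<pi> \<circ> T)} r0 = (if \<pi> = id then 1 else 0 :: complex)"
      using only[OF pi] by (auto simp: r0_def indicator_def)
  qed
  also have "\<dots> = 1" using finC idC by simp
  finally have e0: "e r0 = 1" .
  have eS: "e \<in> specht n \<alpha>" unfolding e_def specht_def
    by (rule cfun.span_base) (use T in \<open>auto simp: is_tableau_def\<close>)
  define u where "u = (\<Sum>\<rho> | \<rho> permutes D. perm_action \<rho> e)"
  have uS: "u \<in> specht n \<alpha>" unfolding u_def specht_def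
  proof (rule cfun.span_sum)
    fix \<rho> assume "\<rho> \<in> {\<rho>. \<rho> permutes D}"
    then have "\<rho> \<in> Sym n" using D permutes_subset by (auto simp: Sym_def)
    then show "perm_action \<rho> e \<in> cfun.span {polytabloid n \<alpha> T |T. is_tableau n \<alpha> T}"
      using inv eS unfolding specht_def by blast
  qed
  have "u r0 = (\<Sum>\<rho> | \<rho> permutes D. 1)" unfolding u_def sum_fun_apply
    by (intro sum.cong refl) (simp add: perm_action_def rinv e0)
  also have "\<dots> = fact (n - t)" using card_permutations[OF cD] finite_sub[OF D] by simp
  finally have "u r0 \<noteq> 0" by simp
  then have u0: "u \<noteq> 0" by (auto simp: zero_fun_def)
  have "perm_action \<sigma> u = u" if s: "\<sigma> permutes D" for \<sigma>
  proof
    fix r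
    have "perm_action \<sigma> u r = (\<Sum>\<rho> | \<rho> permutes D. e (r \<circ> (\<sigma> \<circ> \<rho>)))"
      by (simp add: perm_action_def u_def sum_fun_apply comp_assoc)
    also have "\<dots> = (\<Sum>\<rho> | \<rho> permutes D. e (r \<circ> \<rho>))" by (rule sum_permutes_left[OF s])
    also have "\<dots> = u r" by (simp add: perm_action_def u_def sum_fun_apply)
    finally show "perm_action \<sigma> u r = u r" .
  qed
  then show ?thesis using D cD uS u0 by blast
qed

text \<open>Invariance makes \<open>v \<tau>\<close> a function of the preimages under
  \<open>\<tau>\<close> of the \<open>t\<close> points outside \<open>D\<close>. Prescribing the
  preimages of \<open>t\<close> values again defines a \<open>t\<close>-coset, but its positions
  vary with the coset; so \<open>v\<close> is a sum of coset indicators with different position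
  sets.\<close>

lemma left_invariant_low:
  assumes v: "v \<in> sym_funs n" and D: "D \<subseteq> {1..n}" "card D = n - t" and tn: "t \<le> n"
    and inv: "\<And>\<sigma>. \<sigma> permutes D \<Longrightarrow> left_shift \<sigma> v = v"
  shows "v \<in> low_space n t"
proof -
  define I where "I = {1..n} - D"
  have I: "I \<subseteq> {1..n}" "card I = t" using D tn card_compl[OF D(1)] by (auto simp: I_def)
  have eqv: "v \<tau> = v \<omega>" if t: "\<tau> \<in> Sym n" and w: "\<omega> \<in> Sym n" and ag: "agree I (inv \<tau>) (inv \<omega>)" for \<tau> \<omega>
  proof -
    have pt: "\<tau> permutes {1..n}" and pw: "\<omega> permutes {1..n}" using t w by (auto simp: Sym_def)
    define \<sigma> where "\<sigma> = \<tau> \<circ> inv \<omega>"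
    have sn: "\<sigma> \<in> Sym n" unfolding \<sigma>_def using t w by (intro Sym_comp Sym_inv)
    have "\<sigma> permutes D"
    proof (rule permutes_superset)
      show "\<sigma> permutes {1..n}" using sn by (simp add: Sym_def)
      fix x assume "x \<in> {1..n} - D"
      then have "inv \<omega> x = inv \<tau> x" using ag by (simp add: agree_def I_def)
      then show "\<sigma> x = x" using permutes_inverses(1)[OF pt] by (simp add: \<sigma>_def)
    qed
    then have "v \<tau> = left_shift \<sigma> v \<tau>" using inv by simp
    also have "inv \<sigma> \<circ> \<tau> = \<omega>"
    proof -
      have "\<tau> = \<sigma> \<circ> \<omega>" using Sym_inv_comp(1)[OF w] by (simp add: \<sigma>_def comp_assoc)
      then show ?thesis using Sym_inv_comp(1)[OF sn] by (simp add: comp_assoc[symmetric])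
    qed
    then have "left_shift \<sigma> v \<tau> = v \<omega>" by (simp add: left_shift_def)
    finally show ?thesis .
  qed
  have agi: "agree I (inv \<tau>) (inv \<omega>) \<longleftrightarrow> agree (inv \<omega> ` I) \<tau> \<omega>" if t: "\<tau> \<in> Sym n" and w: "\<omega> \<in> Sym n" for \<tau> \<omega>
  proof -
    have pt: "\<tau> permutes {1..n}" and pw: "\<omega> permutes {1..n}" using t w by (auto simp: Sym_def)
    show ?thesis unfolding agree_def using permutes_inverses[OF pt] permutes_inverses[OF pw] by (metis (no_types, lifting) imageE imageI)
  qed
  have "lowdeg n t (\<lambda>\<tau>. \<Sum>\<omega>\<in>Sym n. (v \<omega> / fact (n - t)) * (if agree (inv \<omega> ` I) \<tau> \<omega> then 1 else 0))"
  proof (intro lowdeg_sum lowdeg_scale lowdeg_agree)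
    fix \<omega> assume "\<omega> \<in> Sym n"
    then show "inv \<omega> ` I \<in> ksets n t" using I by (intro Sym_image_ksets Sym_inv) (auto simp: ksets_def)
  qed
  then have "lowdeg n t v"
  proof (rule lowdeg_cong)
    fix \<tau> assume t: "\<tau> \<in> Sym n"
    have "(\<Sum>\<omega>\<in>Sym n. (v \<omega> / fact (n - t)) * (if agree (inv \<omega> ` I) \<tau> \<omega> then 1 else 0))
      = (\<Sum>\<omega>\<in>Sym n. if agree I (inv \<tau>) (inv \<omega>) then v \<tau> / fact (n - t) else 0)"
      using agi[OF t] eqv[OF t] by (intro sum.cong refl) auto
    also have "\<dots> = (\<Sum>\<omega>\<in>Sym n. if agree I (inv \<tau>) \<omega> then v \<tau> / fact (n - t) else 0)"
      by (rule sum.reindex_bij_witness[of _ inv inv]) (auto simp: Sym_inv intro!: permutes_inv_inv[of _ "{1..n}"], auto simp: Sym_def)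
    also have "\<dots> = v \<tau>"
      unfolding sum.inter_filter[OF finite_Sym, symmetric] sum_constant card_agree[OF Sym_inv[OF t] I(1)] I(2) by simp
    finally show "(\<Sum>\<omega>\<in>Sym n. (v \<omega> / fact (n - t)) * (if agree (inv \<omega> ` I) \<tau> \<omega> then 1 else 0)) = v \<tau>" .
  qed
  then show ?thesis using v by (simp add: low_space_def)
qed

lemma representation_left_shift:
  assumes "cfun.subspace V" "V \<subseteq> sym_funs n" "\<And>\<sigma>. \<sigma> \<in> Sym n \<Longrightarrow> left_shift \<sigma> ` V \<subseteq> V"
  shows "representation n V left_shift"
  unfolding representation_def linear_map_on_def
  using assms by (auto simp: left_shift_add left_shift_scale left_shift_id left_shift_comp)

text \<open>An isomorphism would provide a nonzero vector of \<open>V\<close> fixed by the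
  permutations of \<open>D\<close>, and such a vector lies in \<open>low_space n t\<close>.\<close>

lemma not_isomorphic_specht:
  assumes \<alpha>: "is_partition n \<alpha>" "n - t \<le> largest_part \<alpha>" and tn: "t \<le> n"
    and V: "cfun.subspace V" "V \<subseteq> sym_funs n" "\<And>\<sigma>. \<sigma> \<in> Sym n \<Longrightarrow> left_shift \<sigma> ` V \<subseteq> V"
    and VW: "V \<inter> low_space n t \<subseteq> {0}"
  shows "\<not> isomorphic_reps n V left_shift (specht n \<alpha>) perm_action"
proof
  assume "isomorphic_reps n V left_shift (specht n \<alpha>) perm_action"
  then obtain T where T: "linear_map_on V (specht n \<alpha>) T" "bij_betw T V (specht n \<alpha>)"
    "\<And>\<sigma> v. \<sigma> \<in> Sym n \<Longrightarrow> v \<in> V \<Longrightarrow> T (left_shift \<sigma> v) = perm_action \<sigma> (T v)"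
    unfolding isomorphic_reps_def by blast
  have im: "T ` V = specht n \<alpha>" and inj: "inj_on T V" using T(2) by (auto simp: bij_betw_def)
  \<comment> \<open>The isomorphism transports the invariance of \<open>V\<close> to the Specht
    module.\<close>
  have "perm_action \<sigma> \<phi> \<in> specht n \<alpha>" if s: "\<sigma> \<in> Sym n" and p: "\<phi> \<in> specht n \<alpha>" for \<sigma> \<phi>
  proof -
    obtain v where v: "v \<in> V" "\<phi> = T v" using p im by blast
    then have "perm_action \<sigma> \<phi> = T (left_shift \<sigma> v)" using T(3)[OF s] by simp
    moreover have "left_shift \<sigma> v \<in> V" using V(3)[OF s] v by blast
    ultimately show ?thesis using im by blast
  qed
  then obtain D u where D: "D \<subseteq> {1..n}" "card D = n - t" and u: "u \<in> specht n \<alpha>" "u \<noteq> 0" "\<And>\<sigma>. \<sigma> permutes D \<Longrightarrow> perm_action \<sigma> u = u"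
    using specht_fixed_vector[OF \<alpha> tn] by blast
  obtain v where v: "v \<in> V" "u = T v" using u(1) im by blast
  have "left_shift \<sigma> v = v" if s: "\<sigma> permutes D" for \<sigma>
  proof -
    have sn: "\<sigma> \<in> Sym n" using s D permutes_subset by (auto simp: Sym_def)
    have "T (left_shift \<sigma> v) = T v" using T(3)[OF sn v(1)] u(3)[OF s] v(2) by simp
    moreover have "left_shift \<sigma> v \<in> V" using V(3)[OF sn] v(1) by blast
    ultimately show ?thesis using inj v(1) by (auto dest: inj_onD)
  qed
  then have "v \<in> low_space n t" using V(2) v(1) D tn by (intro left_invariant_low) auto
  then have "v = 0" using VW v(1) by blast
  moreover have "T 0 = 0"
  proof -
    have "0 \<in> V" using V(1) by (rule cfun.subspace_0)
    then have "T (cscale 0 0) = cscale 0 (T 0)" using T(1) unfolding linear_map_on_def by blast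
    then show ?thesis by (simp add: cscale_def zero_fun_def)
  qed
  ultimately show False using u(2) v(2) by simp
qed

lemma smaller_basis:
  assumes B: "finite B" and V: "cfun.subspace V" "V \<subseteq> cfun.span B" "V \<noteq> cfun.span B"
  shows "\<exists>B'. finite B' \<and> card B' < card B \<and> cfun.span B' = V"
proof -
  obtain B' where B': "B' \<subseteq> V" "cfun.independent B'" "V \<subseteq> cfun.span B'"
    using cfun.maximal_independent_subset by blast
  have sp: "cfun.span B' = V" using B' V(1) cfun.span_minimal by blast
  have 1: "finite B'" "card B' \<le> card B" using cfun.independent_span_bound[OF B B'(2)] B'(1) V(2) by auto
  obtain x where x: "x \<in> cfun.span B" "x \<notin> V" using V by blast
  have "cfun.independent (insert x B')" using B'(2) x sp by (simp add: cfun.independent_insert)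
  then have "card (insert x B') \<le> card B"
    using cfun.independent_span_bound[OF B, of "insert x B'"] B'(1) V(2) x by auto
  have "x \<notin> B'" using B'(1) x by blast
  then have "card B' < card B" using 1(1) \<open>card (insert x B') \<le> card B\<close> by simp
  then show ?thesis using 1(1) sp by blast
qed

lemma sym_funs_span: "cfun.span ((\<lambda>\<sigma>. indicator {\<sigma>}) ` Sym n) = sym_funs n"
proof (rule antisym)
  show "cfun.span ((\<lambda>\<sigma>. indicator {\<sigma>}) ` Sym n) \<subseteq> sym_funs n"
    by (rule cfun.span_minimal[OF _ subspace_sym_funs]) (auto simp: sym_funs_def indicator_def)
  show "sym_funs n \<subseteq> cfun.span ((\<lambda>\<sigma>. indicator {\<sigma>}) ` Sym n)"
  proof
    fix f assume f: "f \<in> sym_funs n"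
    have "f = (\<Sum>\<sigma>\<in>Sym n. cscale (f \<sigma>) (indicator {\<sigma>}))"
    proof
      fix x
      have "(\<Sum>\<sigma>\<in>Sym n. cscale (f \<sigma>) (indicator {\<sigma>})) x = (\<Sum>\<sigma>\<in>Sym n. if \<sigma> = x then f \<sigma> else 0)"
        unfolding sum_fun_apply by (intro sum.cong refl) (auto simp: cscale_def indicator_def)
      then show "f x = (\<Sum>\<sigma>\<in>Sym n. cscale (f \<sigma>) (indicator {\<sigma>})) x"
        using f finite_Sym[of n] by (auto simp: sym_funs_def)
    qed
    also have "\<dots> \<in> cfun.span ((\<lambda>\<sigma>. indicator {\<sigma>}) ` Sym n)"
      by (intro cfun.span_sum cfun.span_scale cfun.span_base) auto
    finally show "f \<in> cfun.span ((\<lambda>\<sigma>. indicator {\<sigma>}) ` Sym n)" .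
  qed
qed

text \<open>
  The set \<open>Z\<close> of functions whose translates are convolved by \<open>f\<close> into the low degree space is all of
  \<open>sym_funs n\<close>: a minimal invariant space not contained in \<open>Z\<close> would be irreducible and meet the low degree
  space trivially, so it would not be isomorphic to the Specht module, and \<open>f\<close> would annihilate it.
\<close>

lemma isotypic_subset_low_space:
  assumes \<alpha>: "is_partition n \<alpha>" "n - t \<le> largest_part \<alpha>" and tn: "t \<le> n"
  shows "isotypic n \<alpha> \<subseteq> low_space n t"
proof
  fix f assume f: "f \<in> isotypic n \<alpha>"
  define W where "W = low_space n t"
  have W: "cfun.subspace W" "W \<subseteq> sym_funs n" unfolding W_def using subspace_low_space by (auto simp: low_space_def)
  \<comment> \<open>For the left regular action \<open>fourier\<close> is convolution with
    \<open>f\<close>.\<close>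
  define conv where "conv = fourier n f left_shift"
  have conv_add: "conv (u + v) = conv u + conv v" for u v
    by (simp add: conv_def fourier_def left_shift_add cfun.scale_right_distrib sum.distrib)
  have conv_scale: "conv (cscale c u) = cscale c (conv u)" for c u
    by (simp add: conv_def fourier_def left_shift_scale cfun.scale_sum_right cfun.scale_scale mult.commute)
  have convW: "conv u \<in> W" if "u \<in> W" for u
    unfolding conv_def fourier_def using that left_shift_low_space[of _ n u t] W(1) unfolding W_def
    by (intro cfun.subspace_scale cfun.subspace_sum) auto
  define Z where "Z = {\<phi> \<in> sym_funs n. \<forall>\<sigma>\<in>Sym n. conv (left_shift \<sigma> \<phi>) \<in> W}"
  have Zsub: "cfun.subspace Z"
  proof (rule cfun.subspaceI)
    have "left_shift \<sigma> 0 = 0" for \<sigma> by (simp add: left_shift_def zero_fun_def)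
    then show "0 \<in> Z" unfolding Z_def using cfun.subspace_0[OF W(1)] cfun.subspace_0[OF subspace_sym_funs] convW by auto
    show "x + y \<in> Z" if "x \<in> Z" "y \<in> Z" for x y
      using that cfun.subspace_add[OF W(1)] cfun.subspace_add[OF subspace_sym_funs] unfolding Z_def by (auto simp: left_shift_add conv_add)
    show "cscale c x \<in> Z" if "x \<in> Z" for c x
      using that cfun.subspace_scale[OF W(1)] cfun.subspace_scale[OF subspace_sym_funs] unfolding Z_def by (auto simp: left_shift_scale conv_scale)
  qed
  have Zinv: "left_shift \<sigma> ` Z \<subseteq> Z" if s: "\<sigma> \<in> Sym n" for \<sigma>
  proof
    fix x assume "x \<in> left_shift \<sigma> ` Z"
    then obtain \<phi> where p: "\<phi> \<in> Z" "x = left_shift \<sigma> \<phi>" by blast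
    have "left_shift \<tau> x = left_shift (\<tau> \<circ> \<sigma>) \<phi>" if "\<tau> \<in> Sym n" for \<tau> using left_shift_comp[OF that s] p by simp
    then show "x \<in> Z" using p s Sym_comp left_shift_sym_funs unfolding Z_def by auto
  qed
  have WZ: "W \<subseteq> Z" unfolding Z_def using W(2) convW left_shift_low_space unfolding W_def by blast
  have "Z = sym_funs n"
  proof (rule ccontr)
    assume ne: "Z \<noteq> sym_funs n"
    \<comment> \<open>Dimension is measured by the size of a finite spanning set. The least such
      size gives an invariant space outside \<open>Z\<close> all of whose proper invariant subspaces
      lie in \<open>Z\<close>.\<close>
    define P where "P k \<longleftrightarrow> (\<exists>B. finite B \<and> card B = k \<and> cfun.span B \<subseteq> sym_funs n \<and> \<not> cfun.span B \<subseteq> Z \<and>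
      (\<forall>\<sigma>\<in>Sym n. left_shift \<sigma> ` cfun.span B \<subseteq> cfun.span B))" for k
    have "P (card ((\<lambda>\<sigma>. indicator {\<sigma>} :: (nat \<Rightarrow> nat) \<Rightarrow> complex) ` Sym n))"
      unfolding P_def by (rule exI[of _ "(\<lambda>\<sigma>. indicator {\<sigma>}) ` Sym n"])
        (use ne left_shift_sym_funs in \<open>auto simp: sym_funs_span Z_def\<close>)
    then have PL: "P (LEAST k. P k)" by (rule LeastI)
    obtain B where B: "finite B" "card B = (LEAST k. P k)" "cfun.span B \<subseteq> sym_funs n" "\<not> cfun.span B \<subseteq> Z"
      "\<And>\<sigma>. \<sigma> \<in> Sym n \<Longrightarrow> left_shift \<sigma> ` cfun.span B \<subseteq> cfun.span B"
      using PL unfolding P_def by blast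
    define V where "V = cfun.span B"
    have V: "cfun.subspace V" unfolding V_def by (rule cfun.subspace_span)
    have small: "V' \<subseteq> Z" if V': "cfun.subspace V'" "V' \<subseteq> V" "V' \<noteq> V" "\<And>\<sigma>. \<sigma> \<in> Sym n \<Longrightarrow> left_shift \<sigma> ` V' \<subseteq> V'" for V'
    proof (rule ccontr)
      assume n: "\<not> V' \<subseteq> Z"
      obtain B' where B': "finite B'" "card B' < card B" "cfun.span B' = V'"
        using smaller_basis[OF B(1) V'(1) V'(2)[unfolded V_def] V'(3)[unfolded V_def]] by (elim exE conjE)
      have "V' \<subseteq> sym_funs n" using V'(2) B(3) unfolding V_def by (rule order_trans)
      then have "P (card B')" unfolding P_def
        by (intro exI[of _ B'] conjI) (simp_all add: B'(1,3) n V'(4))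
      then show False using B'(2) B(2) not_less_Least by metis
    qed
    define VZ where "VZ = V \<inter> Z"
    have VZ: "cfun.subspace VZ" unfolding VZ_def using V Zsub by (rule cfun.subspace_inter)
    \<comment> \<open>The orthogonal complement of \<open>V \<inter> Z\<close> in \<open>V\<close>.
      If \<open>V \<inter> Z\<close> were nonzero, this would be a proper invariant subspace, hence
      contained in \<open>Z\<close> and therefore zero, which would force
      \<open>V \<subseteq> Z\<close>.\<close>
    define V' where "V' = {\<phi> \<in> V. \<forall>z\<in>VZ. cip n \<phi> z = 0}"
    have V'sub: "cfun.subspace V'"
    proof (rule cfun.subspaceI)
      show "0 \<in> V'" using cfun.subspace_0[OF V] by (simp add: V'_def cip_def)
      show "x + y \<in> V'" if "x \<in> V'" "y \<in> V'" for x y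
        using that cfun.subspace_add[OF V, of x y] unfolding V'_def mem_Collect_eq cip_add by simp
      show "cscale c x \<in> V'" if "x \<in> V'" for c x
        using that cfun.subspace_scale[OF V, of x c] unfolding V'_def mem_Collect_eq cip_scale by simp
    qed
    have V'inv: "left_shift \<sigma> ` V' \<subseteq> V'" if s: "\<sigma> \<in> Sym n" for \<sigma>
    proof
      fix x assume "x \<in> left_shift \<sigma> ` V'"
      then obtain \<phi> where p: "\<phi> \<in> V'" "x = left_shift \<sigma> \<phi>" by blast
      have "cip n x z = 0" if z: "z \<in> VZ" for z
      proof -
        have "left_shift (inv \<sigma>) z \<in> VZ" using z B(5) Zinv Sym_inv[OF s] unfolding VZ_def V_def by blast
        then have "cip n \<phi> (left_shift (inv \<sigma>) z) = 0" using p by (simp add: V'_def)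
        moreover have "left_shift \<sigma> (left_shift (inv \<sigma>) z) = z"
          using left_shift_comp[OF s Sym_inv[OF s], of z] Sym_inv_comp[OF s] by (simp add: left_shift_id)
        ultimately show ?thesis using cip_left_shift[OF s, of \<phi> "left_shift (inv \<sigma>) z"] p by simp
      qed
      then show "x \<in> V'" using p B(5)[OF s] unfolding V'_def V_def by blast
    qed
    have VZ0: "VZ = {0}"
    proof (rule ccontr)
      assume "VZ \<noteq> {0}"
      then obtain z where z: "z \<in> VZ" "z \<noteq> 0" using cfun.subspace_0[OF VZ] by blast
      have "z \<notin> V'" using z cip_self_eq_0[of n z] B(3) unfolding V'_def VZ_def V_def by blast
      then have "V' \<noteq> V" using z by (auto simp: VZ_def)
      then have "V' \<subseteq> Z" using small[OF V'sub _ _ V'inv] by (auto simp: V'_def)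
      then have V'0: "\<phi> = 0" if "\<phi> \<in> V'" for \<phi>
        using that cip_self_eq_0[of n \<phi>] B(3) unfolding V'_def VZ_def V_def by blast
      have "V \<subseteq> Z"
      proof
        fix \<phi> assume p: "\<phi> \<in> V"
        have "\<exists>B'. finite B' \<and> cfun.span B' = VZ"
        proof (cases "VZ = V")
          case False
          then show ?thesis using smaller_basis[OF B(1) VZ] unfolding VZ_def V_def by blast
        qed (use B(1) V_def in blast)
        then obtain B' where B': "finite B'" "cfun.span B' = VZ" by blast
        obtain q where q: "q \<in> VZ" "\<And>b. b \<in> VZ \<Longrightarrow> cip n (\<phi> - q) b = 0"
          using cip_projection[OF B'(1), of n \<phi>] B'(2) by blast
        have "\<phi> - q \<in> V'" using p q cfun.subspace_diff[OF V] by (auto simp: V'_def VZ_def)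
        then have "\<phi> = q" using V'0 by force
        then show "\<phi> \<in> Z" using q by (simp add: VZ_def)
      qed
      then show False using B(4) by (simp add: V_def)
    qed
    have irr: "irreducible_rep n V left_shift"
      unfolding irreducible_rep_def
    proof (intro conjI allI impI)
      show "representation n V left_shift" by (rule representation_left_shift[OF V B(3)[folded V_def] B(5)[folded V_def]])
      show "V \<noteq> {0}" using B(4)[folded V_def] cfun.subspace_0[OF Zsub] by auto
      fix U assume U: "U \<subseteq> V \<and> cfun.subspace U \<and> (\<forall>\<sigma>\<in>Sym n. left_shift \<sigma> ` U \<subseteq> U)"
      then have U': "U \<subseteq> V" "cfun.subspace U" "\<And>\<sigma>. \<sigma> \<in> Sym n \<Longrightarrow> left_shift \<sigma> ` U \<subseteq> U" by auto
      show "U = {0} \<or> U = V"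
      proof (rule disjCI)
        assume "U \<noteq> V"
        then have "U \<subseteq> Z" using small[of U, OF U'(2,1)] U'(3) by simp
        then have "U \<subseteq> {0}" using U'(1) VZ0 unfolding VZ_def by auto
        then show "U = {0}" using cfun.subspace_0[OF U'(2)] by auto
      qed
    qed
    have VW: "V \<inter> low_space n t \<subseteq> {0}" using VZ0 WZ unfolding VZ_def W_def by auto
    have "\<not> isomorphic_reps n V left_shift (specht n \<alpha>) perm_action"
      by (rule not_isomorphic_specht[OF \<alpha> tn V B(3)[folded V_def] B(5)[folded V_def] VW])
    then have c0: "conv v = 0" if "v \<in> V" for v
      using f irr that unfolding isotypic_def conv_def by blast
    have "V \<subseteq> Z"
    proof
      fix v assume v: "v \<in> V"
      have "conv (left_shift \<sigma> v) \<in> W" if "\<sigma> \<in> Sym n" for \<sigma>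
        using c0[of "left_shift \<sigma> v"] B(5)[OF that] v cfun.subspace_0[OF W(1)] unfolding V_def by auto
      then show "v \<in> Z" using v B(3) by (auto simp: Z_def V_def)
    qed
    then show False using B(4) by (simp add: V_def)
  qed
  \<comment> \<open>Convolution of \<open>f\<close> with this multiple of the point mass at the
    identity returns \<open>f\<close>; the factor \<open>n!\<close> undoes the normalisation in
    \<open>fourier\<close>.\<close>
  define \<delta> where "\<delta> = cscale (fact n) (indicator {id :: nat \<Rightarrow> nat})"
  have "\<delta> \<in> sym_funs n" by (auto simp: \<delta>_def sym_funs_def cscale_def indicator_def Sym_id)
  then have "conv (left_shift id \<delta>) \<in> W" using \<open>Z = sym_funs n\<close> Sym_id unfolding Z_def by blast
  moreover have "conv \<delta> = f"
  proof
    fix \<tau>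
    have fs: "f \<in> sym_funs n" using f by (simp add: isotypic_def)
    have "conv \<delta> \<tau> = (\<Sum>\<sigma>\<in>Sym n. f \<sigma> * indicator {id} (inv \<sigma> \<circ> \<tau>))"
      by (simp add: conv_def fourier_def cscale_def sum_fun_apply left_shift_def \<delta>_def sum_distrib_left algebra_simps)
    also have "\<dots> = (\<Sum>\<sigma>\<in>Sym n. if \<sigma> = \<tau> then f \<sigma> else 0)"
    proof (intro sum.cong refl)
      fix \<sigma> assume s: "\<sigma> \<in> Sym n"
      have "inv \<sigma> \<circ> \<tau> = id \<longleftrightarrow> \<sigma> = \<tau>"
      proof
        assume "inv \<sigma> \<circ> \<tau> = id"
        then have "\<sigma> \<circ> (inv \<sigma> \<circ> \<tau>) = \<sigma>" by simp
        then show "\<sigma> = \<tau>" using Sym_inv_comp(2)[OF s] by (simp add: comp_assoc[symmetric])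
      qed (use Sym_inv_comp(1)[OF s] in simp)
      then show "f \<sigma> * indicator {id} (inv \<sigma> \<circ> \<tau>) = (if \<sigma> = \<tau> then f \<sigma> else 0)" by (simp add: indicator_def)
    qed
    also have "\<dots> = f \<tau>" using fs by (simp add: sym_funs_def)
    finally show "conv \<delta> \<tau> = f \<tau>" .
  qed
  ultimately show "f \<in> low_space n t" by (simp add: left_shift_id W_def)
qed

lemma U_space_low: "t \<le> n \<Longrightarrow> f \<in> U_space n t \<Longrightarrow> lowdeg n t f"
  using cfun.span_minimal[OF _ subspace_low_space[of n t], of "\<Union>\<alpha>\<in>{\<alpha>. is_partition n \<alpha> \<and> n - t \<le> largest_part \<alpha>}. isotypic n \<alpha>"]
    isotypic_subset_low_space[of n _ t] unfolding U_space_def low_space_def by blast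

text \<open>Passes to real functions: coset indicators are real, so the real part only changes the
  coefficients, and it is at least as close to any real function.\<close>

lemma lowdeg_Re:
  assumes "lowdeg n t f"
  shows "lowdeg n t (\<lambda>\<sigma>. Re (f \<sigma>))"
proof -
  obtain a where "\<forall>\<sigma>\<in>Sym n. f \<sigma> = (\<Sum>I\<in>ksets n t. \<Sum>\<tau>\<in>Sym n. if agree I \<sigma> \<tau> then a I \<tau> else 0)"
    using assms unfolding lowdeg_def by blast
  then show ?thesis unfolding lowdeg_def
    by (intro exI[of _ "\<lambda>I \<tau>. Re (a I \<tau>)"]) (auto simp: if_distrib[of Re] cong: if_cong)
qed

section \<open>Heavy cosets\<close>

text \<open>For \<open>u\<close> injective on \<open>S\<close> with image disjoint from
  \<open>S\<close>, the product of the transpositions of \<open>i\<close> and \<open>u i\<close>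
  with \<open>i\<close> in \<open>S\<close>; the closed formula avoids an ordered product.\<close>

definition exch :: "nat set \<Rightarrow> (nat \<Rightarrow> nat) \<Rightarrow> nat \<Rightarrow> nat" where
  "exch S u x = (if x \<in> S then u x else if x \<in> u ` S then inv_into S u x else x)"

lemma exch_exch:
  assumes "inj_on u S" "u ` S \<inter> S = {}"
  shows "exch S u (exch S u x) = x"
proof -
  have "u x \<notin> S" if "x \<in> S" for x using assms(2) that by blast
  moreover have "inv_into S u (u x) = x" if "x \<in> S" for x using assms(1) that by simp
  moreover have "inv_into S u x \<in> S" "u (inv_into S u x) = x" if "x \<in> u ` S" for x
    using that by (auto intro: inv_into_into f_inv_into_f)
  ultimately show ?thesis by (auto simp: exch_def)
qed

lemma exch_permutes:
  assumes "inj_on u S" "u ` S \<inter> S = {}" "S \<subseteq> D" "u ` S \<subseteq> D"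
  shows "exch S u permutes D"
  unfolding permutes_def
proof (intro conjI allI impI)
  show "exch S u x = x" if "x \<notin> D" for x using that assms(3,4) by (auto simp: exch_def)
  show "\<exists>!x. exch S u x = y" for y
    using exch_exch[OF assms(1,2)] by (intro ex1I[of _ "exch S u y"]) metis+
qed

lemma exch_empty: "exch {} u = id"
  by (auto simp: exch_def)

text \<open>Adding or removing \<open>i\<close> pairs up the subsets of \<open>I\<close> with
  opposite signs.\<close>

lemma alternating_toggle:
  fixes h :: "'b set \<Rightarrow> real"
  assumes "finite I" "i \<in> I" "\<And>S. S \<subseteq> I - {i} \<Longrightarrow> h (insert i S) = h S"
  shows "(\<Sum>S\<in>Pow I. (-1) ^ card S * h S) = 0"
proof -
  define J where "J = I - {i}"
  have J: "I = insert i J" "i \<notin> J" "finite J" using assms by (auto simp: J_def)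
  have "(\<Sum>S\<in>Pow I. (-1) ^ card S * h S) = (\<Sum>S\<in>Pow J. (-1) ^ card S * h S) + (\<Sum>S\<in>insert i ` Pow J. (-1) ^ card S * h S)"
    unfolding J(1) Pow_insert using J by (intro sum.union_disjoint) auto
  also have "(\<Sum>S\<in>insert i ` Pow J. (-1) ^ card S * h S) = (\<Sum>S\<in>Pow J. (-1) ^ card (insert i S) * h (insert i S))"
    using J(2) by (subst sum.reindex) (auto simp: inj_on_def)
  also have "\<dots> = (\<Sum>S\<in>Pow J. - ((-1) ^ card S * h S))"
  proof (intro sum.cong refl)
    fix S assume S: "S \<in> Pow J"
    then have "finite S" "i \<notin> S" using J finite_subset by auto
    then show "(-1) ^ card (insert i S) * h (insert i S) = - ((-1) ^ card S * h S)"
      using assms(3)[of S] S by (simp add: J_def)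
  qed
  finally show ?thesis by (simp add: sum_negf)
qed

text \<open>
  For a coset of \<open>K\<close>, either some pair \<open>{i, u i}\<close> misses \<open>K\<close>, and toggling \<open>i\<close> cancels the sum, or \<open>K\<close>
  contains exactly one element of each pair.
\<close>

lemma alternating_exchange:
  fixes g :: "(nat \<Rightarrow> nat) \<Rightarrow> real"
  assumes g: "lowdeg n t g" and I: "I \<in> ksets n t" and u: "inj_on u I" "u ` I \<subseteq> {1..n} - I"
    and s: "\<sigma> \<in> Sym n" "\<sigma>' \<in> Sym n" and ag: "agree (I \<union> u ` I) \<sigma> \<sigma>'"
  shows "(\<Sum>S\<in>Pow I. (-1) ^ card S * g (\<sigma> \<circ> exch S u)) = (\<Sum>S\<in>Pow I. (-1) ^ card S * g (\<sigma>' \<circ> exch S u))"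
proof -
  obtain a where a: "\<And>\<omega>. \<omega> \<in> Sym n \<Longrightarrow> g \<omega> = (\<Sum>K\<in>ksets n t. \<Sum>\<tau>\<in>Sym n. a K \<tau> * (if agree K \<omega> \<tau> then 1 else 0))"
    using g unfolding lowdeg_def by (auto simp: if_distrib[of "\<lambda>x. _ * x"] cong: if_cong)
  have uS: "inj_on u S" "u ` S \<inter> S = {}" "S \<subseteq> {1..n}" "u ` S \<subseteq> {1..n}" if "S \<subseteq> I" for S
    using u that ksets_sub(1)[OF I] by (auto intro: inj_on_subset)
  define R where "R \<omega> K \<tau> = (\<Sum>S\<in>Pow I. (-1) ^ card S * (if agree K (\<omega> \<circ> exch S u) \<tau> then 1 else 0 :: real))" for \<omega> K \<tau>
  have F: "(\<Sum>S\<in>Pow I. (-1) ^ card S * g (\<omega> \<circ> exch S u)) = (\<Sum>K\<in>ksets n t. \<Sum>\<tau>\<in>Sym n. a K \<tau> * R \<omega> K \<tau>)" if w: "\<omega> \<in> Sym n" for \<omega>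
  proof -
    have "(\<Sum>S\<in>Pow I. (-1) ^ card S * g (\<omega> \<circ> exch S u)) =
      (\<Sum>S\<in>Pow I. \<Sum>K\<in>ksets n t. \<Sum>\<tau>\<in>Sym n. (-1) ^ card S * (a K \<tau> * (if agree K (\<omega> \<circ> exch S u) \<tau> then 1 else 0)))"
    proof (intro sum.cong refl)
      fix S assume "S \<in> Pow I"
      then have "\<omega> \<circ> exch S u \<in> Sym n" using uS[of S] by (intro Sym_comp_permutes[OF w exch_permutes, of _ _ "{1..n}"]) auto
      then show "(-1) ^ card S * g (\<omega> \<circ> exch S u) = (\<Sum>K\<in>ksets n t. \<Sum>\<tau>\<in>Sym n. (-1) ^ card S * (a K \<tau> * (if agree K (\<omega> \<circ> exch S u) \<tau> then 1 else 0)))"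
        using a by (simp add: sum_distrib_left)
    qed
    also have "\<dots> = (\<Sum>K\<in>ksets n t. \<Sum>S\<in>Pow I. \<Sum>\<tau>\<in>Sym n. (-1) ^ card S * (a K \<tau> * (if agree K (\<omega> \<circ> exch S u) \<tau> then 1 else 0)))"
      by (rule sum.swap)
    also have "\<dots> = (\<Sum>K\<in>ksets n t. \<Sum>\<tau>\<in>Sym n. \<Sum>S\<in>Pow I. (-1) ^ card S * (a K \<tau> * (if agree K (\<omega> \<circ> exch S u) \<tau> then 1 else 0)))"
      by (intro sum.cong refl sum.swap)
    finally show ?thesis by (simp add: R_def sum_distrib_left mult.left_commute)
  qed
  have "R \<sigma> K \<tau> = R \<sigma>' K \<tau>" if K: "K \<in> ksets n t" for K \<tau>
  proof (cases "K \<subseteq> I \<union> u ` I")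
    case True
    have "agree K (\<sigma> \<circ> exch S u) \<tau> \<longleftrightarrow> agree K (\<sigma>' \<circ> exch S u) \<tau>" if S: "S \<subseteq> I" for S
    proof -
      have "exch S u x \<in> I \<union> u ` I" if "x \<in> I \<union> u ` I" for x
        using that S inv_into_into[of x u S] by (auto simp: exch_def)
      then show ?thesis using True ag by (auto simp: agree_def subset_iff)
    qed
    then show ?thesis unfolding R_def by (intro sum.cong refl) auto
  next
    case False
    have "\<exists>i\<in>I. i \<notin> K \<and> u i \<notin> K"
    proof (rule ccontr)
      assume n: "\<not> (\<exists>i\<in>I. i \<notin> K \<and> u i \<notin> K)"
      \<comment> \<open>If every pair \<open>{i, u i}\<close> met \<open>K\<close>, then
        \<open>p\<close> would pick \<open>t\<close> distinct points of \<open>K\<close> from the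
        pairs, leaving none for a point of \<open>K\<close> outside all pairs.\<close>
      define p where "p i = (if i \<in> K then i else u i)" for i
      have "inj_on p I" using u unfolding p_def inj_on_def by (auto split: if_splits)
      moreover have "p ` I \<subseteq> K \<inter> (I \<union> u ` I)" using n by (auto simp: p_def)
      moreover have "finite (K \<inter> (I \<union> u ` I))" using ksets_sub(3)[OF K] by simp
      ultimately have "card I \<le> card (K \<inter> (I \<union> u ` I))" by (metis card_image card_mono)
      moreover have "card (K \<inter> (I \<union> u ` I)) < card K" using False ksets_sub(3)[OF K] by (intro psubset_card_mono) auto
      ultimately show False using ksets_sub(2)[OF I] ksets_sub(2)[OF K] by simp
    qed
    then obtain i where i: "i \<in> I" "i \<notin> K" "u i \<notin> K" by blast
    have "R \<omega> K \<tau> = 0" for \<omega>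
      unfolding R_def
    proof (rule alternating_toggle[OF ksets_sub(3)[OF I] i(1)])
      fix S assume S: "S \<subseteq> I - {i}"
      have "exch (insert i S) u x = exch S u x" if x: "x \<in> K" for x
      proof -
        have iS: "insert i S \<subseteq> I" using S i(1) by blast
        have "inv_into (insert i S) u x = inv_into S u x" if "x \<in> u ` S"
        proof -
          obtain y where y: "y \<in> S" "x = u y" using \<open>x \<in> u ` S\<close> by blast
          then show ?thesis using uS(1)[OF iS] uS(1)[of S] iS by (simp add: inv_into_f_f inj_on_subset)
        qed
        then show ?thesis using x i by (auto simp: exch_def)
      qed
      then have "agree K (\<omega> \<circ> exch (insert i S) u) \<tau> \<longleftrightarrow> agree K (\<omega> \<circ> exch S u) \<tau>" by (simp add: agree_def)
      then show "(if agree K (\<omega> \<circ> exch (insert i S) u) \<tau> then 1 else 0) = (if agree K (\<omega> \<circ> exch S u) \<tau> then 1 else 0 :: real)" by simp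
    qed
    then show ?thesis by simp
  qed
  then show ?thesis unfolding F[OF s(1)] F[OF s(2)] by (intro sum.cong refl) simp
qed


lemma clip_square_le:
  fixes x :: real
  assumes "x = 0 \<or> x = 1"
  shows "(x - max 0 (min 1 y))\<^sup>2 \<le> min 1 ((x - y)\<^sup>2)"
proof -
  have "\<bar>x - max 0 (min 1 y)\<bar> \<le> 1" "\<bar>x - max 0 (min 1 y)\<bar> \<le> \<bar>x - y\<bar>" using assms by auto
  then show ?thesis using abs_le_square_iff[of "x - max 0 (min 1 y)" 1] abs_le_square_iff[of "x - max 0 (min 1 y)" "x - y"] by simp
qed

text \<open>\<open>av D f\<close> is the nearest function invariant under \<open>av D\<close>, so
  any explicit invariant \<open>F\<close> bounds the distance.\<close>

lemma nsq_minus_av_le: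
  assumes D: "D \<subseteq> {1..n}" and F: "\<And>\<sigma>. \<sigma> \<in> Sym n \<Longrightarrow> av D F \<sigma> = F \<sigma>"
  shows "nsq n (\<lambda>\<sigma>. f \<sigma> - av D f \<sigma>) \<le> nsq n (\<lambda>\<sigma>. f \<sigma> - F \<sigma>)"
proof -
  define e where "e = (\<lambda>\<sigma>. f \<sigma> - F \<sigma>)"
  have "nsq n (\<lambda>\<sigma>. f \<sigma> - av D f \<sigma>) = nsq n (\<lambda>\<sigma>. e \<sigma> - av D e \<sigma>)"
    by (rule ip_cong) (simp_all add: e_def av_diff F)
  also have "\<dots> \<le> nsq n e" unfolding nsq_minus_av[OF D] by simp
  finally show ?thesis by (simp add: e_def)
qed

text \<open>
  Clipping the alternating sum to \<open>[0, 1]\<close> keeps the error at most 1 pointwise; permutations in several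
  heavy cosets could otherwise count a large error several times.
\<close>

lemma coset_block:
  fixes f g :: "(nat \<Rightarrow> nat) \<Rightarrow> real"
  assumes f: "\<And>\<sigma>. \<sigma> \<in> Sym n \<Longrightarrow> f \<sigma> = 0 \<or> f \<sigma> = 1" and g: "lowdeg n t g"
    and I: "I \<in> ksets n t" and u: "inj_on u I" "u ` I \<subseteq> {1..n} - I" and s0: "\<sigma>0 \<in> Sym n"
  defines "f1 \<equiv> \<lambda>\<sigma>. if agree I \<sigma>0 \<sigma> then f \<sigma> else 0"
  shows "fact n * nsq n (\<lambda>\<sigma>. f1 \<sigma> - cnd n (I \<union> u ` I) f1 \<sigma>)
    \<le> (\<Sum>\<sigma> | \<sigma> \<in> Sym n \<and> agree I \<sigma>0 \<sigma>. min 1 (2 ^ t * (f \<sigma> - g \<sigma>)\<^sup>2))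
      + 2 ^ t * (\<Sum>\<sigma> | \<sigma> \<in> Sym n \<and> agree I \<sigma>0 \<sigma>. \<Sum>S\<in>Pow I - {{}}. (g (\<sigma> \<circ> exch S u))\<^sup>2)"
proof -
  define F where "F \<sigma> = (\<Sum>S\<in>Pow I. (-1) ^ card S * g (\<sigma> \<circ> exch S u))" for \<sigma>
  define D where "D = {1..n} - (I \<union> u ` I)"
  have D: "D \<subseteq> {1..n}" by (auto simp: D_def)
  define G where "G \<sigma> = (if agree I \<sigma>0 \<sigma> then max 0 (min 1 (F \<sigma>)) else 0)" for \<sigma>
  have finI: "finite I" using ksets_sub(3)[OF I] .
  have "av D G \<sigma> = G \<sigma>" if s: "\<sigma> \<in> Sym n" for \<sigma>
  proof (rule av_const)
    fix \<pi> assume p: "\<pi> permutes D"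
    have "agree (I \<union> u ` I) \<sigma> (\<sigma> \<circ> \<pi>)" using permutes_not_in[OF p] by (auto simp: agree_def D_def)
    then have "F \<sigma> = F (\<sigma> \<circ> \<pi>)" and "agree I \<sigma> (\<sigma> \<circ> \<pi>)"
      unfolding F_def by (auto intro!: alternating_exchange[OF g I u s Sym_comp_permutes[OF s p D]] simp: agree_Un)
    then show "G (\<sigma> \<circ> \<pi>) = G \<sigma>" unfolding G_def using agree_trans agree_sym by metis
  qed (use finite_sub[OF D] in simp)
  then have "nsq n (\<lambda>\<sigma>. f1 \<sigma> - av D f1 \<sigma>) \<le> nsq n (\<lambda>\<sigma>. f1 \<sigma> - G \<sigma>)" by (rule nsq_minus_av_le[OF D])
  then have "fact n * nsq n (\<lambda>\<sigma>. f1 \<sigma> - av D f1 \<sigma>) \<le> (\<Sum>\<sigma>\<in>Sym n. (f1 \<sigma> - G \<sigma>)\<^sup>2)"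
    by (simp add: ip_def power2_eq_square field_simps)
  also have "\<dots> = (\<Sum>\<sigma>\<in>Sym n. if agree I \<sigma>0 \<sigma> then (f \<sigma> - max 0 (min 1 (F \<sigma>)))\<^sup>2 else 0)"
    by (intro sum.cong refl) (simp add: f1_def G_def)
  also have "\<dots> = (\<Sum>\<sigma> | \<sigma> \<in> Sym n \<and> agree I \<sigma>0 \<sigma>. (f \<sigma> - max 0 (min 1 (F \<sigma>)))\<^sup>2)"
    by (rule sum.inter_filter[symmetric]) simp
  also have "\<dots> \<le> (\<Sum>\<sigma> | \<sigma> \<in> Sym n \<and> agree I \<sigma>0 \<sigma>. min 1 (2 ^ t * (f \<sigma> - g \<sigma>)\<^sup>2) + 2 ^ t * (\<Sum>S\<in>Pow I - {{}}. (g (\<sigma> \<circ> exch S u))\<^sup>2))"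
  proof (rule sum_mono)
    fix \<sigma> assume "\<sigma> \<in> {\<sigma>. \<sigma> \<in> Sym n \<and> agree I \<sigma>0 \<sigma>}"
    then have s: "\<sigma> \<in> Sym n" by simp
    \<comment> \<open>\<open>f - F\<close> as a sum of \<open>2 ^ t\<close> terms: the approximation
      error for \<open>S = {}\<close>, and otherwise values of \<open>g\<close> at exchanged
      permutations, which lie outside the coset. Cauchy-Schwarz produces the factor
      \<open>2 ^ t\<close>.\<close>
    define z where "z S = (if S = {} then f \<sigma> - g \<sigma> else - ((-1) ^ card S * g (\<sigma> \<circ> exch S u)))" for S
    have "f \<sigma> - F \<sigma> = (\<Sum>S\<in>Pow I. z S)"
      using finI unfolding F_def by (subst (1 2) sum.remove[of _ "{}"]) (auto simp: z_def exch_empty sum_negf intro!: sum.cong)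
    then have "(f \<sigma> - F \<sigma>)\<^sup>2 \<le> (\<Sum>S\<in>Pow I. (z S)\<^sup>2) * card (Pow I)"
      using sum_squared_le_sum_of_squares[of z "Pow I"] by simp
    also have "card (Pow I) = 2 ^ t" using ksets_sub(2)[OF I] finI by (simp add: card_Pow)
    also have "(\<Sum>S\<in>Pow I. (z S)\<^sup>2) = (f \<sigma> - g \<sigma>)\<^sup>2 + (\<Sum>S\<in>Pow I - {{}}. (g (\<sigma> \<circ> exch S u))\<^sup>2)"
      using finI by (subst sum.remove[of _ "{}"]) (auto simp: z_def power_mult_distrib power_mult[symmetric] mult.commute[of _ 2] intro!: sum.cong)
    finally have le: "(f \<sigma> - F \<sigma>)\<^sup>2 \<le> 2 ^ t * (f \<sigma> - g \<sigma>)\<^sup>2 + 2 ^ t * (\<Sum>S\<in>Pow I - {{}}. (g (\<sigma> \<circ> exch S u))\<^sup>2)"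
      by (simp add: algebra_simps)
    have nn: "0 \<le> 2 ^ t * (\<Sum>S\<in>Pow I - {{}}. (g (\<sigma> \<circ> exch S u))\<^sup>2)" by (intro mult_nonneg_nonneg sum_nonneg) auto
    show "(f \<sigma> - max 0 (min 1 (F \<sigma>)))\<^sup>2 \<le> min 1 (2 ^ t * (f \<sigma> - g \<sigma>)\<^sup>2) + 2 ^ t * (\<Sum>S\<in>Pow I - {{}}. (g (\<sigma> \<circ> exch S u))\<^sup>2)"
      using clip_square_le[OF f[OF s], of "F \<sigma>"] le nn by linarith
  qed
  finally show ?thesis unfolding D_def by (simp add: sum.distrib sum_distrib_left)
qed

text \<open>Expanding both conditional expectations counts, for each pair \<open>\<alpha>\<close>,
  \<open>\<beta>\<close>, the permutations that follow \<open>\<alpha>\<close> on \<open>I\<close>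
  and \<open>\<beta>\<close> on \<open>J\<close>; there are at most \<open>(n - b)!\<close> of them.
  For \<open>f\<close> supported on one coset of \<open>I \<inter> J\<close> this bounds the
  correlation of the two averages almost as if they were independent on that coset.\<close>

lemma near_independence:
  fixes f :: "(nat \<Rightarrow> nat) \<Rightarrow> real"
  assumes f: "\<And>\<sigma>. \<sigma> \<in> Sym n \<Longrightarrow> 0 \<le> f \<sigma>"
    and I: "I \<subseteq> {1..n}" "J \<subseteq> {1..n}" "card I = a" "card J = a" "card (I \<union> J) = b"
  shows "fact n * ip n (cnd n I f) (cnd n J f) \<le> fact (n - b) / (fact (n - a))\<^sup>2 * (\<Sum>\<sigma>\<in>Sym n. f \<sigma>)\<^sup>2"
proof -
  define c :: real where "c = 1 / (fact (n - a))\<^sup>2"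
  have "fact n * ip n (cnd n I f) (cnd n J f) = (\<Sum>\<sigma>\<in>Sym n. cnd n I f \<sigma> * cnd n J f \<sigma>)" by (simp add: ip_def)
  also have "\<dots> = (\<Sum>\<sigma>\<in>Sym n. \<Sum>\<alpha>\<in>Sym n. \<Sum>\<beta>\<in>Sym n. c * (f \<alpha> * f \<beta>) * (if agree I \<sigma> \<alpha> \<and> agree J \<sigma> \<beta> then 1 else 0))"
  proof (intro sum.cong refl)
    fix \<sigma> assume s: "\<sigma> \<in> Sym n"
    have "cnd n I f \<sigma> * cnd n J f \<sigma> = c * ((\<Sum>\<alpha>\<in>Sym n. if agree I \<sigma> \<alpha> then f \<alpha> else 0) * (\<Sum>\<beta>\<in>Sym n. if agree J \<sigma> \<beta> then f \<beta> else 0))"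
      unfolding cnd_coset[OF s I(1)] cnd_coset[OF s I(2)] I(3,4) by (simp add: c_def power2_eq_square)
    also have "\<dots> = (\<Sum>\<alpha>\<in>Sym n. \<Sum>\<beta>\<in>Sym n. c * ((if agree I \<sigma> \<alpha> then f \<alpha> else 0) * (if agree J \<sigma> \<beta> then f \<beta> else 0)))"
      unfolding sum_product by (simp only: sum_distrib_left)
    also have "\<dots> = (\<Sum>\<alpha>\<in>Sym n. \<Sum>\<beta>\<in>Sym n. c * (f \<alpha> * f \<beta>) * (if agree I \<sigma> \<alpha> \<and> agree J \<sigma> \<beta> then 1 else 0))"
      by (intro sum.cong refl) auto
    finally show "cnd n I f \<sigma> * cnd n J f \<sigma> = \<dots>" .
  qed
  also have "\<dots> = (\<Sum>\<alpha>\<in>Sym n. \<Sum>\<sigma>\<in>Sym n. \<Sum>\<beta>\<in>Sym n. c * (f \<alpha> * f \<beta>) * (if agree I \<sigma> \<alpha> \<and> agree J \<sigma> \<beta> then 1 else 0))"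
    by (rule sum.swap)
  also have "\<dots> = (\<Sum>\<alpha>\<in>Sym n. \<Sum>\<beta>\<in>Sym n. \<Sum>\<sigma>\<in>Sym n. c * (f \<alpha> * f \<beta>) * (if agree I \<sigma> \<alpha> \<and> agree J \<sigma> \<beta> then 1 else 0))"
    by (intro sum.cong refl sum.swap)
  also have "\<dots> = (\<Sum>\<alpha>\<in>Sym n. \<Sum>\<beta>\<in>Sym n. c * (f \<alpha> * f \<beta>) * real (card {\<sigma>\<in>Sym n. agree I \<sigma> \<alpha> \<and> agree J \<sigma> \<beta>}))"
    unfolding sum_distrib_left[symmetric] by (intro sum.cong refl) (simp add: sum.inter_filter[symmetric])
  also have "\<dots> \<le> (\<Sum>\<alpha>\<in>Sym n. \<Sum>\<beta>\<in>Sym n. c * (f \<alpha> * f \<beta>) * fact (n - b))"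
  proof (intro sum_mono mult_left_mono)
    fix \<alpha> \<beta> assume ab: "\<alpha> \<in> Sym n" "\<beta> \<in> Sym n"
    show "0 \<le> c * (f \<alpha> * f \<beta>)" using f ab by (simp add: c_def)
    have "card {\<sigma>\<in>Sym n. agree I \<sigma> \<alpha> \<and> agree J \<sigma> \<beta>} \<le> fact (n - b)"
    proof (cases "{\<sigma>\<in>Sym n. agree I \<sigma> \<alpha> \<and> agree J \<sigma> \<beta>} = {}")
      case False
      then obtain \<omega> where w: "\<omega> \<in> Sym n" "agree I \<omega> \<alpha>" "agree J \<omega> \<beta>" by blast
      have "{\<sigma>\<in>Sym n. agree I \<sigma> \<alpha> \<and> agree J \<sigma> \<beta>} \<subseteq> {\<sigma>\<in>Sym n. agree (I \<union> J) \<omega> \<sigma>}" using w by (auto simp: agree_def)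
      then have "card {\<sigma>\<in>Sym n. agree I \<sigma> \<alpha> \<and> agree J \<sigma> \<beta>} \<le> card {\<sigma>\<in>Sym n. agree (I \<union> J) \<omega> \<sigma>}" by (rule card_mono[rotated]) simp
      then show ?thesis using card_agree[OF w(1), of "I \<union> J"] I by simp
    next
      case True
      then show ?thesis by (simp only: card.empty zero_le)
    qed
    then show "real (card {\<sigma>\<in>Sym n. agree I \<sigma> \<alpha> \<and> agree J \<sigma> \<beta>}) \<le> fact (n - b)" by (metis of_nat_fact of_nat_le_iff)
  qed
  also have "\<dots> = fact (n - b) / (fact (n - a))\<^sup>2 * (\<Sum>\<sigma>\<in>Sym n. f \<sigma>)\<^sup>2"
    unfolding power2_eq_square[of "sum f (Sym n)"] sum_product sum_distrib_left[of "fact (n - b) / (fact (n - a))\<^sup>2"]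
    by (intro sum.cong refl) (simp add: c_def)
  finally show ?thesis .
qed


lemma disjoint_injections:
  assumes "finite I" "finite E" "k * card I \<le> card E"
  shows "\<exists>u :: nat \<Rightarrow> 'i \<Rightarrow> 'e. (\<forall>b<k. \<forall>i\<in>I. u b i \<in> E) \<and> (\<forall>b<k. \<forall>b'<k. \<forall>i\<in>I. \<forall>i'\<in>I. u b i = u b' i' \<longrightarrow> b = b' \<and> i = i')"
proof -
  obtain w where w: "w ` ({..<k} \<times> I) \<subseteq> E" "inj_on w ({..<k} \<times> I)"
    using card_le_inj[of "{..<k} \<times> I" E] assms by (auto simp: card_cartesian_product)
  show ?thesis
  proof (intro exI[of _ "\<lambda>b i. w (b, i)"] conjI allI ballI impI)
    show "w (b, i) \<in> E" if "b < k" "i \<in> I" for b i using w(1) that by auto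
    fix b b' i i' assume "b < k" "b' < k" "i \<in> I" "i' \<in> I" "w (b, i) = w (b', i')"
    then show "b = b'" "i = i'" using inj_onD[OF w(2), of "(b, i)" "(b', i')"] by auto
  qed
qed

text \<open>Everything can be read off from \<open>\<omega> = \<sigma> \<circ> exch S (u b)\<close>.
  \<open>S\<close> is the set of points of \<open>I\<close> where \<open>\<omega>\<close> differs
  from \<open>\<sigma>0\<close>. For \<open>i\<close> in \<open>S\<close> the value
  \<open>\<sigma>0 i\<close> sits at position \<open>u b i\<close>, which identifies
  \<open>b\<close>; this is why \<open>S\<close> must be nonempty. Undoing the exchange gives
  \<open>\<sigma>\<close>.\<close>

lemma inj_on_exchange:
  fixes u :: "nat \<Rightarrow> nat \<Rightarrow> nat"
  assumes s0: "\<sigma>0 \<in> Sym n" and I: "I \<subseteq> {1..n}" and u1: "\<And>b i. b < k \<Longrightarrow> i \<in> I \<Longrightarrow> u b i \<in> {1..n} - I"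
    and u2: "\<And>b b' i i'. b < k \<Longrightarrow> b' < k \<Longrightarrow> i \<in> I \<Longrightarrow> i' \<in> I \<Longrightarrow> u b i = u b' i' \<Longrightarrow> b = b' \<and> i = i'"
  shows "inj_on (\<lambda>(b, \<sigma>, S). \<sigma> \<circ> exch S (u b)) ({..<k} \<times> {\<sigma>. \<sigma> \<in> Sym n \<and> agree I \<sigma>0 \<sigma>} \<times> (Pow I - {{}}))"
proof (rule inj_onI)
  have ex: "exch S (u b) (u b i) = i" "exch S (u b) i = u b i" if "b < k" "S \<subseteq> I" "i \<in> S" for b S i
  proof -
    have "inj_on (u b) S" using u2[OF that(1) that(1)] that(2) by (meson inj_onI subsetD)
    moreover have "u b i \<notin> S" using u1[OF that(1), of i] that(2,3) by blast
    ultimately show "exch S (u b) (u b i) = i" "exch S (u b) i = u b i" using that(3) by (simp_all add: exch_def)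
  qed
  have out: "exch S (u b) i = i" if "b < k" "S \<subseteq> I" "i \<in> I - S" for b S i
    using u1[OF that(1)] that(2,3) by (auto simp: exch_def)
  have val: "S = {i\<in>I. (\<sigma> \<circ> exch S (u b)) i \<noteq> \<sigma>0 i}" if "b < k" "\<sigma> \<in> Sym n" "agree I \<sigma>0 \<sigma>" "S \<subseteq> I" for b \<sigma> S
  proof -
    have "(\<sigma> \<circ> exch S (u b)) i \<noteq> \<sigma>0 i \<longleftrightarrow> i \<in> S" if i: "i \<in> I" for i
    proof (cases "i \<in> S")
      case True
      have "u b i \<noteq> i" using u1[OF \<open>b < k\<close> i] i by auto
      moreover have "inj \<sigma>" using \<open>\<sigma> \<in> Sym n\<close> by (simp add: Sym_def permutes_inj)
      ultimately have "\<sigma> (u b i) \<noteq> \<sigma> i" by (simp add: inj_eq)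
      then show ?thesis using True ex(2)[OF \<open>b < k\<close> \<open>S \<subseteq> I\<close> True] \<open>agree I \<sigma>0 \<sigma>\<close> i by (simp add: agree_def)
    next
      case False
      then show ?thesis using out[OF \<open>b < k\<close> \<open>S \<subseteq> I\<close>, of i] i \<open>agree I \<sigma>0 \<sigma>\<close> by (simp add: agree_def)
    qed
    then show ?thesis using \<open>S \<subseteq> I\<close> by blast
  qed
  fix x y
  assume x: "x \<in> {..<k} \<times> {\<sigma>. \<sigma> \<in> Sym n \<and> agree I \<sigma>0 \<sigma>} \<times> (Pow I - {{}})"
    and y: "y \<in> {..<k} \<times> {\<sigma>. \<sigma> \<in> Sym n \<and> agree I \<sigma>0 \<sigma>} \<times> (Pow I - {{}})"
    and xy: "(case x of (b, \<sigma>, S) \<Rightarrow> \<sigma> \<circ> exch S (u b)) = (case y of (b, \<sigma>, S) \<Rightarrow> \<sigma> \<circ> exch S (u b))"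
  obtain b \<sigma> S b' \<sigma>' S' where eqs: "x = (b, \<sigma>, S)" "y = (b', \<sigma>', S')" by (metis prod_cases3)
  then have b: "b \<in> {..<k}" "b' \<in> {..<k}" and s: "\<sigma> \<in> Sym n" "agree I \<sigma>0 \<sigma>" "\<sigma>' \<in> Sym n" "agree I \<sigma>0 \<sigma>'"
    and S: "S \<subseteq> I" "S \<noteq> {}" "S' \<subseteq> I" and eq: "\<sigma> \<circ> exch S (u b) = \<sigma>' \<circ> exch S' (u b')"
    using x y xy by auto
  have SS: "S = S'" using val[of b \<sigma> S] val[of b' \<sigma>' S'] b s S eq by simp
  obtain i where i: "i \<in> S" using S by blast
  have iI: "i \<in> I" using i S by blast
  define \<omega> where "\<omega> = \<sigma> \<circ> exch S (u b)"
  have inv: "inj_on (u c) S" "u c ` S \<inter> S = {}" "S \<subseteq> {1..n}" "u c ` S \<subseteq> {1..n}" if "c < k" for c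
    using u2[OF that that] u1[OF that] S(1) I by (auto simp: inj_on_def)
  have perm: "exch S (u c) permutes {1..n}" if "c < k" for c by (rule exch_permutes[OF inv[OF that]])
  have "\<omega> (u b i) = \<sigma>0 i" using ex(1)[of b S i] b S i iI s by (simp add: \<omega>_def agree_def)
  moreover have "\<omega> (u b' i) = \<sigma>0 i" unfolding \<omega>_def eq using ex(1)[of b' S' i] b S i iI s SS by (simp add: agree_def)
  moreover have "\<omega> \<in> Sym n" unfolding \<omega>_def using s(1) perm[of b] b by (intro Sym_comp) (auto simp: Sym_def)
  then have "inj \<omega>" by (simp add: Sym_def permutes_inj)
  ultimately have "u b i = u b' i" by (metis injD)
  then have bb: "b = b'" using u2 b iI by blast
  have "exch S (u b) \<circ> exch S (u b) = id" using exch_exch[OF inv(1,2)] b by auto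
  then have "\<sigma> = \<sigma>'" using eq unfolding SS[symmetric] bb[symmetric] by (metis comp_assoc comp_id)
  then show "x = y" using bb SS eqs by simp
qed

text \<open>On the coset \<open>f\<close> is close to two conditional expectations given disjoint
  sets of further coordinates, and these are almost independent, so \<open>f\<close> has little
  variance there. With \<open>a\<close> elements in a coset of size \<open>F\<close>,
  \<open>\<kappa>\<close> is about \<open>1 / F\<close> and the left side about
  \<open>m * a * (1 - a / F)\<close>. The last error term has no factor \<open>m\<close>, because
  the exchanged permutations are all distinct.\<close>

lemma coset_full:
  fixes f g :: "(nat \<Rightarrow> nat) \<Rightarrow> real"
  assumes f: "\<And>\<sigma>. \<sigma> \<in> Sym n \<Longrightarrow> f \<sigma> = 0 \<or> f \<sigma> = 1" and g: "lowdeg n t g"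
    and I: "I \<in> ksets n t" and s0: "\<sigma>0 \<in> Sym n" and m: "2 * m * t + t \<le> n"
  defines "T \<equiv> {\<sigma>. \<sigma> \<in> Sym n \<and> agree I \<sigma>0 \<sigma>}"
  shows "real m * (sum f T - fact (n - 3 * t) / (fact (n - 2 * t))\<^sup>2 * (sum f T)\<^sup>2)
    \<le> 3 * real m * (\<Sum>\<sigma>\<in>T. min 1 (2 ^ t * (f \<sigma> - g \<sigma>)\<^sup>2)) + 3 / 2 * 2 ^ t * (\<Sum>\<sigma>\<in>Sym n. (g \<sigma>)\<^sup>2)"
proof -
  define \<kappa> :: real where "\<kappa> = fact (n - 3 * t) / (fact (n - 2 * t))\<^sup>2"
  define k where "k = 2 * m"
  define a where "a = sum f T"
  have finI: "finite I" and In: "I \<subseteq> {1..n}" and cI: "card I = t" using ksets_sub[OF I] by auto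
  have "k * card I \<le> card ({1..n} - I)" using m by (simp add: card_compl[OF In] cI k_def)
  then obtain u where u1: "\<And>b i. b < k \<Longrightarrow> i \<in> I \<Longrightarrow> u b i \<in> {1..n} - I"
    and u2: "\<And>b b' i i'. b < k \<Longrightarrow> b' < k \<Longrightarrow> i \<in> I \<Longrightarrow> i' \<in> I \<Longrightarrow> u b i = u b' i' \<Longrightarrow> b = b' \<and> i = i'"
    using disjoint_injections[OF finI, of "{1..n} - I" k] by (metis finite_Diff finite_atLeastAtMost)
  define f1 where "f1 = (\<lambda>\<sigma>. if agree I \<sigma>0 \<sigma> then f \<sigma> else 0)"
  define h where "h b = cnd n (I \<union> u b ` I) f1" for b
  define q where "q b = fact n * nsq n (\<lambda>\<sigma>. f1 \<sigma> - h b \<sigma>)" for b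
  define R where "R = (\<Sum>\<sigma>\<in>T. min 1 (2 ^ t * (f \<sigma> - g \<sigma>)\<^sup>2))"
  define Z where "Z b = (\<Sum>\<sigma>\<in>T. \<Sum>S\<in>Pow I - {{}}. (g (\<sigma> \<circ> exch S (u b)))\<^sup>2)" for b
  have ui: "inj_on (u b) I" "u b ` I \<subseteq> {1..n} - I" if "b < k" for b
    using u1[OF that] u2[OF that that] by (auto simp: inj_on_def)
  have q: "q b \<le> R + 2 ^ t * Z b" if "b < k" for b
    unfolding q_def h_def f1_def R_def Z_def T_def by (rule coset_block[OF f g I ui[OF that] s0])
  have sf1: "(\<Sum>\<sigma>\<in>Sym n. f1 \<sigma>) = a" unfolding a_def T_def f1_def by (rule sum.inter_filter[symmetric]) simp
  have nf1: "fact n * nsq n f1 = a"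
  proof -
    have "fact n * nsq n f1 = (\<Sum>\<sigma>\<in>Sym n. f1 \<sigma> * f1 \<sigma>)" by (simp add: ip_def)
    also have "\<dots> = (\<Sum>\<sigma>\<in>Sym n. f1 \<sigma>)" using f by (intro sum.cong refl) (auto simp: f1_def)
    finally show ?thesis using sf1 by simp
  qed
  \<comment> \<open>The constant 3/2: passing from \<open>2 * nsq n f1\<close> to the norms of the
    two conditional expectations costs one copy of the errors, their mutual distance two more, and
    the result is halved.\<close>
  have pair: "a - \<kappa> * a\<^sup>2 \<le> 3 / 2 * (q b + q b')" if b: "b < k" "b' < k" "b \<noteq> b'" for b b'
  proof -
    have nh: "nsq n (\<lambda>\<sigma>. f1 \<sigma> - h c \<sigma>) = nsq n f1 - nsq n (h c)" for c
      unfolding h_def by (rule nsq_minus_av) auto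
    have "nsq n (\<lambda>\<sigma>. (f1 \<sigma> - h b' \<sigma>) - (f1 \<sigma> - h b \<sigma>)) \<le> 2 * nsq n (\<lambda>\<sigma>. f1 \<sigma> - h b' \<sigma>) + 2 * nsq n (\<lambda>\<sigma>. f1 \<sigma> - h b \<sigma>)"
      by (rule nsq_diff_le)
    then have "nsq n (h b) - 2 * ip n (h b) (h b') + nsq n (h b') \<le> 2 * nsq n (\<lambda>\<sigma>. f1 \<sigma> - h b' \<sigma>) + 2 * nsq n (\<lambda>\<sigma>. f1 \<sigma> - h b \<sigma>)"
      by (simp add: nsq_diff[symmetric])
    then have "2 * nsq n f1 - 2 * ip n (h b) (h b') \<le> 3 * (nsq n (\<lambda>\<sigma>. f1 \<sigma> - h b' \<sigma>) + nsq n (\<lambda>\<sigma>. f1 \<sigma> - h b \<sigma>))"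
      using nh[of b] nh[of b'] by simp
    then have "fact n * (2 * nsq n f1 - 2 * ip n (h b) (h b')) \<le> fact n * (3 * (nsq n (\<lambda>\<sigma>. f1 \<sigma> - h b' \<sigma>) + nsq n (\<lambda>\<sigma>. f1 \<sigma> - h b \<sigma>)))"
      by (rule mult_left_mono) simp
    then have le: "2 * a - 2 * (fact n * ip n (h b) (h b')) \<le> 3 * (q b + q b')" using nf1 by (simp add: q_def algebra_simps)
    have c2: "card (I \<union> u c ` I) = 2 * t" if "c < k" for c
    proof -
      have "I \<inter> u c ` I = {}" using ui(2)[OF that] by blast
      then show ?thesis
        using card_Un_disjoint[OF finI finite_imageI[OF finI], of "u c"] card_image[OF ui(1)[OF that]] cI by simp
    qed
    have "u b ` I \<inter> (I \<union> u b' ` I) = {}" using u2 b ui[OF b(1)] by auto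
    then have "card (u b ` I \<union> (I \<union> u b' ` I)) = 3 * t"
      using card_Un_disjoint[of "u b ` I" "I \<union> u b' ` I"] finI c2[OF b(2)] card_image[OF ui(1)[OF b(1)]] cI by simp
    then have c3: "card ((I \<union> u b ` I) \<union> (I \<union> u b' ` I)) = 3 * t" by (simp add: Un_ac)
    have "0 \<le> f1 \<sigma>" if "\<sigma> \<in> Sym n" for \<sigma> using f[OF that] by (auto simp: f1_def)
    then have "fact n * ip n (h b) (h b') \<le> \<kappa> * a\<^sup>2"
      unfolding h_def \<kappa>_def sf1[symmetric]
      using In ui[OF b(1)] ui[OF b(2)] by (intro near_independence c2 c3 b) auto
    then show ?thesis using le by simp
  qed
  have "real m * (a - \<kappa> * a\<^sup>2) = (\<Sum>b<m. a - \<kappa> * a\<^sup>2)" by simp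
  also have "\<dots> \<le> (\<Sum>b<m. 3 / 2 * (q (2 * b) + q (Suc (2 * b))))"
    by (intro sum_mono pair) (auto simp: k_def)
  also have "\<dots> = 3 / 2 * (\<Sum>b<k. q b)"
    unfolding k_def by (induction m) (simp_all add: algebra_simps)
  also have "\<dots> \<le> 3 / 2 * (\<Sum>b<k. R + 2 ^ t * Z b)" using q by (intro mult_left_mono sum_mono) auto
  also have "\<dots> = 3 * real m * R + 3 / 2 * 2 ^ t * (\<Sum>b<k. Z b)" unfolding sum.distrib sum_distrib_left[symmetric] by (simp add: k_def algebra_simps)
  also have "(\<Sum>b<k. Z b) \<le> (\<Sum>\<sigma>\<in>Sym n. (g \<sigma>)\<^sup>2)"
  proof -
    define X where "X = {..<k} \<times> T \<times> (Pow I - {{}})"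
    have inj: "inj_on (\<lambda>(b, \<sigma>, S). \<sigma> \<circ> exch S (u b)) X"
      unfolding X_def T_def by (rule inj_on_exchange[OF s0 In u1 u2])
    have "(\<Sum>b<k. Z b) = (\<Sum>x\<in>X. (g (case x of (b, \<sigma>, S) \<Rightarrow> \<sigma> \<circ> exch S (u b)))\<^sup>2)"
      unfolding Z_def X_def by (simp add: sum.cartesian_product case_prod_unfold)
    also have "\<dots> = (\<Sum>\<omega>\<in>(\<lambda>(b, \<sigma>, S). \<sigma> \<circ> exch S (u b)) ` X. (g \<omega>)\<^sup>2)"
      by (subst sum.reindex[OF inj]) simp
    also have "\<dots> \<le> (\<Sum>\<sigma>\<in>Sym n. (g \<sigma>)\<^sup>2)"
    proof (rule sum_mono2)
      show "(\<lambda>(b, \<sigma>, S). \<sigma> \<circ> exch S (u b)) ` X \<subseteq> Sym n"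
      proof clarify
        fix b \<sigma> S assume x: "(b, \<sigma>, S) \<in> X"
        then have b: "b < k" and s: "\<sigma> \<in> Sym n" and S: "S \<subseteq> I" by (auto simp: X_def T_def)
        have "exch S (u b) permutes {1..n}"
          using ui[OF b] S In by (intro exch_permutes) (auto intro: inj_on_subset)
        then show "\<sigma> \<circ> exch S (u b) \<in> Sym n" using s by (intro Sym_comp) (auto simp: Sym_def)
      qed
    qed auto
    finally show ?thesis .
  qed
  finally show ?thesis by (simp add: a_def \<kappa>_def R_def)
qed

section \<open>Families of \<open>t\<close>-cosets and their overlaps\<close>

lemma t_cosetsE:
  assumes "T \<in> t_cosets n t"
  obtains I \<sigma> where "I \<in> ksets n t" "\<sigma> \<in> Sym n" "T = {\<tau>. \<tau> \<in> Sym n \<and> agree I \<sigma> \<tau>}"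
proof -
  obtain I J where T: "T = t_coset n I J" and I: "I \<in> tuples n t" and J: "J \<in> tuples n t"
    using assms by (auto simp: t_cosets_def)
  have li: "length I = t" "distinct I" "set I \<subseteq> {1..n}" and lj: "length J = t" "distinct J" "set J \<subseteq> {1..n}"
    using I J by (auto simp: tuples_def)
  define f where "f x = J ! inv_into {..<t} ((!) I) x" for x
  have injI: "inj_on ((!) I) {..<t}" using li by (intro inj_on_nth) auto
  have setI: "set I = (!) I ` {..<t}" using li(1) by (auto simp: set_conv_nth)
  have f: "f (I ! k) = J ! k" if "k < t" for k using injI that by (simp add: f_def)
  have "inj_on f (set I)"
    unfolding setI
  proof (rule inj_onI)
    fix x y assume "x \<in> (!) I ` {..<t}" "y \<in> (!) I ` {..<t}" and e: "f x = f y"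
    then obtain k l where k: "k < t" "x = I ! k" and l: "l < t" "y = I ! l" by auto
    then have "J ! k = J ! l" using e f by simp
    then show "x = y" using k l lj nth_eq_iff_index_eq[of J k l] by simp
  qed
  moreover have "f ` set I \<subseteq> {1..n}" using f lj unfolding setI by (auto simp: subset_iff)
  ultimately obtain p where p: "p permutes {1..n}" "\<forall>x\<in>set I. p x = f x"
    using permutation_extension[of f "set I" "{1..n}"] li(3) by auto
  show ?thesis
  proof
    show "set I \<in> ksets n t" using li by (auto simp: ksets_def distinct_card)
    show "p \<in> Sym n" using p by (simp add: Sym_def)
    show "T = {\<tau>. \<tau> \<in> Sym n \<and> agree (set I) p \<tau>}"
      unfolding T t_coset_def agree_def li(1) setI using p(2) f li(1) by (auto simp: setI)
  qed
qed

lemma t_cosetsI: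
  assumes I: "I \<in> ksets n t" and s: "\<sigma> \<in> Sym n"
  shows "{\<tau>. \<tau> \<in> Sym n \<and> agree I \<sigma> \<tau>} \<in> t_cosets n t"
proof -
  define L where "L = sorted_list_of_set I"
  have L: "set L = I" "distinct L" "length L = t"
    using ksets_sub[OF I] by (auto simp: L_def distinct_card[symmetric])
  have p: "\<sigma> permutes {1..n}" using s by (simp add: Sym_def)
  have "L \<in> tuples n t" using L ksets_sub(1)[OF I] by (simp add: tuples_def)
  moreover have "map \<sigma> L \<in> tuples n t"
    using L ksets_sub(1)[OF I] permutes_image[OF p] permutes_inj_on[OF p] by (auto simp: tuples_def distinct_map)
  moreover have "{\<tau>. \<tau> \<in> Sym n \<and> agree I \<sigma> \<tau>} = t_coset n L (map \<sigma> L)"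
    using L by (auto simp: t_coset_def agree_def L(1)[symmetric] set_conv_nth)
  ultimately show ?thesis unfolding t_cosets_def by blast
qed

lemma t_coset_sub: "T \<in> t_cosets n t \<Longrightarrow> T \<subseteq> Sym n"
  by (auto simp: t_cosets_def t_coset_def)

lemma finite_t_cosets: "finite (t_cosets n t)"
  by (rule finite_subset[of _ "Pow (Sym n)"]) (use t_coset_sub in auto)

lemma finite_t_coset: "T \<in> t_cosets n t \<Longrightarrow> finite T"
  using t_coset_sub finite_Sym finite_subset by metis

lemma card_t_coset: "T \<in> t_cosets n t \<Longrightarrow> card T = fact (n - t)"
  by (metis t_cosetsE card_agree ksets_sub(1,2))

text \<open>Distinct cosets that meet must fix different sets of positions, so their common elements
  are prescribed at \<open>t + 1\<close> or more positions.\<close>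

lemma card_t_coset_Int:
  assumes T: "T \<in> t_cosets n t" "T' \<in> t_cosets n t" "T \<noteq> T'"
  shows "card (T \<inter> T') \<le> fact (n - t - 1)"
proof (cases "T \<inter> T' = {}")
  case False
  obtain I \<sigma> where I: "I \<in> ksets n t" "\<sigma> \<in> Sym n" "T = {\<tau>. \<tau> \<in> Sym n \<and> agree I \<sigma> \<tau>}" using t_cosetsE[OF T(1)] .
  obtain J \<rho> where J: "J \<in> ksets n t" "\<rho> \<in> Sym n" "T' = {\<tau>. \<tau> \<in> Sym n \<and> agree J \<rho> \<tau>}" using t_cosetsE[OF T(2)] .
  obtain \<omega> where w: "\<omega> \<in> Sym n" "agree I \<sigma> \<omega>" "agree J \<rho> \<omega>" using False I J by auto
  have "I \<noteq> J" using T(3) I(3) J(3) w by (auto simp: agree_def)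
  then have "\<not> J \<subseteq> I" using ksets_sub[OF I(1)] ksets_sub[OF J(1)] by (metis card_subset_eq)
  then have "card I < card (I \<union> J)" using ksets_sub(3)[OF I(1)] ksets_sub(3)[OF J(1)] by (intro psubset_card_mono) auto
  then have c: "n - card (I \<union> J) \<le> n - t - 1" using ksets_sub(2)[OF I(1)] by simp
  have "T \<inter> T' \<subseteq> {\<tau>\<in>Sym n. agree (I \<union> J) \<omega> \<tau>}" using w I(3) J(3) by (auto simp: agree_def)
  then have "card (T \<inter> T') \<le> card {\<tau>\<in>Sym n. agree (I \<union> J) \<omega> \<tau>}" by (rule card_mono[rotated]) simp
  also have "\<dots> = fact (n - card (I \<union> J))"
    using ksets_sub(1)[OF I(1)] ksets_sub(1)[OF J(1)] by (intro card_agree[OF w(1)]) auto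
  also have "\<dots> \<le> fact (n - t - 1)" using c by (rule fact_mono)
  finally show ?thesis .
qed simp

lemma Union_t_cosets:
  assumes "t \<le> n"
  shows "\<Union>(t_cosets n t) = Sym n"
proof
  show "\<Union>(t_cosets n t) \<subseteq> Sym n" using t_coset_sub by blast
  have "{1..t} \<in> ksets n t" using assms by (auto simp: ksets_def)
  then show "Sym n \<subseteq> \<Union>(t_cosets n t)" using t_cosetsI[of "{1..t}" n t] agree_refl by blast
qed

text \<open>Guarantees later that there are enough cosets to choose \<open>round c\<close> of
  them.\<close>

lemma card_t_cosets_ge:
  assumes "t \<le> n"
  shows "(fact n :: nat) \<le> card (t_cosets n t) * fact (n - t)"
proof -
  have "card (Sym n) \<le> (\<Sum>T\<in>t_cosets n t. card T)"
    unfolding Union_t_cosets[OF assms, symmetric] by (rule card_Union_le_sum_card)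
  also have "\<dots> = card (t_cosets n t) * fact (n - t)" using card_t_coset by simp
  finally show ?thesis by (simp add: card_Sym)
qed

text \<open>The sum of the indicators of the members of \<open>H\<close>. For cosets this has degree
  \<open>t\<close> by construction. It exceeds the indicator of the union by at most
  \<open>m * (m - 1)\<close>, where \<open>m\<close> is its value, and the sum of this quantity is
  controlled by pairwise overlaps.\<close>

definition cover_count :: "'a set set \<Rightarrow> 'a \<Rightarrow> real" where
  "cover_count H \<sigma> = real (card {T\<in>H. \<sigma> \<in> T})"

lemma cover_count_sum: "finite H \<Longrightarrow> cover_count H \<sigma> = (\<Sum>T\<in>H. if \<sigma> \<in> T then 1 else 0)"
  by (simp add: cover_count_def sum.inter_filter[symmetric])

lemma cover_count_pairs_nonneg: "0 \<le> cover_count H \<sigma> * (cover_count H \<sigma> - 1)"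
proof -
  have "cover_count H \<sigma> = 0 \<or> cover_count H \<sigma> \<ge> 1" by (auto simp: cover_count_def)
  then show ?thesis by (auto simp: cover_count_def)
qed

lemma sum_cover_count:
  assumes "finite H" "finite X"
  shows "(\<Sum>\<sigma>\<in>X. cover_count H \<sigma>) = (\<Sum>T\<in>H. real (card (X \<inter> T)))"
proof -
  have "(\<Sum>\<sigma>\<in>X. cover_count H \<sigma>) = (\<Sum>T\<in>H. \<Sum>\<sigma>\<in>X. if \<sigma> \<in> T then 1 else 0)"
    unfolding cover_count_sum[OF assms(1)] by (rule sum.swap)
  also have "\<dots> = (\<Sum>T\<in>H. real (card (X \<inter> T)))"
    using assms(2) by (intro sum.cong refl) (simp add: sum.inter_filter[symmetric] Int_def)
  finally show ?thesis .
qed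

text \<open>\<open>m * (m - 1)\<close> is the number of ordered pairs of distinct members of
  \<open>H\<close> that contain the point.\<close>

lemma sum_cover_count_pairs:
  assumes H: "H \<subseteq> t_cosets n t"
  shows "(\<Sum>\<sigma>\<in>Sym n. cover_count H \<sigma> * (cover_count H \<sigma> - 1)) \<le> (real (card H))\<^sup>2 * fact (n - t - 1)"
proof -
  have fin: "finite H" using finite_subset[OF H finite_t_cosets] .
  have "cover_count H \<sigma> * (cover_count H \<sigma> - 1) = (\<Sum>T\<in>H. \<Sum>T'\<in>H. if T \<noteq> T' \<and> \<sigma> \<in> T \<inter> T' then 1 else 0)" for \<sigma>
  proof -
    have "(\<Sum>T'\<in>H. if T \<noteq> T' \<and> \<sigma> \<in> T \<inter> T' then 1 else 0) = (if \<sigma> \<in> T then 1 else 0) * (cover_count H \<sigma> - 1)" if T: "T \<in> H" for T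
    proof (cases "\<sigma> \<in> T")
      case True
      have "cover_count H \<sigma> = 1 + (\<Sum>T'\<in>H - {T}. if \<sigma> \<in> T' then 1 else 0)"
        unfolding cover_count_sum[OF fin] using True by (subst sum.remove[OF fin T]) simp
      moreover have "(\<Sum>T'\<in>H. if T \<noteq> T' \<and> \<sigma> \<in> T \<inter> T' then 1 else 0) = (\<Sum>T'\<in>H - {T}. if \<sigma> \<in> T' then 1 else 0 :: real)"
      proof -
        have "(if T \<noteq> T' \<and> \<sigma> \<in> T \<inter> T' then 1 else 0) = (if \<sigma> \<in> T' then 1 else 0 :: real)" if "T' \<in> H - {T}" for T'
          using that True by auto
        then show ?thesis by (subst sum.remove[OF fin T]) simp
      qed
      ultimately show ?thesis using True by simp
    qed simp
    then have "(\<Sum>T\<in>H. \<Sum>T'\<in>H. if T \<noteq> T' \<and> \<sigma> \<in> T \<inter> T' then 1 else 0) = (\<Sum>T\<in>H. (if \<sigma> \<in> T then 1 else 0) * (cover_count H \<sigma> - 1))"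
      by (intro sum.cong refl) auto
    then show ?thesis unfolding sum_distrib_right[symmetric] cover_count_sum[OF fin, symmetric] by simp
  qed
  then have "(\<Sum>\<sigma>\<in>Sym n. cover_count H \<sigma> * (cover_count H \<sigma> - 1)) = (\<Sum>\<sigma>\<in>Sym n. \<Sum>T\<in>H. \<Sum>T'\<in>H. if T \<noteq> T' \<and> \<sigma> \<in> T \<inter> T' then 1 else 0)" by simp
  also have "\<dots> = (\<Sum>T\<in>H. \<Sum>\<sigma>\<in>Sym n. \<Sum>T'\<in>H. if T \<noteq> T' \<and> \<sigma> \<in> T \<inter> T' then 1 else 0)" by (rule sum.swap)
  also have "\<dots> = (\<Sum>T\<in>H. \<Sum>T'\<in>H. \<Sum>\<sigma>\<in>Sym n. if T \<noteq> T' \<and> \<sigma> \<in> T \<inter> T' then 1 else 0)" by (intro sum.cong refl sum.swap)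
  also have "\<dots> \<le> (\<Sum>T\<in>H. \<Sum>T'\<in>H. fact (n - t - 1))"
  proof (intro sum_mono)
    fix T T' assume TT: "T \<in> H" "T' \<in> H"
    show "(\<Sum>\<sigma>\<in>Sym n. if T \<noteq> T' \<and> \<sigma> \<in> T \<inter> T' then 1 else 0) \<le> (fact (n - t - 1) :: real)"
    proof (cases "T = T'")
      case False
      have "(\<Sum>\<sigma>\<in>Sym n. if T \<noteq> T' \<and> \<sigma> \<in> T \<inter> T' then 1 else 0) = real (card {\<sigma>\<in>Sym n. \<sigma> \<in> T \<inter> T'})"
        using False by (simp add: sum.inter_filter[symmetric])
      also have "{\<sigma>\<in>Sym n. \<sigma> \<in> T \<inter> T'} = T \<inter> T'" using t_coset_sub TT H by blast
      also have "real (card (T \<inter> T')) \<le> fact (n - t - 1)"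
        using card_t_coset_Int[of T n t T'] TT H False by (metis of_nat_fact of_nat_le_iff subsetD)
      finally show ?thesis .
    qed simp
  qed
  also have "\<dots> = (real (card H))\<^sup>2 * fact (n - t - 1)" by (simp add: power2_eq_square)
  finally show ?thesis .
qed

lemma lowdeg_cover_count:
  assumes H: "H \<subseteq> t_cosets n t"
  shows "lowdeg n t (cover_count H)"
proof -
  have fin: "finite H" using finite_subset[OF H finite_t_cosets] .
  have "lowdeg n t (\<lambda>\<sigma>. \<Sum>T\<in>H. if \<sigma> \<in> T then 1 else 0 :: real)"
  proof (rule lowdeg_sum)
    fix T assume "T \<in> H"
    then obtain I \<sigma>0 where I: "I \<in> ksets n t" "\<sigma>0 \<in> Sym n" "T = {\<tau>. \<tau> \<in> Sym n \<and> agree I \<sigma>0 \<tau>}" using H t_cosetsE by blast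
    show "lowdeg n t (\<lambda>\<sigma>. if \<sigma> \<in> T then 1 else 0 :: real)"
      by (rule lowdeg_cong[OF lowdeg_agree[OF I(1), of \<sigma>0]]) (simp add: I(3) agree_sym)
  qed
  then show ?thesis unfolding cover_count_sum[OF fin, abs_def] .
qed

text \<open>\<open>k\<close> heavy cosets cover elements of \<open>A\<close> at least
  \<open>k * F / 2\<close> times. Overlaps account for at most \<open>k * F / 4\<close> of this, and
  the rest is at most \<open>card A = c * F\<close>; so \<open>k \<le> 4 * c\<close>.\<close>

lemma heavy_count:
  fixes c :: real
  assumes A: "A \<subseteq> Sym n" and tn: "t < n" and c: "real (card A) = c * fact (n - t)" and c0: "0 \<le> c"
    and small: "16 * c + 4 \<le> real (n - t)"
    and H: "H \<subseteq> t_cosets n t" "\<And>T. T \<in> H \<Longrightarrow> fact (n - t) \<le> 2 * card (A \<inter> T)"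
  shows "real (card H) \<le> 4 * c"
proof (rule ccontr)
  assume n: "\<not> real (card H) \<le> 4 * c"
  define F :: real where "F = fact (n - t)"
  \<comment> \<open>The overlap bound is quadratic in the number of cosets, so a subfamily just
    above the claimed bound is taken.\<close>
  define k where "k = nat \<lfloor>4 * c\<rfloor> + 1"
  have F0: "0 < F" by (simp add: F_def)
  have k: "4 * c < real k" "real k \<le> 4 * c + 1" using c0 unfolding k_def by linarith+
  have "k \<le> card H" using n c0 unfolding k_def by linarith
  then obtain H' where H': "H' \<subseteq> H" "card H' = k" "finite H'" by (rule obtain_subset_with_card_n)
  have finA: "finite A" using A finite_subset finite_Sym by blast
  have "real k * (F / 2) = (\<Sum>T\<in>H'. F / 2)" using H' by simp
  also have "\<dots> \<le> (\<Sum>T\<in>H'. real (card (A \<inter> T)))"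
  proof (rule sum_mono)
    fix T assume "T \<in> H'"
    then have "real (fact (n - t)) \<le> real (2 * card (A \<inter> T))" using H(2) H'(1) of_nat_le_iff by blast
    then show "F / 2 \<le> real (card (A \<inter> T))" by (simp add: F_def)
  qed
  also have "\<dots> = (\<Sum>\<sigma>\<in>A. cover_count H' \<sigma>)" using sum_cover_count[OF H'(3) finA] by simp
  also have "\<dots> \<le> (\<Sum>\<sigma>\<in>A. 1 + cover_count H' \<sigma> * (cover_count H' \<sigma> - 1))"
  proof (rule sum_mono)
    fix \<sigma>
    have "0 \<le> (cover_count H' \<sigma> - 1)\<^sup>2" by simp
    then show "cover_count H' \<sigma> \<le> 1 + cover_count H' \<sigma> * (cover_count H' \<sigma> - 1)" by (simp add: power2_eq_square algebra_simps)
  qed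
  also have "\<dots> = c * F + (\<Sum>\<sigma>\<in>A. cover_count H' \<sigma> * (cover_count H' \<sigma> - 1))" using c by (simp add: sum.distrib F_def)
  also have "(\<Sum>\<sigma>\<in>A. cover_count H' \<sigma> * (cover_count H' \<sigma> - 1)) \<le> (\<Sum>\<sigma>\<in>Sym n. cover_count H' \<sigma> * (cover_count H' \<sigma> - 1))"
    using A cover_count_pairs_nonneg by (intro sum_mono2) auto
  also have "\<dots> \<le> (real k)\<^sup>2 * fact (n - t - 1)" using sum_cover_count_pairs[of H' n t] H' H(1) by auto
  also have "\<dots> \<le> real k * (F / 4)"
  proof -
    have "F = real (n - t) * fact (n - t - 1)" unfolding F_def using tn by (subst fact_reduce) auto
    moreover have "4 * real k * fact (n - t - 1) \<le> real (n - t) * fact (n - t - 1)"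
      using k small by (intro mult_right_mono) auto
    ultimately have "4 * (real k * fact (n - t - 1)) \<le> F" by simp
    then have "real k * (real k * fact (n - t - 1)) \<le> real k * (F / 4)" by (intro mult_left_mono) auto
    then show ?thesis by (simp add: power2_eq_square)
  qed
  finally have "real k * F \<le> 4 * c * F" by (simp add: algebra_simps)
  then show False using k F0 by simp
qed

text \<open>With \<open>N = n - 3 * t\<close> the quotient is the product of
  \<open>(N + t + i) / (N + i)\<close> over \<open>i = 1, ..., t\<close>, each factor being at most
  \<open>1 + t / (N + 1)\<close>.\<close>

lemma factorial_ratio_bound:
  assumes "6 * t \<le> n" "0 < n"
  shows "fact (n - 3 * t) / (fact (n - 2 * t))\<^sup>2 * fact (n - t) \<le> 1 + 2 ^ t * (2 * real t / real n)"
proof -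
  define N where "N = n - 3 * t"
  define x where "x = real t / (real N + 1)"
  have x0: "0 \<le> x" by (simp add: x_def)
  have "fact (N + t + j) * fact N \<le> (1 + x) ^ j * (fact (N + j) * fact (N + t) :: real)" if "j \<le> t" for j
    using that
  proof (induction j)
    case (Suc j)
    have "real (N + t + Suc j) = (1 + real t / real (N + Suc j)) * real (N + Suc j)" by (simp add: field_simps)
    also have "\<dots> \<le> (1 + x) * real (N + Suc j)"
      unfolding x_def by (intro mult_right_mono add_left_mono divide_left_mono) auto
    finally have s: "real (N + t + Suc j) \<le> (1 + x) * real (N + Suc j)" .
    have "fact (N + t + Suc j) * fact N = real (N + t + Suc j) * (fact (N + t + j) * fact N)" by simp
    also have "\<dots> \<le> ((1 + x) * real (N + Suc j)) * ((1 + x) ^ j * (fact (N + j) * fact (N + t)))"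
      using s Suc.IH Suc.prems x0 by (intro mult_mono[OF s]) auto
    also have "\<dots> = (1 + x) ^ Suc j * (fact (N + Suc j) * fact (N + t))" by (simp add: algebra_simps)
    finally show ?case .
  qed simp
  from this[of t] have "fact (N + t + t) * fact N \<le> (1 + x) ^ t * (fact (N + t) * fact (N + t) :: real)" by simp
  moreover have "N + t + t = n - t" "N + t = n - 2 * t" using assms by (auto simp: N_def)
  ultimately have "fact (n - t) * fact (n - 3 * t) \<le> (1 + x) ^ t * (fact (n - 2 * t))\<^sup>2" by (simp add: N_def power2_eq_square)
  then have "fact (n - 3 * t) / (fact (n - 2 * t))\<^sup>2 * fact (n - t) \<le> (1 + x) ^ t" by (simp add: field_simps)
  also have "\<dots> \<le> (1 + 2 * real t / real n) ^ t"
  proof (rule power_mono)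
    have "real n \<le> 2 * (real N + 1)" using assms by (simp add: N_def of_nat_diff)
    then have "real t * real n \<le> real t * (2 * (real N + 1))" by (intro mult_left_mono) auto
    then have "x \<le> 2 * real t / real n" using assms by (simp add: x_def divide_simps) (simp add: algebra_simps)
    then show "1 + x \<le> 1 + 2 * real t / real n" by simp
  qed (use x0 in simp)
  also have "\<dots> \<le> 1 + 2 ^ t * (2 * real t / real n)"
  proof -
    have "(1 + y) ^ j \<le> 1 + (2 ^ j - 1) * y" if y: "0 \<le> y" "y \<le> 1" for y :: real and j
    proof (induction j)
      case (Suc j)
      have "(1 + y) ^ Suc j \<le> (1 + y) * (1 + (2 ^ j - 1) * y)" using Suc y by (simp add: mult_left_mono)
      also have "\<dots> = 1 + y + (2 ^ j - 1) * y + (2 ^ j - 1) * (y * y)" by (simp add: algebra_simps)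
      also have "\<dots> \<le> 1 + y + (2 ^ j - 1) * y + (2 ^ j - 1) * (y * 1)"
        using y by (intro add_left_mono mult_left_mono) auto
      finally show ?case by (simp add: algebra_simps)
    qed simp
    from this[of "2 * real t / real n" t] have "(1 + 2 * real t / real n) ^ t \<le> 1 + (2 ^ t - 1) * (2 * real t / real n)"
      using assms by simp
    also have "\<dots> \<le> 1 + 2 ^ t * (2 * real t / real n)" by (intro add_left_mono mult_right_mono) auto
    finally show ?thesis .
  qed
  finally show ?thesis .
qed

lemma sum_indicator_real:
  assumes "finite X"
  shows "(\<Sum>\<sigma>\<in>X. indicator B \<sigma>) = real (card (B \<inter> X))"
  using assms by (simp add: indicator_def Int_commute)

text \<open>A half full coset has \<open>a \<ge> F / 2\<close>, so that
  \<open>F - a \<le> 2 * a * (1 - a / F)\<close>, which up to a small error is what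
  \<open>coset_full\<close> bounds.\<close>

lemma coset_deficit:
  fixes f g :: "(nat \<Rightarrow> nat) \<Rightarrow> real"
  assumes f: "\<And>\<sigma>. \<sigma> \<in> Sym n \<Longrightarrow> f \<sigma> = 0 \<or> f \<sigma> = 1" and g: "lowdeg n t g"
    and T: "T \<in> t_cosets n t" and n: "8 * (t + 1) \<le> n" and heavy: "fact (n - t) \<le> 2 * sum f T"
  shows "fact (n - t) - sum f T \<le> 6 * (\<Sum>\<sigma>\<in>T. min 1 (2 ^ t * (f \<sigma> - g \<sigma>)\<^sup>2))
    + 24 * 2 ^ t * (real t + 1) / real n * (\<Sum>\<sigma>\<in>Sym n. (g \<sigma>)\<^sup>2) + 4 * 2 ^ t * real t / real n * fact (n - t)"
proof -
  obtain I \<sigma>0 where I: "I \<in> ksets n t" "\<sigma>0 \<in> Sym n" "T = {\<tau>. \<tau> \<in> Sym n \<and> agree I \<sigma>0 \<tau>}" using t_cosetsE[OF T] .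
  \<comment> \<open>Small enough for \<open>2 * m * t + t \<le> n\<close>, yet of order
    \<open>n\<close>; dividing by \<open>m\<close> produces the factor \<open>1 / n\<close>.\<close>
  define m where "m = n div (4 * (t + 1))"
  define F :: real where "F = fact (n - t)"
  define a where "a = sum f T"
  define R where "R = (\<Sum>\<sigma>\<in>T. min 1 (2 ^ t * (f \<sigma> - g \<sigma>)\<^sup>2))"
  define W where "W = (\<Sum>\<sigma>\<in>Sym n. (g \<sigma>)\<^sup>2)"
  define \<kappa> :: real where "\<kappa> = fact (n - 3 * t) / (fact (n - 2 * t))\<^sup>2"
  define x where "x = 2 ^ t * (2 * real t / real n)"
  have F0: "0 < F" by (simp add: F_def)
  have n0: "0 < n" using n by simp
  have W0: "0 \<le> W" unfolding W_def by (intro sum_nonneg) auto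
  have m1: "4 * (t + 1) * m \<le> n" unfolding m_def by (rule times_div_less_eq_dividend)
  have m2: "2 \<le> m" unfolding m_def using n by (subst less_eq_div_iff_mult_less_eq) auto
  have "n < 4 * (t + 1) * (m + 1)" unfolding m_def using dividend_less_times_div[of "4 * (t + 1)" n] by (simp add: algebra_simps)
  also have "\<dots> \<le> 4 * (t + 1) * (2 * m)" using m2 by (intro mult_left_mono) auto
  finally have "n \<le> 8 * (t + 1) * m" by (simp add: algebra_simps)
  then have "real n \<le> real (8 * (t + 1) * m)" by (simp only: of_nat_le_iff)
  then have m3: "real n \<le> 8 * (real t + 1) * real m" by simp
  have mt: "2 * m * t + t \<le> n"
  proof -
    have "2 * (2 * m * t) \<le> 4 * (t + 1) * m" by (simp add: algebra_simps)
    then have "2 * (2 * m * t) \<le> n" using m1 by (rule order_trans)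
    moreover have "2 * t \<le> n" using n by simp
    ultimately show ?thesis by simp
  qed
  have main: "real m * (a - \<kappa> * a\<^sup>2) \<le> 3 * real m * R + 3 / 2 * 2 ^ t * W"
    using coset_full[OF f g I(1,2) mt] by (simp add: a_def \<kappa>_def R_def W_def I(3))
  have kF: "\<kappa> * F \<le> 1 + x" unfolding \<kappa>_def F_def x_def using n by (intro factorial_ratio_bound) auto
  have aF: "a \<le> F"
  proof -
    have "a \<le> (\<Sum>\<sigma>\<in>T. 1)" unfolding a_def using f t_coset_sub[OF T] by (intro sum_mono) force
    then show ?thesis using card_t_coset[OF T] by (simp add: F_def)
  qed
  have aF2: "F \<le> 2 * a" using heavy by (simp add: F_def a_def)
  have a0: "0 \<le> a" using aF2 F0 by simp
  have x0: "0 \<le> x" by (simp add: x_def)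
  have lower: "F - a \<le> 2 * (a - \<kappa> * a\<^sup>2) + 2 * x * F"
  proof -
    have "\<kappa> * F * a\<^sup>2 \<le> (1 + x) * a\<^sup>2" using kF by (rule mult_right_mono) simp
    moreover have "x * a\<^sup>2 \<le> x * F\<^sup>2" using x0 aF a0 by (intro mult_left_mono power_mono) auto
    moreover have "(F - a) * F \<le> (F - a) * (2 * a)" using aF aF2 by (intro mult_left_mono) auto
    ultimately have "(F - a) * F \<le> (2 * (a - \<kappa> * a\<^sup>2) + 2 * x * F) * F" by (simp add: power2_eq_square algebra_simps)
    then show ?thesis using F0 by simp
  qed
  have "a - \<kappa> * a\<^sup>2 \<le> 3 * R + 12 * 2 ^ t * (real t + 1) / real n * W"
  proof -
    have mp: "0 < real m" using m2 by simp
    have "a - \<kappa> * a\<^sup>2 \<le> (3 * real m * R + 3 / 2 * 2 ^ t * W) / real m"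
      using main mp by (simp only: pos_le_divide_eq mult.commute[of _ "real m"])
    also have "\<dots> = 3 * R + 3 / 2 * 2 ^ t * W / real m" using mp by (simp add: add_divide_distrib)
    finally have "a - \<kappa> * a\<^sup>2 \<le> 3 * R + 3 / 2 * 2 ^ t * W / real m" .
    moreover have "3 / 2 * 2 ^ t * W / real m \<le> 12 * 2 ^ t * (real t + 1) / real n * W"
    proof -
      have "1 / real m \<le> 8 * (real t + 1) / real n" using m3 mp n0 by (simp add: field_simps)
      then have "(3 / 2 * 2 ^ t * W) * (1 / real m) \<le> (3 / 2 * 2 ^ t * W) * (8 * (real t + 1) / real n)"
        using W0 by (intro mult_left_mono) auto
      also have "\<dots> = 12 * 2 ^ t * (real t + 1) / real n * W" by (simp add: algebra_simps add_divide_distrib)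
      finally show ?thesis by simp
    qed
    ultimately show ?thesis by linarith
  qed
  then show ?thesis using lower unfolding F_def[symmetric] a_def[symmetric] R_def[symmetric] W_def[symmetric] by (simp add: x_def)
qed

text \<open>Pointwise, with \<open>m\<close> the covering number,
  \<open>m * min 1 w \<le> w + m * (m - 1)\<close>: for \<open>m \<le> 1\<close> the first term
  suffices, for \<open>m \<ge> 2\<close> the second.\<close>

lemma sum_cover_count_min:
  fixes w :: "'a \<Rightarrow> real"
  assumes "finite H" "finite X" "\<And>T. T \<in> H \<Longrightarrow> T \<subseteq> X" and w: "\<And>\<sigma>. \<sigma> \<in> X \<Longrightarrow> 0 \<le> w \<sigma>"
  shows "(\<Sum>T\<in>H. \<Sum>\<sigma>\<in>T. min 1 (w \<sigma>)) \<le> (\<Sum>\<sigma>\<in>X. w \<sigma>) + (\<Sum>\<sigma>\<in>X. cover_count H \<sigma> * (cover_count H \<sigma> - 1))"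
proof -
  have "(\<Sum>T\<in>H. \<Sum>\<sigma>\<in>T. min 1 (w \<sigma>)) = (\<Sum>T\<in>H. \<Sum>\<sigma>\<in>X. (if \<sigma> \<in> T then 1 else 0) * min 1 (w \<sigma>))"
  proof (rule sum.cong[OF refl])
    fix T assume "T \<in> H"
    then have "T = {\<sigma>\<in>X. \<sigma> \<in> T}" using assms(3) by blast
    then have "(\<Sum>\<sigma>\<in>T. min 1 (w \<sigma>)) = (\<Sum>\<sigma> | \<sigma> \<in> X \<and> \<sigma> \<in> T. min 1 (w \<sigma>))" by simp
    also have "\<dots> = (\<Sum>\<sigma>\<in>X. if \<sigma> \<in> T then min 1 (w \<sigma>) else 0)" using assms(2) by (rule sum.inter_filter)
    also have "\<dots> = (\<Sum>\<sigma>\<in>X. (if \<sigma> \<in> T then 1 else 0) * min 1 (w \<sigma>))" by (intro sum.cong refl) simp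
    finally show "(\<Sum>\<sigma>\<in>T. min 1 (w \<sigma>)) = (\<Sum>\<sigma>\<in>X. (if \<sigma> \<in> T then 1 else 0) * min 1 (w \<sigma>))" .
  qed
  also have "\<dots> = (\<Sum>\<sigma>\<in>X. \<Sum>T\<in>H. (if \<sigma> \<in> T then 1 else 0) * min 1 (w \<sigma>))" by (rule sum.swap)
  also have "\<dots> = (\<Sum>\<sigma>\<in>X. cover_count H \<sigma> * min 1 (w \<sigma>))" unfolding cover_count_sum[OF assms(1)] sum_distrib_right ..
  also have "\<dots> \<le> (\<Sum>\<sigma>\<in>X. w \<sigma> + cover_count H \<sigma> * (cover_count H \<sigma> - 1))"
  proof (rule sum_mono)
    fix \<sigma> assume s: "\<sigma> \<in> X"
    consider "cover_count H \<sigma> = 0" | "cover_count H \<sigma> = 1" | "cover_count H \<sigma> \<ge> 2"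
    proof -
      have "card {T \<in> H. \<sigma> \<in> T} = 0 \<or> card {T \<in> H. \<sigma> \<in> T} = 1 \<or> card {T \<in> H. \<sigma> \<in> T} \<ge> 2" by linarith
      then show ?thesis using that unfolding cover_count_def by fastforce
    qed
    then show "cover_count H \<sigma> * min 1 (w \<sigma>) \<le> w \<sigma> + cover_count H \<sigma> * (cover_count H \<sigma> - 1)"
    proof cases
      case 3
      then have "cover_count H \<sigma> * min 1 (w \<sigma>) \<le> cover_count H \<sigma> * 1" by (intro mult_left_mono) auto
      also have "\<dots> \<le> cover_count H \<sigma> * (cover_count H \<sigma> - 1)" using 3 by (intro mult_left_mono) auto
      finally show ?thesis using w[OF s] by linarith
    qed (use w[OF s] in auto)
  qed
  finally show ?thesis by (simp add: sum.distrib)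
qed

text \<open>\<open>H\<close> is the family of all half full cosets. Summing
  \<open>coset_deficit\<close> over at most \<open>4 * c\<close> of them turns its terms of order
  \<open>1 / n\<close> into \<open>c / n\<close>, while \<open>sum_cover_count_min\<close> charges
  the approximation error only once.\<close>

lemma heavy_cosets:
  "\<exists>K>0. \<exists>n1. \<forall>n\<ge>n1. \<forall>A g c e. A \<subseteq> Sym n \<longrightarrow> lowdeg n t g \<longrightarrow> real (card A) = c * fact (n - t) \<longrightarrow> 0 \<le> c \<longrightarrow> c \<le> sqrt (real n) \<longrightarrow>
    0 \<le> e \<longrightarrow> e \<le> 1 \<longrightarrow> (\<Sum>\<sigma>\<in>Sym n. (indicator A \<sigma> - g \<sigma>)\<^sup>2) \<le> e * real (card A) \<longrightarrow>
    (\<exists>H\<subseteq>t_cosets n t. (\<forall>T\<in>t_cosets n t - H. 2 * card (A \<inter> T) < fact (n - t)) \<and>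
      (\<Sum>T\<in>H. fact (n - t) - real (card (A \<inter> T))) \<le> K * (e + c / real n) * real (card A) \<and>
      (\<Sum>\<sigma>\<in>Sym n. cover_count H \<sigma> * (cover_count H \<sigma> - 1)) \<le> K * (e + c / real n) * real (card A))"
proof -
  define K1 :: real where "K1 = 24 * 2 ^ t * (real t + 1)"
  define K2 :: real where "K2 = 4 * 2 ^ t * real t"
  define K where "K = 16 * K1 + 16 * K2 + 192 + 6 * 2 ^ t"
  have K12: "0 \<le> K1" "0 \<le> K2" by (auto simp: K1_def K2_def)
  have K: "0 < K" "32 \<le> K" using K12 by (auto simp: K_def intro!: add_nonneg_pos add_increasing)
  have main: "\<exists>H\<subseteq>t_cosets n t. (\<forall>T\<in>t_cosets n t - H. 2 * card (A \<inter> T) < fact (n - t)) \<and>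
      (\<Sum>T\<in>H. fact (n - t) - real (card (A \<inter> T))) \<le> K * (e + c / real n) * real (card A) \<and>
      (\<Sum>\<sigma>\<in>Sym n. cover_count H \<sigma> * (cover_count H \<sigma> - 1)) \<le> K * (e + c / real n) * real (card A)"
    if n: "n \<ge> 8 * (t + 1)" "n \<ge> 40000" and A: "A \<subseteq> Sym n" and g: "lowdeg n t g" and c: "real (card A) = c * fact (n - t)" "0 \<le> c" "c \<le> sqrt (real n)"
      and e: "0 \<le> e" "e \<le> 1" and d: "(\<Sum>\<sigma>\<in>Sym n. (indicator A \<sigma> - g \<sigma>)\<^sup>2) \<le> e * real (card A)" for n A g c e
  proof -
    define F :: real where "F = fact (n - t)"
    define f :: "(nat \<Rightarrow> nat) \<Rightarrow> real" where "f = indicator A"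
    define X where "X = real (card A)"
    define W where "W = (\<Sum>\<sigma>\<in>Sym n. (g \<sigma>)\<^sup>2)"
    define H where "H = {T\<in>t_cosets n t. fact (n - t) \<le> 2 * card (A \<inter> T)}"
    define P where "P = (\<Sum>\<sigma>\<in>Sym n. cover_count H \<sigma> * (cover_count H \<sigma> - 1))"
    have H: "H \<subseteq> t_cosets n t" by (auto simp: H_def)
    have finH: "finite H" using finite_subset[OF H finite_t_cosets] .
    have F0: "0 < F" by (simp add: F_def)
    have n0: "0 < n" "t < n" and nt: "real n \<le> 2 * real (n - t)" using n by auto
    have X0: "0 \<le> X" by (simp add: X_def)
    have XF: "X = c * F" using c by (simp add: X_def F_def)
    have finA: "finite A" using A finite_subset finite_Sym by blast
    have f01: "f \<sigma> = 0 \<or> f \<sigma> = 1" for \<sigma> by (auto simp: f_def indicator_def)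
    have sf: "sum f T = real (card (A \<inter> T))" if "T \<in> H" for T
      unfolding f_def using finite_t_coset[of T n t] that H by (intro sum_indicator_real) auto
    \<comment> \<open>The threshold 40000 gives \<open>sqrt n \<ge> 200\<close>, hence
      \<open>c \<le> sqrt n \<le> n / 200\<close>.\<close>
    have small: "16 * c + 4 \<le> real (n - t)"
    proof -
      have "sqrt 40000 \<le> sqrt (real n)" using n(2) by (intro real_sqrt_le_mono) simp
      moreover have "sqrt 40000 = (200::real)" by (rule real_sqrt_unique) auto
      ultimately have s: "200 \<le> sqrt (real n)" by simp
      then have "200 * sqrt (real n) \<le> sqrt (real n) * sqrt (real n)" by (intro mult_right_mono) auto
      then have "200 * sqrt (real n) \<le> real n" by simp
      then show ?thesis using s c(3) nt by linarith
    qed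
    have cH: "real (card H) \<le> 4 * c"
      by (rule heavy_count[OF A n0(2) c(1,2) small H]) (simp add: H_def)
    have P: "P \<le> 32 * (c / real n) * X"
    proof -
      have F1: "F = real (n - t) * fact (n - t - 1)" unfolding F_def using n0(2) by (subst fact_reduce) auto
      have "real n * fact (n - t - 1) \<le> 2 * real (n - t) * fact (n - t - 1)" using nt by (rule mult_right_mono) simp
      then have "real n * fact (n - t - 1) \<le> 2 * F" unfolding F1 by simp
      then have G: "fact (n - t - 1) \<le> 2 * F / real n" using n0 by (simp add: field_simps)
      have "P \<le> (real (card H))\<^sup>2 * fact (n - t - 1)" unfolding P_def by (rule sum_cover_count_pairs[OF H])
      also have "\<dots> \<le> (4 * c)\<^sup>2 * (2 * F / real n)" using cH G by (intro mult_mono power_mono) auto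
      also have "\<dots> = 32 * (c / real n) * X" unfolding XF by (simp add: power2_eq_square)
      finally show ?thesis .
    qed
    have W: "W \<le> 4 * X"
    proof -
      have "W \<le> (\<Sum>\<sigma>\<in>Sym n. 2 * f \<sigma> + 2 * (f \<sigma> - g \<sigma>)\<^sup>2)"
        unfolding W_def
      proof (rule sum_mono)
        fix \<sigma>
        have "0 \<le> (2 * f \<sigma> - g \<sigma>)\<^sup>2" by simp
        then show "(g \<sigma>)\<^sup>2 \<le> 2 * f \<sigma> + 2 * (f \<sigma> - g \<sigma>)\<^sup>2"
          using f01[of \<sigma>] by (elim disjE) (simp_all add: power2_eq_square algebra_simps)
      qed
      also have "\<dots> = 2 * (\<Sum>\<sigma>\<in>Sym n. f \<sigma>) + 2 * (\<Sum>\<sigma>\<in>Sym n. (f \<sigma> - g \<sigma>)\<^sup>2)" by (simp add: sum.distrib sum_distrib_left)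
      also have "(\<Sum>\<sigma>\<in>Sym n. f \<sigma>) = X" unfolding f_def X_def sum_indicator_real[OF finite_Sym] using A by (simp add: Int_absorb2)
      also have "(\<Sum>\<sigma>\<in>Sym n. (f \<sigma> - g \<sigma>)\<^sup>2) \<le> X" using d e X0 mult_right_mono[of e 1 X] unfolding f_def X_def by linarith
      finally show ?thesis by simp
    qed
    have def_le: "(\<Sum>T\<in>H. F - real (card (A \<inter> T))) \<le> K * (e + c / real n) * X"
    proof -
      have "(\<Sum>T\<in>H. F - real (card (A \<inter> T))) \<le> (\<Sum>T\<in>H. 6 * (\<Sum>\<sigma>\<in>T. min 1 (2 ^ t * (f \<sigma> - g \<sigma>)\<^sup>2)) + (K1 / real n * W + K2 / real n * F))"
      proof (rule sum_mono)
        fix T assume T: "T \<in> H"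
        have "real (fact (n - t)) \<le> real (2 * card (A \<inter> T))" using T unfolding H_def by (simp only: of_nat_le_iff mem_Collect_eq)
        then have "fact (n - t) \<le> 2 * sum f T" using sf[OF T] by simp
        from coset_deficit[OF f01 g _ n(1) this] show "F - real (card (A \<inter> T)) \<le> 6 * (\<Sum>\<sigma>\<in>T. min 1 (2 ^ t * (f \<sigma> - g \<sigma>)\<^sup>2)) + (K1 / real n * W + K2 / real n * F)"
          using T H sf[OF T] by (simp add: K1_def K2_def W_def F_def subset_iff)
      qed
      also have "\<dots> = 6 * (\<Sum>T\<in>H. \<Sum>\<sigma>\<in>T. min 1 (2 ^ t * (f \<sigma> - g \<sigma>)\<^sup>2)) + real (card H) * (K1 / real n * W + K2 / real n * F)"
        by (simp add: sum.distrib sum_distrib_left)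
      also have "real (card H) * (K1 / real n * W + K2 / real n * F) \<le> (16 * K1 + 16 * K2) * (c / real n) * X"
      proof (cases "H = {}")
        case False
        then have "0 < card H" using finH by (simp add: card_gt_0_iff)
        \<comment> \<open>A heavy coset forces \<open>c \<ge> 1/4\<close>, so a single coset has at
          most \<open>4 * card A\<close> elements.\<close>
        then have c1: "1 \<le> 4 * c" using cH by linarith
        have "F \<le> 4 * c * F" using c1 F0 by simp
        then have F4: "F \<le> 4 * X" unfolding XF by simp
        have "real (card H) * (K1 / real n * W + K2 / real n * F) \<le> (4 * c) * (K1 / real n * (4 * X) + K2 / real n * (4 * X))"
          using cH W F4 K12 c(2) F0 X0 unfolding W_def
          by (intro mult_mono add_mono mult_left_mono add_nonneg_nonneg mult_nonneg_nonneg sum_nonneg) auto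
        also have "\<dots> = (16 * K1 + 16 * K2) * (c / real n) * X" by (simp add: algebra_simps add_divide_distrib)
        finally show ?thesis .
      qed (use K12 c(2) X0 in simp)
      also have "(\<Sum>T\<in>H. \<Sum>\<sigma>\<in>T. min 1 (2 ^ t * (f \<sigma> - g \<sigma>)\<^sup>2)) \<le> (\<Sum>\<sigma>\<in>Sym n. 2 ^ t * (f \<sigma> - g \<sigma>)\<^sup>2) + P"
      proof -
        have "T \<subseteq> Sym n" if "T \<in> H" for T using H t_coset_sub that by blast
        then show ?thesis unfolding P_def by (intro sum_cover_count_min[OF finH]) auto
      qed
      also have "(\<Sum>\<sigma>\<in>Sym n. 2 ^ t * (f \<sigma> - g \<sigma>)\<^sup>2) \<le> 2 ^ t * (e * X)"
        using d by (simp add: sum_distrib_left[symmetric] f_def X_def)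
      also note P
      finally have "(\<Sum>T\<in>H. F - real (card (A \<inter> T))) \<le> 6 * (2 ^ t * (e * X) + 32 * (c / real n) * X) + (16 * K1 + 16 * K2) * (c / real n) * X"
        by simp
      also have "\<dots> = (6 * 2 ^ t) * (e * X) + (192 + 16 * K1 + 16 * K2) * (c / real n * X)" by (simp add: algebra_simps)
      also have "\<dots> \<le> K * (e * X) + K * (c / real n * X)"
        using e(1) X0 c(2) K12 by (intro add_mono mult_right_mono) (auto simp: K_def)
      finally show ?thesis by (simp add: algebra_simps)
    qed
    have "P \<le> K * (e + c / real n) * X"
    proof -
      have "32 * (c / real n) * X \<le> K * (e + c / real n) * X"
        using K(2) e(1) c(2) X0 by (intro mult_right_mono mult_mono) auto
      then show ?thesis using P by linarith
    qed
    then show ?thesis using def_le H unfolding P_def F_def X_def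
      by (intro exI[of _ H] conjI) (auto simp: H_def)
  qed
  show ?thesis
    using main K(1) by (intro exI[of _ K] conjI exI[of _ "8 * (t + 1) + 40000"]) auto
qed

text \<open>From \<open>g\<close> the function \<open>cover_count H\<close> of degree
  \<open>t\<close> is subtracted, while \<open>A' = A - U\<close> is defined by the union; the
  discrepancy consists of overlaps and of \<open>U - A\<close>, both bounded by
  \<open>heavy_cosets\<close>. Were \<open>A'\<close> large compared with this error,
  \<open>lowdeg_heavy\<close> would give a coset more than half filled by \<open>A'\<close>. It is
  heavy for \<open>A\<close> too, hence belongs to \<open>H\<close> and is disjoint from
  \<open>A'\<close>.\<close>

lemma near_union_of_cosets:
  "\<exists>K>0. \<exists>n1. \<forall>n\<ge>n1. \<forall>A g c e. A \<subseteq> Sym n \<longrightarrow> lowdeg n t g \<longrightarrow> real (card A) = c * fact (n - t) \<longrightarrow> 0 \<le> c \<longrightarrow> c \<le> sqrt (real n) \<longrightarrow>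
    0 \<le> e \<longrightarrow> e \<le> 1 \<longrightarrow> (\<Sum>\<sigma>\<in>Sym n. (indicator A \<sigma> - g \<sigma>)\<^sup>2) \<le> e * real (card A) \<longrightarrow>
    (\<exists>H\<subseteq>t_cosets n t. real (card (sym_diff A (\<Union>H))) \<le> K * (e + c / real n) * real (card A) \<and>
      \<bar>real (card H) * fact (n - t) - real (card A)\<bar> \<le> K * (e + c / real n) * real (card A))"
proof -
  obtain \<epsilon> n0 where eps: "\<epsilon> > 0" and low: "\<forall>n\<ge>n0. \<forall>f g. (\<forall>\<sigma>\<in>Sym n. f \<sigma> = 0 \<or> f \<sigma> = 1) \<longrightarrow> lowdeg n t g \<longrightarrow>
    nsq n f \<le> sqrt (real n) * fact (n - t) / fact n \<longrightarrow> nsq n (\<lambda>\<sigma>. f \<sigma> - g \<sigma>) \<le> \<epsilon> * nsq n f \<longrightarrow> nsq n f > 0 \<longrightarrow>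
    (\<exists>I\<in>ksets n t. \<exists>\<sigma>\<in>Sym n. cnd n I f \<sigma> > 1 / 2)"
    using lowdeg_heavy[of t] by (elim exE conjE) (rule that)
  obtain K0 n1 where K0: "K0 > 0" and heavy: "\<forall>n\<ge>n1. \<forall>A g c e. A \<subseteq> Sym n \<longrightarrow> lowdeg n t g \<longrightarrow> real (card A) = c * fact (n - t) \<longrightarrow>
    0 \<le> c \<longrightarrow> c \<le> sqrt (real n) \<longrightarrow> 0 \<le> e \<longrightarrow> e \<le> 1 \<longrightarrow> (\<Sum>\<sigma>\<in>Sym n. (indicator A \<sigma> - g \<sigma>)\<^sup>2) \<le> e * real (card A) \<longrightarrow>
    (\<exists>H\<subseteq>t_cosets n t. (\<forall>T\<in>t_cosets n t - H. 2 * card (A \<inter> T) < fact (n - t)) \<and>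
      (\<Sum>T\<in>H. fact (n - t) - real (card (A \<inter> T))) \<le> K0 * (e + c / real n) * real (card A) \<and>
      (\<Sum>\<sigma>\<in>Sym n. cover_count H \<sigma> * (cover_count H \<sigma> - 1)) \<le> K0 * (e + c / real n) * real (card A))"
    using heavy_cosets[of t] by (elim exE conjE) (rule that)
  \<comment> \<open>Three error terms, bounded by \<open>X\<close>, \<open>K0 * X\<close> and
    \<open>K0 * X\<close>, with a factor 3 for the square of a sum of three.\<close>
  define K1 where "K1 = 3 * (1 + 2 * K0)"
  define K where "K = K1 / \<epsilon> + 2 * K0"
  have K: "0 < K" using K0 eps by (simp add: K_def K1_def add_pos_pos)
  have main: "\<exists>H\<subseteq>t_cosets n t. real (card (sym_diff A (\<Union>H))) \<le> K * (e + c / real n) * real (card A) \<and>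
      \<bar>real (card H) * fact (n - t) - real (card A)\<bar> \<le> K * (e + c / real n) * real (card A)"
    if n: "n \<ge> n0" "n \<ge> n1" and A: "A \<subseteq> Sym n" and g: "lowdeg n t g" and c: "real (card A) = c * fact (n - t)" "0 \<le> c" "c \<le> sqrt (real n)"
      and e: "0 \<le> e" "e \<le> 1" and d: "(\<Sum>\<sigma>\<in>Sym n. (indicator A \<sigma> - g \<sigma>)\<^sup>2) \<le> e * real (card A)" for n A g c e
  proof -
    obtain H where H: "H \<subseteq> t_cosets n t" "\<forall>T\<in>t_cosets n t - H. 2 * card (A \<inter> T) < fact (n - t)"
      and def: "(\<Sum>T\<in>H. fact (n - t) - real (card (A \<inter> T))) \<le> K0 * (e + c / real n) * real (card A)"
      and P: "(\<Sum>\<sigma>\<in>Sym n. cover_count H \<sigma> * (cover_count H \<sigma> - 1)) \<le> K0 * (e + c / real n) * real (card A)"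
      using heavy[rule_format, OF n(2) A g c e d] by (elim exE conjE) (rule that)
    define F :: real where "F = fact (n - t)"
    define X where "X = (e + c / real n) * real (card A)"
    define U where "U = \<Union>H"
    define f :: "(nat \<Rightarrow> nat) \<Rightarrow> real" where "f = indicator A"
    define \<chi> :: "(nat \<Rightarrow> nat) \<Rightarrow> real" where "\<chi> = indicator U"
    define A' where "A' = A - U"
    define f' :: "(nat \<Rightarrow> nat) \<Rightarrow> real" where "f' = indicator A'"
    define g' where "g' \<sigma> = g \<sigma> - cover_count H \<sigma>" for \<sigma>
    have finH: "finite H" using finite_subset[OF H(1) finite_t_cosets] .
    have finA: "finite A" using A finite_subset finite_Sym by blast
    have US: "U \<subseteq> Sym n" unfolding U_def using H(1) t_coset_sub by blast
    have finU: "finite U" using US finite_subset finite_Sym by blast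
    have X: "0 \<le> X" "e * real (card A) \<le> X" using e(1) c(2) by (auto simp: X_def intro!: mult_right_mono)
    have def': "(\<Sum>T\<in>H. F - real (card (A \<inter> T))) \<le> K0 * X" and P': "(\<Sum>\<sigma>\<in>Sym n. cover_count H \<sigma> * (cover_count H \<sigma> - 1)) \<le> K0 * X"
      using def P by (simp_all add: X_def F_def mult.assoc)
    have UA: "real (card (U - A)) \<le> K0 * X"
    proof -
      have "card (U - A) = card (\<Union>((\<lambda>T. T - A) ` H))" by (rule arg_cong[where f = card]) (auto simp: U_def)
      also have "\<dots> \<le> (\<Sum>T\<in>H. card (T - A))" by (rule card_UN_le[OF finH])
      finally have "real (card (U - A)) \<le> (\<Sum>T\<in>H. real (card (T - A)))" by (metis of_nat_le_iff of_nat_sum)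
      also have "\<dots> = (\<Sum>T\<in>H. F - real (card (A \<inter> T)))"
      proof (rule sum.cong[OF refl])
        fix T assume "T \<in> H"
        then have T: "T \<in> t_cosets n t" using H(1) by blast
        have "card T = card (T - A) + card (A \<inter> T)"
          using finite_t_coset[OF T] by (subst card_Un_disjoint[symmetric]) (auto intro: arg_cong[where f = card])
        then have "real (card T) = real (card (T - A)) + real (card (A \<inter> T))" by simp
        moreover have "real (card T) = F" using card_t_coset[OF T] by (simp add: F_def)
        ultimately show "real (card (T - A)) = F - real (card (A \<inter> T))" by linarith
      qed
      finally show ?thesis using def' by simp
    qed
    have m1: "cover_count H \<sigma> = 0 \<and> \<chi> \<sigma> = 0 \<or> cover_count H \<sigma> \<ge> 1 \<and> \<chi> \<sigma> = 1" for \<sigma>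
    proof (cases "\<sigma> \<in> U")
      case True
      then have "{T \<in> H. \<sigma> \<in> T} \<noteq> {}" by (auto simp: U_def)
      then have "0 < card {T \<in> H. \<sigma> \<in> T}" using finH by (simp add: card_gt_0_iff)
      then show ?thesis using True by (simp add: cover_count_def \<chi>_def)
    next
      case False
      then have "{T \<in> H. \<sigma> \<in> T} = {}" by (auto simp: U_def)
      then have "cover_count H \<sigma> = 0" unfolding cover_count_def by (simp only: card.empty of_nat_0)
      then show ?thesis using False by (simp add: \<chi>_def)
    qed
    have sq: "(f' \<sigma> - g' \<sigma>)\<^sup>2 \<le> 3 * ((f \<sigma> - g \<sigma>)\<^sup>2 + cover_count H \<sigma> * (cover_count H \<sigma> - 1) + indicator (U - A) \<sigma>)" for \<sigma>
    proof -
      have three: "(x + y + z)\<^sup>2 \<le> 3 * (x\<^sup>2 + y\<^sup>2 + z\<^sup>2)" for x y z :: real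
      proof -
        have "0 \<le> (x - y)\<^sup>2 + (y - z)\<^sup>2 + (x - z)\<^sup>2" by simp
        then show ?thesis by (simp add: power2_eq_square algebra_simps)
      qed
      \<comment> \<open>Removing \<open>U\<close> from \<open>A\<close> subtracts
        \<open>\<chi>\<close> except on \<open>U - A\<close>, where there is nothing to
        remove.\<close>
      have "f' \<sigma> - g' \<sigma> = (f \<sigma> - g \<sigma>) + (cover_count H \<sigma> - \<chi> \<sigma>) + indicator (U - A) \<sigma>"
        by (auto simp: f'_def g'_def f_def \<chi>_def A'_def indicator_def)
      then have le: "(f' \<sigma> - g' \<sigma>)\<^sup>2 \<le> 3 * ((f \<sigma> - g \<sigma>)\<^sup>2 + (cover_count H \<sigma> - \<chi> \<sigma>)\<^sup>2 + (indicator (U - A) \<sigma>)\<^sup>2)" using three by simp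
      have m2: "(cover_count H \<sigma> - \<chi> \<sigma>)\<^sup>2 \<le> cover_count H \<sigma> * (cover_count H \<sigma> - 1)"
        using m1[of \<sigma>] by (auto simp: power2_eq_square intro!: mult_right_mono)
      have i2: "(indicator (U - A) \<sigma>)\<^sup>2 = (indicator (U - A) \<sigma> :: real)" by (simp add: indicator_def)
      show ?thesis by (rule order_trans[OF le]) (use m2 i2 in simp)
    qed
    have "(\<Sum>\<sigma>\<in>Sym n. (f' \<sigma> - g' \<sigma>)\<^sup>2) \<le> (\<Sum>\<sigma>\<in>Sym n. 3 * ((f \<sigma> - g \<sigma>)\<^sup>2 + cover_count H \<sigma> * (cover_count H \<sigma> - 1) + indicator (U - A) \<sigma>))"
      using sq by (intro sum_mono)
    also have "\<dots> = 3 * ((\<Sum>\<sigma>\<in>Sym n. (f \<sigma> - g \<sigma>)\<^sup>2) + (\<Sum>\<sigma>\<in>Sym n. cover_count H \<sigma> * (cover_count H \<sigma> - 1)) + (\<Sum>\<sigma>\<in>Sym n. indicator (U - A) \<sigma>))"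
      unfolding sum_distrib_left[symmetric] sum.distrib ..
    also have "(\<Sum>\<sigma>\<in>Sym n. indicator (U - A) \<sigma>) = real (card (U - A))"
    proof -
      have "(U - A) \<inter> Sym n = U - A" using US by blast
      then show ?thesis using sum_indicator_real[OF finite_Sym, of "U - A" n] by simp
    qed
    also have "3 * ((\<Sum>\<sigma>\<in>Sym n. (f \<sigma> - g \<sigma>)\<^sup>2) + (\<Sum>\<sigma>\<in>Sym n. cover_count H \<sigma> * (cover_count H \<sigma> - 1)) + real (card (U - A))) \<le> 3 * (X + K0 * X + K0 * X)"
      using d X(2) P' UA by (simp add: f_def)
    also have "\<dots> = K1 * X" by (simp add: K1_def algebra_simps)
    finally have dist: "(\<Sum>\<sigma>\<in>Sym n. (f' \<sigma> - g' \<sigma>)\<^sup>2) \<le> K1 * X" .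
    have A'S: "A' \<subseteq> Sym n" using A by (auto simp: A'_def)
    have nf': "fact n * nsq n f' = real (card A')"
    proof -
      have "fact n * nsq n f' = (\<Sum>\<sigma>\<in>Sym n. f' \<sigma> * f' \<sigma>)" by (simp add: ip_def)
      also have "\<dots> = (\<Sum>\<sigma>\<in>Sym n. f' \<sigma>)" by (intro sum.cong refl) (simp add: f'_def indicator_def)
      also have "\<dots> = real (card A')" unfolding f'_def sum_indicator_real[OF finite_Sym] using A'S by (simp add: Int_absorb2)
      finally show ?thesis .
    qed
    have A': "real (card A') \<le> K1 / \<epsilon> * X"
    proof (rule ccontr)
      assume "\<not> real (card A') \<le> K1 / \<epsilon> * X"
      then have big: "K1 * X < \<epsilon> * real (card A')" using eps by (simp add: field_simps)
      have nn: "0 \<le> K1 * X" using X(1) K0 by (simp add: K1_def)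
      then have "0 < \<epsilon> * real (card A')" using big by linarith
      then have pos: "0 < real (card A')" using eps by (simp add: zero_less_mult_iff)
      have nsq_eq: "nsq n f' = real (card A') / fact n" using nf' by (simp add: field_simps)
      have "\<exists>I\<in>ksets n t. \<exists>\<sigma>\<in>Sym n. cnd n I f' \<sigma> > 1 / 2"
      proof (rule low[rule_format, OF n(1)])
        show "f' \<sigma> = 0 \<or> f' \<sigma> = 1" for \<sigma> by (simp add: f'_def indicator_def)
        show "lowdeg n t g'" unfolding g'_def by (rule lowdeg_diff[OF g lowdeg_cover_count[OF H(1)]])
        have "real (card A') \<le> real (card A)" using card_mono[OF finA, of A'] by (auto simp: A'_def)
        also have "\<dots> \<le> sqrt (real n) * fact (n - t)" unfolding c(1) using c(3) by (rule mult_right_mono) simp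
        finally show "nsq n f' \<le> sqrt (real n) * fact (n - t) / fact n" unfolding nsq_eq by (rule divide_right_mono) simp
        have "nsq n (\<lambda>\<sigma>. f' \<sigma> - g' \<sigma>) = (\<Sum>\<sigma>\<in>Sym n. (f' \<sigma> - g' \<sigma>)\<^sup>2) / fact n" by (simp add: ip_def power2_eq_square)
        also have "\<dots> \<le> (\<epsilon> * real (card A')) / fact n" using dist big by (intro divide_right_mono) auto
        finally show "nsq n (\<lambda>\<sigma>. f' \<sigma> - g' \<sigma>) \<le> \<epsilon> * nsq n f'" unfolding nsq_eq by simp
        show "nsq n f' > 0" unfolding nsq_eq using pos by simp
      qed
      then obtain I \<sigma> where I: "I \<in> ksets n t" "\<sigma> \<in> Sym n" "cnd n I f' \<sigma> > 1 / 2" by blast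
      define T where "T = {\<tau>. \<tau> \<in> Sym n \<and> agree I \<sigma> \<tau>}"
      have T: "T \<in> t_cosets n t" unfolding T_def by (rule t_cosetsI[OF I(1,2)])
      have "cnd n I f' \<sigma> = (\<Sum>\<tau>\<in>T. f' \<tau>) / F"
        unfolding cnd_coset[OF I(2) ksets_sub(1)[OF I(1)]] ksets_sub(2)[OF I(1)] F_def T_def
        by (simp add: sum.inter_filter[symmetric])
      also have "(\<Sum>\<tau>\<in>T. f' \<tau>) = real (card (A' \<inter> T))" unfolding f'_def by (rule sum_indicator_real[OF finite_t_coset[OF T]])
      finally have "1 / 2 < real (card (A' \<inter> T)) / F" using I(3) by simp
      moreover have F0: "0 < F" by (simp add: F_def)
      ultimately have AT: "F < 2 * real (card (A' \<inter> T))" by (simp only: pos_less_divide_eq)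
      have "card (A' \<inter> T) \<le> card (A \<inter> T)" using finA by (intro card_mono) (auto simp: A'_def)
      then have "real (fact (n - t)) < real (2 * card (A \<inter> T))" using AT by (simp add: F_def)
      then have "fact (n - t) < 2 * card (A \<inter> T)" by (simp only: of_nat_less_iff)
      then have "\<not> 2 * card (A \<inter> T) < fact (n - t)" by (rule less_not_sym)
      then have "T \<in> H" using H(2) T by blast
      then have "A' \<inter> T = {}" by (auto simp: A'_def U_def)
      then show False using AT F0 by simp
    qed
    have sd: "real (card (sym_diff A U)) \<le> K1 / \<epsilon> * X + K0 * X"
    proof -
      have "card (sym_diff A U) \<le> card A' + card (U - A)" unfolding A'_def by (rule card_Un_le)
      then have "real (card (sym_diff A U)) \<le> real (card A') + real (card (U - A))" by linarith
      then show ?thesis using A' UA by linarith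
    qed
    have "\<bar>real (card H) * F - real (card A)\<bar> \<le> real (card (sym_diff A U)) + K0 * X"
    proof -
      have "(\<Sum>\<sigma>\<in>Sym n. cover_count H \<sigma>) = (\<Sum>T\<in>H. real (card (Sym n \<inter> T)))" by (rule sum_cover_count[OF finH finite_Sym])
      also have "\<dots> = (\<Sum>T\<in>H. F)"
      proof (rule sum.cong[OF refl])
        fix T assume "T \<in> H"
        then have T: "T \<in> t_cosets n t" using H(1) by blast
        then show "real (card (Sym n \<inter> T)) = F" using t_coset_sub[OF T] card_t_coset[OF T] by (simp add: Int_absorb1 F_def)
      qed
      finally have s1: "(\<Sum>\<sigma>\<in>Sym n. cover_count H \<sigma>) = real (card H) * F" by simp
      have s2: "(\<Sum>\<sigma>\<in>Sym n. f \<sigma>) = real (card A)" unfolding f_def sum_indicator_real[OF finite_Sym] using A by (simp add: Int_absorb2)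
      have s3: "(\<Sum>\<sigma>\<in>Sym n. indicator (sym_diff A U) \<sigma>) = real (card (sym_diff A U))"
      proof -
        have "sym_diff A U \<inter> Sym n = sym_diff A U" using A US by blast
        then show ?thesis using sum_indicator_real[OF finite_Sym, of "sym_diff A U" n] by simp
      qed
      have "\<bar>(\<Sum>\<sigma>\<in>Sym n. cover_count H \<sigma> - f \<sigma>)\<bar> \<le> (\<Sum>\<sigma>\<in>Sym n. \<bar>cover_count H \<sigma> - f \<sigma>\<bar>)" by (rule sum_abs)
      also have "\<dots> \<le> (\<Sum>\<sigma>\<in>Sym n. indicator (sym_diff A U) \<sigma> + cover_count H \<sigma> * (cover_count H \<sigma> - 1))"
      proof (rule sum_mono)
        fix \<sigma>
        have "\<bar>\<chi> \<sigma> - f \<sigma>\<bar> \<le> indicator (sym_diff A U) \<sigma>" by (auto simp: \<chi>_def f_def indicator_def)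
        moreover have "cover_count H \<sigma> - \<chi> \<sigma> \<ge> 0" using m1[of \<sigma>] by auto
        moreover have "cover_count H \<sigma> - \<chi> \<sigma> \<le> cover_count H \<sigma> * (cover_count H \<sigma> - 1)"
          using m1[of \<sigma>] mult_right_mono[of 1 "cover_count H \<sigma>" "cover_count H \<sigma> - 1"] by auto
        ultimately show "\<bar>cover_count H \<sigma> - f \<sigma>\<bar> \<le> indicator (sym_diff A U) \<sigma> + cover_count H \<sigma> * (cover_count H \<sigma> - 1)" by linarith
      qed
      finally show ?thesis using P' by (simp add: sum_subtractf sum.distrib s1 s2 s3)
    qed
    then have "\<bar>real (card H) * F - real (card A)\<bar> \<le> K * X" using sd by (simp add: K_def algebra_simps)
    moreover have "real (card (sym_diff A U)) \<le> K * X"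
    proof -
      have "K1 / \<epsilon> * X + K0 * X \<le> K * X" using X(1) K0 by (simp add: K_def algebra_simps)
      then show ?thesis using sd by linarith
    qed
    ultimately show ?thesis using H(1) unfolding U_def F_def X_def by (intro exI[of _ H]) (simp add: mult.assoc)
  qed
  show ?thesis
    using main K by (intro exI[of _ K] conjI exI[of _ "max n0 n1"]) auto
qed

section \<open>Exactly \<open>round c\<close> cosets, and the trivial ranges of the
  parameters\<close>

lemma resize_cosets:
  assumes H: "H \<subseteq> t_cosets n t" and A: "A \<subseteq> Sym n" and r: "r \<le> card (t_cosets n t)"
  shows "\<exists>\<T>\<subseteq>t_cosets n t. card \<T> = r \<and>
    real (card (sym_diff A (\<Union>\<T>))) \<le> real (card (sym_diff A (\<Union>H))) + \<bar>real r - real (card H)\<bar> * fact (n - t)"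
proof -
  have finH: "finite H" using finite_subset[OF H finite_t_cosets] .
  \<comment> \<open>Cosets are either only removed or only added, so the number changed is the
    difference of the cardinalities.\<close>
  have "\<exists>\<T>\<subseteq>t_cosets n t. card \<T> = r \<and> (\<T> \<subseteq> H \<or> H \<subseteq> \<T>)"
  proof (cases "r \<le> card H")
    case True
    then obtain \<T> where "\<T> \<subseteq> H" "card \<T> = r" "finite \<T>" by (rule obtain_subset_with_card_n)
    then show ?thesis using H by blast
  next
    case False
    have "r - card H \<le> card (t_cosets n t - H)" using r card_Diff_subset[OF finH H] by simp
    then obtain X where X: "X \<subseteq> t_cosets n t - H" "card X = r - card H" "finite X" by (rule obtain_subset_with_card_n)
    then have "card (H \<union> X) = r" using False finH by (subst card_Un_disjoint) auto
    then show ?thesis using X H by blast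
  qed
  then obtain \<T> where T: "\<T> \<subseteq> t_cosets n t" "card \<T> = r" "\<T> \<subseteq> H \<or> H \<subseteq> \<T>" by blast
  have finT: "finite \<T>" using finite_subset[OF T(1) finite_t_cosets] .
  define D where "D = sym_diff H \<T>"
  have D: "finite D" "D \<subseteq> t_cosets n t" using finH finT H T by (auto simp: D_def)
  have cD: "real (card D) = \<bar>real r - real (card H)\<bar>"
    using T(3)
  proof
    assume s: "\<T> \<subseteq> H"
    then have "D = H - \<T>" by (auto simp: D_def)
    then show ?thesis using s T(2) finT card_mono[OF finH s] by (simp add: card_Diff_subset of_nat_diff)
  next
    assume s: "H \<subseteq> \<T>"
    then have "D = \<T> - H" by (auto simp: D_def)
    then show ?thesis using s T(2) finH card_mono[OF finT s] by (simp add: card_Diff_subset of_nat_diff)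
  qed
  have US: "\<Union>H \<subseteq> Sym n" "\<Union>D \<subseteq> Sym n" using H D t_coset_sub by blast+
  have fin: "finite (sym_diff A (\<Union>H) \<union> \<Union>D)" by (rule finite_subset[OF _ finite_Sym[of n]]) (use US A in blast)
  have "card (sym_diff A (\<Union>\<T>)) \<le> card (sym_diff A (\<Union>H) \<union> \<Union>D)" by (rule card_mono[OF fin]) (auto simp: D_def)
  also have "\<dots> \<le> card (sym_diff A (\<Union>H)) + card (\<Union>D)" by (rule card_Un_le)
  also have "card (\<Union>D) \<le> (\<Sum>T\<in>D. card T)" by (rule card_Union_le_sum_card)
  also have "(\<Sum>T\<in>D. card T) = (\<Sum>T\<in>D. fact (n - t))" using D(2) card_t_coset by (intro sum.cong refl) blast
  finally have "real (card (sym_diff A (\<Union>\<T>))) \<le> real (card (sym_diff A (\<Union>H)) + (\<Sum>T\<in>D. fact (n - t)))" by (simp only: of_nat_le_iff)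
  then show ?thesis using T cD by auto
qed

lemma falling_fact: "t \<le> n \<Longrightarrow> falling n t * fact (n - t) = fact n"
proof (induction t)
  case (Suc t)
  have "n - t = Suc (n - Suc t)" using Suc.prems by simp
  then have "fact (n - t) = (n - t) * (fact (n - Suc t) :: nat)" by (metis fact_Suc of_nat_id)
  then show ?case using Suc by (simp add: falling_def)
qed (simp add: falling_def)

lemma round_le_twice:
  fixes c :: real
  assumes "0 \<le> c"
  shows "of_int (round c) \<le> 2 * c"
  using round_diff_minimal[of c 0] assms by simp

lemma round_nat:
  fixes c :: real
  assumes "0 \<le> c"
  obtains r where "round c = int r"
proof -
  have "0 \<le> round c" using round_mono[OF assms] by simp
  then show thesis using that[of "nat (round c)"] by simp
qed

text \<open>For \<open>n \<ge> n1\<close> and \<open>c \<le> sqrt n\<close> the family of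
  \<open>near_union_of_cosets\<close> has about \<open>c\<close> members. As \<open>round c\<close>
  is an integer nearest to \<open>c\<close>, passing to it at most doubles the discrepancy. The
  error \<open>\<epsilon> + c / n\<close> obtained there is below the claimed
  \<open>sqrt \<epsilon> + c / sqrt n\<close>. In the remaining range with \<open>n > 0\<close> and
  \<open>c > 0\<close> the claimed bound is at least \<open>3 * card A\<close>, and any
  \<open>round c\<close> cosets will do.\<close>

lemma stability:
  "\<exists>C>0. \<forall>n A g c \<epsilon>. t \<le> n \<longrightarrow> A \<subseteq> Sym n \<longrightarrow> lowdeg n t g \<longrightarrow> real (card A) = c * fact (n - t) \<longrightarrow> 0 \<le> c \<longrightarrow>
    0 \<le> \<epsilon> \<longrightarrow> \<epsilon> \<le> 1 \<longrightarrow> (\<Sum>\<sigma>\<in>Sym n. (indicator A \<sigma> - g \<sigma>)\<^sup>2) \<le> \<epsilon> * real (card A) \<longrightarrow>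
    (\<exists>\<T>\<subseteq>t_cosets n t. int (card \<T>) = round c \<and>
      real (card (sym_diff A (\<Union>\<T>))) \<le> C * (sqrt \<epsilon> + c / sqrt (real n)) * real (card A)) \<and>
    \<bar>c - of_int (round c)\<bar> \<le> C * (sqrt \<epsilon> + c / sqrt (real n)) * c"
proof -
  obtain K n1 where K: "K > 0" and near: "\<forall>n\<ge>n1. \<forall>A g c e. A \<subseteq> Sym n \<longrightarrow> lowdeg n t g \<longrightarrow> real (card A) = c * fact (n - t) \<longrightarrow> 0 \<le> c \<longrightarrow> c \<le> sqrt (real n) \<longrightarrow>
    0 \<le> e \<longrightarrow> e \<le> 1 \<longrightarrow> (\<Sum>\<sigma>\<in>Sym n. (indicator A \<sigma> - g \<sigma>)\<^sup>2) \<le> e * real (card A) \<longrightarrow>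
    (\<exists>H\<subseteq>t_cosets n t. real (card (sym_diff A (\<Union>H))) \<le> K * (e + c / real n) * real (card A) \<and>
      \<bar>real (card H) * fact (n - t) - real (card A)\<bar> \<le> K * (e + c / real n) * real (card A))"
    using near_union_of_cosets[of t] by (elim exE conjE) (rule that)
  \<comment> \<open>The summand \<open>3 * K\<close> has one \<open>K\<close> for the heavy family
    and two for the rounding. The other makes the claim trivial for \<open>0 < n < n1\<close>, where
    a nonempty set has \<open>c * n1! \<ge> 1\<close> and
    \<open>sqrt n \<le> n1 + 1\<close>.\<close>
  define C where "C = 3 * K + 3 * fact n1 * (real n1 + 1)"
  have C3: "3 \<le> C"
  proof -
    have "3 * 1 * 1 \<le> 3 * fact n1 * (real n1 + 1)" by (intro mult_mono) (auto simp: fact_ge_1)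
    then show ?thesis using K by (simp add: C_def)
  qed
  have main: "(\<exists>\<T>\<subseteq>t_cosets n t. int (card \<T>) = round c \<and>
      real (card (sym_diff A (\<Union>\<T>))) \<le> C * (sqrt \<epsilon> + c / sqrt (real n)) * real (card A)) \<and>
    \<bar>c - of_int (round c)\<bar> \<le> C * (sqrt \<epsilon> + c / sqrt (real n)) * c"
    if tn: "t \<le> n" and A: "A \<subseteq> Sym n" and g: "lowdeg n t g" and c: "real (card A) = c * fact (n - t)" "0 \<le> c"
      and e: "0 \<le> \<epsilon>" "\<epsilon> \<le> 1" and d: "(\<Sum>\<sigma>\<in>Sym n. (indicator A \<sigma> - g \<sigma>)\<^sup>2) \<le> \<epsilon> * real (card A)" for n A g c \<epsilon>
  proof -
    define F :: real where "F = fact (n - t)"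
    define \<delta> where "\<delta> = sqrt \<epsilon> + c / sqrt (real n)"
    have F0: "0 < F" by (simp add: F_def)
    have cF: "real (card A) = c * F" using c by (simp add: F_def)
    have finA: "finite A" using A finite_subset finite_Sym by blast
    have d0: "0 \<le> \<delta>" using e c by (simp add: \<delta>_def)
    obtain r where r: "round c = int r" using round_nat[OF c(2)] .
    have r2: "real r \<le> 2 * c" using round_le_twice[OF c(2)] r by simp
    have rc: "\<bar>c - real r\<bar> \<le> \<bar>c - real k\<bar>" for k using round_diff_minimal[of c "int k"] r by simp
    have rN: "r \<le> card (t_cosets n t)"
    proof -
      have "c * F \<le> fact n" unfolding cF[symmetric] using card_mono[OF finite_Sym A] card_Sym[of n] by (metis of_nat_fact of_nat_le_iff)
      also have "\<dots> \<le> real (card (t_cosets n t)) * F"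
        using card_t_cosets_ge[OF tn] unfolding F_def by (metis of_nat_fact of_nat_le_iff of_nat_mult)
      finally have "c \<le> real (card (t_cosets n t))" using F0 by simp
      then have "round c \<le> round (real (card (t_cosets n t)))" by (rule round_mono)
      then show ?thesis using r by simp
    qed
    \<comment> \<open>\<open>A\<close> has \<open>c * F\<close> elements and
      \<open>round c \<le> 2 * c\<close> cosets have at most \<open>2 * c * F\<close>, hence the
      3.\<close>
    have crude: "(\<exists>\<T>\<subseteq>t_cosets n t. int (card \<T>) = round c \<and> real (card (sym_diff A (\<Union>\<T>))) \<le> C * \<delta> * real (card A)) \<and>
      \<bar>c - of_int (round c)\<bar> \<le> C * \<delta> * c" if C\<delta>: "3 \<le> C * \<delta> \<or> c = 0"
    proof
      obtain \<T> where T: "\<T> \<subseteq> t_cosets n t" "card \<T> = r"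
        and sd: "real (card (sym_diff A (\<Union>\<T>))) \<le> real (card A) + real r * fact (n - t)"
        using resize_cosets[OF empty_subsetI A rN] by auto
      have "real (card (sym_diff A (\<Union>\<T>))) \<le> c * F + real r * F" using sd cF by (simp add: F_def)
      also have "\<dots> \<le> 3 * (c * F)" using mult_right_mono[OF r2, of F] F0 by simp
      also have "\<dots> \<le> C * \<delta> * (c * F)" using C\<delta> c(2) F0 mult_right_mono[of 3 "C * \<delta>" "c * F"] by auto
      finally show "\<exists>\<T>\<subseteq>t_cosets n t. int (card \<T>) = round c \<and> real (card (sym_diff A (\<Union>\<T>))) \<le> C * \<delta> * real (card A)"
        using T r cF by (intro exI[of _ \<T>]) simp
      have "\<bar>c - of_int (round c)\<bar> \<le> c" using rc[of 0] c(2) r by simp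
      also have "\<dots> \<le> C * \<delta> * c" using C\<delta> c(2) mult_right_mono[of 1 "C * \<delta>" c] by auto
      finally show "\<bar>c - of_int (round c)\<bar> \<le> C * \<delta> * c" .
    qed
    consider "c = 0" | "n = 0" "c > 0" | "n > 0" "c > 0" "n < n1 \<or> sqrt (real n) < c" | "n > 0" "n1 \<le> n" "c \<le> sqrt (real n)"
      using c(2) by linarith
    then show ?thesis
    proof cases
      case 1
      show ?thesis by (rule crude[OF disjI2[OF 1], unfolded \<delta>_def])
    next
      case 2
      \<comment> \<open>For \<open>n = 0\<close> the quotient \<open>c / sqrt n\<close> is 0 by
        convention and the crude bound fails; but here \<open>c = 1\<close> and the only coset
        equals \<open>A\<close>.\<close>
      then have t0: "t = 0" using tn by simp
      have S: "Sym n = {id}" using 2 by (auto simp: Sym_def)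
      have "A \<noteq> {}" using cF 2 F0 by auto
      then have A1: "A = {id}" using A unfolding S by (simp add: subset_singleton_iff)
      then have c1: "c = 1" using c(1) 2 by simp
      have "{{id}} \<subseteq> t_cosets n t" using t_cosetsI[of "{}" n t id] t0 S by (auto simp: ksets_def agree_def)
      moreover have "int (card {{id :: nat \<Rightarrow> nat}}) = round c" using c1 by simp
      moreover have "real (card (sym_diff A (\<Union>{{id}}))) \<le> C * \<delta> * real (card A)" using A1 d0 C3 by simp
      ultimately have "\<exists>\<T>\<subseteq>t_cosets n t. int (card \<T>) = round c \<and> real (card (sym_diff A (\<Union>\<T>))) \<le> C * \<delta> * real (card A)"
        by (intro exI[of _ "{{id}}"] conjI)
      moreover have "\<bar>c - of_int (round c)\<bar> \<le> C * \<delta> * c" using c1 d0 C3 by simp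
      ultimately show ?thesis unfolding \<delta>_def ..
    next
      case 3
      have "3 \<le> C * (c / sqrt (real n))"
        using 3(3)
      proof
        assume n: "n < n1"
        have "0 < real (card A)" using cF 3(2) F0 by simp
        then have "1 \<le> card A" unfolding of_nat_0_less_iff by presburger
        then have "real 1 \<le> real (card A)" by (simp only: of_nat_le_iff)
        then have "1 \<le> c * F" unfolding cF of_nat_1 .
        also have "\<dots> \<le> c * fact n1" using n c(2) unfolding F_def by (intro mult_left_mono fact_mono) auto
        finally have c1: "1 \<le> c * fact n1" .
        have "sqrt (real n) \<le> real n1 + 1"
        proof (rule real_le_lsqrt)
          have "real n * 1 \<le> (real n1 + 1) * (real n1 + 1)" using n by (intro mult_mono) auto
          then show "real n \<le> (real n1 + 1)\<^sup>2" by (simp add: power2_eq_square)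
        qed auto
        then have "3 * sqrt (real n) * 1 \<le> 3 * (real n1 + 1) * (c * fact n1)" using c1 by (intro mult_mono) auto
        also have "\<dots> = (3 * fact n1 * (real n1 + 1)) * c" by simp
        also have "\<dots> \<le> C * c" using K c(2) by (intro mult_right_mono) (auto simp: C_def)
        finally show ?thesis using 3(1) by (simp add: pos_le_divide_eq)
      next
        assume "sqrt (real n) < c"
        then have "1 \<le> c / sqrt (real n)" using 3(1) by simp
        then have "3 * 1 \<le> C * (c / sqrt (real n))" using C3 by (intro mult_mono) auto
        then show ?thesis by simp
      qed
      also have "\<dots> \<le> C * \<delta>" using C3 e by (intro mult_left_mono) (auto simp: \<delta>_def)
      finally have "3 \<le> C * \<delta>" .
      from crude[OF disjI1[OF this]] show ?thesis unfolding \<delta>_def .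
    next
      case 4
      define x where "x = \<epsilon> + c / real n"
      obtain H where H: "H \<subseteq> t_cosets n t" and h1: "real (card (sym_diff A (\<Union>H))) \<le> K * x * real (card A)"
        and h2: "\<bar>real (card H) * fact (n - t) - real (card A)\<bar> \<le> K * x * real (card A)"
        using near[rule_format, OF 4(2) A g c 4(3) e d, folded x_def] by (elim exE conjE) (rule that)
      have x\<delta>: "x \<le> \<delta>"
      proof -
        have "\<epsilon> * \<epsilon> \<le> \<epsilon> * 1" using e by (intro mult_left_mono) auto
        then have "\<epsilon> \<le> sqrt \<epsilon>" by (intro real_le_rsqrt) (simp add: power2_eq_square)
        moreover have "sqrt (real n) \<le> real n" using 4(1) by (intro real_le_lsqrt) (auto simp: power2_eq_square)
        then have "c / real n \<le> c / sqrt (real n)" using c(2) 4(1) by (intro divide_left_mono) auto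
        ultimately show ?thesis by (simp add: x_def \<delta>_def)
      qed
      have "\<bar>real (card H) - c\<bar> * F = \<bar>real (card H) * F - c * F\<bar>" unfolding left_diff_distrib[symmetric] abs_mult using F0 by simp
      also have "\<dots> \<le> K * x * c * F" using h2 cF by (simp add: F_def mult.assoc)
      finally have D: "\<bar>real (card H) - c\<bar> \<le> K * x * c" using F0 by simp
      have KC: "3 * K * x \<le> C * \<delta>" "K * x \<le> C * \<delta>"
      proof -
        have x0: "0 \<le> x" using e(1) c(2) by (simp add: x_def)
        have "3 * K * x \<le> C * \<delta>" using x\<delta> x0 K C3 by (intro mult_mono) (auto simp: C_def)
        moreover have "0 \<le> K * x" using K x0 by simp
        ultimately show "3 * K * x \<le> C * \<delta>" "K * x \<le> C * \<delta>" by linarith+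
      qed
      obtain \<T> where T: "\<T> \<subseteq> t_cosets n t" "card \<T> = r"
        and sd: "real (card (sym_diff A (\<Union>\<T>))) \<le> real (card (sym_diff A (\<Union>H))) + \<bar>real r - real (card H)\<bar> * fact (n - t)"
        using resize_cosets[OF H A rN] by (elim exE conjE) (rule that)
      have "\<bar>real r - real (card H)\<bar> \<le> 2 * (K * x * c)" using rc[of "card H"] D by linarith
      then have "\<bar>real r - real (card H)\<bar> * F \<le> 2 * (K * x * c) * F" using F0 by (intro mult_right_mono) auto
      then have "real (card (sym_diff A (\<Union>\<T>))) \<le> K * x * real (card A) + 2 * (K * x * c) * F"
        using sd h1 unfolding F_def by linarith
      also have "\<dots> = 3 * K * x * real (card A)" by (simp add: cF)
      also have "\<dots> \<le> C * \<delta> * real (card A)" using KC(1) by (rule mult_right_mono) simp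
      finally have s: "real (card (sym_diff A (\<Union>\<T>))) \<le> C * \<delta> * real (card A)" .
      have "\<bar>c - of_int (round c)\<bar> \<le> K * x * c" using rc[of "card H"] D r by simp
      also have "\<dots> \<le> C * \<delta> * c" using KC(2) c(2) by (rule mult_right_mono)
      finally show ?thesis unfolding \<delta>_def[symmetric] using s T r by (intro conjI exI[of _ \<T>]) simp_all
    qed
  qed
  show ?thesis using main C3 by (intro exI[of _ C] conjI allI impI) auto
qed

theorem theorem1p3:
  fixes t :: nat
  shows "\<exists>C>0. \<forall>(n::nat) (A :: (nat \<Rightarrow> nat) set) (c::real) (f :: (nat \<Rightarrow> nat) \<Rightarrow> complex)
      (ft :: (nat \<Rightarrow> nat) \<Rightarrow> complex) (\<epsilon>::real).
    t \<le> n \<longrightarrow> A \<subseteq> Sym n \<longrightarrow> 0 \<le> c \<longrightarrow> real (card A) = c * fact (n - t) \<longrightarrow>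
    f = indicator A \<longrightarrow> is_orthogonal_projection n (U_space n t) f ft \<longrightarrow>
    0 \<le> \<epsilon> \<longrightarrow> \<epsilon> \<le> 1 \<longrightarrow>
    expect n (\<lambda>\<sigma>. (cmod (f \<sigma> - ft \<sigma>))\<^sup>2) \<le> \<epsilon> * c / real (falling n t) \<longrightarrow>
      (\<exists>\<T> \<subseteq> t_cosets n t. int (card \<T>) = round c \<and>
         real (card (sym_diff A (\<Union>\<T>))) \<le> C * (sqrt \<epsilon> + c / sqrt (real n)) * real (card A)) \<and>
      \<bar>c - of_int (round c)\<bar> \<le> C * (sqrt \<epsilon> + c / sqrt (real n)) * c"
proof -
  obtain C where C: "C > 0" and st: "\<forall>n A g c \<epsilon>. t \<le> n \<longrightarrow> A \<subseteq> Sym n \<longrightarrow> lowdeg n t g \<longrightarrow> real (card A) = c * fact (n - t) \<longrightarrow> 0 \<le> c \<longrightarrow>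
    0 \<le> \<epsilon> \<longrightarrow> \<epsilon> \<le> 1 \<longrightarrow> (\<Sum>\<sigma>\<in>Sym n. (indicator A \<sigma> - g \<sigma>)\<^sup>2) \<le> \<epsilon> * real (card A) \<longrightarrow>
    (\<exists>\<T>\<subseteq>t_cosets n t. int (card \<T>) = round c \<and>
      real (card (sym_diff A (\<Union>\<T>))) \<le> C * (sqrt \<epsilon> + c / sqrt (real n)) * real (card A)) \<and>
    \<bar>c - of_int (round c)\<bar> \<le> C * (sqrt \<epsilon> + c / sqrt (real n)) * c"
    using stability[of t] by (elim exE conjE) (rule that)
  show ?thesis
  proof (intro exI[of _ C] conjI[OF C] allI impI)
    fix n :: nat and A :: "(nat \<Rightarrow> nat) set" and c :: real and f ft :: "(nat \<Rightarrow> nat) \<Rightarrow> complex" and \<epsilon> :: real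
    assume tn: "t \<le> n" and A: "A \<subseteq> Sym n" and c: "0 \<le> c" "real (card A) = c * fact (n - t)" and f: "f = indicator A"
      and proj: "is_orthogonal_projection n (U_space n t) f ft" and e: "0 \<le> \<epsilon>" "\<epsilon> \<le> 1"
      and d: "expect n (\<lambda>\<sigma>. (cmod (f \<sigma> - ft \<sigma>))\<^sup>2) \<le> \<epsilon> * c / real (falling n t)"
    have "lowdeg n t ft" using proj U_space_low[OF tn] by (simp add: is_orthogonal_projection_def)
    then have g: "lowdeg n t (\<lambda>\<sigma>. Re (ft \<sigma>))" by (rule lowdeg_Re)
    have "(\<Sum>\<sigma>\<in>Sym n. (indicator A \<sigma> - Re (ft \<sigma>))\<^sup>2) \<le> (\<Sum>\<sigma>\<in>Sym n. (cmod (f \<sigma> - ft \<sigma>))\<^sup>2)"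
    proof (rule sum_mono)
      fix \<sigma>
      have "indicator A \<sigma> - Re (ft \<sigma>) = Re (f \<sigma> - ft \<sigma>)" by (simp add: f indicator_def)
      then have "\<bar>indicator A \<sigma> - Re (ft \<sigma>)\<bar> \<le> \<bar>cmod (f \<sigma> - ft \<sigma>)\<bar>" using abs_Re_le_cmod[of "f \<sigma> - ft \<sigma>"] by simp
      then show "(indicator A \<sigma> - Re (ft \<sigma>))\<^sup>2 \<le> (cmod (f \<sigma> - ft \<sigma>))\<^sup>2" by (simp only: abs_le_square_iff)
    qed
    also have "\<dots> = expect n (\<lambda>\<sigma>. (cmod (f \<sigma> - ft \<sigma>))\<^sup>2) * fact n" by (simp add: expect_def)
    also have "\<dots> \<le> \<epsilon> * c / real (falling n t) * fact n" using d by (rule mult_right_mono) simp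
    \<comment> \<open>Since \<open>falling n t * (n - t)! = n!\<close>, the factor
      \<open>c / falling n t\<close> is the density of \<open>A\<close>.\<close>
    also have "\<dots> = \<epsilon> * real (card A)"
    proof -
      have ff: "real (falling n t) * fact (n - t) = fact n" using falling_fact[OF tn] by (metis of_nat_fact of_nat_mult)
      then have "real (falling n t) \<noteq> 0" by (metis fact_nonzero mult_zero_left)
      then show ?thesis unfolding ff[symmetric] c(2) by simp
    qed
    finally have "(\<Sum>\<sigma>\<in>Sym n. (indicator A \<sigma> - Re (ft \<sigma>))\<^sup>2) \<le> \<epsilon> * real (card A)" .
    from st[rule_format, OF tn A g c(2,1) e this]
    show "(\<exists>\<T>\<subseteq>t_cosets n t. int (card \<T>) = round c \<and>
         real (card (sym_diff A (\<Union>\<T>))) \<le> C * (sqrt \<epsilon> + c / sqrt (real n)) * real (card A)) \<and>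
      \<bar>c - of_int (round c)\<bar> \<le> C * (sqrt \<epsilon> + c / sqrt (real n)) * c" .
  qed
qed

end
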